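(* Let $X$ be a proper metric space and $G$ a cyclic group of prime order $p$, with a coarse action on $X$. Assume that $X$ is $G$-finitistic and that $X^G_{bd}$ exists. Then, for any $m\ge 0$ and for any $\varrho=\tau^j$ with $1\le j\le p-1$, $$\operatorname{rank} HC_m^{\varrho}(X)+\sum_{i\ge m}\operatorname{rank} HC_i(X^G_{bd})\le\sum_{i\ge m}\operatorname{rank} HC_i(X).$$ If the right-hand side is finite, then the left-hand side is also finite, and in particular $\operatorname{rank} HC_i(X/G,X^G_{bd})$ is finite for all $i\ge m$.
   Context: All homology has $\mathbb F_p$ coefficients and rank means dimension over $\mathbb F_p$. Coarse action: $G$ acts coarsely on $(X,d)$ if there are constants $L,C>0$ and a map $G\times X\to X$, $(g,x)\mapsto gx$, such that each $x\mapsto gx$ is an $(L,C)$-quasi-isometry (i.e. $\frac1L d(x,y)-C\le d(gx,gy)\le L d(x,y)+C$ and every point of $X$ is within $C$ of $gX$), $ex=x$, and $d(g(hx),(gh)x)\le C$ for all $g,h\in G$, $x\in X$. Coarse maps: a map $f\colon X\to Y$ is coarse if preimages of bounded sets are bounded and for every $R>0$ there is $S_R$ with $d(x_1,x_2)\le R\Rightarrow d(f(x_1),f(x_2))\le S_R$; it is a coarse equivalence if it has a coarse inverse up to maps at uniformly bounded distance from the identities. Bounded fixed set: $X^G_k=\{x\mid d(x,gx)\le k\ \forall g\in G\}$. $X^G_{bd}$ exists if there are $k_0>0$ and $Y\subset X^G_{k_0}$ such that the inclusion $Y\to X^G_k$ is a coarse equivalence for all $k\ge k_0$; then $X^G_{bd}=Y$.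 Coarse homology: a uniform covering is a covering by relatively compact sets such that each bounded subset meets only finitely many members. A coarsening system is a sequence of uniform coverings $\{\mathscr U_n\}$ with increasing reals $R_n\to\infty$ such that every $U\in\mathscr U_n$ has diameter $\le R_n$ and $\mathscr U_{n+1}$ has a Lebesgue number $\ge R_n$, together with refinement projections $\mathscr U_n\to\mathscr U_{n+1}$. Let $K(\mathscr U)$ be the nerve, and for $A\subset X$ let $K(\mathscr U|A)$ be the subcomplex of simplices $(U_0,\dots,U_q)$ with $U_0\cap\dots\cap U_q\cap A\ne\emptyset$. With $H^{lf}_*$ simplicial homology of infinite locally finite chains, $HC_*(X)=\varinjlim H^{lf}_*(K(\mathscr U_n))$, $HC_*(A)=\varinjlim H^{lf}_*(K(\mathscr U_n|A))$, $HC_*(X,A)=\varinjlim H^{lf}_*(K(\mathscr U_n),K(\mathscr U_n|A))$; $HC_*(X^G_{bd})=\varinjlim_r HC_*(X^G_r)$. $G$-finitistic: a covering $\mathscr U$ is a $G$-covering if $\{gU\mid U\in\mathscr U\}=\mathscr U$ for all $g$ and $g_1(g_2U)=(g_1g_2)U$. Then $G$ acts simplicially on the nerve. A simplicial $G$-complex $K$ is regular if for every subgroup $H\le G$, whenever $h_0,\dots,h_n\in H$ and $(v_0,\dots,v_n)$ and $(h_0v_0,\dots,h_nv_n)$ are simplices of $K$, there is $h\in H$ with $hv_i=h_iv_i$ for all $i$. A regular $G$-coarsening system is a coarsening system of $G$-coverings with regular nerves; its refinement projections can be chosen $G$-equivariant. $X$ is $G$-finitistic if there is a regular $G$-coarsening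 system $\{\mathscr U_n\}$ whose nerves have uniformly bounded dimension. Smith special groups: fix a generator $g$ of $G$ and put $\tau=1-g\in\mathbb F_p[G]$. For a regular $G$-complex $K$ and $\varrho=\tau^j$, $1\le j\le p-1$, let $H^{lf,\varrho}_*(K)$ be the homology of the subcomplex $\varrho\, C$ of the locally finite chain complex $C$ of $K$ over $\mathbb F_p$. For a regular $G$-coarsening system with equivariant refinement projections, $HC^{\varrho}_*(X)=\varinjlim H^{lf,\varrho}_*(K(\mathscr U_n))$. Orbit space: for an isometric action of a finite group, $X/G$ has the metric $d^*(\bar x,\bar y)=\min_{g}d(x,gy)$. For a coarse action, $X/G$ means $X'/G$ where $X'$ is a proper metric space with isometric $G$-action that is coarsely $G$-equivalent to $X$, meaning that there is a quasi-isometry $f\colon X\to X'$ with $d(gf(x),f(gx))$ uniformly bounded in $g$ and $x$ (such an $X'$ exists, and $X/G$ is well defined up to quasi-isometry). In $HC_*(X/G,X^G_{bd})$, $X^G_{bd}$ is regarded as a subspace of $X/G$ through the projection (which restricts to a coarse equivalence of $X'^G_k$ with its image for $k$ large). *)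

theory Defs
  imports
    "HOL-Analysis.Abstract_Metric_Spaces"
    "HOL-Library.Extended_Real"
    "HOL-Combinatorics.Permutations"
    "HOL-Algebra.Group_Action"
    "HOL-Algebra.Generated_Groups"
    "Jordan_Normal_Form.VS_Connect"
    "Berlekamp_Zassenhaus.Finite_Field"
begin

section \<open>Metric spaces, coarse maps and coarse actions\<close>

text \<open>
  Metric spaces are given by an explicit carrier and a distance, as in the locale
  \<^locale>\<open>Metric_space\<close>; this is needed for subspaces and orbit spaces.
\<close>

definition proper_metric_space :: "'a set \<Rightarrow> ('a \<Rightarrow> 'a \<Rightarrow> real) \<Rightarrow> bool" where
  "proper_metric_space M d \<longleftrightarrow> Metric_space M d \<and>
     (\<forall>S. closedin (Metric_space.mtopology M d) S \<and> Metric_space.mbounded M d S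
          \<longrightarrow> compactin (Metric_space.mtopology M d) S)"

definition quasi_isometry ::
  "real \<Rightarrow> real \<Rightarrow> 'a set \<Rightarrow> ('a \<Rightarrow> 'a \<Rightarrow> real) \<Rightarrow> 'b set \<Rightarrow> ('b \<Rightarrow> 'b \<Rightarrow> real) \<Rightarrow> ('a \<Rightarrow> 'b) \<Rightarrow> bool" where
  "quasi_isometry L C M d N e f \<longleftrightarrow>
     f \<in> M \<rightarrow> N \<and>
     (\<forall>x\<in>M. \<forall>y\<in>M. (1 / L) * d x y - C \<le> e (f x) (f y) \<and> e (f x) (f y) \<le> L * d x y + C) \<and>
     (\<forall>z\<in>N. \<exists>x\<in>M. e z (f x) \<le> C)"

definition coarse_action ::
  "('g, 'r) monoid_scheme \<Rightarrow> 'a set \<Rightarrow> ('a \<Rightarrow> 'a \<Rightarrow> real) \<Rightarrow> ('g \<Rightarrow> 'a \<Rightarrow> 'a) \<Rightarrow> bool" where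
  "coarse_action G M d \<phi> \<longleftrightarrow>
     (\<exists>L>0. \<exists>C>0.
        (\<forall>g\<in>carrier G. quasi_isometry L C M d M d (\<phi> g)) \<and>
        (\<forall>x\<in>M. \<phi> \<one>\<^bsub>G\<^esub> x = x) \<and>
        (\<forall>g\<in>carrier G. \<forall>h\<in>carrier G. \<forall>x\<in>M. d (\<phi> g (\<phi> h x)) (\<phi> (g \<otimes>\<^bsub>G\<^esub> h) x) \<le> C))"

definition coarse_map ::
  "'a set \<Rightarrow> ('a \<Rightarrow> 'a \<Rightarrow> real) \<Rightarrow> 'b set \<Rightarrow> ('b \<Rightarrow> 'b \<Rightarrow> real) \<Rightarrow> ('a \<Rightarrow> 'b) \<Rightarrow> bool" where
  "coarse_map M d N e f \<longleftrightarrow>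
     f \<in> M \<rightarrow> N \<and>
     (\<forall>B. Metric_space.mbounded N e B \<longrightarrow> Metric_space.mbounded M d {x \<in> M. f x \<in> B}) \<and>
     (\<forall>R>0. \<exists>S. \<forall>x\<in>M. \<forall>y\<in>M. d x y \<le> R \<longrightarrow> e (f x) (f y) \<le> S)"

definition coarse_equivalence ::
  "'a set \<Rightarrow> ('a \<Rightarrow> 'a \<Rightarrow> real) \<Rightarrow> 'b set \<Rightarrow> ('b \<Rightarrow> 'b \<Rightarrow> real) \<Rightarrow> ('a \<Rightarrow> 'b) \<Rightarrow> bool" where
  "coarse_equivalence M d N e f \<longleftrightarrow>
     coarse_map M d N e f \<and>
     (\<exists>h. coarse_map N e M d h \<and>
        (\<exists>B. (\<forall>x\<in>M. d (h (f x)) x \<le> B) \<and> (\<forall>y\<in>N. e (f (h y)) y \<le> B)))"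

definition fixed_upto ::
  "('g, 'r) monoid_scheme \<Rightarrow> 'a set \<Rightarrow> ('a \<Rightarrow> 'a \<Rightarrow> real) \<Rightarrow> ('g \<Rightarrow> 'a \<Rightarrow> 'a) \<Rightarrow> real \<Rightarrow> 'a set" where
  "fixed_upto G M d \<phi> k = {x \<in> M. \<forall>g\<in>carrier G. d x (\<phi> g x) \<le> k}"

text \<open>
  \<open>Y\<close> is a bounded fixed set (the set \<open>X\<close> with superscript \<open>G\<close> and subscript \<open>bd\<close>);
  that set exists if there is such a \<open>Y\<close>.
\<close>

definition bounded_fixed_set ::
  "('g, 'r) monoid_scheme \<Rightarrow> 'a set \<Rightarrow> ('a \<Rightarrow> 'a \<Rightarrow> real) \<Rightarrow> ('g \<Rightarrow> 'a \<Rightarrow> 'a) \<Rightarrow> 'a set \<Rightarrow> bool" where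
  "bounded_fixed_set G M d \<phi> Y \<longleftrightarrow>
     (\<exists>k0>0. Y \<subseteq> fixed_upto G M d \<phi> k0 \<and>
        (\<forall>k\<ge>k0. coarse_equivalence Y d (fixed_upto G M d \<phi> k) d (\<lambda>x. x)))"

definition isometric_action ::
  "('g, 'r) monoid_scheme \<Rightarrow> 'a set \<Rightarrow> ('a \<Rightarrow> 'a \<Rightarrow> real) \<Rightarrow> ('g \<Rightarrow> 'a \<Rightarrow> 'a) \<Rightarrow> bool" where
  "isometric_action G M d \<phi> \<longleftrightarrow>
     group_action G M \<phi> \<and> (\<forall>g\<in>carrier G. \<forall>x\<in>M. \<forall>y\<in>M. d (\<phi> g x) (\<phi> g y) = d x y)"

definition coarsely_G_equivalent ::
  "('g, 'r) monoid_scheme \<Rightarrow> 'a set \<Rightarrow> ('a \<Rightarrow> 'a \<Rightarrow> real) \<Rightarrow> ('g \<Rightarrow> 'a \<Rightarrow> 'a)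
     \<Rightarrow> 'b set \<Rightarrow> ('b \<Rightarrow> 'b \<Rightarrow> real) \<Rightarrow> ('g \<Rightarrow> 'b \<Rightarrow> 'b) \<Rightarrow> bool" where
  "coarsely_G_equivalent G M d \<phi> N e \<psi> \<longleftrightarrow>
     (\<exists>f. (\<exists>L>0. \<exists>C>0. quasi_isometry L C M d N e f) \<and>
          (\<exists>B. \<forall>g\<in>carrier G. \<forall>x\<in>M. e (\<psi> g (f x)) (f (\<phi> g x)) \<le> B))"

text \<open>
  The points of the orbit space are the \<^const>\<open>orbits\<close>. For an isometric action the distance
  from a representative \<open>x\<close> of \<open>P\<close> to the orbit \<open>Q\<close> does not depend on \<open>x\<close>, so the
  minimum below is the minimum of \<open>d x (g y)\<close> over \<open>g\<close>. The value \<open>0\<close> off the carrier makes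
  the distance symmetric and nonnegative everywhere, as \<^locale>\<open>Metric_space\<close> demands.
\<close>

definition orbit_dist ::
  "('g, 'r) monoid_scheme \<Rightarrow> 'a set \<Rightarrow> ('a \<Rightarrow> 'a \<Rightarrow> real) \<Rightarrow> ('g \<Rightarrow> 'a \<Rightarrow> 'a) \<Rightarrow> 'a set \<Rightarrow> 'a set \<Rightarrow> real" where
  "orbit_dist G M d \<phi> P Q =
     (if P \<in> orbits G M \<phi> \<and> Q \<in> orbits G M \<phi> then Min {d x y | x y. x \<in> P \<and> y \<in> Q} else 0)"

section \<open>Vector spaces: rank, quotients and direct limits\<close>

text \<open>
  Vector spaces over a field type \<open>'k\<close> are module records over \<^term>\<open>class_ring\<close>, the
  ring record of \<open>'k\<close>. The ring multiplication and unit of the module record are irrelevant.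
\<close>

definition vs_rank :: "('k::field, 'b) module \<Rightarrow> enat" where
  "vs_rank V =
     (if vectorspace.fin_dim (class_ring :: 'k ring) V
      then enat (vectorspace.dim (class_ring :: 'k ring) V) else \<infinity>)"

definition fun_space :: "('s \<Rightarrow> 'k::field) set \<Rightarrow> ('k, 's \<Rightarrow> 'k) module" where
  "fun_space S =
     \<lparr>carrier = S, monoid.mult = undefined, one = undefined, zero = (\<lambda>_. 0),
      add = (\<lambda>c c' s. c s + c' s), module.smult = (\<lambda>a c s. a * c s)\<rparr>"

definition quotient_space :: "('k, 'b) module \<Rightarrow> 'b set \<Rightarrow> ('k, 'b set) module" where
  "quotient_space V W =
     \<lparr>carrier = a_rcosets\<^bsub>V\<^esub> W, monoid.mult = undefined, one = undefined, zero = W,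
      add = set_add V, module.smult = (\<lambda>a S. W <+>\<^bsub>V\<^esub> (\<lambda>x. a \<odot>\<^bsub>V\<^esub> x) ` S)\<rparr>"

text \<open>
  The map into \<^term>\<open>quotient_space V W\<close> that a linear map \<open>f\<close> of representatives induces on a
  quotient: the coset of \<open>x\<close> goes to the coset of \<open>f x\<close>.
\<close>

definition coset_map :: "('k, 'c) module \<Rightarrow> 'c set \<Rightarrow> ('b \<Rightarrow> 'c) \<Rightarrow> 'b set \<Rightarrow> 'c set" where
  "coset_map V W f S = W <+>\<^bsub>V\<^esub> f ` S"

text \<open>
  Direct limit of the spaces \<open>V i\<close>, indexed by a linear order, along the maps
  \<open>t i j\<close> from \<open>V i\<close> to \<open>V j\<close> for \<open>i \<le> j\<close>.
\<close>

definition dirlim_rel ::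
  "('i::linorder \<Rightarrow> ('k, 'b) module) \<Rightarrow> ('i \<Rightarrow> 'i \<Rightarrow> 'b \<Rightarrow> 'b) \<Rightarrow> (('i \<times> 'b) \<times> ('i \<times> 'b)) set" where
  "dirlim_rel V t =
     {((i, x), (j, y)). x \<in> carrier (V i) \<and> y \<in> carrier (V j) \<and>
        (\<exists>k. i \<le> k \<and> j \<le> k \<and> t i k x = t j k y)}"

definition dirlim ::
  "('i::linorder \<Rightarrow> ('k, 'b) module) \<Rightarrow> ('i \<Rightarrow> 'i \<Rightarrow> 'b \<Rightarrow> 'b) \<Rightarrow> ('k, ('i \<times> 'b) set) module" where
  "dirlim V t =
     \<lparr>carrier = (SIGMA i:UNIV. carrier (V i)) // dirlim_rel V t,
      monoid.mult = undefined, one = undefined,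
      zero = {(i, x). x \<in> carrier (V i) \<and> (\<exists>k\<ge>i. t i k x = \<zero>\<^bsub>V k\<^esub>)},
      add = (\<lambda>P Q. \<Union>(i, x)\<in>P. \<Union>(j, y)\<in>Q.
        dirlim_rel V t `` {(max i j, t i (max i j) x \<oplus>\<^bsub>V (max i j)\<^esub> t j (max i j) y)}),
      module.smult = (\<lambda>a P. \<Union>(i, x)\<in>P. dirlim_rel V t `` {(i, a \<odot>\<^bsub>V i\<^esub> x)})\<rparr>"

definition dirlim_map ::
  "('i::linorder \<Rightarrow> ('k, 'c) module) \<Rightarrow> ('i \<Rightarrow> 'i \<Rightarrow> 'c \<Rightarrow> 'c) \<Rightarrow> ('i \<Rightarrow> 'b \<Rightarrow> 'c)
     \<Rightarrow> ('i \<times> 'b) set \<Rightarrow> ('i \<times> 'c) set" where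
  "dirlim_map V t f P = (\<Union>(i, x)\<in>P. dirlim_rel V t `` {(i, f i x)})"

section \<open>Locally finite simplicial homology\<close>

text \<open>
  A simplicial complex is the set of its simplices, which are finite nonempty sets of vertices.
  A (possibly infinite) oriented \<open>q\<close>-chain, formally a sum of \<open>c \<sigma>\<close> times the oriented simplex
  \<open>\<sigma>\<close>, is the alternating function \<open>c\<close> on vertex tuples of length \<open>q + 1\<close>. It is locally finite
  if every vertex lies in only finitely many simplices of the support.
\<close>

definition alternating :: "('v list \<Rightarrow> 'k::field) \<Rightarrow> bool" where
  "alternating c \<longleftrightarrow>
     (\<forall>\<sigma>. \<not> distinct \<sigma> \<longrightarrow> c \<sigma> = 0) \<and>
     (\<forall>\<sigma> \<pi>. \<pi> permutes {..<length \<sigma>} \<longrightarrow> c (permute_list \<pi> \<sigma>) = of_int (sign \<pi>) * c \<sigma>)"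

definition lf_chains :: "nat \<Rightarrow> 'v set set \<Rightarrow> ('v list \<Rightarrow> 'k::field) set" where
  "lf_chains q K =
     {c. alternating c \<and>
         (\<forall>\<sigma>. c \<sigma> \<noteq> 0 \<longrightarrow> length \<sigma> = Suc q \<and> set \<sigma> \<in> K) \<and>
         (\<forall>v. finite {\<sigma>. c \<sigma> \<noteq> 0 \<and> v \<in> set \<sigma>})}"

text \<open>
  The coefficient of \<open>\<partial>c\<close> at \<open>\<tau>\<close> collects the simplices \<open>v # \<tau>\<close>, each of which contains
  \<open>\<tau>\<close> as its zeroth face, with sign \<open>+1\<close>. The value at the empty tuple is \<open>0\<close>, so that
  homology is not augmented.
\<close>

definition lf_boundary :: "('v list \<Rightarrow> 'k::field) \<Rightarrow> 'v list \<Rightarrow> 'k" where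
  "lf_boundary c \<tau> = (if \<tau> = [] then 0 else (\<Sum>v | c (v # \<tau>) \<noteq> 0. c (v # \<tau>)))"

text \<open>
  The chain map of a simplicial map: \<open>\<sigma>\<close> goes to \<^term>\<open>map f \<sigma>\<close>, or to \<open>0\<close> if that tuple is
  degenerate.
\<close>

definition chain_push :: "('v \<Rightarrow> 'w) \<Rightarrow> ('v list \<Rightarrow> 'k::field) \<Rightarrow> 'w list \<Rightarrow> 'k" where
  "chain_push f c \<tau> = (if distinct \<tau> then (\<Sum>\<sigma> | map f \<sigma> = \<tau> \<and> c \<sigma> \<noteq> 0. c \<sigma>) else 0)"

definition lf_relcycles :: "nat \<Rightarrow> 'v set set \<Rightarrow> 'v set set \<Rightarrow> ('v list \<Rightarrow> 'k::field) set" where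
  "lf_relcycles q K L =
     {c \<in> lf_chains q K. \<forall>\<tau>. lf_boundary c \<tau> \<noteq> 0 \<longrightarrow> set \<tau> \<in> L}"

definition lf_relboundaries :: "nat \<Rightarrow> 'v set set \<Rightarrow> 'v set set \<Rightarrow> ('v list \<Rightarrow> 'k::field) set" where
  "lf_relboundaries q K L =
     {(\<lambda>\<tau>. lf_boundary c \<tau> + l \<tau>) | c l. c \<in> lf_chains (Suc q) K \<and> l \<in> lf_chains q L}"

text \<open>Homology of the pair \<open>(K, L)\<close>; absolute homology is the case \<open>L = {}\<close>.\<close>

definition lf_homology ::
  "nat \<Rightarrow> 'v set set \<Rightarrow> 'v set set \<Rightarrow> ('k::field, ('v list \<Rightarrow> 'k) set) module" where
  "lf_homology q K L = quotient_space (fun_space (lf_relcycles q K L)) (lf_relboundaries q K L)"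

definition lf_homology_map ::
  "nat \<Rightarrow> 'w set set \<Rightarrow> 'w set set \<Rightarrow> ('v \<Rightarrow> 'w)
     \<Rightarrow> ('v list \<Rightarrow> 'k::field) set \<Rightarrow> ('w list \<Rightarrow> 'k) set" where
  "lf_homology_map q K L f =
     coset_map (fun_space (lf_relcycles q K L)) (lf_relboundaries q K L) (chain_push f)"

text \<open>
  Smith special groups. Here \<open>\<gamma>\<close> is the action of the chosen generator on vertices, and
  \<^term>\<open>tau \<gamma>\<close> is the operator \<open>1 - \<gamma>\<close> on chains.
\<close>

definition tau :: "('v \<Rightarrow> 'v) \<Rightarrow> ('v list \<Rightarrow> 'k::field) \<Rightarrow> 'v list \<Rightarrow> 'k" where
  "tau \<gamma> c = (\<lambda>\<sigma>. c \<sigma> - chain_push \<gamma> c \<sigma>)"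

definition smith_chains ::
  "nat \<Rightarrow> ('v \<Rightarrow> 'v) \<Rightarrow> nat \<Rightarrow> 'v set set \<Rightarrow> ('v list \<Rightarrow> 'k::field) set" where
  "smith_chains j \<gamma> q K = (tau \<gamma> ^^ j) ` lf_chains q K"

definition smith_cycles ::
  "nat \<Rightarrow> ('v \<Rightarrow> 'v) \<Rightarrow> nat \<Rightarrow> 'v set set \<Rightarrow> ('v list \<Rightarrow> 'k::field) set" where
  "smith_cycles j \<gamma> q K = {c \<in> smith_chains j \<gamma> q K. lf_boundary c = (\<lambda>_. 0)}"

definition smith_boundaries ::
  "nat \<Rightarrow> ('v \<Rightarrow> 'v) \<Rightarrow> nat \<Rightarrow> 'v set set \<Rightarrow> ('v list \<Rightarrow> 'k::field) set" where
  "smith_boundaries j \<gamma> q K = lf_boundary ` smith_chains j \<gamma> (Suc q) K"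

definition smith_homology ::
  "nat \<Rightarrow> ('v \<Rightarrow> 'v) \<Rightarrow> nat \<Rightarrow> 'v set set \<Rightarrow> ('k::field, ('v list \<Rightarrow> 'k) set) module" where
  "smith_homology j \<gamma> q K =
     quotient_space (fun_space (smith_cycles j \<gamma> q K)) (smith_boundaries j \<gamma> q K)"

definition smith_homology_map ::
  "nat \<Rightarrow> ('v \<Rightarrow> 'v) \<Rightarrow> nat \<Rightarrow> 'v set set \<Rightarrow> ('v \<Rightarrow> 'v)
     \<Rightarrow> ('v list \<Rightarrow> 'k::field) set \<Rightarrow> ('v list \<Rightarrow> 'k) set" where
  "smith_homology_map j \<gamma> q K f =
     coset_map (fun_space (smith_cycles j \<gamma> q K)) (smith_boundaries j \<gamma> q K) (chain_push f)"

section \<open>Coarsening systems\<close>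

definition uniform_covering :: "'a set \<Rightarrow> ('a \<Rightarrow> 'a \<Rightarrow> real) \<Rightarrow> 'a set set \<Rightarrow> bool" where
  "uniform_covering M d \<U> \<longleftrightarrow>
     \<Union>\<U> = M \<and>
     (\<forall>U\<in>\<U>. compactin (Metric_space.mtopology M d) (Metric_space.mtopology M d closure_of U)) \<and>
     (\<forall>B. Metric_space.mbounded M d B \<longrightarrow> finite {U \<in> \<U>. U \<inter> B \<noteq> {}})"

definition lebesgue_number :: "'a set \<Rightarrow> ('a \<Rightarrow> 'a \<Rightarrow> real) \<Rightarrow> 'a set set \<Rightarrow> real \<Rightarrow> bool" where
  "lebesgue_number M d \<U> l \<longleftrightarrow>
     (\<forall>S\<subseteq>M. (\<forall>x\<in>S. \<forall>y\<in>S. d x y \<le> l) \<longrightarrow> (\<exists>U\<in>\<U>. S \<subseteq> U))"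

definition coarsening_system ::
  "'a set \<Rightarrow> ('a \<Rightarrow> 'a \<Rightarrow> real) \<Rightarrow> (nat \<Rightarrow> 'a set set) \<Rightarrow> (nat \<Rightarrow> 'a set \<Rightarrow> 'a set) \<Rightarrow> bool" where
  "coarsening_system M d \<U> pr \<longleftrightarrow>
     (\<forall>n. uniform_covering M d (\<U> n)) \<and>
     (\<exists>R :: nat \<Rightarrow> real. incseq R \<and> filterlim R at_top sequentially \<and>
        (\<forall>n. (\<forall>U\<in>\<U> n. \<forall>x\<in>U. \<forall>y\<in>U. d x y \<le> R n) \<and>
             (\<exists>l\<ge>R n. lebesgue_number M d (\<U> (Suc n)) l))) \<and>
     (\<forall>n. \<forall>U\<in>\<U> n. pr n U \<in> \<U> (Suc n) \<and> U \<subseteq> pr n U)"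

text \<open>The complex \<open>K(\<U>|A)\<close>; for a covering \<open>\<U>\<close> of \<open>X\<close>, the nerve of \<open>\<U>\<close> is \<open>K(\<U>|X)\<close>.\<close>

definition nerve :: "'a set set \<Rightarrow> 'a set \<Rightarrow> 'a set set set" where
  "nerve \<U> A = {S. finite S \<and> S \<noteq> {} \<and> S \<subseteq> \<U> \<and> \<Inter>S \<inter> A \<noteq> {}}"

definition G_covering :: "('g, 'r) monoid_scheme \<Rightarrow> ('g \<Rightarrow> 'a \<Rightarrow> 'a) \<Rightarrow> 'a set set \<Rightarrow> bool" where
  "G_covering G \<phi> \<U> \<longleftrightarrow>
     (\<forall>g\<in>carrier G. {\<phi> g ` U | U. U \<in> \<U>} = \<U>) \<and>
     (\<forall>g1\<in>carrier G. \<forall>g2\<in>carrier G. \<forall>U\<in>\<U>. \<phi> g1 ` \<phi> g2 ` U = \<phi> (g1 \<otimes>\<^bsub>G\<^esub> g2) ` U)"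

text \<open>Tuples of vertices of a simplex may contain repetitions here.\<close>

definition regular_G_complex ::
  "('g, 'r) monoid_scheme \<Rightarrow> ('g \<Rightarrow> 'v \<Rightarrow> 'v) \<Rightarrow> 'v set set \<Rightarrow> bool" where
  "regular_G_complex G \<alpha> K \<longleftrightarrow>
     (\<forall>H. subgroup H G \<longrightarrow>
        (\<forall>hs vs. length hs = length vs \<and> set hs \<subseteq> H \<and> set vs \<in> K \<and> set (map2 \<alpha> hs vs) \<in> K \<longrightarrow>
           (\<exists>h\<in>H. \<forall>i<length vs. \<alpha> h (vs ! i) = \<alpha> (hs ! i) (vs ! i))))"

definition regular_G_coarsening_system ::
  "('g, 'r) monoid_scheme \<Rightarrow> 'a set \<Rightarrow> ('a \<Rightarrow> 'a \<Rightarrow> real) \<Rightarrow> ('g \<Rightarrow> 'a \<Rightarrow> 'a)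
     \<Rightarrow> (nat \<Rightarrow> 'a set set) \<Rightarrow> (nat \<Rightarrow> 'a set \<Rightarrow> 'a set) \<Rightarrow> bool" where
  "regular_G_coarsening_system G M d \<phi> \<U> pr \<longleftrightarrow>
     coarsening_system M d \<U> pr \<and>
     (\<forall>n. G_covering G \<phi> (\<U> n) \<and> regular_G_complex G (\<lambda>g U. \<phi> g ` U) (nerve (\<U> n) M))"

definition equivariant_projections ::
  "('g, 'r) monoid_scheme \<Rightarrow> ('g \<Rightarrow> 'a \<Rightarrow> 'a) \<Rightarrow> (nat \<Rightarrow> 'a set set)
     \<Rightarrow> (nat \<Rightarrow> 'a set \<Rightarrow> 'a set) \<Rightarrow> bool" where
  "equivariant_projections G \<phi> \<U> pr \<longleftrightarrow>
     (\<forall>n. \<forall>g\<in>carrier G. \<forall>U\<in>\<U> n. pr n (\<phi> g ` U) = \<phi> g ` pr n U)"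

definition G_finitistic ::
  "('g, 'r) monoid_scheme \<Rightarrow> 'a set \<Rightarrow> ('a \<Rightarrow> 'a \<Rightarrow> real) \<Rightarrow> ('g \<Rightarrow> 'a \<Rightarrow> 'a) \<Rightarrow> bool" where
  "G_finitistic G M d \<phi> \<longleftrightarrow>
     (\<exists>\<U> pr. regular_G_coarsening_system G M d \<phi> \<U> pr \<and>
        (\<exists>D. \<forall>n. \<forall>S\<in>nerve (\<U> n) M. card S \<le> D + 1))"

section \<open>Coarse homology\<close>

text \<open>
  The transition map from stage \<open>m\<close> to stage \<open>n\<close> is induced by the composite
  \<open>pr m\<close>, \<open>pr (m + 1)\<close>, \dots, \<open>pr (n - 1)\<close> of refinement projections,
  which is \<^term>\<open>fold pr [m..<n]\<close>.
\<close>

definition HC_stage ::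
  "(nat \<Rightarrow> 'a set set) \<Rightarrow> nat \<Rightarrow> 'a set \<Rightarrow> 'a set \<Rightarrow> nat \<Rightarrow> ('k::field, ('a set list \<Rightarrow> 'k) set) module" where
  "HC_stage \<U> q A B n = lf_homology q (nerve (\<U> n) A) (nerve (\<U> n) B)"

definition HC_trans ::
  "(nat \<Rightarrow> 'a set set) \<Rightarrow> (nat \<Rightarrow> 'a set \<Rightarrow> 'a set) \<Rightarrow> nat \<Rightarrow> 'a set \<Rightarrow> 'a set \<Rightarrow> nat \<Rightarrow> nat
     \<Rightarrow> ('a set list \<Rightarrow> 'k::field) set \<Rightarrow> ('a set list \<Rightarrow> 'k) set" where
  "HC_trans \<U> pr q A B m n =
     lf_homology_map q (nerve (\<U> n) A) (nerve (\<U> n) B) (fold pr [m..<n])"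

text \<open>
  The coarse homology of a pair of subsets of \<open>X\<close> with \<open>B \<subseteq> A\<close>, computed with a coarsening
  system of \<open>X\<close>. The nerve over the empty set is empty, so \<open>B = {}\<close> gives the coarse homology
  of \<open>A\<close>.
\<close>

definition HC ::
  "(nat \<Rightarrow> 'a set set) \<Rightarrow> (nat \<Rightarrow> 'a set \<Rightarrow> 'a set) \<Rightarrow> nat \<Rightarrow> 'a set \<Rightarrow> 'a set
     \<Rightarrow> ('k::field, (nat \<times> ('a set list \<Rightarrow> 'k) set) set) module" where
  "HC \<U> pr q A B = dirlim (HC_stage \<U> q A B) (HC_trans \<U> pr q A B)"

definition HC_inclusion ::
  "(nat \<Rightarrow> 'a set set) \<Rightarrow> (nat \<Rightarrow> 'a set \<Rightarrow> 'a set) \<Rightarrow> nat \<Rightarrow> 'a set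
     \<Rightarrow> (nat \<times> ('a set list \<Rightarrow> 'k::field) set) set \<Rightarrow> (nat \<times> ('a set list \<Rightarrow> 'k) set) set" where
  "HC_inclusion \<U> pr q A =
     dirlim_map (HC_stage \<U> q A {}) (HC_trans \<U> pr q A {})
       (\<lambda>n. lf_homology_map q (nerve (\<U> n) A) (nerve (\<U> n) {}) id)"

definition HC_bd ::
  "('g, 'r) monoid_scheme \<Rightarrow> 'a set \<Rightarrow> ('a \<Rightarrow> 'a \<Rightarrow> real) \<Rightarrow> ('g \<Rightarrow> 'a \<Rightarrow> 'a)
     \<Rightarrow> (nat \<Rightarrow> 'a set set) \<Rightarrow> (nat \<Rightarrow> 'a set \<Rightarrow> 'a set) \<Rightarrow> nat
     \<Rightarrow> ('k::field, (real \<times> (nat \<times> ('a set list \<Rightarrow> 'k) set) set) set) module" where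
  "HC_bd G M d \<phi> \<U> pr q =
     dirlim (\<lambda>r. HC \<U> pr q (fixed_upto G M d \<phi> r) {})
            (\<lambda>r s. HC_inclusion \<U> pr q (fixed_upto G M d \<phi> s))"

text \<open>
  \<open>HC_smith M \<phi> g j \<U> pr q\<close> is the group for \<open>\<rho> = \<tau>\<^sup>j\<close>, \<open>\<tau> = 1 - g\<close>, computed with a regular
  coarsening system with equivariant projections.
\<close>

definition HC_smith ::
  "'a set \<Rightarrow> ('g \<Rightarrow> 'a \<Rightarrow> 'a) \<Rightarrow> 'g \<Rightarrow> nat
     \<Rightarrow> (nat \<Rightarrow> 'a set set) \<Rightarrow> (nat \<Rightarrow> 'a set \<Rightarrow> 'a set) \<Rightarrow> nat
     \<Rightarrow> ('k::field, (nat \<times> ('a set list \<Rightarrow> 'k) set) set) module" where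
  "HC_smith M \<phi> g j \<U> pr q =
     dirlim (\<lambda>n. smith_homology j (image (\<phi> g)) q (nerve (\<U> n) M))
            (\<lambda>m n. smith_homology_map j (image (\<phi> g)) q (nerve (\<U> n) M) (fold pr [m..<n]))"

end

theory Submission
  imports Defs "HOL-Algebra.Multiplicative_Group"
begin

text \<open>
  Away from the fixed simplices the chains of a regular complex form a free module over the group
  ring, so the kernel of \<open>\<tau>\<^sup>j\<close> on chains consists of the image of \<open>\<tau>\<^bsup>p - j\<^esup>\<close> plus the chains of
  the fixed complex. With \<open>s j q\<close>, \<open>b q\<close> and \<open>h q\<close> for the ranks of the special groups, of the homology
  of the bounded fixed set and of \<open>X\<close>, this gives \<open>s j q + b q \<le> h q + s (p - j) (q + 1)\<close> in the limit,
  and these inequalities telescope because \<open>s\<close> vanishes above the dimension of a finite-dimensional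
  system. As \<open>\<tau>\<^bsup>p - 1\<^esup>\<close> is the norm, the transfer embeds the relative homology of the orbit space into the
  special group for \<open>j = p - 1\<close>. The field is finite, so ranks are compared by counting elements,
  and each inequality only needs an injection defined on representatives.
\<close>

text \<open>Long exact sequences are never formed in the limit. The coarsening systems do not match:
  \<open>\<U>\<close> computes the homology of X, \<open>\<V>\<close> the special groups, a third
  system bounds the dimension and a fourth covers the orbit space. A comparison between them is
  therefore required neither to be linear nor to commute with transition maps; it only has to
  reflect the relation of being homologous at a later stage. Reflection rests on one geometric fact:
  two refinements of a covering are contiguous. The homotopy between contiguous maps has to be built
  for infinite chains, in characteristic 2 as well, and equivariantly where special groups are
  involved. The instance of regularity behind most steps is that a simplex has at most one vertex in
  each orbit. Thus a member of a covering that meets its translate is fixed, and this is what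
  relates points moved by a bounded distance to fixed vertices of the nerve.\<close>

section \<open>Ranks of vector spaces over a finite field\<close>

text \<open>Coordinates with respect to a finite basis identify the vectors with the functions from
  the basis to the field. Conversely a finite carrier is itself a finite spanning set. So finite
  rank means finite cardinality, which is special to finite fields.\<close>

lemma card_of_vectorspace:
  fixes V :: "('k::{field,finite}, 'b) module"
  assumes "vectorspace (class_ring :: 'k ring) V"
  shows vs_rank_finite_iff: "vs_rank V < \<infinity> \<longleftrightarrow> finite (carrier V)"
    and card_eq_power_vs_rank:
      "vs_rank V = enat n \<Longrightarrow> finite (carrier V) \<and> card (carrier V) = CARD('k) ^ n"
proof -
  interpret vectorspace "class_ring :: 'k ring" V by fact
  have 1: "finite (carrier V) \<and> card (carrier V) = CARD('k) ^ dim" if fd: fin_dim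
  proof -
    obtain A where A: "finite A" "A \<subseteq> carrier V" "basis A"
      using finite_basis_exists[OF fd] basis_def by blast
    \<comment> \<open>Coefficient functions are taken extensional, that is constant off
      \<open>A\<close>; otherwise they would not be determined by the vector.\<close>
    let ?F = "A \<rightarrow>\<^sub>E (UNIV :: 'k set)"
    have ex1: "\<exists>!a. a \<in> ?F \<and> lincomb a A = v" if "v \<in> carrier V" for v
      using A basis_criterion that by simp
    have "bij_betw (\<lambda>a. lincomb a A) ?F (carrier V)"
      unfolding bij_betw_def inj_on_def
    proof (intro conjI ballI impI)
      fix a b assume "a \<in> ?F" "b \<in> ?F" "lincomb a A = lincomb b A"
      moreover have "lincomb b A \<in> carrier V" using A by (simp add: Pi_def)
      ultimately show "a = b" using ex1 by blast
    next
      show "(\<lambda>a. lincomb a A) ` ?F = carrier V"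
        using A ex1 by (auto simp: Pi_def image_iff) metis
    qed
    moreover have "finite ?F" "card ?F = CARD('k) ^ card A"
      using A by (auto simp: finite_PiE card_PiE)
    ultimately show ?thesis
      using A dim_basis bij_betw_finite bij_betw_same_card by metis
  qed
  have 2: "fin_dim" if "finite (carrier V)"
    using that in_own_span[of "carrier V"] span_is_subset2[of "carrier V"]
    unfolding fin_dim_def by (metis subset_antisym subset_refl)
  show "vs_rank V < \<infinity> \<longleftrightarrow> finite (carrier V)" using 1 2 by (auto simp: vs_rank_def)
  show "vs_rank V = enat n \<Longrightarrow> finite (carrier V) \<and> card (carrier V) = CARD('k) ^ n"
    using 1 by (auto simp: vs_rank_def split: if_splits)
qed

lemma carrier_nonempty: "vectorspace K V \<Longrightarrow> carrier V \<noteq> {}"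
  by (metis abelian_group.a_group equals0D group.is_monoid module.axioms(2) monoid.one_closed
      partial_object.select_convs(1) vectorspace.axioms(1))

text \<open>With Q scalars the injection gives Q^(a+b) \<le> Q^(c+d), and exponents compare because
  1 < Q. The map \<open>f\<close> is an arbitrary injection of sets; it sends pairs to pairs and
  need not split into two maps.\<close>

lemma vs_rank_add_le:
  fixes V1 :: "('k::{field,finite}, 'b1) module" and V2 :: "('k, 'b2) module"
    and V3 :: "('k, 'b3) module" and V4 :: "('k, 'b4) module"
  assumes vs: "vectorspace (class_ring :: 'k ring) V1" "vectorspace (class_ring :: 'k ring) V2"
    "vectorspace (class_ring :: 'k ring) V3" "vectorspace (class_ring :: 'k ring) V4"
    and inj: "inj_on f (carrier V1 \<times> carrier V2)"
    and ran: "f ` (carrier V1 \<times> carrier V2) \<subseteq> carrier V3 \<times> carrier V4"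
  shows "vs_rank V1 + vs_rank V2 \<le> vs_rank V3 + vs_rank V4"
proof (cases "vs_rank V3 = \<infinity> \<or> vs_rank V4 = \<infinity>")
  case False
  then obtain c d where cd: "vs_rank V3 = enat c" "vs_rank V4 = enat d" by auto
  note k3 = card_eq_power_vs_rank[OF vs(3) cd(1)] and k4 = card_eq_power_vs_rank[OF vs(4) cd(2)]
  have "finite (carrier V1 \<times> carrier V2)"
    using inj ran k3 k4 by (meson finite_SigmaI finite_imageD finite_subset)
  \<comment> \<open>Both carriers contain zero, so a finite product has finite factors.\<close>
  then have fin: "finite (carrier V1)" "finite (carrier V2)"
    using carrier_nonempty[OF vs(1)] carrier_nonempty[OF vs(2)] finite_cartesian_productD1
      finite_cartesian_productD2 by blast+
  then obtain a b where ab: "vs_rank V1 = enat a" "vs_rank V2 = enat b"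
    using vs_rank_finite_iff[OF vs(1)] vs_rank_finite_iff[OF vs(2)] by (metis enat_ord_simps(4) not_infinity_eq)
  note k1 = card_eq_power_vs_rank[OF vs(1) ab(1)] and k2 = card_eq_power_vs_rank[OF vs(2) ab(2)]
  have "card (carrier V1 \<times> carrier V2) \<le> card (carrier V3 \<times> carrier V4)"
    using inj ran k3 k4 by (metis card_inj_on_le finite_SigmaI)
  then have "CARD('k) ^ (a + b) \<le> CARD('k) ^ (c + d)"
    using k1 k2 k3 k4 by (simp add: card_cartesian_product power_add)
  moreover have "1 < CARD('k)"
    using card_mono[of "UNIV :: 'k set" "{0, 1}"] by simp
  ultimately show ?thesis using ab cd by simp
qed auto

lemma vs_rank_le:
  fixes V :: "('k::{field,finite}, 'b) module" and W :: "('k, 'c) module"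
  assumes "vectorspace (class_ring :: 'k ring) V" "vectorspace (class_ring :: 'k ring) W"
    and "inj_on f (carrier V)" "f ` carrier V \<subseteq> carrier W"
  shows "vs_rank V \<le> vs_rank W"
proof (cases "vs_rank W")
  case (enat c)
  note k = card_eq_power_vs_rank[OF assms(2) enat]
  have "finite (carrier V)" using assms(3,4) k by (meson finite_imageD finite_subset)
  then obtain a where a: "vs_rank V = enat a"
    using vs_rank_finite_iff[OF assms(1)] by (metis enat_ord_simps(4) not_infinity_eq)
  note k' = card_eq_power_vs_rank[OF assms(1) a]
  have "CARD('k) ^ a \<le> CARD('k) ^ c" using card_inj_on_le[OF assms(3,4)] k k' by simp
  moreover have "1 < CARD('k)"
    using card_mono[of "UNIV :: 'k set" "{0, 1}"] by simp
  ultimately show ?thesis using a enat by simp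
qed auto

text \<open>The axioms of a vector space are equations, so they pass to linear images.\<close>

lemma vectorspace_image:
  fixes V :: "('k::field, 'b) module" and W :: "('k, 'c) module"
  assumes V: "vectorspace (class_ring :: 'k ring) V"
    and surj: "h ` carrier V = carrier W"
    and add: "\<And>x y. x \<in> carrier V \<Longrightarrow> y \<in> carrier V \<Longrightarrow> h x \<oplus>\<^bsub>W\<^esub> h y = h (x \<oplus>\<^bsub>V\<^esub> y)"
    and smult: "\<And>a x. x \<in> carrier V \<Longrightarrow> a \<odot>\<^bsub>W\<^esub> h x = h (a \<odot>\<^bsub>V\<^esub> x)"
    and zero: "\<zero>\<^bsub>W\<^esub> = h \<zero>\<^bsub>V\<^esub>"
  shows "vectorspace (class_ring :: 'k ring) W"
proof -
  interpret vectorspace "class_ring :: 'k ring" V by fact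
  have ex: "\<exists>x\<in>carrier V. y = h x" if "y \<in> carrier W" for y using surj that by blast
  have mem: "h x \<in> carrier W" if "x \<in> carrier V" for x using surj that by blast
  have smc: "a \<odot>\<^bsub>V\<^esub> x \<in> carrier V" if "x \<in> carrier V" for a x
    using smult_closed[of a x] that by simp
  note rs = add smult zero mem smc
  have "abelian_group W"
  proof (rule abelian_groupI)
    fix x y z assume "x \<in> carrier W" "y \<in> carrier W" "z \<in> carrier W"
    then obtain u v w where u: "u \<in> carrier V" "v \<in> carrier V" "w \<in> carrier V"
      "x = h u" "y = h v" "z = h w" using ex by metis
    then show "x \<oplus>\<^bsub>W\<^esub> y \<oplus>\<^bsub>W\<^esub> z = x \<oplus>\<^bsub>W\<^esub> (y \<oplus>\<^bsub>W\<^esub> z)" by (simp add: add a_assoc)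
  next
    fix x y assume "x \<in> carrier W" "y \<in> carrier W"
    then obtain u v where u: "u \<in> carrier V" "v \<in> carrier V" "x = h u" "y = h v" using ex by metis
    then show "x \<oplus>\<^bsub>W\<^esub> y \<in> carrier W" "x \<oplus>\<^bsub>W\<^esub> y = y \<oplus>\<^bsub>W\<^esub> x"
      by (simp_all add: add a_comm mem)
  next
    fix x assume "x \<in> carrier W"
    then obtain u where u: "u \<in> carrier V" "x = h u" using ex by metis
    then show "\<zero>\<^bsub>W\<^esub> \<oplus>\<^bsub>W\<^esub> x = x" by (simp add: zero add)
    have "h (\<ominus>\<^bsub>V\<^esub> u) \<oplus>\<^bsub>W\<^esub> x = \<zero>\<^bsub>W\<^esub>" "h (\<ominus>\<^bsub>V\<^esub> u) \<in> carrier W"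
      using u by (auto simp: mem zero add l_neg)
    then show "\<exists>y\<in>carrier W. y \<oplus>\<^bsub>W\<^esub> x = \<zero>\<^bsub>W\<^esub>" by blast
  qed (simp add: zero mem)
  moreover have "field (class_ring :: 'k ring)" "cring (class_ring :: 'k ring)"
    by (rule class_field.field_axioms, rule class_cring.cring_axioms)
  moreover have "module (class_ring :: 'k ring) W"
  proof (rule moduleI)
    fix a b and x y assume "x \<in> carrier W" "y \<in> carrier W"
    then obtain u v where u: "u \<in> carrier V" "v \<in> carrier V" "x = h u" "y = h v" using ex by metis
    show "a \<odot>\<^bsub>W\<^esub> (x \<oplus>\<^bsub>W\<^esub> y) = a \<odot>\<^bsub>W\<^esub> x \<oplus>\<^bsub>W\<^esub> a \<odot>\<^bsub>W\<^esub> y"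
      using u smult_r_distr[of a u v] by (simp add: add smult smc)
  next
    fix a b :: 'k and x assume "x \<in> carrier W"
    then obtain u where u: "u \<in> carrier V" "x = h u" using ex by metis
    show "a \<odot>\<^bsub>W\<^esub> x \<in> carrier W" using u by (simp add: smult smc mem)
    show "(a \<oplus>\<^bsub>class_ring\<^esub> b) \<odot>\<^bsub>W\<^esub> x = a \<odot>\<^bsub>W\<^esub> x \<oplus>\<^bsub>W\<^esub> b \<odot>\<^bsub>W\<^esub> x"
      using u smult_l_distr[of a b u] by (simp add: add smult smc)
    show "(a \<otimes>\<^bsub>class_ring\<^esub> b) \<odot>\<^bsub>W\<^esub> x = a \<odot>\<^bsub>W\<^esub> (b \<odot>\<^bsub>W\<^esub> x)"
      using u smult_assoc1[of a b u] by (simp add: add smult smc)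
    show "\<one>\<^bsub>class_ring\<^esub> \<odot>\<^bsub>W\<^esub> x = x"
      using u smult_one[of u] by (simp add: smult)
  qed fact+
  ultimately show ?thesis unfolding vectorspace_def by blast
qed

section \<open>Function spaces and their quotients\<close>

definition lin_subspace :: "('s \<Rightarrow> 'k::field) set \<Rightarrow> bool" where
  "lin_subspace Z \<longleftrightarrow> (\<lambda>_. 0) \<in> Z \<and> (\<forall>x\<in>Z. \<forall>y\<in>Z. (\<lambda>s. x s + y s) \<in> Z) \<and>
     (\<forall>a. \<forall>x\<in>Z. (\<lambda>s. a * x s) \<in> Z)"

lemma lin_subspaceD:
  assumes "lin_subspace Z"
  shows "(\<lambda>_. 0) \<in> Z" "x \<in> Z \<Longrightarrow> y \<in> Z \<Longrightarrow> (\<lambda>s. x s + y s) \<in> Z" "x \<in> Z \<Longrightarrow> (\<lambda>s. a * x s) \<in> Z"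
    "x \<in> Z \<Longrightarrow> (\<lambda>s. - x s) \<in> Z" "x \<in> Z \<Longrightarrow> y \<in> Z \<Longrightarrow> (\<lambda>s. x s - y s) \<in> Z"
proof -
  show 1: "(\<lambda>_. 0) \<in> Z" "\<And>x y. x \<in> Z \<Longrightarrow> y \<in> Z \<Longrightarrow> (\<lambda>s. x s + y s) \<in> Z"
    "\<And>a x. x \<in> Z \<Longrightarrow> (\<lambda>s. a * x s) \<in> Z" using assms by (auto simp: lin_subspace_def)
  show 2: "(\<lambda>s. - x s) \<in> Z" if "x \<in> Z" for x using 1(3)[of x "-1"] that by simp
  show "x \<in> Z \<Longrightarrow> y \<in> Z \<Longrightarrow> (\<lambda>s. x s - y s) \<in> Z" using 1(2)[of x "\<lambda>s. - y s"] 2 by simp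
qed

lemma fun_space_vectorspace:
  assumes "lin_subspace (Z :: ('s \<Rightarrow> 'k::field) set)"
  shows "vectorspace (class_ring :: 'k ring) (fun_space Z)"
proof -
  note Z = lin_subspaceD[OF assms]
  have "abelian_group (fun_space Z)"
  proof (rule abelian_groupI, goal_cases)
    case (6 x)
    then show ?case using Z(4)[of x] by (auto simp: fun_space_def intro!: bexI[of _ "\<lambda>s. - x s"])
  qed (auto simp: fun_space_def Z algebra_simps)
  moreover have "field (class_ring :: 'k ring)" "cring (class_ring :: 'k ring)"
    by (rule class_field.field_axioms, rule class_cring.cring_axioms)
  ultimately show ?thesis
    unfolding vectorspace_def
    by (intro conjI moduleI) (auto simp: fun_space_def Z algebra_simps)
qed

text \<open>A coset with the representative on the right, the shape to which
  \<open>a_rcosets\<close> of a \<open>fun_space\<close> unfolds.\<close>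

definition cst :: "('s \<Rightarrow> 'k::field) set \<Rightarrow> ('s \<Rightarrow> 'k) \<Rightarrow> ('s \<Rightarrow> 'k) set" where
  "cst W x = {\<lambda>s. w s + x s | w. w \<in> W}"

lemma cst_mem: "lin_subspace W \<Longrightarrow> y \<in> cst W x \<longleftrightarrow> (\<lambda>s. y s - x s) \<in> W"
proof
  assume W: "lin_subspace W" and y: "(\<lambda>s. y s - x s) \<in> W"
  show "y \<in> cst W x" unfolding cst_def
    by (rule CollectI, rule exI[of _ "\<lambda>s. y s - x s"]) (simp add: y)
qed (auto simp: cst_def)

lemma cst_eq_iff:
  assumes W: "lin_subspace W"
  shows "cst W x = cst W y \<longleftrightarrow> (\<lambda>s. x s - y s) \<in> W"
proof
  assume "cst W x = cst W y"
  moreover have "x \<in> cst W x" using W by (simp add: cst_mem lin_subspaceD)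
  ultimately show "(\<lambda>s. x s - y s) \<in> W" using W by (simp add: cst_mem)
next
  assume xy: "(\<lambda>s. x s - y s) \<in> W"
  have "(\<lambda>s. z s - x s) \<in> W \<longleftrightarrow> (\<lambda>s. z s - y s) \<in> W" for z
  proof
    assume "(\<lambda>s. z s - x s) \<in> W"
    from lin_subspaceD(2)[OF W this xy] show "(\<lambda>s. z s - y s) \<in> W" by simp
  next
    assume "(\<lambda>s. z s - y s) \<in> W"
    from lin_subspaceD(5)[OF W this xy] show "(\<lambda>s. z s - x s) \<in> W" by simp
  qed
  then show "cst W x = cst W y" by (auto simp: cst_mem[OF W])
qed

lemma set_add_fun_space: "A <+>\<^bsub>fun_space Z\<^esub> B = {\<lambda>s. a s + b s | a b. a \<in> A \<and> b \<in> B}"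
  by (auto simp: fun_space_def set_add_def set_mult_def)

lemma set_add_fun_spaceI:
  "a \<in> A \<Longrightarrow> b \<in> B \<Longrightarrow> (\<And>s. z s = a s + b s) \<Longrightarrow> z \<in> A <+>\<^bsub>fun_space Z\<^esub> B"
  unfolding set_add_fun_space by blast

lemma set_add_cst:
  assumes W: "lin_subspace W"
  shows "cst W x <+>\<^bsub>fun_space Z\<^esub> cst W y = cst W (\<lambda>s. x s + y s)"
proof (intro equalityI subsetI)
  fix z assume "z \<in> cst W x <+>\<^bsub>fun_space Z\<^esub> cst W y"
  then obtain a b where ab: "a \<in> cst W x" "b \<in> cst W y" "z = (\<lambda>s. a s + b s)"
    unfolding set_add_fun_space by blast
  then have "(\<lambda>s. (a s - x s) + (b s - y s)) \<in> W"
    using lin_subspaceD(2)[OF W] cst_mem[OF W] by blast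
  then show "z \<in> cst W (\<lambda>s. x s + y s)"
    by (simp add: cst_mem[OF W] ab(3) algebra_simps)
next
  fix z assume "z \<in> cst W (\<lambda>s. x s + y s)"
  then have "(\<lambda>s. z s - y s) \<in> cst W x" by (simp add: cst_mem[OF W] algebra_simps)
  moreover have "y \<in> cst W y" by (simp add: cst_mem[OF W] lin_subspaceD[OF W])
  ultimately show "z \<in> cst W x <+>\<^bsub>fun_space Z\<^esub> cst W y"
    by (intro set_add_fun_spaceI[of "\<lambda>s. z s - y s" _ y]) auto
qed

lemma quotient_space_carrier: "carrier (quotient_space (fun_space Z) W) = cst W ` Z"
  by (auto simp: quotient_space_def A_RCOSETS_def RCOSETS_def r_coset_def fun_space_def cst_def)

text \<open>\<open>f\<close> has to change only by elements of \<open>W'\<close> when its argument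
  changes by elements of \<open>W\<close>. Then all values on a coset lie in one coset, and the
  summand \<open>W'\<close> built into \<open>coset_map\<close> fills that coset completely.\<close>

lemma coset_map_cst:
  assumes W: "lin_subspace W" and W': "lin_subspace W'"
    and f: "\<And>w. w \<in> W \<Longrightarrow> (\<lambda>s. f (\<lambda>s. w s + x s) s - f x s) \<in> W'"
  shows "coset_map (fun_space Z) W' f (cst W x) = cst W' (f x)"
proof (intro equalityI subsetI)
  fix z assume "z \<in> coset_map (fun_space Z) W' f (cst W x)"
  then obtain w' w where w: "w' \<in> W'" "w \<in> W" "z = (\<lambda>s. w' s + f (\<lambda>s. w s + x s) s)"
    unfolding set_add_fun_space coset_map_def cst_def by blast
  then show "z \<in> cst W' (f x)"
    using lin_subspaceD(2)[OF W' w(1) f[OF w(2)]] by (simp add: cst_mem[OF W'] algebra_simps)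
next
  fix z assume "z \<in> cst W' (f x)"
  then have "(\<lambda>s. z s - f x s) \<in> W'" by (simp add: cst_mem[OF W'])
  moreover have "x \<in> cst W x" by (simp add: cst_mem[OF W] lin_subspaceD[OF W])
  ultimately show "z \<in> coset_map (fun_space Z) W' f (cst W x)"
    unfolding coset_map_def by (intro set_add_fun_spaceI[of "\<lambda>s. z s - f x s" _ "f x"]) auto
qed

lemma quotient_space_ops:
  assumes W: "lin_subspace W" and Z: "lin_subspace Z" and WZ: "W \<subseteq> Z"
  shows "cst W x \<oplus>\<^bsub>quotient_space (fun_space Z) W\<^esub> cst W y = cst W (\<lambda>s. x s + y s)"
    and "a \<odot>\<^bsub>quotient_space (fun_space Z) W\<^esub> cst W x = cst W (\<lambda>s. a * x s)"
    and "\<zero>\<^bsub>quotient_space (fun_space Z) W\<^esub> = cst W (\<lambda>_. 0)"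
proof -
  show "cst W x \<oplus>\<^bsub>quotient_space (fun_space Z) W\<^esub> cst W y = cst W (\<lambda>s. x s + y s)"
    by (simp add: quotient_space_def set_add_cst[OF W])
  show "\<zero>\<^bsub>quotient_space (fun_space Z) W\<^esub> = cst W (\<lambda>_. 0)"
    by (auto simp: quotient_space_def cst_def)
  show "a \<odot>\<^bsub>quotient_space (fun_space Z) W\<^esub> cst W x = cst W (\<lambda>s. a * x s)"
    using coset_map_cst[OF W W, of "\<lambda>x s. a * x s" x Z] lin_subspaceD(3)[OF W]
    by (simp add: quotient_space_def coset_map_def fun_space_def algebra_simps)
qed

lemma quotient_space_vectorspace:
  fixes Z :: "('s \<Rightarrow> 'k::field) set"
  assumes W: "lin_subspace W" and Z: "lin_subspace Z" and WZ: "W \<subseteq> Z"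
  shows "vectorspace (class_ring :: 'k ring) (quotient_space (fun_space Z) W)"
  by (rule vectorspace_image[OF fun_space_vectorspace[OF Z], of "cst W"])
    (auto simp: quotient_space_ops[OF assms] quotient_space_carrier, auto simp: fun_space_def)

section \<open>Direct limits\<close>

locale dirsys =
  fixes V :: "'i::linorder \<Rightarrow> ('k::field, 'b) module" and t :: "'i \<Rightarrow> 'i \<Rightarrow> 'b \<Rightarrow> 'b"
  assumes vs: "vectorspace (class_ring :: 'k ring) (V i)"
    and closed: "i \<le> j \<Longrightarrow> x \<in> carrier (V i) \<Longrightarrow> t i j x \<in> carrier (V j)"
    and add: "i \<le> j \<Longrightarrow> x \<in> carrier (V i) \<Longrightarrow> y \<in> carrier (V i) \<Longrightarrow>
      t i j (x \<oplus>\<^bsub>V i\<^esub> y) = t i j x \<oplus>\<^bsub>V j\<^esub> t i j y"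
    and smult: "i \<le> j \<Longrightarrow> x \<in> carrier (V i) \<Longrightarrow> t i j (a \<odot>\<^bsub>V i\<^esub> x) = a \<odot>\<^bsub>V j\<^esub> t i j x"
    and refl: "x \<in> carrier (V i) \<Longrightarrow> t i i x = x"
    and comp: "i \<le> j \<Longrightarrow> j \<le> k \<Longrightarrow> x \<in> carrier (V i) \<Longrightarrow> t j k (t i j x) = t i k x"
begin

lemma add_closed: "x \<in> carrier (V i) \<Longrightarrow> y \<in> carrier (V i) \<Longrightarrow> x \<oplus>\<^bsub>V i\<^esub> y \<in> carrier (V i)"
  using vs[of i] by (metis abelian_group.axioms(1) abelian_monoid.a_closed module.axioms(2) vectorspace.axioms(1))

lemma smult_closed: "x \<in> carrier (V i) \<Longrightarrow> a \<odot>\<^bsub>V i\<^esub> x \<in> carrier (V i)"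
proof -
  interpret vectorspace "class_ring :: 'k ring" "V i" by (rule vs)
  show "x \<in> carrier (V i) \<Longrightarrow> a \<odot>\<^bsub>V i\<^esub> x \<in> carrier (V i)" by simp
qed

lemma zero_closed: "\<zero>\<^bsub>V i\<^esub> \<in> carrier (V i)"
proof -
  interpret vectorspace "class_ring :: 'k ring" "V i" by (rule vs)
  show ?thesis by simp
qed

lemma zero: "i \<le> j \<Longrightarrow> t i j \<zero>\<^bsub>V i\<^esub> = \<zero>\<^bsub>V j\<^esub>"
proof -
  assume ij: "i \<le> j"
  interpret i: vectorspace "class_ring :: 'k ring" "V i" by (rule vs)
  interpret j: vectorspace "class_ring :: 'k ring" "V j" by (rule vs)
  have "t i j (\<zero>\<^bsub>class_ring\<^esub> \<odot>\<^bsub>V i\<^esub> \<zero>\<^bsub>V i\<^esub>) = \<zero>\<^bsub>class_ring\<^esub> \<odot>\<^bsub>V j\<^esub> t i j \<zero>\<^bsub>V i\<^esub>"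
    using smult[OF ij zero_closed] .
  then show ?thesis
    using i.lmult_0[OF zero_closed] j.lmult_0[OF closed[OF ij zero_closed]] by simp
qed

definition dcls :: "'i \<Rightarrow> 'b \<Rightarrow> ('i \<times> 'b) set" where
  "dcls i x = dirlim_rel V t `` {(i, x)}"

lemma equiv: "equiv (SIGMA i:UNIV. carrier (V i)) (dirlim_rel V t)"
proof (rule equivI)
  show "dirlim_rel V t \<subseteq> (SIGMA i:UNIV. carrier (V i)) \<times> (SIGMA i:UNIV. carrier (V i))"
    by (auto simp: dirlim_rel_def)
  show "refl_on (SIGMA i:UNIV. carrier (V i)) (dirlim_rel V t)"
    by (auto simp: dirlim_rel_def refl_on_def)
  show "sym (dirlim_rel V t)" by (auto simp: dirlim_rel_def sym_def)
  show "trans (dirlim_rel V t)"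
  proof (rule transI)
    fix P Q R assume PQ: "(P, Q) \<in> dirlim_rel V t" and QR: "(Q, R) \<in> dirlim_rel V t"
    obtain i x j y l z where PQR: "P = (i, x)" "Q = (j, y)" "R = (l, z)" by (metis prod.exhaust)
    obtain k where k: "i \<le> k" "j \<le> k" "t i k x = t j k y" "x \<in> carrier (V i)" "y \<in> carrier (V j)"
      using PQ by (auto simp: dirlim_rel_def PQR)
    obtain k' where k': "j \<le> k'" "l \<le> k'" "t j k' y = t l k' z" "z \<in> carrier (V l)"
      using QR by (auto simp: dirlim_rel_def PQR)
    \<comment> \<open>Two witnesses of equality are pushed to a common later stage; the index order
      is linear, so the maximum serves.\<close>
    let ?m = "max k k'"
    have "t i ?m x = t k ?m (t i k x)" using k comp[of i k ?m x] by simp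
    also have "\<dots> = t k' ?m (t j k' y)" using k k' comp[of j k ?m y] comp[of j k' ?m y] by simp
    also have "\<dots> = t l ?m z" using k' comp[of l k' ?m z] by simp
    finally show "(P, R) \<in> dirlim_rel V t"
      using k k' unfolding dirlim_rel_def PQR by (auto simp: le_max_iff_disj intro!: exI[of _ ?m])
  qed
qed

lemma dcls_eq_iff:
  "x \<in> carrier (V i) \<Longrightarrow> y \<in> carrier (V j) \<Longrightarrow>
    dcls i x = dcls j y \<longleftrightarrow> (\<exists>k. i \<le> k \<and> j \<le> k \<and> t i k x = t j k y)"
  unfolding dcls_def using eq_equiv_class_iff[OF equiv, of "(i, x)" "(j, y)"]
  by (auto simp: dirlim_rel_def)

lemma dcls_shift: "i \<le> k \<Longrightarrow> x \<in> carrier (V i) \<Longrightarrow> dcls k (t i k x) = dcls i x"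
  by (subst dcls_eq_iff) (auto simp: closed refl intro!: exI[of _ k])

lemma mem_dcls: "(j, y) \<in> dcls i x \<Longrightarrow> x \<in> carrier (V i) \<and> y \<in> carrier (V j) \<and> dcls j y = dcls i x"
  using equiv_class_eq[OF equiv, of "(i, x)" "(j, y)"] by (auto simp: dcls_def dirlim_rel_def)

lemma dcls_self: "x \<in> carrier (V i) \<Longrightarrow> (i, x) \<in> dcls i x"
  unfolding dcls_def by (rule equiv_class_self[OF equiv]) simp

lemma carrier_dirlim: "P \<in> carrier (dirlim V t) \<longleftrightarrow> (\<exists>i. \<exists>x\<in>carrier (V i). P = dcls i x)"
  by (auto simp: dirlim_def quotient_def dcls_def)

lemma dcls_closed: "x \<in> carrier (V i) \<Longrightarrow> dcls i x \<in> carrier (dirlim V t)"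
  using carrier_dirlim by blast

text \<open>An element represented at one stage is represented at every later one. Hence finitely
  many elements can be brought to a common stage, where the vector space axioms are read
  off.\<close>

lemma dirlim_stage:
  assumes "P \<in> carrier (dirlim V t)"
  shows "\<exists>i. \<forall>k\<ge>i. \<exists>x\<in>carrier (V k). P = dcls k x"
  using assms unfolding carrier_dirlim by (metis closed dcls_shift)

lemma dirlim_common:
  assumes "P \<in> carrier (dirlim V t)" "Q \<in> carrier (dirlim V t)"
  shows "\<exists>k. \<exists>x\<in>carrier (V k). \<exists>y\<in>carrier (V k). P = dcls k x \<and> Q = dcls k y"
  using dirlim_stage[OF assms(1)] dirlim_stage[OF assms(2)] by (meson linorder_linear)

lemma dirlim_common3:
  assumes "P \<in> carrier (dirlim V t)" "Q \<in> carrier (dirlim V t)" "R \<in> carrier (dirlim V t)"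
  shows "\<exists>k. \<exists>x\<in>carrier (V k). \<exists>y\<in>carrier (V k). \<exists>z\<in>carrier (V k).
    P = dcls k x \<and> Q = dcls k y \<and> R = dcls k z"
proof -
  obtain a b c where "\<forall>k\<ge>a. \<exists>x\<in>carrier (V k). P = dcls k x"
    "\<forall>k\<ge>b. \<exists>x\<in>carrier (V k). Q = dcls k x" "\<forall>k\<ge>c. \<exists>x\<in>carrier (V k). R = dcls k x"
    using dirlim_stage assms by metis
  moreover have "a \<le> max a (max b c)" "b \<le> max a (max b c)" "c \<le> max a (max b c)"
    by (auto simp: le_max_iff_disj)
  ultimately show ?thesis by metis
qed

text \<open>\<open>dirlim\<close> defines a sum as a union over all pairs of representatives. All
  sets in this union are one and the same class, and the union is not empty because a class contains
  its own representative.\<close>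

lemma dcls_add:
  assumes x: "x \<in> carrier (V k)" and y: "y \<in> carrier (V k)"
  shows "dcls k x \<oplus>\<^bsub>dirlim V t\<^esub> dcls k y = dcls k (x \<oplus>\<^bsub>V k\<^esub> y)"
proof -
  have *: "dcls (max i j) (t i (max i j) x' \<oplus>\<^bsub>V (max i j)\<^esub> t j (max i j) y') = dcls k (x \<oplus>\<^bsub>V k\<^esub> y)"
    if "(i, x') \<in> dcls k x" "(j, y') \<in> dcls k y" for i j x' y'
  proof -
    let ?m = "max i j"
    have x': "x' \<in> carrier (V i)" "dcls i x' = dcls k x" and y': "y' \<in> carrier (V j)" "dcls j y' = dcls k y"
      using mem_dcls that by auto
    obtain p where p: "i \<le> p" "k \<le> p" "t i p x' = t k p x" using x' x dcls_eq_iff by blast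
    obtain q where q: "j \<le> q" "k \<le> q" "t j q y' = t k q y" using y' y dcls_eq_iff by blast
    let ?r = "max p q"
    have r: "t i ?r x' = t k ?r x" "t j ?r y' = t k ?r y"
      using p q x x' y y' comp[of i p ?r x'] comp[of k p ?r x] comp[of j q ?r y'] comp[of k q ?r y] by auto
    have le: "?m \<le> ?r" "k \<le> ?r" using p q by (auto simp: le_max_iff_disj)
    have "t ?m ?r (t i ?m x' \<oplus>\<^bsub>V ?m\<^esub> t j ?m y') = t i ?r x' \<oplus>\<^bsub>V ?r\<^esub> t j ?r y'"
      using x' y' le by (simp add: add closed comp)
    also have "\<dots> = t k ?r (x \<oplus>\<^bsub>V k\<^esub> y)" using x y le by (simp add: r add)
    finally show ?thesis using le x y x' y' by (subst dcls_eq_iff) (auto simp: closed add_closed)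
  qed
  have "dcls k x \<oplus>\<^bsub>dirlim V t\<^esub> dcls k y =
    (\<Union>(i, x')\<in>dcls k x. \<Union>(j, y')\<in>dcls k y. dcls (max i j) (t i (max i j) x' \<oplus>\<^bsub>V (max i j)\<^esub> t j (max i j) y'))"
    by (simp add: dirlim_def dcls_def)
  also have "\<dots> = (\<Union>P\<in>dcls k x. \<Union>Q\<in>dcls k y. dcls k (x \<oplus>\<^bsub>V k\<^esub> y))"
    by (intro SUP_cong HOL.refl) (auto simp: *)
  also have "\<dots> = dcls k (x \<oplus>\<^bsub>V k\<^esub> y)" using dcls_self x y by fastforce
  finally show ?thesis .
qed

lemma dcls_smult:
  assumes x: "x \<in> carrier (V k)"
  shows "a \<odot>\<^bsub>dirlim V t\<^esub> dcls k x = dcls k (a \<odot>\<^bsub>V k\<^esub> x)"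
proof -
  have *: "dcls i (a \<odot>\<^bsub>V i\<^esub> x') = dcls k (a \<odot>\<^bsub>V k\<^esub> x)" if "(i, x') \<in> dcls k x" for i x'
  proof -
    have x': "x' \<in> carrier (V i)" "dcls i x' = dcls k x" using mem_dcls that by auto
    obtain p where p: "i \<le> p" "k \<le> p" "t i p x' = t k p x" using x' x dcls_eq_iff by blast
    then show ?thesis using x x' by (subst dcls_eq_iff) (auto simp: smult smult_closed intro!: exI[of _ p])
  qed
  have "a \<odot>\<^bsub>dirlim V t\<^esub> dcls k x = (\<Union>(i, x')\<in>dcls k x. dcls i (a \<odot>\<^bsub>V i\<^esub> x'))"
    by (simp add: dirlim_def dcls_def)
  also have "\<dots> = (\<Union>P\<in>dcls k x. dcls k (a \<odot>\<^bsub>V k\<^esub> x))"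
    by (intro SUP_cong HOL.refl) (auto simp: *)
  also have "\<dots> = dcls k (a \<odot>\<^bsub>V k\<^esub> x)" using dcls_self x by fastforce
  finally show ?thesis .
qed

text \<open>\<open>dirlim\<close> describes zero as the set of all elements that die at some stage.
  This set is a single class, and zero at any stage \<open>k\<close> represents it.\<close>

lemma dcls_zero: "\<zero>\<^bsub>dirlim V t\<^esub> = dcls k \<zero>\<^bsub>V k\<^esub>"
proof (rule Set.set_eqI)
  fix P :: "'i \<times> 'b"
  obtain i x where P: "P = (i, x)" by (cases P)
  show "P \<in> \<zero>\<^bsub>dirlim V t\<^esub> \<longleftrightarrow> P \<in> dcls k \<zero>\<^bsub>V k\<^esub>" unfolding P
  proof
    assume "(i, x) \<in> \<zero>\<^bsub>dirlim V t\<^esub>"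
    then obtain l where l: "x \<in> carrier (V i)" "i \<le> l" "t i l x = \<zero>\<^bsub>V l\<^esub>" by (auto simp: dirlim_def)
    let ?m = "max l k"
    have "t k ?m \<zero>\<^bsub>V k\<^esub> = t i ?m x" using l comp[of i l ?m x] by (simp add: zero)
    then show "(i, x) \<in> dcls k \<zero>\<^bsub>V k\<^esub>"
      using l by (auto simp: dcls_def dirlim_rel_def zero_closed le_max_iff_disj intro!: exI[of _ ?m])
  next
    assume "(i, x) \<in> dcls k \<zero>\<^bsub>V k\<^esub>"
    then show "(i, x) \<in> \<zero>\<^bsub>dirlim V t\<^esub>"
      by (auto simp: dcls_def dirlim_rel_def dirlim_def zero)
  qed
qed

lemma dirlim_vectorspace: "vectorspace (class_ring :: 'k ring) (dirlim V t)"
proof -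
  let ?L = "dirlim V t"
  have vsk: "vectorspace (class_ring :: 'k ring) (V k)" for k by (rule vs)
  note rs = dcls_add dcls_smult dcls_closed add_closed smult_closed
  have "abelian_group ?L"
  proof (rule abelian_groupI)
    fix P Q R assume "P \<in> carrier ?L" "Q \<in> carrier ?L" "R \<in> carrier ?L"
    then obtain k x y z where k: "x \<in> carrier (V k)" "y \<in> carrier (V k)" "z \<in> carrier (V k)"
      "P = dcls k x" "Q = dcls k y" "R = dcls k z" using dirlim_common3 by metis
    interpret vectorspace "class_ring :: 'k ring" "V k" by (rule vs)
    show "P \<oplus>\<^bsub>?L\<^esub> Q \<oplus>\<^bsub>?L\<^esub> R = P \<oplus>\<^bsub>?L\<^esub> (Q \<oplus>\<^bsub>?L\<^esub> R)" using k by (simp add: rs a_assoc)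
  next
    fix P Q assume "P \<in> carrier ?L" "Q \<in> carrier ?L"
    then obtain k x y where k: "x \<in> carrier (V k)" "y \<in> carrier (V k)"
      "P = dcls k x" "Q = dcls k y" using dirlim_common by metis
    interpret vectorspace "class_ring :: 'k ring" "V k" by (rule vs)
    show "P \<oplus>\<^bsub>?L\<^esub> Q \<in> carrier ?L" "P \<oplus>\<^bsub>?L\<^esub> Q = Q \<oplus>\<^bsub>?L\<^esub> P" using k by (simp_all add: rs a_comm)
  next
    fix P assume "P \<in> carrier ?L"
    then obtain k x where k: "x \<in> carrier (V k)" "P = dcls k x" using carrier_dirlim by blast
    interpret vectorspace "class_ring :: 'k ring" "V k" by (rule vs)
    show "\<zero>\<^bsub>?L\<^esub> \<oplus>\<^bsub>?L\<^esub> P = P" using k by (simp add: dcls_zero[of k] rs)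
    have "dcls k (\<ominus>\<^bsub>V k\<^esub> x) \<oplus>\<^bsub>?L\<^esub> P = \<zero>\<^bsub>?L\<^esub>" using k by (simp add: dcls_zero[of k] rs l_neg)
    then show "\<exists>Q\<in>carrier ?L. Q \<oplus>\<^bsub>?L\<^esub> P = \<zero>\<^bsub>?L\<^esub>"
      using k by (intro bexI[of _ "dcls k (\<ominus>\<^bsub>V k\<^esub> x)"]) (auto simp: rs)
  qed (simp add: dcls_zero[of undefined] rs zero_closed)
  moreover have "field (class_ring :: 'k ring)" "cring (class_ring :: 'k ring)"
    by (rule class_field.field_axioms, rule class_cring.cring_axioms)
  moreover have "module (class_ring :: 'k ring) ?L"
  proof (rule moduleI)
    fix a b and P Q assume "P \<in> carrier ?L" "Q \<in> carrier ?L"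
    then obtain k x y where k: "x \<in> carrier (V k)" "y \<in> carrier (V k)"
      "P = dcls k x" "Q = dcls k y" using dirlim_common by metis
    interpret vectorspace "class_ring :: 'k ring" "V k" by (rule vs)
    show "a \<odot>\<^bsub>?L\<^esub> (P \<oplus>\<^bsub>?L\<^esub> Q) = a \<odot>\<^bsub>?L\<^esub> P \<oplus>\<^bsub>?L\<^esub> a \<odot>\<^bsub>?L\<^esub> Q"
      using k smult_r_distr[of a x y] by (simp add: rs)
  next
    fix a b :: 'k and P assume "P \<in> carrier ?L"
    then obtain k x where k: "x \<in> carrier (V k)" "P = dcls k x" using carrier_dirlim by blast
    interpret vectorspace "class_ring :: 'k ring" "V k" by (rule vs)
    show "a \<odot>\<^bsub>?L\<^esub> P \<in> carrier ?L" using k by (simp add: rs)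
    show "(a \<oplus>\<^bsub>class_ring\<^esub> b) \<odot>\<^bsub>?L\<^esub> P = a \<odot>\<^bsub>?L\<^esub> P \<oplus>\<^bsub>?L\<^esub> b \<odot>\<^bsub>?L\<^esub> P"
      using k smult_l_distr[of a b x] by (simp add: rs)
    show "(a \<otimes>\<^bsub>class_ring\<^esub> b) \<odot>\<^bsub>?L\<^esub> P = a \<odot>\<^bsub>?L\<^esub> (b \<odot>\<^bsub>?L\<^esub> P)"
      using k smult_assoc1[of a b x] by (simp add: rs)
    show "\<one>\<^bsub>class_ring\<^esub> \<odot>\<^bsub>?L\<^esub> P = P"
      using k smult_one[of x] by (simp add: rs)
  qed fact+
  ultimately show ?thesis unfolding vectorspace_def by blast
qed

end

locale dirsys_map = U: dirsys U s + V: dirsys V t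
  for U :: "'i::linorder \<Rightarrow> ('k::field, 'b) module" and s
    and V :: "'i::linorder \<Rightarrow> ('k::field, 'c) module" and t +
  fixes f :: "'i \<Rightarrow> 'b \<Rightarrow> 'c"
  assumes f_closed: "x \<in> carrier (U i) \<Longrightarrow> f i x \<in> carrier (V i)"
    and f_add: "x \<in> carrier (U i) \<Longrightarrow> y \<in> carrier (U i) \<Longrightarrow> f i (x \<oplus>\<^bsub>U i\<^esub> y) = f i x \<oplus>\<^bsub>V i\<^esub> f i y"
    and f_smult: "x \<in> carrier (U i) \<Longrightarrow> f i (a \<odot>\<^bsub>U i\<^esub> x) = a \<odot>\<^bsub>V i\<^esub> f i x"
    and f_commute: "i \<le> j \<Longrightarrow> x \<in> carrier (U i) \<Longrightarrow> f j (s i j x) = t i j (f i x)"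
begin

lemma dirlim_map_dcls:
  assumes x: "x \<in> carrier (U i)"
  shows "dirlim_map V t f (U.dcls i x) = V.dcls i (f i x)"
proof -
  have *: "V.dcls j (f j y) = V.dcls i (f i x)" if "(j, y) \<in> U.dcls i x" for j y
  proof -
    have y: "y \<in> carrier (U j)" "U.dcls j y = U.dcls i x" using U.mem_dcls that by auto
    obtain k where "j \<le> k" "i \<le> k" "s j k y = s i k x" using U.dcls_eq_iff x y by blast
    then show ?thesis using x y
      by (subst V.dcls_eq_iff) (auto simp: f_closed f_commute[symmetric] intro!: exI[of _ k])
  qed
  have "dirlim_map V t f (U.dcls i x) = (\<Union>(j, y)\<in>U.dcls i x. V.dcls j (f j y))"
    by (simp add: dirlim_map_def V.dcls_def)
  also have "\<dots> = (\<Union>P\<in>U.dcls i x. V.dcls i (f i x))"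
    by (intro SUP_cong HOL.refl) (auto simp: *)
  also have "\<dots> = V.dcls i (f i x)" using U.dcls_self x by fastforce
  finally show ?thesis .
qed

end

section \<open>Towers of cycles modulo boundaries\<close>

definition linear_between :: "('s \<Rightarrow> 'k::field) set \<Rightarrow> (('s \<Rightarrow> 'k) \<Rightarrow> 'r \<Rightarrow> 'k) \<Rightarrow> bool" where
  "linear_between Z f \<longleftrightarrow>
     (\<forall>x\<in>Z. \<forall>y\<in>Z. f (\<lambda>s. x s + y s) = (\<lambda>s. f x s + f y s)) \<and> (\<forall>a. \<forall>x\<in>Z. f (\<lambda>s. a * x s) = (\<lambda>s. a * f x s))"

lemma linear_betweenD:
  assumes "linear_between Z f" "lin_subspace Z"
  shows "x \<in> Z \<Longrightarrow> y \<in> Z \<Longrightarrow> f (\<lambda>s. x s + y s) = (\<lambda>s. f x s + f y s)"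
    "x \<in> Z \<Longrightarrow> f (\<lambda>s. a * x s) = (\<lambda>s. a * f x s)"
    "x \<in> Z \<Longrightarrow> y \<in> Z \<Longrightarrow> f (\<lambda>s. x s - y s) = (\<lambda>s. f x s - f y s)"
    "f (\<lambda>_. 0) = (\<lambda>_. 0)"
proof -
  show 1: "x \<in> Z \<Longrightarrow> y \<in> Z \<Longrightarrow> f (\<lambda>s. x s + y s) = (\<lambda>s. f x s + f y s)" for x y
    using assms(1) unfolding linear_between_def by blast
  show 2: "x \<in> Z \<Longrightarrow> f (\<lambda>s. a * x s) = (\<lambda>s. a * f x s)" for x a
    using assms(1) unfolding linear_between_def by blast
  show "f (\<lambda>s. x s - y s) = (\<lambda>s. f x s - f y s)" if x: "x \<in> Z" and y: "y \<in> Z"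
  proof -
    have "f (\<lambda>s. - y s) = (\<lambda>s. - f y s)" using 2[OF y, of "-1"] by simp
    then show ?thesis using 1[OF x lin_subspaceD(4)[OF assms(2) y]] by simp
  qed
  show "f (\<lambda>_. 0) = (\<lambda>_. 0)"
    using 2[of "\<lambda>_. 0" 0] lin_subspaceD(1)[OF assms(2)] by simp
qed

text \<open>The common form of all homology groups in the proof, with transition maps given on
  chains. They are required to be linear on cycles only, since \<open>chain_push\<close> is additive
  only where its sums are finite.\<close>

locale tower =
  fixes Z B :: "nat \<Rightarrow> ('s \<Rightarrow> 'k::field) set" and T :: "nat \<Rightarrow> nat \<Rightarrow> ('s \<Rightarrow> 'k) \<Rightarrow> 's \<Rightarrow> 'k"
  assumes Z: "lin_subspace (Z n)" and B: "lin_subspace (B n)" and BZ: "B n \<subseteq> Z n"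
    and T_Z: "m \<le> n \<Longrightarrow> z \<in> Z m \<Longrightarrow> T m n z \<in> Z n"
    and T_B: "m \<le> n \<Longrightarrow> z \<in> B m \<Longrightarrow> T m n z \<in> B n"
    and T_lin: "m \<le> n \<Longrightarrow> linear_between (Z m) (T m n)"
    and T_refl: "z \<in> Z n \<Longrightarrow> T n n z = z"
    and T_comp: "l \<le> m \<Longrightarrow> m \<le> n \<Longrightarrow> z \<in> Z l \<Longrightarrow> T m n (T l m z) = T l n z"
begin

definition stage :: "nat \<Rightarrow> ('k, ('s \<Rightarrow> 'k) set) module" where
  "stage n = quotient_space (fun_space (Z n)) (B n)"

definition trans :: "nat \<Rightarrow> nat \<Rightarrow> ('s \<Rightarrow> 'k) set \<Rightarrow> ('s \<Rightarrow> 'k) set" where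
  "trans m n = coset_map (fun_space (Z n)) (B n) (T m n)"

abbreviation lim :: "('k, (nat \<times> ('s \<Rightarrow> 'k) set) set) module" where
  "lim \<equiv> dirlim stage trans"

lemma trans_cst:
  assumes "m \<le> n" "z \<in> Z m"
  shows "trans m n (cst (B m) z) = cst (B n) (T m n z)"
  unfolding trans_def
proof (rule coset_map_cst[OF B B])
  fix w assume w: "w \<in> B m"
  then have "w \<in> Z m" using BZ by blast
  then have "T m n (\<lambda>s. w s + z s) = (\<lambda>s. T m n w s + T m n z s)"
    by (rule linear_betweenD(1)[OF T_lin[OF assms(1)] Z _ assms(2)])
  then show "(\<lambda>s. T m n (\<lambda>s. w s + z s) s - T m n z s) \<in> B n"
    using T_B[OF assms(1) w] by simp
qed

lemma stage_carrier: "carrier (stage n) = cst (B n) ` Z n"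
  by (simp add: stage_def quotient_space_carrier)

lemma stage_ops:
  "cst (B n) x \<oplus>\<^bsub>stage n\<^esub> cst (B n) y = cst (B n) (\<lambda>s. x s + y s)"
  "a \<odot>\<^bsub>stage n\<^esub> cst (B n) x = cst (B n) (\<lambda>s. a * x s)"
  "\<zero>\<^bsub>stage n\<^esub> = cst (B n) (\<lambda>_. 0)"
  unfolding stage_def by (rule quotient_space_ops[OF B Z BZ])+

sublocale dirsys stage trans
proof (rule dirsys.intro)
  show "vectorspace (class_ring :: 'k ring) (stage n)" for n
    unfolding stage_def by (rule quotient_space_vectorspace[OF B Z BZ])
next
  fix m n l and X Y :: "('s \<Rightarrow> 'k) set" and a :: 'k
  assume "X \<in> carrier (stage m)"
  then obtain x where x: "X = cst (B m) x" "x \<in> Z m" by (auto simp: stage_carrier)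
  show "trans m m X = X" using x by (simp add: trans_cst T_refl)
  assume mn: "m \<le> n"
  show "trans n l (trans m n X) = trans m l X" if "n \<le> l"
    using x mn that by (simp add: trans_cst T_comp T_Z)
  show "trans m n X \<in> carrier (stage n)" using x mn by (simp add: stage_carrier trans_cst T_Z)
  show "trans m n (a \<odot>\<^bsub>stage m\<^esub> X) = a \<odot>\<^bsub>stage n\<^esub> trans m n X"
    using x mn linear_betweenD(2)[OF T_lin[OF mn] Z x(2)]
    by (simp add: stage_ops trans_cst T_Z lin_subspaceD(3)[OF Z])
  assume "Y \<in> carrier (stage m)"
  then obtain y where y: "Y = cst (B m) y" "y \<in> Z m" by (auto simp: stage_carrier)
  show "trans m n (X \<oplus>\<^bsub>stage m\<^esub> Y) = trans m n X \<oplus>\<^bsub>stage n\<^esub> trans m n Y"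
    using x y mn linear_betweenD(1)[OF T_lin[OF mn] Z x(2) y(2)]
    by (simp add: stage_ops trans_cst T_Z lin_subspaceD(2)[OF Z])
qed

definition cl :: "nat \<Rightarrow> ('s \<Rightarrow> 'k) \<Rightarrow> (nat \<times> ('s \<Rightarrow> 'k) set) set" where
  "cl n z = dcls n (cst (B n) z)"

lemma carrier_lim: "P \<in> carrier lim \<longleftrightarrow> (\<exists>n. \<exists>z\<in>Z n. P = cl n z)"
  unfolding carrier_dirlim stage_carrier cl_def by blast

lemma cl_closed: "z \<in> Z n \<Longrightarrow> cl n z \<in> carrier lim"
  using carrier_lim by blast

text \<open>Reduces equality in the limit to chains: the two cycles become homologous at a common
  later stage. The rank comparisons use the limit of a tower mostly through this criterion and
  \<open>carrier_lim\<close>.\<close>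

lemma cl_eq_iff:
  assumes "z \<in> Z n" "w \<in> Z m"
  shows "cl n z = cl m w \<longleftrightarrow> (\<exists>k. n \<le> k \<and> m \<le> k \<and> (\<lambda>s. T n k z s - T m k w s) \<in> B k)"
proof -
  have "cl n z = cl m w \<longleftrightarrow> (\<exists>k. n \<le> k \<and> m \<le> k \<and> trans n k (cst (B n) z) = trans m k (cst (B m) w))"
    unfolding cl_def using assms by (intro dcls_eq_iff) (auto simp: stage_carrier)
  also have "\<dots> \<longleftrightarrow> (\<exists>k. n \<le> k \<and> m \<le> k \<and> (\<lambda>s. T n k z s - T m k w s) \<in> B k)"
  proof -
    have "trans n k (cst (B n) z) = trans m k (cst (B m) w) \<longleftrightarrow> (\<lambda>s. T n k z s - T m k w s) \<in> B k"
      if "n \<le> k" "m \<le> k" for k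
      using that assms by (simp add: trans_cst cst_eq_iff[OF B])
    then show ?thesis by blast
  qed
  finally show ?thesis .
qed

lemma cl_shift: "n \<le> k \<Longrightarrow> z \<in> Z n \<Longrightarrow> cl k (T n k z) = cl n z"
  unfolding cl_def using dcls_shift[of n k "cst (B n) z"] by (simp add: trans_cst stage_carrier)

end

text \<open>Only one chosen representative of each class is mapped, so \<open>\<alpha>\<close> need
  not send boundaries to boundaries or commute with transition maps. By \<open>reflect\<close>,
  representatives with equal image classes have equal classes, which makes the resulting map of
  limits injective.\<close>

lemma vs_rank_le_tower:
  fixes Z B :: "nat \<Rightarrow> ('s \<Rightarrow> 'k::{field,finite}) set" and Z' B' :: "nat \<Rightarrow> ('r \<Rightarrow> 'k) set"
  assumes "tower Z B T" "tower Z' B' T'"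
    and \<alpha>: "\<And>n z. z \<in> Z n \<Longrightarrow> \<alpha> n z \<in> Z' (k n)"
    and reflect: "\<And>n m z w K. z \<in> Z n \<Longrightarrow> w \<in> Z m \<Longrightarrow> k n \<le> K \<Longrightarrow> k m \<le> K \<Longrightarrow>
      (\<lambda>s. T' (k n) K (\<alpha> n z) s - T' (k m) K (\<alpha> m w) s) \<in> B' K \<Longrightarrow>
      \<exists>l. n \<le> l \<and> m \<le> l \<and> (\<lambda>s. T n l z s - T m l w s) \<in> B l"
  shows "vs_rank (tower.lim Z B T) \<le> vs_rank (tower.lim Z' B' T')"
proof -
  interpret A: tower Z B T by fact
  interpret A': tower Z' B' T' by fact
  obtain N z where Nz: "\<And>P. P \<in> carrier A.lim \<Longrightarrow> z P \<in> Z (N P) \<and> P = A.cl (N P) (z P)"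
    using A.carrier_lim by metis
  define f where "f P = A'.cl (k (N P)) (\<alpha> (N P) (z P))" for P
  show ?thesis
  proof (rule vs_rank_le[OF A.dirlim_vectorspace A'.dirlim_vectorspace])
    show "f ` carrier A.lim \<subseteq> carrier A'.lim"
      using Nz \<alpha> by (auto simp: f_def intro!: A'.cl_closed)
    show "inj_on f (carrier A.lim)"
    proof (rule inj_onI)
      fix P Q assume P: "P \<in> carrier A.lim" and Q: "Q \<in> carrier A.lim" and "f P = f Q"
      then obtain K where "k (N P) \<le> K" "k (N Q) \<le> K"
        "(\<lambda>s. T' (k (N P)) K (\<alpha> (N P) (z P)) s - T' (k (N Q)) K (\<alpha> (N Q) (z Q)) s) \<in> B' K"
        unfolding f_def using A'.cl_eq_iff[OF \<alpha> \<alpha>, of "z P" "N P" "z Q" "N Q"] Nz[OF P] Nz[OF Q] by blast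
      from reflect[OF _ _ this] have "A.cl (N P) (z P) = A.cl (N Q) (z Q)"
        using Nz[OF P] Nz[OF Q] by (subst A.cl_eq_iff) auto
      then show "P = Q" using Nz[OF P] Nz[OF Q] by simp
    qed
  qed
qed

section \<open>Alternating functions on tuples\<close>

text \<open>Alternation tested on adjacent entries, the form that suits recursion on tuples.
  Vanishing on repetitions is a separate clause because antisymmetry does not give it in
  characteristic 2.\<close>

definition alt :: "('v list \<Rightarrow> 'k::field) \<Rightarrow> bool" where
  "alt c \<longleftrightarrow> (\<forall>xs v ys. c (xs @ v # v # ys) = 0) \<and>
     (\<forall>xs v w ys. c (xs @ v # w # ys) = - c (xs @ w # v # ys))"

lemma altD: "alt c \<Longrightarrow> c (xs @ v # v # ys) = 0" "alt c \<Longrightarrow> c (xs @ v # w # ys) = - c (xs @ w # v # ys)"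
  unfolding alt_def by blast+

text \<open>Exchange \<open>a\<close> with its right neighbour, then the pair by induction, then the
  neighbour with \<open>b\<close>: three signs.\<close>

lemma alt_swap: "alt c \<Longrightarrow> c (xs @ a # ys @ b # zs) = - c (xs @ b # ys @ a # zs)"
proof (induction ys arbitrary: xs)
  case Nil
  then show ?case using altD(2)[of c xs a b zs] by simp
next
  case (Cons y ys)
  have "c (xs @ a # (y # ys) @ b # zs) = - c ((xs @ [y]) @ a # ys @ b # zs)"
    using altD(2)[OF Cons.prems, of xs a y] by simp
  also have "\<dots> = c ((xs @ [y]) @ b # ys @ a # zs)" using Cons.IH[OF Cons.prems, of "xs @ [y]"] by simp
  also have "\<dots> = - c (xs @ b # (y # ys) @ a # zs)"
    using altD(2)[OF Cons.prems, of xs y b] by simp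
  finally show ?case .
qed

lemma alt_repeat: "alt c \<Longrightarrow> c (xs @ a # ys @ a # zs) = 0"
proof (induction ys arbitrary: xs)
  case Nil
  then show ?case using altD(1)[of c xs a zs] by simp
next
  case (Cons y ys)
  have "c (xs @ a # (y # ys) @ a # zs) = - c ((xs @ [y]) @ a # ys @ a # zs)"
    using altD(2)[OF Cons.prems, of xs a y] by simp
  then show ?case using Cons.IH[OF Cons.prems, of "xs @ [y]"] by simp
qed

lemma alt_distinct: "alt c \<Longrightarrow> c \<sigma> \<noteq> 0 \<Longrightarrow> distinct \<sigma>"
  using not_distinct_decomp[of \<sigma>] alt_repeat[of c] by auto

lemma alternating_iff_alt:
  fixes c :: "'v list \<Rightarrow> 'k::field"
  shows "alternating c \<longleftrightarrow> alt c"
proof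
  assume c: "alternating c"
  show "alt c" unfolding alt_def
  proof (intro conjI allI)
    fix xs v ys show "c (xs @ v # v # ys) = 0" using c unfolding alternating_def by simp
  next
    fix xs ys :: "'v list" and v w
    let ?i = "length xs" and ?s = "xs @ w # v # ys"
    let ?p = "Transposition.transpose ?i (Suc ?i)"
    have p: "?p permutes {..<length ?s}" by (rule permutes_swap_id) auto
    have "permute_list ?p ?s = xs @ v # w # ys"
    proof (rule nth_equalityI)
      fix n assume "n < length (permute_list ?p ?s)"
      then have "permute_list ?p ?s ! n = ?s ! (?p n)" using permute_list_nth[OF p, of n] by simp
      also have "\<dots> = (xs @ v # w # ys) ! n"
        by (simp add: Transposition.transpose_def nth_append nth_Cons')
      finally show "permute_list ?p ?s ! n = (xs @ v # w # ys) ! n" .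
    qed simp
    moreover have "sign ?p = -1" by (simp add: sign_swap_id)
    ultimately show "c (xs @ v # w # ys) = - c (xs @ w # v # ys)"
      using c p unfolding alternating_def by (metis mult_minus1 of_int_1 of_int_minus)
  qed
next
  assume c: "alt c"
  \<comment> \<open>\<open>\<sigma>\<close> is cut at the places \<open>i\<close> and
    \<open>j\<close>, so that the transposition becomes the exchange treated in
    \<open>alt_swap\<close>.\<close>
  have sw: "c (permute_list (Transposition.transpose i j) \<sigma>) = - c \<sigma>" if ij: "i < j" "j < length \<sigma>" for i j \<sigma>
  proof -
    define xs ys zs where "xs = take i \<sigma>" and "ys = take (j - Suc i) (drop (Suc i) \<sigma>)" and "zs = drop (Suc j) \<sigma>"
    have s: "\<sigma> = xs @ \<sigma> ! i # ys @ \<sigma> ! j # zs"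
    proof -
      have "drop (Suc i) \<sigma> = ys @ drop (Suc i) \<sigma> ! (j - Suc i) # drop (Suc (j - Suc i)) (drop (Suc i) \<sigma>)"
        unfolding ys_def using ij by (intro id_take_nth_drop) auto
      also have "drop (Suc i) \<sigma> ! (j - Suc i) = \<sigma> ! j" using ij by simp
      also have "drop (Suc (j - Suc i)) (drop (Suc i) \<sigma>) = zs" using ij by (simp add: zs_def)
      finally show ?thesis using id_take_nth_drop[of i \<sigma>] ij unfolding xs_def by simp
    qed
    have l: "length xs = i" "length ys = j - Suc i" using ij by (auto simp: xs_def ys_def)
    define a b where "a = \<sigma> ! i" and "b = \<sigma> ! j"
    have s': "\<sigma> = xs @ a # ys @ b # zs" using s by (simp add: a_def b_def)
    have "permute_list (Transposition.transpose i j) \<sigma> = xs @ b # ys @ a # zs" (is "?L = ?R")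
    proof (rule nth_equalityI)
      show "length ?L = length ?R" by (simp add: s')
    next
      fix n assume "n < length ?L"
      then have n: "n < length \<sigma>" by simp
      have "?L ! n = \<sigma> ! (Transposition.transpose i j n)" using n by (simp add: permute_list_def)
      also have "\<dots> = ?R ! n"
        unfolding s' using l ij by (auto simp: Transposition.transpose_def nth_append nth_Cons')
      finally show "?L ! n = ?R ! n" .
    qed
    then show ?thesis using alt_swap[OF c, of xs b ys a zs] s' by simp
  qed
  \<comment> \<open>Transpositions generate the permutations of a finite set, and each changes
    \<open>sign\<close>.\<close>
  have perm: "\<forall>\<sigma>. length \<sigma> = n \<longrightarrow> c (permute_list p \<sigma>) = of_int (sign p) * c \<sigma>"
    if "p permutes {..<n}" for p n
    using that finite_lessThan
  proof (induction rule: permutes_induct)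
    case (swap a b p)
    have "c (permute_list (Transposition.transpose a b \<circ> p) \<sigma>) = of_int (sign (Transposition.transpose a b \<circ> p)) * c \<sigma>"
      if l: "length \<sigma> = n" for \<sigma>
    proof -
      have "c (permute_list (Transposition.transpose a b) \<sigma>) = - c \<sigma>"
        using swap(1-3) l sw[of a b \<sigma>] sw[of b a \<sigma>]
        by (cases a b rule: linorder_cases) (auto simp: Transposition.transpose_commute)
      moreover have "sign (Transposition.transpose a b \<circ> p) = - sign p"
        using swap by (simp add: sign_compose permutation_swap_id permutes_imp_permutation[OF finite_lessThan]
            sign_swap_id)
      moreover have "p permutes {..<length \<sigma>}" using swap l by simp
      ultimately show ?thesis using swap l by (simp add: permute_list_compose)
    qed
    then show ?case by blast
  qed auto
  then show "alternating c" using alt_distinct[OF c] unfolding alternating_def by blast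
qed

text \<open>The pairs (x, y) and (y, x) cancel and the diagonal vanishes. The induction on
  \<open>S\<close> carries out this pairing; that the sum equals its own negative would give nothing
  in characteristic 2.\<close>

lemma sum_antisym:
  fixes F :: "'a \<Rightarrow> 'a \<Rightarrow> 'k::field"
  assumes "finite S" "\<And>x y. F x y = - F y x" "\<And>x. F x x = 0"
  shows "(\<Sum>x\<in>S. \<Sum>y\<in>S. F x y) = 0"
  using assms(1)
proof (induction S rule: finite_induct)
  case (insert a S)
  have "(\<Sum>x\<in>S. F x a) = - (\<Sum>x\<in>S. F a x)" using assms(2)[of _ a] by (simp add: sum_negf)
  then show ?case using insert by (simp add: sum.distrib assms(3))
qed simp

section \<open>Links, pushforwards and cones of alternating functions\<close>

text \<open>The contraction of a chain with the vertex \<open>u\<close>. Recursion on the first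
  entry of a tuple expresses pushforwards and cones through contractions, which anticommute by
  \<open>lnk_lnk\<close>.\<close>

definition lnk :: "'v \<Rightarrow> ('v list \<Rightarrow> 'k::field) \<Rightarrow> 'v list \<Rightarrow> 'k" where
  "lnk u c = (\<lambda>\<sigma>. c (u # \<sigma>))"

lemma lnk_apply: "lnk u c \<sigma> = c (u # \<sigma>)" by (simp add: lnk_def)

lemma alt_lnk: "alt c \<Longrightarrow> alt (lnk u c)"
  using altD[of c "u # _"] unfolding alt_def by (metis append_Cons lnk_apply)

lemma lnk_lnk: "alt c \<Longrightarrow> lnk u (lnk v c) = (\<lambda>\<sigma>. - lnk v (lnk u c) \<sigma>)"
  "alt c \<Longrightarrow> lnk u (lnk u c) = (\<lambda>_. 0)"
proof -
  show "lnk u (lnk v c) = (\<lambda>\<sigma>. - lnk v (lnk u c) \<sigma>)" if "alt c"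
    using altD(2)[OF that, of "[]" v u] by (intro ext) (simp only: lnk_apply append_Nil)
  show "lnk u (lnk u c) = (\<lambda>_. 0)" if "alt c"
    using altD(1)[OF that, of "[]" u] by (intro ext) (simp only: lnk_apply append_Nil)
qed

lemma lnk_lin: "lnk u (\<lambda>\<sigma>. - c \<sigma>) = (\<lambda>\<sigma>. - lnk u c \<sigma>)" "lnk u (\<lambda>\<sigma>. 0) = (\<lambda>_. 0)"
  "lnk u (\<lambda>\<sigma>. c \<sigma> + d \<sigma>) = (\<lambda>\<sigma>. lnk u c \<sigma> + lnk u d \<sigma>)"
  "lnk u (\<lambda>\<sigma>. c \<sigma> - d \<sigma>) = (\<lambda>\<sigma>. lnk u c \<sigma> - lnk u d \<sigma>)"
  "lnk u (\<lambda>\<sigma>. a * c \<sigma>) = (\<lambda>\<sigma>. a * lnk u c \<sigma>)"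
  "lnk u (\<lambda>\<sigma>. \<Sum>i\<in>I. e i \<sigma>) = (\<lambda>\<sigma>. \<Sum>i\<in>I. lnk u (e i) \<sigma>)"
  by (auto simp: lnk_def)

text \<open>Pushforward along \<open>h\<close> of the part of \<open>c\<close> on the vertices in
  \<open>A\<close>. It is linear without any condition on supports, unlike
  \<open>chain_push\<close>. There is no clause for degenerate tuples: for finite \<open>A\<close>
  alternation makes those values vanish.\<close>

fun psh :: "'v set \<Rightarrow> ('v \<Rightarrow> 'w) \<Rightarrow> ('v list \<Rightarrow> 'k::field) \<Rightarrow> 'w list \<Rightarrow> 'k" where
  "psh A h c [] = c []"
| "psh A h c (v # \<tau>) = (\<Sum>u | u \<in> A \<and> h u = v. psh A h (lnk u c) \<tau>)"

text \<open>The join of \<open>c\<close> with the vertex \<open>a\<close>: the entry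
  \<open>a\<close> is either first or further back, and moving the cone point past the first entry
  costs a sign.\<close>

fun cone :: "'v \<Rightarrow> ('v list \<Rightarrow> 'k::field) \<Rightarrow> 'v list \<Rightarrow> 'k" where
  "cone a c [] = 0"
| "cone a c (v # \<tau>) = (if v = a then c \<tau> else 0) - cone a (lnk v c) \<tau>"

text \<open>In contrast to \<open>lf_boundary\<close> this sums also at the empty tuple. It is the
  augmented boundary, for which the cone formula \<open>bd_cone\<close> holds at every
  tuple.\<close>

definition bd :: "'v set \<Rightarrow> ('v list \<Rightarrow> 'k::field) \<Rightarrow> 'v list \<Rightarrow> 'k" where
  "bd B c \<tau> = (\<Sum>u\<in>B. c (u # \<tau>))"

lemma psh_lin: "psh A h (\<lambda>\<sigma>. 0) \<tau> = 0" "psh A h (\<lambda>\<sigma>. - c \<sigma>) \<tau> = - psh A h c \<tau>"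
  "psh A h (\<lambda>\<sigma>. c \<sigma> + d \<sigma>) \<tau> = psh A h c \<tau> + psh A h d \<tau>"
  "psh A h (\<lambda>\<sigma>. c \<sigma> - d \<sigma>) \<tau> = psh A h c \<tau> - psh A h d \<tau>"
  "psh A h (\<lambda>\<sigma>. a * c \<sigma>) \<tau> = a * psh A h c \<tau>"
  "psh A h (\<lambda>\<sigma>. \<Sum>i\<in>I. e i \<sigma>) \<tau> = (\<Sum>i\<in>I. psh A h (e i) \<tau>)"
proof -
  show "psh A h (\<lambda>\<sigma>. 0) \<tau> = 0" by (induction \<tau>) (auto simp: lnk_lin)
  show "psh A h (\<lambda>\<sigma>. - c \<sigma>) \<tau> = - psh A h c \<tau>"
    by (induction \<tau> arbitrary: c) (auto simp: lnk_lin sum_negf)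
  show "psh A h (\<lambda>\<sigma>. c \<sigma> + d \<sigma>) \<tau> = psh A h c \<tau> + psh A h d \<tau>"
    by (induction \<tau> arbitrary: c d) (auto simp: lnk_lin sum.distrib)
  show "psh A h (\<lambda>\<sigma>. c \<sigma> - d \<sigma>) \<tau> = psh A h c \<tau> - psh A h d \<tau>"
    by (induction \<tau> arbitrary: c d) (auto simp: lnk_lin sum_subtractf)
  show "psh A h (\<lambda>\<sigma>. a * c \<sigma>) \<tau> = a * psh A h c \<tau>"
    by (induction \<tau> arbitrary: c) (auto simp: lnk_lin sum_distrib_left)
  show "psh A h (\<lambda>\<sigma>. \<Sum>i\<in>I. e i \<sigma>) \<tau> = (\<Sum>i\<in>I. psh A h (e i) \<tau>)"
    by (induction \<tau> arbitrary: e) (auto simp: lnk_lin intro: sum.swap)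
qed

lemma psh_zero: "psh A h (\<lambda>_. 0) = (\<lambda>_. 0)"
  by (rule ext) (rule psh_lin(1))

lemma cone_lin: "cone a (\<lambda>\<sigma>. 0) \<tau> = 0" "cone a (\<lambda>\<sigma>. - c \<sigma>) \<tau> = - cone a c \<tau>"
  "cone a (\<lambda>\<sigma>. c \<sigma> + d \<sigma>) \<tau> = cone a c \<tau> + cone a d \<tau>"
  "cone a (\<lambda>\<sigma>. c \<sigma> - d \<sigma>) \<tau> = cone a c \<tau> - cone a d \<tau>"
  "cone a (\<lambda>\<sigma>. b * c \<sigma>) \<tau> = b * cone a c \<tau>"
  "cone a (\<lambda>\<sigma>. \<Sum>i\<in>I. e i \<sigma>) \<tau> = (\<Sum>i\<in>I. cone a (e i) \<tau>)"
proof -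
  show "cone a (\<lambda>\<sigma>. 0) \<tau> = 0" by (induction \<tau>) (auto simp: lnk_lin)
  show "cone a (\<lambda>\<sigma>. - c \<sigma>) \<tau> = - cone a c \<tau>"
    by (induction \<tau> arbitrary: c) (auto simp: lnk_lin)
  show "cone a (\<lambda>\<sigma>. c \<sigma> + d \<sigma>) \<tau> = cone a c \<tau> + cone a d \<tau>"
    by (induction \<tau> arbitrary: c d) (auto simp: lnk_lin)
  show "cone a (\<lambda>\<sigma>. c \<sigma> - d \<sigma>) \<tau> = cone a c \<tau> - cone a d \<tau>"
    by (induction \<tau> arbitrary: c d) (auto simp: lnk_lin)
  show "cone a (\<lambda>\<sigma>. b * c \<sigma>) \<tau> = b * cone a c \<tau>"
    by (induction \<tau> arbitrary: c) (auto simp: lnk_lin algebra_simps)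
  show "cone a (\<lambda>\<sigma>. \<Sum>i\<in>I. e i \<sigma>) \<tau> = (\<Sum>i\<in>I. cone a (e i) \<tau>)"
    by (induction \<tau> arbitrary: e) (auto simp: lnk_lin sum_subtractf sum_negf)
qed

lemma psh_alt:
  assumes "finite A" "alt c"
  shows "alt (psh A h c)"
proof -
  have fin: "finite {u \<in> A. h u = v}" for v using assms(1) by simp
  have 1: "psh A h c (xs @ v # v # ys) = 0" if "alt c" for c xs v ys
    using that
  proof (induction xs arbitrary: c)
    case Nil
    \<comment> \<open>Two adjacent entries \<open>v\<close> give a sum over pairs of preimages, and
      the double contraction is antisymmetric in the pair.\<close>
    have "(\<Sum>u | u \<in> A \<and> h u = v. \<Sum>w | w \<in> A \<and> h w = v. psh A h (lnk w (lnk u c)) ys) = 0"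
    proof (rule sum_antisym[OF fin])
      show "psh A h (lnk y (lnk x c)) ys = - psh A h (lnk x (lnk y c)) ys" for x y
        by (subst lnk_lnk(1)[OF Nil]) (rule psh_lin(2))
      show "psh A h (lnk x (lnk x c)) ys = 0" for x
        by (subst lnk_lnk(2)[OF Nil]) (rule psh_lin(1))
    qed
    then show ?case by simp
  qed (auto simp: alt_lnk)
  have 2: "psh A h c (xs @ v # w # ys) = - psh A h c (xs @ w # v # ys)" if "alt c" for c xs v w ys
    using that
  proof (induction xs arbitrary: c)
    case Nil
    have "psh A h c (v # w # ys) = (\<Sum>u | u \<in> A \<and> h u = v. \<Sum>x | x \<in> A \<and> h x = w. psh A h (lnk x (lnk u c)) ys)"
      by simp
    also have "\<dots> = (\<Sum>x | x \<in> A \<and> h x = w. \<Sum>u | u \<in> A \<and> h u = v. psh A h (lnk x (lnk u c)) ys)"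
      by (rule sum.swap)
    also have "\<dots> = (\<Sum>x | x \<in> A \<and> h x = w. \<Sum>u | u \<in> A \<and> h u = v. - psh A h (lnk u (lnk x c)) ys)"
      using lnk_lnk(1)[OF Nil] by (intro sum.cong refl) (metis psh_lin(2))
    finally show ?case by (simp add: sum_negf)
  qed (auto simp: alt_lnk sum_negf)
  show ?thesis using 1 2 assms unfolding alt_def by blast
qed

lemma cone_alt:
  assumes "alt c"
  shows "alt (cone a c)"
proof -
  have 1: "cone a c (xs @ v # v # ys) = 0" if "alt c" for c xs v ys
    using that
  proof (induction xs arbitrary: c)
    case Nil
    then show ?case by (auto simp: lnk_lnk(2) cone_lin lnk_apply)
  next
    case (Cons x xs)
    then show ?case using altD(1)[of c xs v ys] by (auto simp: alt_lnk)
  qed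
  have 2: "cone a c (xs @ v # w # ys) = - cone a c (xs @ w # v # ys)" if "alt c" for c xs v w ys
    using that
  proof (induction xs arbitrary: c)
    case Nil
    have "cone a (lnk w (lnk v c)) ys = - cone a (lnk v (lnk w c)) ys"
      by (subst lnk_lnk(1)[OF Nil]) (rule cone_lin(2))
    then show ?case by (auto simp: lnk_apply)
  next
    case (Cons x xs)
    then show ?case using altD(2)[OF Cons.prems, of xs v w ys] by (auto simp: alt_lnk)
  qed
  show ?thesis using 1 2 assms unfolding alt_def by blast
qed

text \<open>A join that uses the same vertex twice is degenerate. This disposes of edges from
  \<open>f u\<close> to \<open>g u\<close> that collapse to a point.\<close>

lemma cone_cone: "cone a (cone a c) \<tau> = 0"
proof (induction \<tau> arbitrary: c)
  case (Cons v \<tau>)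
  have "lnk v (cone a c) = (\<lambda>\<sigma>. (if v = a then c \<sigma> else 0) - cone a (lnk v c) \<sigma>)" by (auto simp: fun_eq_iff lnk_apply)
  then show ?case using Cons by (auto simp: cone_lin)
qed simp

lemma cone_support:
  "cone a c \<tau> \<noteq> 0 \<Longrightarrow> \<exists>xs ys. \<tau> = xs @ a # ys \<and> c (xs @ ys) \<noteq> 0"
proof (induction \<tau> arbitrary: c)
  case (Cons v \<tau>)
  show ?case
  proof (cases "cone a (lnk v c) \<tau> = 0")
    case True
    then show ?thesis using Cons.prems by (intro exI[of _ "[]"] exI[of _ \<tau>]) (auto split: if_splits)
  next
    case False
    from Cons.IH[OF this] obtain xs ys where "\<tau> = xs @ a # ys" "c (v # xs @ ys) \<noteq> 0"
      by (auto simp: lnk_apply)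
    then show ?thesis by (intro exI[of _ "v # xs"] exI[of _ ys]) auto
  qed
qed simp

lemma cone_cong: "(\<And>\<omega>. set \<omega> \<subseteq> set \<tau> \<Longrightarrow> c \<omega> = d \<omega>) \<Longrightarrow> cone a c \<tau> = cone a d \<tau>"
proof (induction \<tau> arbitrary: c d)
  case (Cons v \<tau>)
  have "c \<tau> = d \<tau>" by (rule Cons.prems) auto
  moreover have "cone a (lnk v c) \<tau> = cone a (lnk v d) \<tau>" by (rule Cons.IH) (simp add: lnk_apply, rule Cons.prems, auto)
  ultimately show ?case by simp
qed simp

lemma psh_sum:
  assumes "finite A"
  shows "psh A h c \<tau> = (\<Sum>\<sigma> | set \<sigma> \<subseteq> A \<and> map h \<sigma> = \<tau>. c \<sigma>)"
proof (induction \<tau> arbitrary: c)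
  case Nil
  have "{\<sigma>. set \<sigma> \<subseteq> A \<and> map h \<sigma> = []} = {[]}" by auto
  then show ?case by simp
next
  case (Cons v \<tau>)
  let ?S = "{\<sigma>. set \<sigma> \<subseteq> A \<and> map h \<sigma> = \<tau>}"
  have fin: "finite ?S"
    by (rule finite_subset[OF _ finite_lists_length_eq[OF assms, of "length \<tau>"]]) auto
  have "psh A h c (v # \<tau>) = (\<Sum>u | u \<in> A \<and> h u = v. \<Sum>\<sigma>\<in>?S. c (u # \<sigma>))"
    by (simp add: Cons lnk_apply)
  also have "\<dots> = (\<Sum>(u, \<sigma>)\<in>{u \<in> A. h u = v} \<times> ?S. c (u # \<sigma>))" by (simp add: sum.cartesian_product)
  also have "\<dots> = (\<Sum>\<sigma> | set \<sigma> \<subseteq> A \<and> map h \<sigma> = v # \<tau>. c \<sigma>)"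
    by (rule sum.reindex_bij_witness[of _ "\<lambda>\<sigma>. (hd \<sigma>, tl \<sigma>)" "\<lambda>(u, \<sigma>). u # \<sigma>"]) auto
  finally show ?case .
qed

lemma psh_cong:
  assumes "finite A" "\<And>\<sigma>. set \<sigma> \<subseteq> A \<Longrightarrow> map h \<sigma> = \<tau> \<Longrightarrow> c \<sigma> = d \<sigma>"
  shows "psh A h c \<tau> = psh A h d \<tau>"
  unfolding psh_sum[OF assms(1)] by (intro sum.cong) (auto intro: assms(2))

lemma finite_map_preimage: "finite A \<Longrightarrow> finite {\<sigma>. set \<sigma> \<subseteq> A \<and> map h \<sigma> = \<tau>}"
  by (rule finite_subset[OF _ finite_lists_length_eq[of A "length \<tau>"]]) auto

text \<open>Vertex set and map may be changed together, as long as nothing changes on the simplices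
  of the support that matter at \<open>\<tau>\<close>. This is how pushforwards over different
  finite vertex sets are compared.\<close>

lemma psh_cong_set:
  assumes "finite A" "finite A'"
    "\<And>\<sigma>. map h \<sigma> = \<tau> \<Longrightarrow> map h' \<sigma> = \<tau> \<or> c \<sigma> = 0" "\<And>\<sigma>. map h' \<sigma> = \<tau> \<Longrightarrow> map h \<sigma> = \<tau> \<or> c \<sigma> = 0"
    "\<And>\<sigma>. map h \<sigma> = \<tau> \<Longrightarrow> c \<sigma> \<noteq> 0 \<Longrightarrow> set \<sigma> \<subseteq> A \<longleftrightarrow> set \<sigma> \<subseteq> A'"
  shows "psh A h c \<tau> = psh A' h' c \<tau>"
  unfolding psh_sum[OF assms(1)] psh_sum[OF assms(2)]
  using assms by (intro sum.mono_neutral_cong) (auto intro: finite_map_preimage)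

text \<open>The contracting homotopy of a cone: one face of a joined simplex is opposite to
  \<open>a\<close>, and the others are joins with the faces of the base, with opposite sign.\<close>

lemma bd_cone:
  assumes "finite B" "a \<in> B"
  shows "bd B (cone a c) = (\<lambda>\<tau>. c \<tau> - cone a (bd B c) \<tau>)"
proof
  fix \<tau>
  have "bd B (cone a c) \<tau> = (\<Sum>v\<in>B. (if v = a then c \<tau> else 0)) - (\<Sum>v\<in>B. cone a (lnk v c) \<tau>)"
    by (simp add: bd_def sum_subtractf)
  also have "(\<Sum>v\<in>B. cone a (lnk v c) \<tau>) = cone a (bd B c) \<tau>"
    using cone_lin(6)[of a "\<lambda>v. lnk v c" B \<tau>] by (simp add: bd_def[abs_def] lnk_apply)
  finally show "bd B (cone a c) \<tau> = c \<tau> - cone a (bd B c) \<tau>" using assms by simp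
qed

text \<open>Each vertex of \<open>A\<close> lies in exactly one fibre of \<open>h\<close> over
  \<open>B\<close>, so summing over \<open>B\<close> and then over fibres is summing over
  \<open>A\<close>.\<close>

lemma bd_psh:
  assumes "finite A" "finite B" "h ` A \<subseteq> B"
  shows "bd B (psh A h c) = psh A h (bd A c)"
proof
  fix \<tau>
  have "bd B (psh A h c) \<tau> = (\<Sum>u\<in>A. psh A h (lnk u c) \<tau>)"
    unfolding bd_def by (simp add: sum.group[OF assms])
  also have "\<dots> = psh A h (bd A c) \<tau>"
    using psh_lin(6)[of A h "\<lambda>u. lnk u c" A \<tau>] by (simp add: bd_def[abs_def] lnk_apply)
  finally show "bd B (psh A h c) \<tau> = psh A h (bd A c) \<tau>" .
qed

text \<open>By the second assumption a simplex of the support has at most one vertex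
  \<open>u\<close> in \<open>D\<close>. Up to orientation it is \<open>u\<close> joined with its
  link, on which \<open>h\<close> and \<open>h'\<close> agree; only the cone point moves, from
  \<open>h u\<close> to \<open>h' u\<close>.\<close>

lemma psh_change:
  fixes c :: "'v list \<Rightarrow> 'k::field" and h h' :: "'v \<Rightarrow> 'w"
  assumes A: "finite A" and h: "\<And>u. u \<notin> D \<Longrightarrow> h' u = h u"
  shows "alt c \<Longrightarrow> (\<And>xs u ys w zs. u \<in> D \<Longrightarrow> w \<in> D \<Longrightarrow> c (xs @ u # ys @ w # zs) = 0) \<Longrightarrow>
    psh A h' c \<tau> - psh A h c \<tau> =
    (\<Sum>u | u \<in> A \<and> u \<in> D. cone (h' u) (psh A h (lnk u c)) \<tau> - cone (h u) (psh A h (lnk u c)) \<tau>)"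
proof (induction \<tau> arbitrary: c)
  case (Cons v \<tau>)
  let ?AD = "{u. u \<in> A \<and> u \<in> D}"
  define R where "R c = (\<Sum>u\<in>?AD. cone (h' u) (psh A h (lnk u c)) \<tau> - cone (h u) (psh A h (lnk u c)) \<tau>)" for c :: "'v list \<Rightarrow> 'k"
  \<comment> \<open>After contraction with a vertex of \<open>D\<close> no further vertex of
    \<open>D\<close> occurs in the support, so both maps push the link in the same way.\<close>
  have lnkD: "psh A h' (lnk w c) \<omega> = psh A h (lnk w c) \<omega>" if w: "w \<in> D" for w \<omega>
  proof (rule psh_cong_set[OF A A])
    have *: "map h' \<sigma> = map h \<sigma> \<or> lnk w c \<sigma> = 0" for \<sigma>
    proof (cases "set \<sigma> \<inter> D = {}")
      case True
      then show ?thesis using h by auto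
    next
      case False
      then obtain x where "x \<in> set \<sigma>" "x \<in> D" by blast
      then obtain ys zs where "\<sigma> = ys @ x # zs" "x \<in> D" by (meson split_list)
      then show ?thesis using Cons.prems(2)[OF w, of x "[]" ys zs] by (simp add: lnk_apply)
    qed
    show "map h' \<sigma> = \<omega> \<Longrightarrow> map h \<sigma> = \<omega> \<or> lnk w c \<sigma> = 0" for \<sigma> using *[of \<sigma>] by auto
    show "map h \<sigma> = \<omega> \<Longrightarrow> map h' \<sigma> = \<omega> \<or> lnk w c \<sigma> = 0" for \<sigma> using *[of \<sigma>] by auto
  qed simp
  have lnkDD: "lnk u (lnk w c) = (\<lambda>_. 0)" if "w \<in> D" "u \<in> D" for u w
    using Cons.prems(2)[OF that, of "[]" "[]"] by (auto simp: fun_eq_iff lnk_apply)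
  have RD: "R (lnk w c) = 0" if "w \<in> D" for w
    unfolding R_def using lnkDD[OF that]
    by (intro sum.neutral) (auto simp: cone_lin psh_zero)
  have IH: "psh A h' (lnk w c) \<tau> - psh A h (lnk w c) \<tau> = R (lnk w c)" for w
    unfolding R_def
  proof (rule Cons.IH)
    show "alt (lnk w c)" by (rule alt_lnk[OF Cons.prems(1)])
    show "lnk w c (xs @ u # ys @ x # zs) = 0" if "u \<in> D" "x \<in> D" for xs u ys x zs
      using Cons.prems(2)[OF that, of "w # xs"] by (simp add: lnk_apply)
  qed
  have fin: "finite {u. u \<in> A \<and> P u}" for P using A by simp
  let ?F = "\<lambda>w. psh A h (lnk w c) \<tau>"
  have split: "(\<Sum>w | w \<in> A \<and> P w. F w) = (\<Sum>w | w \<in> A \<and> P w \<and> w \<in> D. F w) + (\<Sum>w | w \<in> A \<and> P w \<and> w \<notin> D. F w)"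
    for P and F :: "'v \<Rightarrow> 'k"
  proof -
    have "{w. w \<in> A \<and> P w} \<inter> D = {w. w \<in> A \<and> P w \<and> w \<in> D}"
      "{w. w \<in> A \<and> P w} - D = {w. w \<in> A \<and> P w \<and> w \<notin> D}" by auto
    then show ?thesis using sum.Int_Diff[of "{w. w \<in> A \<and> P w}" F D] fin by simp
  qed
  have e1: "{w. w \<in> A \<and> h' w = v \<and> w \<notin> D} = {w. w \<in> A \<and> h w = v \<and> w \<notin> D}" using h by auto
  have "psh A h' c (v # \<tau>) = (\<Sum>w | w \<in> A \<and> h' w = v \<and> w \<in> D. ?F w) +
      (\<Sum>w | w \<in> A \<and> h w = v \<and> w \<notin> D. ?F w + R (lnk w c))"
  proof -
    have "psh A h' (lnk w c) \<tau> = ?F w + R (lnk w c)" for w using IH[of w] by (simp add: algebra_simps)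
    then show ?thesis using split[where P="\<lambda>w. h' w = v"] e1 RD by simp
  qed
  moreover have "psh A h c (v # \<tau>) = (\<Sum>w | w \<in> A \<and> h w = v \<and> w \<in> D. ?F w) +
      (\<Sum>w | w \<in> A \<and> h w = v \<and> w \<notin> D. ?F w)"
    using split[where P="\<lambda>w. h w = v"] by simp
  moreover have "(\<Sum>w | w \<in> A \<and> h w = v \<and> w \<notin> D. R (lnk w c)) = (\<Sum>w | w \<in> A \<and> h w = v. R (lnk w c))"
    using split[where P="\<lambda>w. h w = v" and F="\<lambda>w. R (lnk w c)"] RD by simp
  ultimately have L: "psh A h' c (v # \<tau>) - psh A h c (v # \<tau>) =
      (\<Sum>w | w \<in> A \<and> h' w = v \<and> w \<in> D. ?F w) - (\<Sum>w | w \<in> A \<and> h w = v \<and> w \<in> D. ?F w)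
      + (\<Sum>w | w \<in> A \<and> h w = v. R (lnk w c))"
    by (simp add: sum.distrib)
  \<comment> \<open>The first entry \<open>v\<close> comes from the cone point or from a vertex
    \<open>w\<close> of the link. In the second case the sign of the cone cancels the sign from
    exchanging \<open>u\<close> and \<open>w\<close>.\<close>
  have cone1: "cone b (psh A h (lnk u c)) (v # \<tau>) =
      (if v = b then ?F u else 0) + (\<Sum>w | w \<in> A \<and> h w = v. cone b (psh A h (lnk u (lnk w c))) \<tau>)" for b u
  proof -
    have "lnk v (psh A h (lnk u c)) = (\<lambda>\<omega>. \<Sum>w | w \<in> A \<and> h w = v. - psh A h (lnk u (lnk w c)) \<omega>)"
    proof
      fix \<omega>
      have "psh A h (lnk w (lnk u c)) \<omega> = - psh A h (lnk u (lnk w c)) \<omega>" for w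
        by (subst lnk_lnk(1)[OF Cons.prems(1)]) (rule psh_lin(2))
      then show "lnk v (psh A h (lnk u c)) \<omega> = (\<Sum>w | w \<in> A \<and> h w = v. - psh A h (lnk u (lnk w c)) \<omega>)"
        by (simp add: lnk_apply)
    qed
    then show ?thesis by (simp add: cone_lin sum_negf)
  qed
  have "(\<Sum>u\<in>?AD. cone (h' u) (psh A h (lnk u c)) (v # \<tau>) - cone (h u) (psh A h (lnk u c)) (v # \<tau>))
     = (\<Sum>u\<in>?AD. if v = h' u then ?F u else 0) - (\<Sum>u\<in>?AD. if v = h u then ?F u else 0)
       + (\<Sum>u\<in>?AD. \<Sum>w | w \<in> A \<and> h w = v. cone (h' u) (psh A h (lnk u (lnk w c))) \<tau> - cone (h u) (psh A h (lnk u (lnk w c))) \<tau>)"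
    unfolding cone1 by (simp add: sum.distrib sum_subtractf)
  also have "(\<Sum>u\<in>?AD. if v = h' u then ?F u else 0) = (\<Sum>w | w \<in> A \<and> h' w = v \<and> w \<in> D. ?F w)"
    using fin by (subst sum.inter_filter[symmetric]) (auto intro!: sum.cong)
  also have "(\<Sum>u\<in>?AD. if v = h u then ?F u else 0) = (\<Sum>w | w \<in> A \<and> h w = v \<and> w \<in> D. ?F w)"
    using fin by (subst sum.inter_filter[symmetric]) (auto intro!: sum.cong)
  also have "(\<Sum>u\<in>?AD. \<Sum>w | w \<in> A \<and> h w = v. cone (h' u) (psh A h (lnk u (lnk w c))) \<tau> - cone (h u) (psh A h (lnk u (lnk w c))) \<tau>)
     = (\<Sum>w | w \<in> A \<and> h w = v. R (lnk w c))"
    unfolding R_def by (rule sum.swap)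
  finally show ?case using L by simp
qed simp

section \<open>Locally finite complexes and simplicial maps\<close>

text \<open>Local finiteness and degree are left out on purpose: in a locally finite complex every
  alternating function of fixed degree supported on simplices is a locally finite chain, see
  \<open>lf_chains_eq\<close>.\<close>

definition CH :: "'v set set \<Rightarrow> ('v list \<Rightarrow> 'k::field) set" where
  "CH K = {c. alt c \<and> (\<forall>\<sigma>. c \<sigma> \<noteq> 0 \<longrightarrow> set \<sigma> \<in> K)}"

text \<open>The zero chain has every degree, so the chains of degree \<open>q\<close> form a
  subspace.\<close>

definition deg :: "nat \<Rightarrow> ('v list \<Rightarrow> 'k::field) \<Rightarrow> bool" where
  "deg q c \<longleftrightarrow> (\<forall>\<sigma>. c \<sigma> \<noteq> 0 \<longrightarrow> length \<sigma> = Suc q)"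

text \<open>Simplicial and proper: with infinite fibres on vertices the pushforward of an infinite
  chain would involve infinite sums.\<close>

definition smap :: "'v set set \<Rightarrow> 'w set set \<Rightarrow> ('v \<Rightarrow> 'w) \<Rightarrow> bool" where
  "smap K L f \<longleftrightarrow> (\<forall>S\<in>K. f ` S \<in> L) \<and> (\<forall>w. finite {v \<in> \<Union>K. f v = w})"

lemma CH_D: "c \<in> CH K \<Longrightarrow> alt c" "c \<in> CH K \<Longrightarrow> c \<sigma> \<noteq> 0 \<Longrightarrow> set \<sigma> \<in> K"
  by (auto simp: CH_def)

lemma CH_mono: "K \<subseteq> L \<Longrightarrow> CH K \<subseteq> CH L" by (auto simp: CH_def)

lemma CH_empty: "CH {} = {\<lambda>_. 0}"
  by (auto simp: CH_def alt_def)

lemma alt_lin: "alt (\<lambda>_. 0)" "alt c \<Longrightarrow> alt d \<Longrightarrow> alt (\<lambda>\<sigma>. c \<sigma> + d \<sigma>)" "alt c \<Longrightarrow> alt (\<lambda>\<sigma>. a * c \<sigma>)"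
proof -
  show "alt (\<lambda>_. 0)" by (simp add: alt_def)
  show "alt (\<lambda>\<sigma>. c \<sigma> + d \<sigma>)" if c: "alt c" and d: "alt d"
    unfolding alt_def
  proof (intro conjI allI)
    fix xs v w ys
    show "c (xs @ v # v # ys) + d (xs @ v # v # ys) = 0" using altD(1)[OF c] altD(1)[OF d] by simp
    show "c (xs @ v # w # ys) + d (xs @ v # w # ys) = - (c (xs @ w # v # ys) + d (xs @ w # v # ys))"
      using altD(2)[OF c, of xs v w] altD(2)[OF d, of xs v w] by simp
  qed
  show "alt (\<lambda>\<sigma>. a * c \<sigma>)" if c: "alt c"
    unfolding alt_def
  proof (intro conjI allI)
    fix xs v w ys
    show "a * c (xs @ v # v # ys) = 0" using altD(1)[OF c] by simp
    show "a * c (xs @ v # w # ys) = - (a * c (xs @ w # v # ys))"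
      using altD(2)[OF c, of xs v w] by simp
  qed
qed

lemma lin_subspace_CH: "lin_subspace (CH K)"
  unfolding lin_subspace_def
proof (intro conjI ballI allI)
  show "(\<lambda>_. 0) \<in> CH K" by (simp add: CH_def alt_lin)
  fix x y :: "'a list \<Rightarrow> 'b" assume xy: "x \<in> CH K" "y \<in> CH K"
  then show "(\<lambda>s. x s + y s) \<in> CH K"
    using alt_lin(2)[of x y] unfolding CH_def by (auto) (metis add_0)
next
  fix a and x :: "'a list \<Rightarrow> 'b" assume "x \<in> CH K"
  then show "(\<lambda>s. a * x s) \<in> CH K" using alt_lin(3)[of x a] unfolding CH_def by auto
qed

lemma lin_subspace_deg: "lin_subspace {c. deg q c}"
  unfolding lin_subspace_def deg_def by (auto) (metis add_0)

lemma lin_subspace_Int: "lin_subspace A \<Longrightarrow> lin_subspace B \<Longrightarrow> lin_subspace (A \<inter> B)"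
  by (simp add: lin_subspace_def)

lemma linear_between_subset: "linear_between Z f \<Longrightarrow> Z' \<subseteq> Z \<Longrightarrow> linear_between Z' f"
  unfolding linear_between_def by blast

lemma linear_between_image:
  assumes "lin_subspace Z" "linear_between Z f"
  shows "lin_subspace (f ` Z)"
  unfolding lin_subspace_def
proof (intro conjI ballI allI)
  note f = linear_betweenD[OF assms(2,1)]
  note Z = lin_subspaceD[OF assms(1)]
  show "(\<lambda>_. 0) \<in> f ` Z" using f(4) Z(1) by (rule image_eqI[OF sym])
  fix x y assume "x \<in> f ` Z" "y \<in> f ` Z"
  then obtain u v where uv: "u \<in> Z" "v \<in> Z" and xy: "x = f u" "y = f v" by blast
  show "(\<lambda>s. x s + y s) \<in> f ` Z" unfolding xy f(1)[OF uv, symmetric] using Z(2)[OF uv] by (rule imageI)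
next
  note f = linear_betweenD[OF assms(2,1)]
  note Z = lin_subspaceD[OF assms(1)]
  fix a x assume "x \<in> f ` Z"
  then obtain u where u: "u \<in> Z" and x: "x = f u" by blast
  show "(\<lambda>s. a * x s) \<in> f ` Z" unfolding x f(2)[OF u, symmetric] using Z(3)[OF u] by (rule imageI)
qed

lemma lf_boundary_bd:
  "finite B \<Longrightarrow> (\<And>v. c (v # \<tau>) \<noteq> 0 \<Longrightarrow> v \<in> B) \<Longrightarrow> \<tau> \<noteq> [] \<Longrightarrow> lf_boundary c \<tau> = bd B c \<tau>"
  unfolding lf_boundary_def bd_def by (simp, intro sum.mono_neutral_left) auto

lemma lf_boundary_Nil [simp]: "lf_boundary c [] = 0"
  by (simp add: lf_boundary_def)

lemma sum_nonzero: "sum f A \<noteq> 0 \<Longrightarrow> \<exists>x\<in>A. f x \<noteq> 0"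
  by (metis sum.neutral)

lemma lf_boundary_support: "lf_boundary c \<tau> \<noteq> 0 \<Longrightarrow> \<exists>v. c (v # \<tau>) \<noteq> 0"
  unfolding lf_boundary_def using sum_nonzero[of "\<lambda>v. c (v # \<tau>)"] by (auto split: if_splits)

lemma chain_push_support: "chain_push f c \<tau> \<noteq> 0 \<Longrightarrow> \<exists>\<sigma>. map f \<sigma> = \<tau> \<and> c \<sigma> \<noteq> 0"
  unfolding chain_push_def using sum_nonzero[of c] by (auto split: if_splits)

section \<open>The chain complex of a locally finite complex\<close>

locale lf_complex =
  fixes K :: "'v set set"
  assumes simplex: "S \<in> K \<Longrightarrow> finite S \<and> S \<noteq> {}"
    and face: "S \<in> K \<Longrightarrow> T \<subseteq> S \<Longrightarrow> T \<noteq> {} \<Longrightarrow> T \<in> K"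
    and locfin: "finite {S \<in> K. v \<in> S}"
begin

definition star :: "'v \<Rightarrow> 'v set" where "star v = \<Union>{S \<in> K. v \<in> S}"

lemma finite_star: "finite (star v)"
  unfolding star_def using locfin simplex by auto

lemma simplex_star: "S \<in> K \<Longrightarrow> v \<in> S \<Longrightarrow> S \<subseteq> star v"
  by (auto simp: star_def)

lemma CH_Nil: "c \<in> CH K \<Longrightarrow> c [] = 0"
  using CH_D(2)[of c K "[]"] simplex by fastforce

lemma CH_star: "c \<in> CH K \<Longrightarrow> c \<sigma> \<noteq> 0 \<Longrightarrow> v \<in> set \<sigma> \<Longrightarrow> set \<sigma> \<subseteq> star v"
  using CH_D(2) simplex_star by blast

lemma CH_verts: "c \<in> CH K \<Longrightarrow> c \<sigma> \<noteq> 0 \<Longrightarrow> set \<sigma> \<subseteq> \<Union>K"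
  using CH_D(2) by blast

lemma lf_chains_eq: "lf_chains q K = CH K \<inter> {c. deg q c}"
proof -
  have "finite {\<sigma>. c \<sigma> \<noteq> 0 \<and> v \<in> set \<sigma>}" if "c \<in> CH K" "deg q c" for c v
    using that by (intro finite_subset[OF _ finite_lists_length_eq[OF finite_star, of v "Suc q"]])
      (auto simp: deg_def dest: CH_star)
  then show ?thesis by (auto simp: lf_chains_def CH_def deg_def alternating_iff_alt)
qed

text \<open>A vertex that extends \<open>\<tau>\<close> to a simplex of the support lies in the star
  of the first entry of \<open>\<tau>\<close>. This set is finite and independent of
  \<open>c\<close>, so the boundary becomes a sum over a fixed index set and hence linear.\<close>

lemma boundary_bd:
  assumes "c \<in> CH K" "\<tau> \<noteq> []"
  shows "lf_boundary c \<tau> = bd (star (hd \<tau>)) c \<tau>"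
proof (rule lf_boundary_bd[OF finite_star _ assms(2)])
  fix v assume "c (v # \<tau>) \<noteq> 0"
  from CH_star[OF assms(1) this, of "hd \<tau>"] show "v \<in> star (hd \<tau>)" using assms(2) by auto
qed

lemma boundary_bd':
  assumes "c \<in> CH K" "\<tau> \<noteq> []" "finite A" "\<And>v. set (v # \<tau>) \<in> K \<Longrightarrow> v \<in> A"
  shows "lf_boundary c \<tau> = bd A c \<tau>"
  using assms CH_D(2) by (intro lf_boundary_bd) blast+

lemma boundary_linear: "linear_between (CH K) lf_boundary"
  unfolding linear_between_def
proof (intro conjI ballI allI ext)
  fix c d :: "'v list \<Rightarrow> 'k::field" and \<tau> a assume c: "c \<in> CH K"
  show "lf_boundary (\<lambda>s. a * c s) \<tau> = a * lf_boundary c \<tau>"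
    by (cases "\<tau> = []") (auto simp: boundary_bd c lin_subspaceD(3)[OF lin_subspace_CH] bd_def sum_distrib_left)
  assume d: "d \<in> CH K"
  show "lf_boundary (\<lambda>s. c s + d s) \<tau> = lf_boundary c \<tau> + lf_boundary d \<tau>"
    by (cases "\<tau> = []") (auto simp: boundary_bd c d lin_subspaceD(2)[OF lin_subspace_CH] bd_def sum.distrib)
qed

lemma boundary_CH:
  assumes c: "c \<in> CH K"
  shows "lf_boundary c \<in> CH K"
proof -
  note alt = CH_D(1)[OF c]
  have "set \<tau> \<in> K" if nz: "lf_boundary c \<tau> \<noteq> 0" for \<tau>
  proof -
    have ne: "\<tau> \<noteq> []" using nz by auto
    obtain v where "c (v # \<tau>) \<noteq> 0" using lf_boundary_support[OF nz] by blast
    from CH_D(2)[OF c this] face[of "set (v # \<tau>)" "set \<tau>"] ne show ?thesis by auto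
  qed
  moreover have "alt (lf_boundary c)"
    unfolding alt_def
  proof (intro conjI allI)
    fix xs v w ys
    show "lf_boundary c (xs @ v # v # ys) = 0"
      using altD(1)[OF alt, of "_ # xs"] by (simp add: lf_boundary_def)
    \<comment> \<open>One finite set that serves both orders of the tuple; the star of the first
      entry would differ for the two when \<open>xs\<close> is empty.\<close>
    let ?B = "star v \<union> star w"
    have mem: "u \<in> ?B" if s: "c (u # \<tau>) \<noteq> 0" and "v \<in> set \<tau>" for u \<tau>
      using CH_star[OF c s, of v] that by auto
    have "lf_boundary c (xs @ v # w # ys) = bd ?B c (xs @ v # w # ys)"
      by (rule lf_boundary_bd) (use mem in \<open>auto simp: finite_star\<close>)
    also have "\<dots> = - bd ?B c (xs @ w # v # ys)"
      using altD(2)[OF alt, of "_ # xs" v w ys] by (simp add: bd_def sum_negf)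
    also have "bd ?B c (xs @ w # v # ys) = lf_boundary c (xs @ w # v # ys)"
      by (rule lf_boundary_bd[symmetric]) (use mem in \<open>auto simp: finite_star\<close>)
    finally show "lf_boundary c (xs @ v # w # ys) = - lf_boundary c (xs @ w # v # ys)" .
  qed
  ultimately show ?thesis by (simp add: CH_def)
qed

lemma boundary_deg: "deg (Suc q) c \<Longrightarrow> deg q (lf_boundary c)"
  unfolding deg_def using lf_boundary_support[of c] by fastforce

text \<open>The value at \<open>\<tau>\<close> is a sum over two inserted vertices, both in the star
  of \<open>hd \<tau>\<close>, and it is antisymmetric in them.\<close>

lemma boundary_boundary:
  assumes c: "c \<in> CH K"
  shows "lf_boundary (lf_boundary c) = (\<lambda>_. 0)"
proof
  fix \<tau>
  show "lf_boundary (lf_boundary c) \<tau> = 0"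
  proof (cases "\<tau> = []")
    case False
    let ?A = "star (hd \<tau>)"
    have "lf_boundary (lf_boundary c) \<tau> = (\<Sum>v\<in>?A. lf_boundary c (v # \<tau>))"
      using False by (simp add: boundary_bd boundary_CH c bd_def)
    also have "\<dots> = (\<Sum>v\<in>?A. \<Sum>u\<in>?A. c (u # v # \<tau>))"
    proof (intro sum.cong refl)
      fix v
      have "lf_boundary c (v # \<tau>) = bd ?A c (v # \<tau>)"
      proof (rule lf_boundary_bd[OF finite_star])
        fix u assume "c (u # v # \<tau>) \<noteq> 0"
        from CH_star[OF c this, of "hd \<tau>"] False show "u \<in> ?A" by auto
      qed simp
      then show "lf_boundary c (v # \<tau>) = (\<Sum>u\<in>?A. c (u # v # \<tau>))" by (simp add: bd_def)
    qed
    also have "\<dots> = 0"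
    proof (rule sum_antisym[OF finite_star])
      show "c (y # x # \<tau>) = - c (x # y # \<tau>)" for x y
        using altD(2)[OF CH_D(1)[OF c], of "[]"] unfolding append_Nil .
      show "c (x # x # \<tau>) = 0" for x
        using altD(1)[OF CH_D(1)[OF c], of "[]"] unfolding append_Nil .
    qed
    finally show ?thesis .
  qed simp
qed

lemma finite_pre: "smap K L f \<Longrightarrow> finite W \<Longrightarrow> finite {u \<in> \<Union>K. f u \<in> W}"
proof -
  assume "smap K L f" "finite W"
  then have "finite (\<Union>w\<in>W. {v \<in> \<Union>K. f v = w})" by (auto simp: smap_def)
  then show ?thesis by (rule rev_finite_subset) auto
qed

lemma push_psh:
  assumes c: "alt c" and A: "finite A" and s: "\<And>\<sigma>. map f \<sigma> = \<tau> \<Longrightarrow> c \<sigma> \<noteq> 0 \<Longrightarrow> set \<sigma> \<subseteq> A"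
  shows "chain_push f c \<tau> = psh A f c \<tau>"
proof (cases "distinct \<tau>")
  case True
  then show ?thesis using s unfolding psh_sum[OF A] chain_push_def
    by (auto intro!: sum.mono_neutral_left finite_map_preimage A)
next
  case False
  then show ?thesis using alt_distinct[OF psh_alt[OF A c], of f \<tau>] by (auto simp: chain_push_def)
qed

lemma push_pre:
  assumes "c \<in> CH K" "smap K L f" "set \<tau> \<subseteq> W" "finite W"
  shows "chain_push f c \<tau> = psh {u \<in> \<Union>K. f u \<in> W} f c \<tau>"
proof (rule push_psh[OF CH_D(1)[OF assms(1)] finite_pre[OF assms(2,4)]])
  fix \<sigma> assume "map f \<sigma> = \<tau>" "c \<sigma> \<noteq> 0"
  then show "set \<sigma> \<subseteq> {u \<in> \<Union>K. f u \<in> W}" using CH_verts[OF assms(1)] assms(3) by fastforce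
qed

lemma push_linear: "smap K L f \<Longrightarrow> linear_between (CH K) (chain_push f)"
  unfolding linear_between_def
proof (intro conjI ballI allI ext)
  fix c d :: "'v list \<Rightarrow> 'k::field" and \<tau> a assume f: "smap K L f" and c: "c \<in> CH K"
  show "chain_push f (\<lambda>s. a * c s) \<tau> = a * chain_push f c \<tau>"
    by (simp add: push_pre[OF _ f subset_refl] c lin_subspaceD(3)[OF lin_subspace_CH] psh_lin)
  assume d: "d \<in> CH K"
  show "chain_push f (\<lambda>s. c s + d s) \<tau> = chain_push f c \<tau> + chain_push f d \<tau>"
    by (simp add: push_pre[OF _ f subset_refl] c d lin_subspaceD(2)[OF lin_subspace_CH] psh_lin)
qed

lemma push_CH:
  assumes c: "c \<in> CH K" and f: "smap K L f"
  shows "chain_push f c \<in> CH L"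
proof -
  have "set \<tau> \<in> L" if nz: "chain_push f c \<tau> \<noteq> 0" for \<tau>
  proof -
    obtain \<sigma> where "map f \<sigma> = \<tau>" "c \<sigma> \<noteq> 0"
      using chain_push_support[OF nz] by blast
    then show ?thesis using CH_D(2)[OF c] f by (auto simp: smap_def)
  qed
  moreover have "alt (chain_push f c)"
    unfolding alt_def
  proof (intro conjI allI)
    fix xs v w ys
    show "chain_push f c (xs @ v # v # ys) = 0" by (simp add: chain_push_def)
    let ?W = "set (xs @ v # w # ys)"
    let ?A = "{u \<in> \<Union>K. f u \<in> ?W}"
    have "chain_push f c (xs @ v # w # ys) = psh ?A f c (xs @ v # w # ys)"
      by (rule push_pre[OF c f]) auto
    also have "\<dots> = - psh ?A f c (xs @ w # v # ys)"
      by (rule altD(2)[OF psh_alt[OF finite_pre[OF f] CH_D(1)[OF c]]]) simp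
    also have "psh ?A f c (xs @ w # v # ys) = chain_push f c (xs @ w # v # ys)"
      by (rule push_pre[OF c f, symmetric]) auto
    finally show "chain_push f c (xs @ v # w # ys) = - chain_push f c (xs @ w # v # ys)" .
  qed
  ultimately show ?thesis by (simp add: CH_def)
qed

lemma push_deg: "deg q c \<Longrightarrow> deg q (chain_push f c)"
  unfolding deg_def using chain_push_support[of f c] by fastforce

lemma push_boundary:
  assumes c: "c \<in> CH K" and f: "smap K L f"
  shows "lf_boundary (chain_push f c) = chain_push f (lf_boundary c)"
proof
  fix \<tau>
  show "lf_boundary (chain_push f c) \<tau> = chain_push f (lf_boundary c) \<tau>"
  proof (cases "\<tau> = []")
    case True
    then show ?thesis by (simp add: chain_push_def)
  next
    case False
    let ?D = "{u \<in> \<Union>K. f u \<in> set \<tau>}"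
    \<comment> \<open>A simplex of the support with a vertex over \<open>\<tau>\<close> has all its
      vertices in \<open>A\<close>. On this finite set the claim becomes
      \<open>bd_psh\<close>.\<close>
    define A where "A = \<Union>(star ` ?D)"
    have fA0: "finite ?D" by (rule finite_pre[OF f]) simp
    have fA: "finite A" unfolding A_def
    proof (rule finite_Union)
      show "finite (star ` ?D)" using fA0 by (rule finite_imageI)
      show "finite M" if "M \<in> star ` ?D" for M using that finite_star by blast
    qed
    have sub: "set \<sigma> \<subseteq> A" if s: "c \<sigma> \<noteq> 0" "x \<in> set \<sigma>" "f x \<in> set \<tau>" for \<sigma> x
    proof -
      have "x \<in> ?D" using CH_verts[OF c s(1)] s(2,3) by blast
      then show ?thesis using CH_star[OF c s(1,2)] unfolding A_def by (meson SUP_upper order_trans)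
    qed
    obtain t where t: "t \<in> set \<tau>" using False by (meson hd_in_set)
    have vt: "chain_push f c (v # \<tau>) = psh A f c (v # \<tau>)" for v
    proof (rule push_psh[OF CH_D(1)[OF c] fA])
      fix \<sigma> assume m: "map f \<sigma> = v # \<tau>" and s: "c \<sigma> \<noteq> 0"
      from m have "t \<in> f ` set \<sigma>" using t by (metis list.set_intros(2) list.set_map)
      then obtain x where "x \<in> set \<sigma>" "t = f x" by (rule imageE)
      then show "set \<sigma> \<subseteq> A" using sub[OF s, of x] t by simp
    qed
    have "lf_boundary (chain_push f c) \<tau> = bd (f ` A) (chain_push f c) \<tau>"
    proof (rule lf_boundary_bd[OF finite_imageI[OF fA] _ False])
      fix v assume "chain_push f c (v # \<tau>) \<noteq> 0"
      then have "psh A f c (v # \<tau>) \<noteq> 0" using vt by simp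
      then have "(\<Sum>\<sigma> | set \<sigma> \<subseteq> A \<and> map f \<sigma> = v # \<tau>. c \<sigma>) \<noteq> 0"
        unfolding psh_sum[OF fA] .
      from sum_nonzero[OF this] obtain \<sigma> where "\<sigma> \<in> {\<sigma>. set \<sigma> \<subseteq> A \<and> map f \<sigma> = v # \<tau>}"
        by (rule bexE)
      then have "set \<sigma> \<subseteq> A" "map f \<sigma> = v # \<tau>" by simp_all
      then show "v \<in> f ` A" by (metis image_mono list.set_intros(1) list.set_map subsetD)
    qed
    also have "\<dots> = bd (f ` A) (psh A f c) \<tau>" by (simp add: bd_def vt)
    also have "\<dots> = psh A f (bd A c) \<tau>"
      using bd_psh[OF fA finite_imageI[OF fA] subset_refl] by metis
    also have "\<dots> = psh A f (lf_boundary c) \<tau>"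
    proof (rule psh_cong[OF fA])
      fix \<sigma> assume m: "map f \<sigma> = \<tau>"
      have ne: "\<sigma> \<noteq> []" using m False by auto
      have "f (hd \<sigma>) \<in> set \<tau>" using m ne by (metis hd_in_set imageI list.set_map)
      then show "bd A c \<sigma> = lf_boundary c \<sigma>"
        using sub[of "_ # \<sigma>" "hd \<sigma>"] ne by (intro lf_boundary_bd[symmetric] fA) auto
    qed
    also have "\<dots> = chain_push f (lf_boundary c) \<tau>"
    proof (rule push_psh[symmetric, OF CH_D(1)[OF boundary_CH[OF c]] fA])
      fix \<sigma> assume m: "map f \<sigma> = \<tau>" and s: "lf_boundary c \<sigma> \<noteq> 0"
      have v: "set \<sigma> \<subseteq> \<Union>K" using CH_verts[OF boundary_CH[OF c] s] .
      have "x \<in> star x" if "x \<in> \<Union>K" for x using that by (auto simp: star_def)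
      then show "set \<sigma> \<subseteq> A" using v m unfolding A_def by fastforce
    qed
    finally show ?thesis .
  qed
qed

lemma push_cong:
  assumes "c \<in> CH K" "\<And>v. v \<in> \<Union>K \<Longrightarrow> f v = g v"
  shows "chain_push f c = chain_push g c"
proof -
  have "{\<sigma>. map f \<sigma> = \<tau> \<and> c \<sigma> \<noteq> 0} = {\<sigma>. map g \<sigma> = \<tau> \<and> c \<sigma> \<noteq> 0}" for \<tau>
  proof -
    have "map f \<sigma> = map g \<sigma>" if "c \<sigma> \<noteq> 0" for \<sigma>
      using CH_verts[OF assms(1) that] assms(2) by auto
    then show ?thesis by auto
  qed
  then show ?thesis by (simp add: chain_push_def fun_eq_iff)
qed

lemma push_id:
  assumes "c \<in> CH K"
  shows "chain_push id c = c"
proof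
  fix \<tau>
  show "chain_push id c \<tau> = c \<tau>"
  proof (cases "c \<tau> = 0")
    case True
    then have "{\<sigma>. \<sigma> = \<tau> \<and> c \<sigma> \<noteq> 0} = {}" by auto
    then show ?thesis using True by (simp add: chain_push_def)
  next
    case False
    then have "{\<sigma>. \<sigma> = \<tau> \<and> c \<sigma> \<noteq> 0} = {\<tau>}" by auto
    then show ?thesis using alt_distinct[OF CH_D(1)[OF assms] False] by (simp add: chain_push_def)
  qed
qed

text \<open>Both pushforwards are finite sums over tuples, and the tuples over \<open>\<tau>\<close>
  are grouped by their image under \<open>f\<close>.\<close>

lemma push_comp:
  assumes c: "c \<in> CH K" and f: "smap K L f" and g: "smap L M g" and L: "lf_complex L"
  shows "chain_push g (chain_push f c) = chain_push (g \<circ> f) c"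
proof
  fix \<tau>
  interpret L: lf_complex L by fact
  let ?W = "{u \<in> \<Union>L. g u \<in> set \<tau>}"
  have W: "finite ?W" by (rule L.finite_pre[OF g]) simp
  let ?A = "{u \<in> \<Union>K. f u \<in> ?W}"
  have A: "finite ?A" by (rule finite_pre[OF f W])
  have fV: "f v \<in> \<Union>L" if "v \<in> \<Union>K" for v using that f by (auto simp: smap_def)
  have "chain_push g (chain_push f c) \<tau> = psh ?W g (chain_push f c) \<tau>"
    by (rule L.push_pre[OF push_CH[OF c f] g]) auto
  also have "\<dots> = (\<Sum>\<omega> | set \<omega> \<subseteq> ?W \<and> map g \<omega> = \<tau>. \<Sum>\<sigma> | set \<sigma> \<subseteq> ?A \<and> map f \<sigma> = \<omega>. c \<sigma>)"
    unfolding psh_sum[OF W]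
  proof (intro sum.cong refl)
    fix \<omega> assume "\<omega> \<in> {\<omega>. set \<omega> \<subseteq> ?W \<and> map g \<omega> = \<tau>}"
    then have "chain_push f c \<omega> = psh ?A f c \<omega>" by (intro push_pre[OF c f _ W]) auto
    then show "chain_push f c \<omega> = (\<Sum>\<sigma> | set \<sigma> \<subseteq> ?A \<and> map f \<sigma> = \<omega>. c \<sigma>)"
      unfolding psh_sum[OF A] .
  qed
  also have "\<dots> = (\<Sum>\<omega> | set \<omega> \<subseteq> ?W \<and> map g \<omega> = \<tau>.
      \<Sum>\<sigma> | \<sigma> \<in> {\<sigma>. set \<sigma> \<subseteq> ?A \<and> map (g \<circ> f) \<sigma> = \<tau>} \<and> map f \<sigma> = \<omega>. c \<sigma>)"
    by (intro sum.cong refl) auto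
  also have "\<dots> = (\<Sum>\<sigma> | set \<sigma> \<subseteq> ?A \<and> map (g \<circ> f) \<sigma> = \<tau>. c \<sigma>)"
    by (rule sum.group[OF finite_map_preimage[OF A] finite_map_preimage[OF W]]) auto
  also have "\<dots> = psh ?A (g \<circ> f) c \<tau>" unfolding psh_sum[OF A] ..
  also have "\<dots> = chain_push (g \<circ> f) c \<tau>"
    using CH_verts[OF c] fV by (intro push_psh[symmetric] CH_D(1)[OF c] A) fastforce
  finally show "chain_push g (chain_push f c) \<tau> = chain_push (g \<circ> f) c \<tau>" .
qed

end

lemma smap_comp:
  assumes "smap K L f" "smap L M g" "lf_complex K"
  shows "smap K M (g \<circ> f)"
  unfolding smap_def
proof (intro conjI ballI allI)
  show "(g \<circ> f) ` S \<in> M" if "S \<in> K" for S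
    using assms(1,2) that by (metis image_comp smap_def)
  fix w
  have "finite {u \<in> \<Union>L. g u = w}" using assms(2) by (auto simp: smap_def)
  then have "finite {v \<in> \<Union>K. f v \<in> {u \<in> \<Union>L. g u = w}}"
    by (rule lf_complex.finite_pre[OF assms(3,1)])
  moreover have "f v \<in> \<Union>L" if "v \<in> \<Union>K" for v using that assms(1) by (auto simp: smap_def)
  ultimately show "finite {v \<in> \<Union>K. (g \<circ> f) v = w}"
    by (auto elim!: rev_finite_subset)
qed

lemma smap_id: "K \<subseteq> L \<Longrightarrow> smap K L id"
  by (auto simp: smap_def)

section \<open>Contiguous maps\<close>

text \<open>
  The map \<open>f\<close> is moved to \<open>g\<close> on one level set of \<open>\<kappa>\<close> after the other. As a simplex meets a
  level set in at most one vertex \<open>u\<close>, each move is undone by the operator that replaces \<open>u\<close>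
  by the edge from \<open>f u\<close> to \<open>g u\<close>. An invariant \<open>\<kappa>\<close> gives an equivariant homotopy.
\<close>

locale contiguous_maps = K: lf_complex K + L: lf_complex L
  for K :: "'v set set" and L :: "'w set set" +
  fixes f g :: "'v \<Rightarrow> 'w" and \<kappa> :: "'v \<Rightarrow> nat"
  assumes f: "smap K L f" and g: "smap K L g"
    and contig: "S \<in> K \<Longrightarrow> f ` S \<union> g ` S \<in> L"
    and \<kappa>: "S \<in> K \<Longrightarrow> inj_on \<kappa> S"
begin

text \<open>The map at time \<open>k\<close>: vertices of rank below \<open>k\<close> have already
  been moved from \<open>f\<close> to \<open>g\<close>.\<close>

definition hh :: "nat \<Rightarrow> 'v \<Rightarrow> 'w" where
  "hh k v = (if \<kappa> v < k then g v else f v)"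

text \<open>The prism over the simplices at \<open>u\<close>: the edge from \<open>f u\<close> to
  \<open>g u\<close> joined with the link of \<open>u\<close>, taken at the moment when the vertices
  of smaller rank have been moved and the others have not.\<close>

definition Q :: "'v \<Rightarrow> ('v list \<Rightarrow> 'k::field) \<Rightarrow> 'w list \<Rightarrow> 'k" where
  "Q u c = cone (f u) (cone (g u) (psh (K.star u) (hh (\<kappa> u)) (lnk u c)))"

text \<open>Formally the sum of \<open>Q u c\<close> over all vertices. At \<open>\<tau>\<close>
  only those \<open>u\<close> contribute for which \<open>f u\<close> is an entry, and they are
  finitely many because \<open>f\<close> is proper.\<close>

definition P :: "('v list \<Rightarrow> 'k::field) \<Rightarrow> 'w list \<Rightarrow> 'k" where
  "P c \<tau> = (\<Sum>u | u \<in> \<Union>K \<and> f u \<in> set \<tau>. Q u c \<tau>)"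

lemma Q_support:
  assumes "Q u c \<tau> \<noteq> 0"
  shows "\<exists>\<sigma>. c (u # \<sigma>) \<noteq> 0 \<and> set \<tau> \<subseteq> f ` set (u # \<sigma>) \<union> g ` set (u # \<sigma>) \<and>
    length \<tau> = Suc (length (u # \<sigma>)) \<and> set \<tau> = {f u, g u} \<union> hh (\<kappa> u) ` set \<sigma> \<and> set \<sigma> \<subseteq> K.star u"
proof -
  obtain xs ys where 1: "\<tau> = xs @ f u # ys"
    "cone (g u) (psh (K.star u) (hh (\<kappa> u)) (lnk u c)) (xs @ ys) \<noteq> 0"
    using cone_support[OF assms[unfolded Q_def]] by blast
  obtain xs' ys' where 2: "xs @ ys = xs' @ g u # ys'" "psh (K.star u) (hh (\<kappa> u)) (lnk u c) (xs' @ ys') \<noteq> 0"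
    using cone_support[OF 1(2)] by blast
  obtain \<sigma> where \<sigma>: "\<sigma> \<in> {\<sigma>. set \<sigma> \<subseteq> K.star u \<and> map (hh (\<kappa> u)) \<sigma> = xs' @ ys'}" "lnk u c \<sigma> \<noteq> 0"
    using sum_nonzero[OF 2(2)[unfolded psh_sum[OF K.finite_star]]] by (rule bexE)
  have "set \<tau> = insert (f u) (set (xs @ ys))" using 1 by auto
  also have "\<dots> = insert (f u) (insert (g u) (set (xs' @ ys')))" unfolding 2 by auto
  also have "set (xs' @ ys') = hh (\<kappa> u) ` set \<sigma>" using \<sigma> by (metis (mono_tags) list.set_map mem_Collect_eq)
  finally have s: "set \<tau> = {f u, g u} \<union> hh (\<kappa> u) ` set \<sigma>" by auto
  have "length \<tau> = Suc (length (xs @ ys))" using 1 by simp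
  also have "length (xs @ ys) = Suc (length (xs' @ ys'))" unfolding 2 by simp
  also have "length (xs' @ ys') = length \<sigma>" using \<sigma> by (metis (mono_tags) length_map mem_Collect_eq)
  finally have l: "length \<tau> = Suc (length (u # \<sigma>))" by simp
  have "set \<tau> \<subseteq> f ` set (u # \<sigma>) \<union> g ` set (u # \<sigma>)" unfolding s by (auto simp: hh_def)
  moreover have "set \<sigma> \<subseteq> K.star u" using \<sigma> by simp
  ultimately show ?thesis using \<sigma>(2) s l by (auto simp: lnk_apply intro!: exI[of _ \<sigma>])
qed

lemma Q_eq: "f u = g u \<Longrightarrow> Q u c \<tau> = 0"
  by (simp add: Q_def cone_cone)

lemma Q_alt: "alt c \<Longrightarrow> alt (Q u c)"
  unfolding Q_def by (intro cone_alt psh_alt K.finite_star alt_lnk)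

lemma P_alt:
  assumes "alt c"
  shows "alt (P c)"
  unfolding alt_def
proof (intro conjI allI)
  fix xs v w ys
  show "P c (xs @ v # v # ys) = 0"
    using altD(1)[OF Q_alt[OF assms]] by (simp add: P_def)
  show "P c (xs @ v # w # ys) = - P c (xs @ w # v # ys)"
    unfolding P_def sum_negf[symmetric]
    by (rule sum.cong) (use altD(2)[OF Q_alt[OF assms], of _ xs v w ys] in auto)
qed

lemma P_support:
  assumes "P c \<tau> \<noteq> 0"
  shows "\<exists>\<sigma>. c \<sigma> \<noteq> 0 \<and> set \<tau> \<subseteq> f ` set \<sigma> \<union> g ` set \<sigma> \<and> length \<tau> = Suc (length \<sigma>)"
  using sum_nonzero[OF assms[unfolded P_def]] Q_support by blast

text \<open>A tuple in the support of \<open>P c\<close> uses only images under \<open>f\<close> and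
  \<open>g\<close> of the vertices of one simplex, so the operator respects subcomplexes. This makes
  the homotopy a relative one.\<close>

lemma P_sub:
  assumes c: "c \<in> CH K'" and KL: "\<And>S. S \<in> K' \<Longrightarrow> f ` S \<union> g ` S \<in> L'" and L': "lf_complex L'"
  shows "P c \<in> CH L'"
  unfolding CH_def
proof (intro CollectI conjI allI impI)
  show "alt (P c)" by (rule P_alt[OF CH_D(1)[OF c]])
  fix \<tau> assume "P c \<tau> \<noteq> 0"
  then obtain \<sigma> where s: "c \<sigma> \<noteq> 0" "set \<tau> \<subseteq> f ` set \<sigma> \<union> g ` set \<sigma>" "length \<tau> = Suc (length \<sigma>)"
    using P_support by blast
  have "f ` set \<sigma> \<union> g ` set \<sigma> \<in> L'" using CH_D(2)[OF c s(1)] KL by blast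
  moreover have "set \<tau> \<noteq> {}" using s(3) by auto
  ultimately show "set \<tau> \<in> L'" using lf_complex.face[OF L'] s(2) by blast
qed

lemma P_CH: "c \<in> CH K \<Longrightarrow> P c \<in> CH L"
  using P_sub[of c K L] contig L.lf_complex_axioms by blast

lemma P_deg: "deg q c \<Longrightarrow> deg (Suc q) (P c)"
  unfolding deg_def using P_support by fastforce

lemma Q_lin:
  fixes c d :: "'v list \<Rightarrow> 'k::field"
  shows "Q u (\<lambda>\<sigma>. c \<sigma> + d \<sigma>) \<tau> = Q u c \<tau> + Q u d \<tau>" "Q u (\<lambda>\<sigma>. - c \<sigma>) \<tau> = - Q u c \<tau>"
  "Q u (\<lambda>\<sigma>. a * c \<sigma>) \<tau> = a * Q u c \<tau>"
proof -
  have "psh A h (\<lambda>\<sigma>. c \<sigma> + d \<sigma>) = (\<lambda>\<tau>. psh A h c \<tau> + psh A h d \<tau>)" for A and h :: "'v \<Rightarrow> 'w" and c d :: "'v list \<Rightarrow> 'k"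
    by (rule ext) (rule psh_lin)
  moreover have "cone a (\<lambda>\<sigma>. c \<sigma> + d \<sigma>) = (\<lambda>\<tau>. cone a c \<tau> + cone a d \<tau>)" for a and c d :: "'w list \<Rightarrow> 'k"
    by (rule ext) (rule cone_lin)
  ultimately show "Q u (\<lambda>\<sigma>. c \<sigma> + d \<sigma>) \<tau> = Q u c \<tau> + Q u d \<tau>" unfolding Q_def lnk_lin by simp
  have "psh A h (\<lambda>\<sigma>. - c \<sigma>) = (\<lambda>\<tau>. - psh A h c \<tau>)" for A and h :: "'v \<Rightarrow> 'w" and c :: "'v list \<Rightarrow> 'k"
    by (rule ext) (rule psh_lin)
  moreover have "cone a (\<lambda>\<sigma>. - c \<sigma>) = (\<lambda>\<tau>. - cone a c \<tau>)" for a and c :: "'w list \<Rightarrow> 'k"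
    by (rule ext) (rule cone_lin)
  ultimately show "Q u (\<lambda>\<sigma>. - c \<sigma>) \<tau> = - Q u c \<tau>" unfolding Q_def lnk_lin by simp
  have "psh A h (\<lambda>\<sigma>. b * c \<sigma>) = (\<lambda>\<tau>. b * psh A h c \<tau>)" for A and h :: "'v \<Rightarrow> 'w" and b and c :: "'v list \<Rightarrow> 'k"
    by (rule ext) (rule psh_lin)
  moreover have "cone a (\<lambda>\<sigma>. b * c \<sigma>) = (\<lambda>\<tau>. b * cone a c \<tau>)" for a b and c :: "'w list \<Rightarrow> 'k"
    by (rule ext) (rule cone_lin)
  ultimately show "Q u (\<lambda>\<sigma>. a * c \<sigma>) \<tau> = a * Q u c \<tau>" unfolding Q_def lnk_lin by simp
qed

lemma P_linear: "linear_between Z P"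
  unfolding linear_between_def P_def by (simp add: Q_lin sum.distrib sum_distrib_left)

text \<open>Passing from \<open>hh k\<close> to \<open>hh (Suc k)\<close> moves the vertices of rank
  \<open>k\<close>. As \<open>\<kappa>\<close> is injective on simplices, \<open>psh_change\<close>
  applies with that level set as \<open>D\<close>, and the sum over the levels telescopes from
  \<open>f\<close> to \<open>g\<close>.\<close>

lemma hh_telescope:
  assumes c: "c \<in> CH K" and A: "finite A"
  shows "(\<Sum>u\<in>A. cone (g u) (psh A (hh (\<kappa> u)) (lnk u c)) \<tau> - cone (f u) (psh A (hh (\<kappa> u)) (lnk u c)) \<tau>)
    = psh A g c \<tau> - psh A f c \<tau>"
proof -
  \<comment> \<open>Exceeds all ranks on \<open>A\<close>, so that \<open>hh N\<close> agrees with
    \<open>g\<close> there; \<open>insert 0\<close> covers the case of empty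
    \<open>A\<close>.\<close>
  define N where "N = Suc (Max (insert 0 (\<kappa> ` A)))"
  have N: "\<kappa> u < N" if "u \<in> A" for u
    using that A by (simp add: N_def less_Suc_eq_le)
  let ?t = "\<lambda>u. cone (g u) (psh A (hh (\<kappa> u)) (lnk u c)) \<tau> - cone (f u) (psh A (hh (\<kappa> u)) (lnk u c)) \<tau>"
  have step: "(\<Sum>u | u \<in> A \<and> \<kappa> u = k. ?t u) = psh A (hh (Suc k)) c \<tau> - psh A (hh k) c \<tau>" for k
  proof -
    have "psh A (hh (Suc k)) c \<tau> - psh A (hh k) c \<tau> =
      (\<Sum>u | u \<in> A \<and> u \<in> {u. \<kappa> u = k}. cone (hh (Suc k) u) (psh A (hh k) (lnk u c)) \<tau>
         - cone (hh k u) (psh A (hh k) (lnk u c)) \<tau>)"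
    proof (rule psh_change[OF A _ CH_D(1)[OF c]])
      show "hh (Suc k) u = hh k u" if "u \<notin> {u. \<kappa> u = k}" for u
        using that by (auto simp: hh_def)
      fix xs u ys w zs assume uw: "u \<in> {u. \<kappa> u = k}" "w \<in> {u. \<kappa> u = k}"
      let ?s = "xs @ u # ys @ w # zs"
      show "c ?s = 0"
      proof (rule ccontr)
        assume nz: "c ?s \<noteq> 0"
        have "u \<in> set ?s" "w \<in> set ?s" by simp_all
        then have "u = w" using \<kappa>[OF CH_D(2)[OF c nz]] uw unfolding inj_on_def by blast
        then show False using alt_distinct[OF CH_D(1)[OF c] nz] by simp
      qed
    qed
    also have "\<dots> = (\<Sum>u | u \<in> A \<and> \<kappa> u = k. ?t u)"
      by (rule sum.cong) (auto simp: hh_def)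
    finally show ?thesis by simp
  qed
  have "(\<Sum>u\<in>A. ?t u) = (\<Sum>k<N. \<Sum>u | u \<in> A \<and> \<kappa> u = k. ?t u)"
    by (rule sum.group[symmetric]) (use A N in auto)
  also have "\<dots> = psh A (hh N) c \<tau> - psh A (hh 0) c \<tau>"
    unfolding step by (rule sum_lessThan_telescope)
  also have "hh 0 = f" by (auto simp: hh_def)
  also have "psh A (hh N) c \<tau> = psh A g c \<tau>"
  proof -
    have "map (hh N) \<sigma> = map g \<sigma>" if "set \<sigma> \<subseteq> A" for \<sigma> using that N by (auto simp: hh_def)
    then show ?thesis unfolding psh_sum[OF A] by (intro sum.cong) auto
  qed
  finally show ?thesis .
qed

theorem homotopy:
  assumes c: "c \<in> CH K"
  shows "lf_boundary (P c) \<tau> + P (lf_boundary c) \<tau> = chain_push g c \<tau> - chain_push f c \<tau>"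
proof (cases "\<tau> = []")
  case True
  have "{\<sigma>. \<sigma> = [] \<and> c \<sigma> \<noteq> 0} = {}" using K.CH_Nil[OF c] by auto
  then show ?thesis using True by (simp add: P_def chain_push_def)
next
  case False
  \<comment> \<open>Vertices carried into \<open>\<tau>\<close> by either map. The pushforwards at
    \<open>\<tau>\<close> are sums over \<open>A\<close>, and so are the values of \<open>P\<close>
    at \<open>\<tau>\<close> and at its extensions \<open>v # \<tau>\<close>.\<close>
  define A where "A = {u \<in> \<Union>K. f u \<in> set \<tau>} \<union> {u \<in> \<Union>K. g u \<in> set \<tau>}"
  have A: "finite A" unfolding A_def by (intro finite_UnI K.finite_pre[OF f] K.finite_pre[OF g]) auto
  define B where "B = (\<Union>u\<in>A. {f u, g u} \<union> hh (\<kappa> u) ` K.star u)"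
  have B: "finite B" unfolding B_def using K.finite_star by (intro finite_UN_I A) simp
  have Pv: "P c (v # \<tau>) = (\<Sum>u\<in>A. Q u c (v # \<tau>))" for v
    unfolding P_def
  proof (rule sum.mono_neutral_cong)
    show "finite A" by (rule A)
    show "finite {u. u \<in> \<Union>K \<and> f u \<in> set (v # \<tau>)}" by (rule K.finite_pre[OF f]) simp
    fix u
    {
      assume "u \<in> A - {u. u \<in> \<Union>K \<and> f u \<in> set (v # \<tau>)}"
      then have "f u \<notin> set (v # \<tau>)" by (auto simp: A_def)
      then show "Q u c (v # \<tau>) = 0" using Q_support[of u c "v # \<tau>"] by blast
    next
      \<comment> \<open>Here \<open>f u\<close> is the new entry \<open>v\<close>. A nonzero value
        would also force \<open>g u\<close> into \<open>v # \<tau>\<close>, hence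
        \<open>g u = v = f u\<close>, and the edge collapses.\<close>
      assume "u \<in> {u. u \<in> \<Union>K \<and> f u \<in> set (v # \<tau>)} - A"
      then have u: "f u \<notin> set \<tau>" "g u \<notin> set \<tau>" "f u = v" by (auto simp: A_def)
      show "Q u c (v # \<tau>) = 0"
      proof (rule ccontr)
        assume nz: "Q u c (v # \<tau>) \<noteq> 0"
        then have "g u \<in> set (v # \<tau>)" "f u \<noteq> g u" using Q_support[OF nz] Q_eq[of u c "v # \<tau>"] by auto
        then show False using u by auto
      qed
    }
  qed simp
  have PA: "P d \<tau> = (\<Sum>u\<in>A. Q u d \<tau>)" for d :: "'v list \<Rightarrow> 'a"
    unfolding P_def
  proof (rule sum.mono_neutral_left)
    show "finite A" by (rule A)
    show "{u. u \<in> \<Union>K \<and> f u \<in> set \<tau>} \<subseteq> A" by (auto simp: A_def)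
    show "\<forall>u\<in>A - {u. u \<in> \<Union>K \<and> f u \<in> set \<tau>}. Q u d \<tau> = 0"
    proof
      fix u assume "u \<in> A - {u. u \<in> \<Union>K \<and> f u \<in> set \<tau>}"
      then have "f u \<notin> set \<tau>" by (auto simp: A_def)
      then show "Q u d \<tau> = 0" using Q_support[of u d \<tau>] by blast
    qed
  qed
  \<comment> \<open>The cone formula is used for both cone points: removing \<open>f u\<close>
    leaves the join with \<open>g u\<close>, removing \<open>g u\<close> leaves the join with
    \<open>f u\<close>, and the boundary of the link is up to sign the link of the boundary.\<close>
  have Qb: "bd B (Q u c) \<tau> = cone (g u) (psh A (hh (\<kappa> u)) (lnk u c)) \<tau>
      - cone (f u) (psh A (hh (\<kappa> u)) (lnk u c)) \<tau> - Q u (lf_boundary c) \<tau>" if u: "u \<in> A" for u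
  proof -
    let ?h = "hh (\<kappa> u)" let ?y = "psh (K.star u) ?h (lnk u c)"
    have Bu: "f u \<in> B" "g u \<in> B" "?h ` K.star u \<subseteq> B" using u by (auto simp: B_def)
    have lk: "bd (K.star u) (lnk u c) = (\<lambda>\<sigma>. - lnk u (lf_boundary c) \<sigma>)"
    proof
      fix \<sigma>
      have "lf_boundary c (u # \<sigma>) = bd (K.star u) c (u # \<sigma>)" using K.boundary_bd[OF c, of "u # \<sigma>"] by simp
      moreover have "c (u # v # \<sigma>) = - c (v # u # \<sigma>)" for v
        using altD(2)[OF CH_D(1)[OF c], of "[]" u v \<sigma>] by (simp only: append_Nil)
      ultimately show "bd (K.star u) (lnk u c) \<sigma> = - lnk u (lf_boundary c) \<sigma>"
        by (simp add: bd_def lnk_apply sum_negf)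
    qed
    have bdy: "bd B ?y = (\<lambda>\<tau>. - psh (K.star u) ?h (lnk u (lf_boundary c)) \<tau>)"
      unfolding bd_psh[OF K.finite_star B Bu(3)] lk by (rule ext) (rule psh_lin)
    \<comment> \<open>The star of \<open>u\<close> may be replaced by \<open>A\<close>: a link
      vertex whose image lies in \<open>\<tau>\<close> belongs to \<open>A\<close>.\<close>
    have cong: "cone a ?y \<tau> = cone a (psh A ?h (lnk u c)) \<tau>" for a
    proof (rule cone_cong)
      fix \<omega> assume w: "set \<omega> \<subseteq> set \<tau>"
      show "?y \<omega> = psh A ?h (lnk u c) \<omega>"
      proof (rule psh_cong_set[OF K.finite_star A])
        fix \<sigma> assume m: "map ?h \<sigma> = \<omega>" and nz: "lnk u c \<sigma> \<noteq> 0"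
        then have nz': "c (u # \<sigma>) \<noteq> 0" by (simp add: lnk_apply)
        have "set \<sigma> \<subseteq> K.star u" using K.CH_star[OF c nz', of u] by simp
        moreover have "x \<in> A" if x: "x \<in> set \<sigma>" for x
        proof -
          have "?h x \<in> set \<tau>" using x m w by (metis image_eqI list.set_map subsetD)
          moreover have "x \<in> \<Union>K" using K.CH_verts[OF c nz'] x by auto
          ultimately show ?thesis by (auto simp: A_def hh_def split: if_splits)
        qed
        ultimately show "set \<sigma> \<subseteq> K.star u \<longleftrightarrow> set \<sigma> \<subseteq> A" by blast
      qed auto
    qed
    have "bd B (Q u c) \<tau> = cone (g u) ?y \<tau> - cone (f u) (\<lambda>\<tau>. ?y \<tau> - cone (g u) (bd B ?y) \<tau>) \<tau>"
      unfolding Q_def bd_cone[OF B Bu(1)] bd_cone[OF B Bu(2)] ..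
    also have "\<dots> = cone (g u) ?y \<tau> - cone (f u) ?y \<tau> + cone (f u) (cone (g u) (bd B ?y)) \<tau>"
      by (simp add: cone_lin(4))
    also have "cone (g u) (bd B ?y) = (\<lambda>\<tau>. - cone (g u) (psh (K.star u) ?h (lnk u (lf_boundary c))) \<tau>)"
      unfolding bdy by (rule ext) (rule cone_lin)
    also have "cone (f u) (\<lambda>\<tau>. - cone (g u) (psh (K.star u) ?h (lnk u (lf_boundary c))) \<tau>) \<tau> = - Q u (lf_boundary c) \<tau>"
      unfolding Q_def by (rule cone_lin)
    finally show ?thesis unfolding cong by simp
  qed
  have "lf_boundary (P c) \<tau> = bd B (P c) \<tau>"
  proof (rule lf_boundary_bd[OF B _ False])
    fix v assume "P c (v # \<tau>) \<noteq> 0"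
    then obtain u where u: "u \<in> A" "Q u c (v # \<tau>) \<noteq> 0" unfolding Pv using sum_nonzero by blast
    from Q_support[OF u(2)] obtain \<sigma> where "set (v # \<tau>) = {f u, g u} \<union> hh (\<kappa> u) ` set \<sigma>"
      "set \<sigma> \<subseteq> K.star u" by blast
    then have "set (v # \<tau>) \<subseteq> {f u, g u} \<union> hh (\<kappa> u) ` K.star u" by blast
    then show "v \<in> B" unfolding B_def using u(1) by auto
  qed
  also have "\<dots> = (\<Sum>v\<in>B. \<Sum>u\<in>A. Q u c (v # \<tau>))" by (simp add: bd_def Pv)
  also have "\<dots> = (\<Sum>u\<in>A. bd B (Q u c) \<tau>)" unfolding bd_def by (rule sum.swap)
  also have "\<dots> = (\<Sum>u\<in>A. (cone (g u) (psh A (hh (\<kappa> u)) (lnk u c)) \<tau>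
      - cone (f u) (psh A (hh (\<kappa> u)) (lnk u c)) \<tau>) - Q u (lf_boundary c) \<tau>)"
    by (rule sum.cong) (simp_all add: Qb)
  also have "\<dots> = psh A g c \<tau> - psh A f c \<tau> - P (lf_boundary c) \<tau>"
    unfolding sum_subtractf[of _ "\<lambda>u. Q u (lf_boundary c) \<tau>"] hh_telescope[OF c A] PA ..
  also have "psh A g c \<tau> = chain_push g c \<tau>"
    using K.CH_verts[OF c] by (intro K.push_psh[symmetric] CH_D(1)[OF c] A) (fastforce simp: A_def)
  also have "psh A f c \<tau> = chain_push f c \<tau>"
    using K.CH_verts[OF c] by (intro K.push_psh[symmetric] CH_D(1)[OF c] A) (fastforce simp: A_def)
  finally show ?thesis by simp
qed

end

section \<open>Automorphisms and equivariance of the homotopy\<close>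

text \<open>Nothing is demanded off the vertices of \<open>K\<close>: the map will be
  \<open>image (\<phi> g)\<close>, which is controlled on the members of a covering only.\<close>

definition aut :: "'v set set \<Rightarrow> ('v \<Rightarrow> 'v) \<Rightarrow> bool" where
  "aut K \<gamma> \<longleftrightarrow> bij_betw \<gamma> (\<Union>K) (\<Union>K) \<and> (\<forall>S. S \<subseteq> \<Union>K \<longrightarrow> (\<gamma> ` S \<in> K \<longleftrightarrow> S \<in> K))"

lemma autD:
  assumes "aut K \<gamma>"
  shows "inj_on \<gamma> (\<Union>K)" "\<gamma> ` (\<Union>K) = \<Union>K" "S \<subseteq> \<Union>K \<Longrightarrow> \<gamma> ` S \<in> K \<longleftrightarrow> S \<in> K" "smap K K \<gamma>"
proof -
  show 1: "inj_on \<gamma> (\<Union>K)" "\<gamma> ` (\<Union>K) = \<Union>K" "S \<subseteq> \<Union>K \<Longrightarrow> \<gamma> ` S \<in> K \<longleftrightarrow> S \<in> K" for S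
    using assms by (auto simp: aut_def bij_betw_def)
  have "finite {v \<in> \<Union>K. \<gamma> v = w}" for w
  proof (cases "\<exists>v\<in>\<Union>K. \<gamma> v = w")
    case True
    then obtain v where "v \<in> \<Union>K" "\<gamma> v = w" by blast
    then have "{v \<in> \<Union>K. \<gamma> v = w} \<subseteq> {v}" using 1(1) by (auto simp: inj_on_def)
    then show ?thesis by (rule finite_subset) simp
  next
    case False
    then have "{v \<in> \<Union>K. \<gamma> v = w} = {}" by blast
    then show ?thesis by (simp only: finite.emptyI)
  qed
  moreover have "\<gamma> ` S \<in> K" if "S \<in> K" for S using 1(3)[of S] that by blast
  ultimately show "smap K K \<gamma>" by (simp add: smap_def)
qed

text \<open>By injectivity on vertices, \<open>\<sigma>\<close> is the only tuple of the support
  that can lie over \<open>map \<gamma> \<sigma>\<close>; pushing forward is translation.\<close>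

lemma aut_push:
  assumes "aut K \<gamma>" "c \<in> CH K" "set \<sigma> \<subseteq> \<Union>K" "lf_complex K"
  shows "chain_push \<gamma> c (map \<gamma> \<sigma>) = c \<sigma>"
proof (cases "distinct \<sigma>")
  case True
  have inj: "inj_on \<gamma> (\<Union>K)" by (rule autD(1)[OF assms(1)])
  have "{\<omega>. map \<gamma> \<omega> = map \<gamma> \<sigma> \<and> c \<omega> \<noteq> 0} = (if c \<sigma> = 0 then {} else {\<sigma>})"
  proof -
    have "\<omega> = \<sigma>" if "map \<gamma> \<omega> = map \<gamma> \<sigma>" "c \<omega> \<noteq> 0" for \<omega>
      using lf_complex.CH_verts[OF assms(4,2) that(2)] assms(3) that(1)
      by (intro map_inj_on[OF that(1)] inj_on_subset[OF inj]) auto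
    then show ?thesis by auto
  qed
  moreover have "distinct (map \<gamma> \<sigma>)"
    using True inj_on_subset[OF inj assms(3)] by (simp add: distinct_map)
  ultimately show ?thesis by (auto simp: chain_push_def)
next
  case False
  then have "\<not> distinct (map \<gamma> \<sigma>)" by (simp add: distinct_map)
  then show ?thesis using False alt_distinct[OF CH_D(1)[OF assms(2)], of \<sigma>] by (auto simp: chain_push_def)
qed

lemma cone_map:
  assumes "inj_on \<delta> W" "a \<in> W"
  shows "set \<tau> \<subseteq> W \<Longrightarrow> (\<And>\<omega>. set \<omega> \<subseteq> W \<Longrightarrow> y' (map \<delta> \<omega>) = y \<omega>) \<Longrightarrow>
    cone (\<delta> a) y' (map \<delta> \<tau>) = cone a y \<tau>"
proof (induction \<tau> arbitrary: y y')
  case (Cons v \<tau>)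
  have "cone (\<delta> a) (lnk (\<delta> v) y') (map \<delta> \<tau>) = cone a (lnk v y) \<tau>"
  proof (rule Cons.IH)
    show "set \<tau> \<subseteq> W" using Cons.prems(1) by simp
    show "lnk (\<delta> v) y' (map \<delta> \<omega>) = lnk v y \<omega>" if "set \<omega> \<subseteq> W" for \<omega>
      using Cons.prems(2)[of "v # \<omega>"] Cons.prems(1) that by (simp add: lnk_apply)
  qed
  moreover have "\<delta> v = \<delta> a \<longleftrightarrow> v = a" using assms Cons.prems(1) by (auto simp: inj_on_def)
  moreover have "y' (map \<delta> \<tau>) = y \<tau>" using Cons.prems by simp
  ultimately show ?case by simp
qed simp

lemma psh_map:
  assumes A: "finite A" and inj: "inj_on \<gamma> A" "inj_on \<delta> W" and h: "\<And>v. v \<in> A \<Longrightarrow> h v \<in> W \<and> h (\<gamma> v) = \<delta> (h v)"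
    and w: "set \<omega> \<subseteq> W" and y: "\<And>\<sigma>. set \<sigma> \<subseteq> A \<Longrightarrow> y' (map \<gamma> \<sigma>) = y \<sigma>"
  shows "psh (\<gamma> ` A) h y' (map \<delta> \<omega>) = psh A h y \<omega>"
proof -
  have "psh (\<gamma> ` A) h y' (map \<delta> \<omega>) = (\<Sum>\<sigma> | set \<sigma> \<subseteq> \<gamma> ` A \<and> map h \<sigma> = map \<delta> \<omega>. y' \<sigma>)"
    by (rule psh_sum) (use A in simp)
  also have "\<dots> = (\<Sum>\<sigma> | set \<sigma> \<subseteq> A \<and> map h \<sigma> = \<omega>. y \<sigma>)"
  proof -
    have "bij_betw (map \<gamma>) {\<sigma>. set \<sigma> \<subseteq> A \<and> map h \<sigma> = \<omega>} {\<sigma>. set \<sigma> \<subseteq> \<gamma> ` A \<and> map h \<sigma> = map \<delta> \<omega>}"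
      unfolding bij_betw_def
    proof (intro conjI equalityI subsetI)
      show "inj_on (map \<gamma>) {\<sigma>. set \<sigma> \<subseteq> A \<and> map h \<sigma> = \<omega>}"
        by (rule inj_onI) (use inj(1) in \<open>auto intro!: map_inj_on[of \<gamma>] elim: inj_on_subset\<close>)
      have hm: "map h (map \<gamma> \<sigma>) = map \<delta> (map h \<sigma>)" if "set \<sigma> \<subseteq> A" for \<sigma>
        using that h by auto
      fix x
      {
        assume "x \<in> map \<gamma> ` {\<sigma>. set \<sigma> \<subseteq> A \<and> map h \<sigma> = \<omega>}"
        then show "x \<in> {\<sigma>. set \<sigma> \<subseteq> \<gamma> ` A \<and> map h \<sigma> = map \<delta> \<omega>}"
          using hm by (auto simp del: map_map) (simp add: subset_iff)
      next
        assume x: "x \<in> {\<sigma>. set \<sigma> \<subseteq> \<gamma> ` A \<and> map h \<sigma> = map \<delta> \<omega>}"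
        then have "x \<in> lists (\<gamma> ` A)" by auto
        then obtain \<sigma> where s: "set \<sigma> \<subseteq> A" "x = map \<gamma> \<sigma>" unfolding lists_image by auto
        then have "map \<delta> (map h \<sigma>) = map \<delta> \<omega>" using x hm[OF s(1)] by (simp del: map_map)
        then have "map h \<sigma> = \<omega>"
          by (rule map_inj_on) (use s h w in \<open>auto intro!: inj_on_subset[OF inj(2)]\<close>)
        then show "x \<in> map \<gamma> ` {\<sigma>. set \<sigma> \<subseteq> A \<and> map h \<sigma> = \<omega>}" using s by blast
      }
    qed
    from sum.reindex_bij_betw[OF this, of y'] show ?thesis
      by (simp add: y cong: sum.cong_simp)
  qed
  also have "\<dots> = psh A h y \<omega>" by (rule psh_sum[symmetric, OF A])
  finally show ?thesis .
qed

context contiguous_maps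
begin

text \<open>As \<open>\<kappa>\<close> is invariant, \<open>u\<close> and \<open>\<gamma> u\<close>
  are moved at the same moment, so each \<open>hh k\<close> is equivariant. Cones and pushforwards
  are natural, hence the summands of \<open>P\<close> at \<open>u\<close> and at
  \<open>\<gamma> u\<close> correspond.\<close>

lemma P_equivariant:
  assumes \<gamma>: "aut K \<gamma>" and \<delta>: "aut L \<delta>"
    and f\<gamma>: "\<And>v. v \<in> \<Union>K \<Longrightarrow> f (\<gamma> v) = \<delta> (f v)" and g\<gamma>: "\<And>v. v \<in> \<Union>K \<Longrightarrow> g (\<gamma> v) = \<delta> (g v)"
    and \<kappa>\<gamma>: "\<And>v. v \<in> \<Union>K \<Longrightarrow> \<kappa> (\<gamma> v) = \<kappa> v" and c: "c \<in> CH K"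
  shows "P (chain_push \<gamma> c) = chain_push \<delta> (P c)"
proof
  fix \<tau>
  have c': "chain_push \<gamma> c \<in> CH K" by (rule K.push_CH[OF c autD(4)[OF \<gamma>]])
  have d: "chain_push \<delta> (P c) \<in> CH L" by (rule L.push_CH[OF P_CH[OF c] autD(4)[OF \<delta>]])
  show "P (chain_push \<gamma> c) \<tau> = chain_push \<delta> (P c) \<tau>"
  proof (cases "set \<tau> \<subseteq> \<Union>L")
    case False
    then show ?thesis using L.CH_verts[OF P_CH[OF c'], of \<tau>] L.CH_verts[OF d, of \<tau>] by metis
  next
    case True
    then have "\<tau> \<in> lists (\<delta> ` (\<Union>L))" using autD(2)[OF \<delta>] by auto
    then obtain \<rho> where r: "set \<rho> \<subseteq> \<Union>L" "\<tau> = map \<delta> \<rho>" unfolding lists_image by auto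
    have fL: "f v \<in> \<Union>L" and gL: "g v \<in> \<Union>L" if "v \<in> \<Union>K" for v
      using that f g by (auto simp: smap_def)
    have hL: "hh k v \<in> \<Union>L \<and> hh k (\<gamma> v) = \<delta> (hh k v)" if "v \<in> \<Union>K" for k v
      using that fL gL f\<gamma> g\<gamma> \<kappa>\<gamma> by (simp add: hh_def)
    note i\<delta> = autD(1)[OF \<delta>] and i\<gamma> = autD(1)[OF \<gamma>]
    have Q: "Q (\<gamma> u) (chain_push \<gamma> c) (map \<delta> \<rho>) = Q u c \<rho>" if u: "u \<in> \<Union>K" for u
    proof -
      have sub: "K.star u \<subseteq> \<Union>K" by (auto simp: K.star_def)
      have star: "K.star (\<gamma> u) = \<gamma> ` K.star u"
      proof (intro equalityI subsetI)
        fix x assume "x \<in> K.star (\<gamma> u)"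
        then obtain S where S: "S \<in> K" "\<gamma> u \<in> S" "x \<in> S" by (auto simp: K.star_def)
        define S' where "S' = {v \<in> \<Union>K. \<gamma> v \<in> S}"
        have "S \<subseteq> \<gamma> ` (\<Union>K)" using S(1) autD(2)[OF \<gamma>] by blast
        then have "S = \<gamma> ` S'" unfolding S'_def by blast
        moreover have "S' \<subseteq> \<Union>K" unfolding S'_def by blast
        then have "S' \<in> K" using autD(3)[OF \<gamma>, of S'] S(1) \<open>S = \<gamma> ` S'\<close> by simp
        moreover have "u \<in> S'" using S u by (auto simp: S'_def)
        ultimately show "x \<in> \<gamma> ` K.star u" using S(3) by (auto simp: K.star_def)
      next
        fix x assume "x \<in> \<gamma> ` K.star u"
        then obtain S v where "S \<in> K" "u \<in> S" "v \<in> S" "x = \<gamma> v" by (auto simp: K.star_def)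
        then show "x \<in> K.star (\<gamma> u)" using autD(3)[OF \<gamma>, of S] by (auto simp: K.star_def)
      qed
      have \<kappa>u: "\<kappa> (\<gamma> u) = \<kappa> u" using \<kappa>\<gamma> u by blast
      show ?thesis
        unfolding Q_def f\<gamma>[OF u] g\<gamma>[OF u] star \<kappa>u
      proof (rule cone_map[OF i\<delta> fL[OF u] r(1)], rule cone_map[OF i\<delta> gL[OF u]], assumption)
        fix \<omega> assume w: "set \<omega> \<subseteq> \<Union>L"
        show "psh (\<gamma> ` K.star u) (hh (\<kappa> u)) (lnk (\<gamma> u) (chain_push \<gamma> c)) (map \<delta> \<omega>) = psh (K.star u) (hh (\<kappa> u)) (lnk u c) \<omega>"
        proof (rule psh_map[OF K.finite_star inj_on_subset[OF i\<gamma> sub] i\<delta> _ w])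
          show "hh (\<kappa> u) v \<in> \<Union>L \<and> hh (\<kappa> u) (\<gamma> v) = \<delta> (hh (\<kappa> u) v)" if "v \<in> K.star u" for v
            by (rule hL) (use sub that in \<open>rule subsetD\<close>)
          show "lnk (\<gamma> u) (chain_push \<gamma> c) (map \<gamma> \<sigma>) = lnk u c \<sigma>" if "set \<sigma> \<subseteq> K.star u" for \<sigma>
            using aut_push[OF \<gamma> c, of "u # \<sigma>"] u sub that K.lf_complex_axioms by (auto simp: lnk_apply)
        qed
      qed
    qed
    have "{u. u \<in> \<Union>K \<and> f u \<in> set (map \<delta> \<rho>)} = \<gamma> ` {u. u \<in> \<Union>K \<and> f u \<in> set \<rho>}"
    proof (intro equalityI subsetI)
      fix x assume x: "x \<in> {u. u \<in> \<Union>K \<and> f u \<in> set (map \<delta> \<rho>)}"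
      then have "x \<in> \<gamma> ` (\<Union>K)" using autD(2)[OF \<gamma>] by simp
      then obtain u where u: "u \<in> \<Union>K" "x = \<gamma> u" by (rule imageE)
      then have "\<delta> (f u) \<in> \<delta> ` set \<rho>" using x f\<gamma> by auto
      then have "f u \<in> set \<rho>" using inj_on_image_mem_iff[OF i\<delta> fL[OF u(1)] r(1)] by blast
      then have "u \<in> {u. u \<in> \<Union>K \<and> f u \<in> set \<rho>}" using u(1) by simp
      then show "x \<in> \<gamma> ` {u. u \<in> \<Union>K \<and> f u \<in> set \<rho>}" unfolding u(2) by (rule imageI)
    next
      fix x assume "x \<in> \<gamma> ` {u. u \<in> \<Union>K \<and> f u \<in> set \<rho>}"
      then obtain u where u: "u \<in> \<Union>K" "x = \<gamma> u" "f u \<in> set \<rho>" by (elim imageE CollectE conjE) (rule that)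
      then have "x \<in> \<Union>K" using imageI[OF u(1), of \<gamma>] autD(2)[OF \<gamma>] by simp
      then show "x \<in> {u. u \<in> \<Union>K \<and> f u \<in> set (map \<delta> \<rho>)}" using u f\<gamma> by simp
    qed
    then have "P (chain_push \<gamma> c) \<tau> = (\<Sum>u \<in> \<gamma> ` {u. u \<in> \<Union>K \<and> f u \<in> set \<rho>}. Q u (chain_push \<gamma> c) (map \<delta> \<rho>))"
      unfolding P_def r(2) by simp
    also have "\<dots> = (\<Sum>u | u \<in> \<Union>K \<and> f u \<in> set \<rho>. Q (\<gamma> u) (chain_push \<gamma> c) (map \<delta> \<rho>))"
      by (subst sum.reindex) (auto intro!: inj_on_subset[OF i\<gamma>])
    also have "\<dots> = P c \<rho>" unfolding P_def by (rule sum.cong) (auto simp: Q)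
    also have "\<dots> = chain_push \<delta> (P c) \<tau>"
      unfolding r(2) by (rule aut_push[symmetric, OF \<delta> P_CH[OF c] r(1) L.lf_complex_axioms])
    finally show ?thesis .
  qed
qed

end

section \<open>Smith theory of a regular complex\<close>

lemma linear_between_comp:
  "linear_between Z f \<Longrightarrow> (\<And>x. x \<in> Z \<Longrightarrow> f x \<in> W) \<Longrightarrow> linear_between W g \<Longrightarrow> linear_between Z (\<lambda>x. g (f x))"
  by (simp add: linear_between_def)

lemma linear_between_funpow:
  assumes "linear_between Z f" "\<And>x. x \<in> Z \<Longrightarrow> f x \<in> Z"
  shows "linear_between Z (f ^^ n) \<and> (\<forall>x\<in>Z. (f ^^ n) x \<in> Z)"
proof (induction n)
  case 0
  then show ?case by (simp add: linear_between_def)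
next
  case (Suc n)
  then show ?case using linear_between_comp[of Z "f ^^ n" Z f] assms by (simp add: o_def)
qed

text \<open>The identity (1 - t)^(n+1) = (1 - t)^n - (1 - t)^n t, where t shifts the sequence
  \<open>x\<close>.\<close>

lemma alternating_binomial_sum:
  fixes x :: "nat \<Rightarrow> 'k::comm_ring_1"
  shows "(\<Sum>i\<le>Suc n. (-1) ^ i * of_nat (Suc n choose i) * x i) =
    (\<Sum>i\<le>n. (-1) ^ i * of_nat (n choose i) * x i) - (\<Sum>i\<le>n. (-1) ^ i * of_nat (n choose i) * x (Suc i))"
proof -
  have "(\<Sum>i\<le>Suc n. (-1) ^ i * of_nat (Suc n choose i) * x i) =
      x 0 + (\<Sum>i\<le>n. (-1) ^ Suc i * of_nat (Suc n choose Suc i) * x (Suc i))"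
    by (subst sum.atMost_Suc_shift) simp
  also have "(\<Sum>i\<le>n. (-1) ^ Suc i * of_nat (Suc n choose Suc i) * x (Suc i)) =
      - (\<Sum>i\<le>n. (-1) ^ i * of_nat (n choose i) * x (Suc i))
      + (\<Sum>i\<le>n. (-1) ^ Suc i * of_nat (n choose Suc i) * x (Suc i))"
    by (simp add: sum.distrib[symmetric] sum_negf[symmetric] algebra_simps)
  also have "x 0 + (- (\<Sum>i\<le>n. (-1) ^ i * of_nat (n choose i) * x (Suc i))
      + (\<Sum>i\<le>n. (-1) ^ Suc i * of_nat (n choose Suc i) * x (Suc i)))
    = (x 0 + (\<Sum>i\<le>n. (-1) ^ Suc i * of_nat (n choose Suc i) * x (Suc i)))
      - (\<Sum>i\<le>n. (-1) ^ i * of_nat (n choose i) * x (Suc i))"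
    by (simp add: algebra_simps)
  also have "x 0 + (\<Sum>i\<le>n. (-1) ^ Suc i * of_nat (n choose Suc i) * x (Suc i)) =
      (\<Sum>i\<le>Suc n. (-1) ^ i * of_nat (n choose i) * x i)"
    by (subst sum.atMost_Suc_shift) simp
  also have "\<dots> = (\<Sum>i\<le>n. (-1) ^ i * of_nat (n choose i) * x i)"
    by (simp add: binomial_eq_0)
  finally show ?thesis .
qed

text \<open>The prime divides the binomial p over i+1, so by Pascal's rule neighbouring binomials of
  p-1 are negatives of each other. Hence (1 - t)^(p-1) = 1 + t + ... + t^(p-1) over the prime
  field.\<close>

lemma choose_prime_minus_1:
  assumes "i \<le> CARD('p::prime_card) - 1"
  shows "(-1) ^ i * of_nat ((CARD('p) - 1) choose i) = (1 :: 'p mod_ring)"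
  using assms
proof (induction i)
  case (Suc i)
  let ?n = "CARD('p) - 1"
  have p: "prime CARD('p)" by (rule prime_card)
  have S: "CARD('p) = Suc ?n" using prime_gt_0_nat[OF p] by simp
  have "CARD('p) dvd (CARD('p) choose Suc i)"
    using Suc.prems prime_gt_0_nat[OF p] by (intro dvd_choose_prime p) auto
  then obtain k where "CARD('p) choose Suc i = CARD('p) * k" by (elim dvdE)
  then have "of_nat (CARD('p) choose Suc i) = (0 :: 'p mod_ring)" by simp
  then have "of_nat (?n choose Suc i) = - (of_nat (?n choose i) :: 'p mod_ring)"
    using S by (metis add.commute add_eq_0_iff2 binomial_Suc_Suc of_nat_add)
  then show ?case using Suc by simp
qed simp

text \<open>By \<open>free_simplex\<close> a simplex of a regular complex that is invariant as a set
  is fixed vertex by vertex, so this is the fixed complex in either sense.\<close>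

definition fixc :: "'v set set \<Rightarrow> ('v \<Rightarrow> 'v) \<Rightarrow> 'v set set" where
  "fixc K \<gamma> = {S \<in> K. \<forall>v\<in>S. \<gamma> v = v}"

lemma restrict_CH:
  assumes "c \<in> CH K"
  shows "(\<lambda>\<sigma>. if set \<sigma> \<in> N then c \<sigma> else 0) \<in> CH (K \<inter> N)"
  unfolding CH_def alt_def
proof (intro CollectI conjI allI impI)
  fix xs v w ys
  show "(if set (xs @ v # v # ys) \<in> N then c (xs @ v # v # ys) else 0) = 0"
    using altD(1)[OF CH_D(1)[OF assms]] by simp
  have "set (xs @ v # w # ys) = set (xs @ w # v # ys)" by auto
  then show "(if set (xs @ v # w # ys) \<in> N then c (xs @ v # w # ys) else 0) =
      - (if set (xs @ w # v # ys) \<in> N then c (xs @ w # v # ys) else 0)"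
    using altD(2)[OF CH_D(1)[OF assms], of xs v w ys] by simp
next
  fix \<sigma> assume "(if set \<sigma> \<in> N then c \<sigma> else 0) \<noteq> 0"
  then show "set \<sigma> \<in> K \<inter> N" using CH_D(2)[OF assms, of \<sigma>] by (auto split: if_splits)
qed

text \<open>The group appears through powers of one generator with natural exponents;
  \<open>period\<close> makes the inverse a power as well.\<close>

locale regular_complex = lf_complex K for K :: "'v set set" +
  fixes \<gamma> :: "'v \<Rightarrow> 'v" and p :: nat
  assumes aut: "aut K \<gamma>" and p: "prime p"
    and period: "v \<in> \<Union>K \<Longrightarrow> (\<gamma> ^^ p) v = v"
    and regular: "length ks = length vs \<Longrightarrow> set vs \<in> K \<Longrightarrow> set (map2 (\<lambda>k. \<gamma> ^^ k) ks vs) \<in> K \<Longrightarrow>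
      \<exists>k. \<forall>i<length vs. (\<gamma> ^^ k) (vs ! i) = (\<gamma> ^^ (ks ! i)) (vs ! i)"
begin

lemma gamma_vert: "v \<in> \<Union>K \<Longrightarrow> (\<gamma> ^^ i) v \<in> \<Union>K"
  by (induction i) (use autD(2)[OF aut] in auto)

lemma period_mult: "v \<in> \<Union>K \<Longrightarrow> (\<gamma> ^^ (p * n)) v = v"
  by (induction n) (auto simp: funpow_add period)

lemma funpow_mod: "v \<in> \<Union>K \<Longrightarrow> (\<gamma> ^^ i) v = (\<gamma> ^^ (i mod p)) v"
proof -
  assume v: "v \<in> \<Union>K"
  have "(\<gamma> ^^ i) v = (\<gamma> ^^ (i mod p + p * (i div p))) v" by simp
  also have "\<dots> = (\<gamma> ^^ (i mod p)) ((\<gamma> ^^ (p * (i div p))) v)" by (simp only: funpow_add o_apply)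
  finally show ?thesis using period_mult[OF v] by simp
qed

text \<open>By Bezout \<open>i * x = p * y + 1\<close> for some \<open>x\<close> and
  \<open>y\<close>, so on \<open>v\<close> the map \<open>\<gamma>\<close> agrees with
  \<open>\<gamma> ^^ (i * x)\<close>, which fixes \<open>v\<close>.\<close>

lemma fixed_if_power_fixed:
  assumes v: "v \<in> \<Union>K" and i: "(\<gamma> ^^ i) v = v" "\<not> p dvd i"
  shows "\<gamma> v = v"
proof -
  have cop: "coprime i p" using prime_imp_coprime[OF p i(2)] by (simp add: coprime_commute)
  have "i \<noteq> 0" using i(2) by (metis dvd_0_right)
  from bezout_nat[OF this] obtain x y where xy: "i * x = p * y + gcd i p" by blast
  have "((\<gamma> ^^ i) ^^ x) v = v" using i(1) by (induction x) auto
  then have "v = (\<gamma> ^^ (1 + p * y)) v" using xy cop by (simp add: funpow_mult mult.commute)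
  also have "\<dots> = \<gamma> v" using period_mult[OF v] by (simp add: funpow_add)
  finally show ?thesis by simp
qed

text \<open>Regularity for the degenerate tuple \<open>[v, v]\<close> with exponents 0 and
  \<open>i\<close>: a single power has to send \<open>v\<close> both to itself and to its
  translate.\<close>

lemma one_per_orbit:
  assumes S: "S \<in> K" "v \<in> S" "(\<gamma> ^^ i) v \<in> S"
  shows "(\<gamma> ^^ i) v = v"
proof -
  have "{v} \<in> K" "{v, (\<gamma> ^^ i) v} \<in> K" using S by (auto intro: face[OF S(1)])
  then obtain k where "\<forall>j<2. (\<gamma> ^^ k) ([v, v] ! j) = (\<gamma> ^^ ([0, i] ! j)) ([v, v] ! j)"
    using regular[of "[0, i]" "[v, v]"] by (auto simp: numeral_2_eq_2)
  then have "(\<gamma> ^^ k) v = v" "(\<gamma> ^^ k) v = (\<gamma> ^^ i) v"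
    by (metis nth_Cons_0 funpow_0 pos2, metis nth_Cons_0 nth_Cons_Suc One_nat_def one_less_numeral_iff semiring_norm(76))
  then show ?thesis by simp
qed

text \<open>A power that preserves \<open>S\<close> keeps every vertex by
  \<open>one_per_orbit\<close>; with an exponent prime to p all vertices would be fixed. So a
  simplex outside the fixed complex has p different translates.\<close>

lemma free_simplex:
  assumes S: "S \<in> K" "S \<notin> fixc K \<gamma>" and i: "(\<gamma> ^^ i) ` S = S"
  shows "p dvd i"
proof (rule ccontr)
  assume n: "\<not> p dvd i"
  have "\<gamma> v = v" if "v \<in> S" for v
    using fixed_if_power_fixed[of v i] one_per_orbit[OF S(1) that, of i] i n S(1) that by blast
  then show False using S by (auto simp: fixc_def)
qed

lemma smap_gamma: "smap K K \<gamma>" by (rule autD(4)[OF aut])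

lemma gamma_simplex: "S \<subseteq> \<Union>K \<Longrightarrow> (\<gamma> ^^ i) ` S \<in> K \<longleftrightarrow> S \<in> K"
proof (induction i)
  case (Suc i)
  have "(\<gamma> ^^ Suc i) ` S = \<gamma> ` ((\<gamma> ^^ i) ` S)" by (simp add: image_comp)
  moreover have "(\<gamma> ^^ i) ` S \<subseteq> \<Union>K" using Suc.prems gamma_vert by blast
  ultimately show ?case using autD(3)[OF aut] Suc by metis
qed simp

lemma fixed_pow: "\<gamma> v = v \<Longrightarrow> (\<gamma> ^^ i) v = v"
  by (induction i) auto

lemma gamma_fixed_iff: "v \<in> \<Union>K \<Longrightarrow> \<gamma> ((\<gamma> ^^ i) v) = (\<gamma> ^^ i) v \<longleftrightarrow> \<gamma> v = v"
proof
  assume v: "v \<in> \<Union>K" and f: "\<gamma> ((\<gamma> ^^ i) v) = (\<gamma> ^^ i) v"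
  have "(\<gamma> ^^ (p * i - i)) ((\<gamma> ^^ i) v) = v"
    using period_mult[OF v, of i] prime_gt_0_nat[OF p]
    by (metis comp_apply funpow_add le_add_diff_inverse2 mult.commute nat_mult_le_cancel_disj
        One_nat_def Suc_leI mult_1)
  then have "(\<gamma> ^^ i) v = v" using fixed_pow[OF f] by metis
  then show "\<gamma> v = v" using f by simp
qed (metis fixed_pow)

lemma gamma_fixc: "S \<subseteq> \<Union>K \<Longrightarrow> (\<gamma> ^^ i) ` S \<in> fixc K \<gamma> \<longleftrightarrow> S \<in> fixc K \<gamma>"
  using gamma_simplex[of S i] gamma_fixed_iff[of _ i] by (auto simp: fixc_def subset_iff)

lemma fixc_complex: "lf_complex (fixc K \<gamma>)"
proof
  fix S assume "S \<in> fixc K \<gamma>"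
  then show "finite S \<and> S \<noteq> {}" using simplex by (auto simp: fixc_def)
  show "T \<in> fixc K \<gamma>" if "T \<subseteq> S" "T \<noteq> {}" for T
    using face[of S T] \<open>S \<in> fixc K \<gamma>\<close> that by (auto simp: fixc_def)
next
  show "finite {S \<in> fixc K \<gamma>. v \<in> S}" for v
    by (rule finite_subset[OF _ locfin[of v]]) (auto simp: fixc_def)
qed

lemma fixc_sub: "fixc K \<gamma> \<subseteq> K" by (auto simp: fixc_def)

text \<open>The inverse of \<open>\<gamma>\<close> on vertices. Pushing a chain forward along
  \<open>\<gamma>\<close> is pulling it back along \<open>dl\<close>, see
  \<open>push_gamma\<close>.\<close>

definition dl :: "'v \<Rightarrow> 'v" where "dl = \<gamma> ^^ (p - 1)"

lemma dl_pow: "dl ^^ i = \<gamma> ^^ ((p - 1) * i)"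
  by (simp add: dl_def funpow_mult)

lemma dl_vert: "v \<in> \<Union>K \<Longrightarrow> (dl ^^ i) v \<in> \<Union>K"
  unfolding dl_pow by (rule gamma_vert)

lemma gamma_dl: "v \<in> \<Union>K \<Longrightarrow> \<gamma> (dl v) = v"
  using period[of v] prime_gt_0_nat[OF p] by (metis One_nat_def Suc_pred comp_apply dl_def funpow.simps(2))

lemma dl_period: "v \<in> \<Union>K \<Longrightarrow> (dl ^^ p) v = v"
  unfolding dl_pow using period_mult by (metis mult.commute)

lemma map_dl_vert: "set \<sigma> \<subseteq> \<Union>K \<Longrightarrow> set (map (dl ^^ i) \<sigma>) \<subseteq> \<Union>K"
proof
  fix x assume s: "set \<sigma> \<subseteq> \<Union>K" and "x \<in> set (map (dl ^^ i) \<sigma>)"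
  then obtain y where "y \<in> set \<sigma>" "x = (dl ^^ i) y" by auto
  then show "x \<in> \<Union>K" using dl_vert[of y i] s by (simp add: subset_iff)
qed

lemma map_dl_vert1: "set \<sigma> \<subseteq> \<Union>K \<Longrightarrow> set (map dl \<sigma>) \<subseteq> \<Union>K"
  using map_dl_vert[of \<sigma> 1] by simp

lemma push_gamma:
  assumes c: "c \<in> CH K" and s: "set \<sigma> \<subseteq> \<Union>K"
  shows "chain_push \<gamma> c \<sigma> = c (map dl \<sigma>)"
proof -
  have "map \<gamma> (map dl \<sigma>) = \<sigma>" unfolding map_map
    by (rule map_idI) (use gamma_dl s in \<open>simp add: subset_iff\<close>)
  then have "chain_push \<gamma> c \<sigma> = chain_push \<gamma> c (map \<gamma> (map dl \<sigma>))" by simp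
  also have "\<dots> = c (map dl \<sigma>)"
    by (rule aut_push[OF aut c _ lf_complex_axioms]) (rule map_dl_vert1[OF s])
  finally show ?thesis .
qed

lemma tau_eq:
  assumes c: "c \<in> CH K" and s: "set \<sigma> \<subseteq> \<Union>K"
  shows "tau \<gamma> c \<sigma> = c \<sigma> - c (map dl \<sigma>)"
  unfolding tau_def push_gamma[OF assms] ..

lemma tau_linear: "linear_between (CH K) (tau \<gamma>)"
  unfolding linear_between_def
proof (intro conjI ballI allI)
  note push = linear_betweenD[OF push_linear[OF smap_gamma] lin_subspace_CH]
  fix x y :: "'v list \<Rightarrow> 'k::field" and a assume x: "x \<in> CH K"
  show "tau \<gamma> (\<lambda>s. a * x s) = (\<lambda>s. a * tau \<gamma> x s)"
    unfolding tau_def push(2)[OF x] by (simp add: algebra_simps)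
  assume y: "y \<in> CH K"
  show "tau \<gamma> (\<lambda>s. x s + y s) = (\<lambda>s. tau \<gamma> x s + tau \<gamma> y s)"
    unfolding tau_def push(1)[OF x y] by (simp add: algebra_simps)
qed

lemma tau_CH: "c \<in> CH K \<Longrightarrow> tau \<gamma> c \<in> CH K"
  unfolding tau_def using lin_subspaceD(5)[OF lin_subspace_CH] push_CH[OF _ smap_gamma] by blast

lemma tau_deg: "deg q c \<Longrightarrow> deg q (tau \<gamma> c)"
  unfolding tau_def using lin_subspaceD(5)[OF lin_subspace_deg[of q], of c "chain_push \<gamma> c"] push_deg[of q c \<gamma>]
  by simp

lemma tau_pow_linear: "linear_between (CH K) (tau \<gamma> ^^ n)"
  using linear_between_funpow[OF tau_linear tau_CH] by blast

lemma tau_pow_CH: "c \<in> CH K \<Longrightarrow> (tau \<gamma> ^^ n) c \<in> CH K"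
  using linear_between_funpow[OF tau_linear tau_CH] by blast

lemma tau_pow_deg: "deg q c \<Longrightarrow> deg q ((tau \<gamma> ^^ n) c)"
  by (induction n) (auto intro: tau_deg)

lemma tau_boundary: "c \<in> CH K \<Longrightarrow> lf_boundary (tau \<gamma> c) = tau \<gamma> (lf_boundary c)"
  unfolding tau_def
  by (simp add: linear_betweenD(3)[OF boundary_linear lin_subspace_CH] push_CH[OF _ smap_gamma]
      push_boundary[OF _ smap_gamma])

lemma tau_pow_boundary: "c \<in> CH K \<Longrightarrow> lf_boundary ((tau \<gamma> ^^ n) c) = (tau \<gamma> ^^ n) (lf_boundary c)"
  by (induction n) (auto simp: tau_boundary tau_pow_CH)

lemma tau_pow_eq:
  assumes c: "c \<in> CH K" and s: "set \<sigma> \<subseteq> \<Union>K"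
  shows "(tau \<gamma> ^^ n) c \<sigma> = (\<Sum>i\<le>n. (-1) ^ i * of_nat (n choose i) * c (map (dl ^^ i) \<sigma>))"
  using s
proof (induction n arbitrary: \<sigma>)
  case (Suc n)
  have s': "set (map dl \<sigma>) \<subseteq> \<Union>K" by (rule map_dl_vert1[OF Suc.prems])
  have "(tau \<gamma> ^^ Suc n) c \<sigma> = (tau \<gamma> ^^ n) c \<sigma> - (tau \<gamma> ^^ n) c (map dl \<sigma>)"
    using tau_eq[OF tau_pow_CH[OF c] Suc.prems] by simp
  also have "\<dots> = (\<Sum>i\<le>Suc n. (-1) ^ i * of_nat (Suc n choose i) * c (map (dl ^^ i) \<sigma>))"
    unfolding Suc.IH[OF Suc.prems] Suc.IH[OF s'] alternating_binomial_sum
    by (simp add: funpow_swap1 o_def)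
  finally show ?case .
qed simp

lemma CH_outside: "c \<in> CH K \<Longrightarrow> \<not> set \<sigma> \<subseteq> \<Union>K \<Longrightarrow> c \<sigma> = 0"
  using CH_verts by blast

text \<open>On a fixed simplex 1 - g is 0. So the image of \<open>tau\<close> has no component on
  the fixed complex, which later makes its sum with the fixed chains direct.\<close>

lemma tau_fixed_simplex:
  assumes "c \<in> CH K" "set \<sigma> \<in> fixc K \<gamma>"
  shows "tau \<gamma> c \<sigma> = 0"
proof -
  have "map dl \<sigma> = \<sigma>"
    using assms(2) fixed_pow unfolding dl_def by (auto simp: fixc_def intro!: map_idI)
  moreover have "set \<sigma> \<subseteq> \<Union>K" using assms(2) by (auto simp: fixc_def)
  ultimately show ?thesis using tau_eq[OF assms(1)] by simp
qed

lemma tau_pow_fixed_simplex: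
  "c \<in> CH K \<Longrightarrow> set \<sigma> \<in> fixc K \<gamma> \<Longrightarrow> 0 < n \<Longrightarrow> (tau \<gamma> ^^ n) c \<sigma> = 0"
  using tau_fixed_simplex[OF tau_pow_CH] by (cases n) auto

lemma tau_fixed_chain:
  assumes c: "c \<in> CH (fixc K \<gamma>)"
  shows "tau \<gamma> c = (\<lambda>_. 0)"
proof
  fix \<sigma>
  have cK: "c \<in> CH K" using c CH_mono[OF fixc_sub] by blast
  show "tau \<gamma> c \<sigma> = 0"
  proof (cases "set \<sigma> \<in> fixc K \<gamma>")
    case True
    then show ?thesis by (rule tau_fixed_simplex[OF cK])
  next
    case False
    show ?thesis
    proof (cases "set \<sigma> \<subseteq> \<Union>K")
      case True
      have "(\<gamma> ^^ (p - 1)) ` set \<sigma> \<notin> fixc K \<gamma>" using False gamma_fixc[OF True] by simp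
      then have "set (map dl \<sigma>) \<notin> fixc K \<gamma>" by (simp add: dl_def)
      then have "c (map dl \<sigma>) = 0" "c \<sigma> = 0" using CH_D(2)[OF c] False by blast+
      then show ?thesis using tau_eq[OF cK True] by simp
    next
      case False
      then show ?thesis by (rule CH_outside[OF tau_CH[OF cK]])
    qed
  qed
qed

lemma tau_pow_zero: "(tau \<gamma> ^^ n) (\<lambda>_. 0) = (\<lambda>_. 0)"
  using linear_betweenD(4)[OF tau_pow_linear lin_subspace_CH] .

lemma tau_pow_fixed_chain: "c \<in> CH (fixc K \<gamma>) \<Longrightarrow> 0 < n \<Longrightarrow> (tau \<gamma> ^^ n) c = (\<lambda>_. 0)"
proof (cases n)
  case (Suc m)
  assume "c \<in> CH (fixc K \<gamma>)"
  then have "tau \<gamma> c = (\<lambda>_. 0)" by (rule tau_fixed_chain)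
  then show ?thesis unfolding Suc funpow_Suc_right o_apply by (simp only: tau_pow_zero)
qed simp

section \<open>A transversal of the free orbits of simplices\<close>

text \<open>The choice depends on the set of all translates alone and is therefore constant on
  orbits; a choice depending on \<open>S\<close> itself would not be.\<close>

definition rep :: "'v set \<Rightarrow> 'v set" where
  "rep S = (SOME S'. S' \<in> range (\<lambda>i. (\<gamma> ^^ i) ` S))"

definition T :: "'v set set" where
  "T = {S \<in> K. S \<notin> fixc K \<gamma> \<and> rep S = S}"

lemma rep_gamma:
  assumes "S \<subseteq> \<Union>K"
  shows "rep ((\<gamma> ^^ j) ` S) = rep S"
proof -
  have "range (\<lambda>i. (\<gamma> ^^ i) ` (\<gamma> ^^ j) ` S) = range (\<lambda>i. (\<gamma> ^^ i) ` S)"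
  proof (intro equalityI subsetI; elim rangeE; simp only:)
    fix i show "(\<gamma> ^^ i) ` (\<gamma> ^^ j) ` S \<in> range (\<lambda>i. (\<gamma> ^^ i) ` S)"
      unfolding image_comp funpow_add[symmetric] by blast
  next
    fix i
    \<comment> \<open>The exponent \<open>p * j - j\<close> stands for -j and undoes the translation
      by \<open>\<gamma> ^^ j\<close>.\<close>
    have "(\<gamma> ^^ i) v = (\<gamma> ^^ (i + (p * j - j) + j)) v" if "v \<in> S" for v
    proof -
      have "j \<le> p * j" using prime_gt_0_nat[OF p] by simp
      then have "i + (p * j - j) + j = i + p * j" by linarith
      then have "(\<gamma> ^^ (i + (p * j - j) + j)) v = (\<gamma> ^^ (i + p * j)) v" by (simp only:)
      also have "\<dots> = (\<gamma> ^^ i) v" using period_mult[OF subsetD[OF assms that], of j] by (simp add: funpow_add)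
      finally show ?thesis by simp
    qed
    then have "(\<gamma> ^^ i) ` S = (\<gamma> ^^ (i + (p * j - j))) ` (\<gamma> ^^ j) ` S"
      by (force simp: image_comp funpow_add[symmetric])
    then show "(\<gamma> ^^ i) ` S \<in> range (\<lambda>i. (\<gamma> ^^ i) ` (\<gamma> ^^ j) ` S)" by blast
  qed
  then show ?thesis by (simp add: rep_def)
qed

text \<open>Some translate is the chosen one of the orbit, and by \<open>free_simplex\<close> two
  different exponents below p never give the same simplex.\<close>

lemma T_unique:
  assumes S: "S \<in> K" "S \<notin> fixc K \<gamma>"
  shows "\<exists>!i. i < p \<and> (dl ^^ i) ` S \<in> T"
proof -
  have sub: "S \<subseteq> \<Union>K" using S(1) by blast
  have "rep S \<in> range (\<lambda>i. (\<gamma> ^^ i) ` S)" unfolding rep_def by (rule someI[of _ "(\<gamma> ^^ 0) ` S"]) blast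
  then obtain i where i: "rep S = (\<gamma> ^^ i) ` S" by blast
  have rT: "rep S \<in> T"
    unfolding T_def using gamma_simplex[OF sub, of i] gamma_fixc[OF sub, of i] rep_gamma[OF sub, of i] S i by simp
  have Tr: "S' = rep S" if "S' \<in> T" "S' = (\<gamma> ^^ k) ` S" for S' k
    using that rep_gamma[OF sub, of k] by (simp add: T_def)
  have inv: "v = (dl ^^ k) ((\<gamma> ^^ k) v)" if "v \<in> S" for v k
  proof -
    have "(p - 1) * k + k = p * k" using prime_gt_0_nat[OF p] by (simp add: algebra_simps diff_mult_distrib)
    then have "(dl ^^ k) ((\<gamma> ^^ k) v) = (\<gamma> ^^ (p * k)) v"
      by (metis comp_apply dl_pow funpow_add)
    moreover have "v \<in> \<Union>K" using that sub by blast
    ultimately show ?thesis using period_mult[of v k] by simp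
  qed
  show ?thesis
  proof (rule ex_ex1I)
    \<comment> \<open>Solves \<open>(p - 1) * k = i\<close> modulo p: as p - 1 is -1, the solution
      is -i, written as a natural number.\<close>
    let ?k = "(p * i - i) mod p"
    have "(dl ^^ ?k) ` S = rep S"
    proof -
      have "(dl ^^ ?k) v = (\<gamma> ^^ i) v" if "v \<in> S" for v
      proof -
        have v: "v \<in> \<Union>K" using that sub by blast
        have "[(p - 1) * ?k = i] (mod p)"
        proof -
          have "[(p - 1) * ?k = (p - 1) * (p * i - i)] (mod p)"
            by (intro cong_scalar_left) (simp add: cong_def)
          also have "(p - 1) * (p * i - i) = (p - 1) * ((p - 1) * i)"
            by (rule arg_cong[where f = "(*) (p - 1)"]) (simp add: diff_mult_distrib)
          also have "(p - 1) * ((p - 1) * i) = (p - 1) * (p - 1) * i" by (simp only: mult.assoc)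
          also have "(p - 1) * (p - 1) = p * (p - 2) + 1"
            using prime_ge_2_nat[OF p] by (auto simp: algebra_simps le_iff_add)
          also have "(p * (p - 2) + 1) * i = i + p * ((p - 2) * i)" by (simp add: algebra_simps)
          also have "[i + p * ((p - 2) * i) = i] (mod p)" by (simp add: cong_def)
          finally show ?thesis .
        qed
        then show ?thesis unfolding dl_pow
          using funpow_mod[OF v, of "(p - 1) * ?k"] funpow_mod[OF v, of i] by (simp add: cong_def)
      qed
      then show ?thesis unfolding i by auto
    qed
    then show "\<exists>k. k < p \<and> (dl ^^ k) ` S \<in> T"
      using rT prime_gt_0_nat[OF p] by (intro exI[of _ ?k]) auto
  next
    have one: "k \<le> l \<Longrightarrow> k = l" if k: "k < p" "(dl ^^ k) ` S \<in> T" and l: "l < p" "(dl ^^ l) ` S \<in> T" for k l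
    proof -
      assume kl: "k \<le> l"
      have eq: "(dl ^^ k) ` S = (dl ^^ l) ` S"
        using Tr[OF k(2)] Tr[OF l(2)] unfolding dl_pow by blast
      have "(\<gamma> ^^ k) ` (dl ^^ k) ` S = S"
        using inv[of _ k] by (auto simp: image_comp o_def dl_pow funpow_add[symmetric] add.commute intro!: image_eqI)
          (metis comp_apply funpow_add add.commute dl_pow)+
      moreover have "(\<gamma> ^^ k) ` (dl ^^ l) ` S = (dl ^^ (l - k)) ` S"
      proof -
        have "(\<gamma> ^^ k) ((dl ^^ l) v) = (dl ^^ (l - k)) v" if "v \<in> S" for v
        proof -
          have "(dl ^^ l) v = (dl ^^ k) ((dl ^^ (l - k)) v)" using kl by (metis comp_apply funpow_add le_add_diff_inverse)
          moreover have "(\<gamma> ^^ k) ((dl ^^ k) w) = w" if "w \<in> \<Union>K" for w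
          proof -
            have "k + (p - 1) * k = p * k" using prime_gt_0_nat[OF p] by (simp add: algebra_simps diff_mult_distrib)
            then show ?thesis using period_mult[OF that, of k] by (metis comp_apply dl_pow funpow_add)
          qed
          ultimately show ?thesis using dl_vert sub that by (metis subsetD)
        qed
        then show ?thesis by (force simp: image_comp)
      qed
      ultimately have "(\<gamma> ^^ ((p - 1) * (l - k))) ` S = S" using eq unfolding dl_pow by simp
      then have "p dvd (p - 1) * (l - k)" by (rule free_simplex[OF S])
      then have "p dvd l - k"
        using p prime_ge_2_nat[OF p] by (auto simp: prime_dvd_mult_iff dest: dvd_imp_le)
      then show "k = l" using kl l(1) by (auto dest: dvd_imp_le)
    qed
    fix k l assume "k < p \<and> (dl ^^ k) ` S \<in> T" "l < p \<and> (dl ^^ l) ` S \<in> T"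
    then show "k = l" using one[of k l] one[of l k] by (cases k l rule: le_cases) auto
  qed
qed

text \<open>Restriction to the transversal, which plays the role of a basis of the free part over
  the group ring.\<close>

definition mT :: "('v list \<Rightarrow> 'k::field) \<Rightarrow> 'v list \<Rightarrow> 'k" where
  "mT c \<sigma> = (if set \<sigma> \<in> T then c \<sigma> else 0)"

lemma mT_CH:
  assumes "c \<in> CH K"
  shows "mT c \<in> CH K"
proof -
  have "mT c = (\<lambda>\<sigma>. if set \<sigma> \<in> T then c \<sigma> else 0)" by (auto simp: mT_def)
  then show ?thesis using restrict_CH[OF assms, of T] CH_mono[of "K \<inter> T" K] by auto
qed

lemma mT_deg: "deg q c \<Longrightarrow> deg q (mT c)"
  by (auto simp: deg_def mT_def)

lemma mT_fixed: "set \<sigma> \<in> fixc K \<gamma> \<Longrightarrow> mT c \<sigma> = 0"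
  by (auto simp: mT_def T_def)

end

section \<open>Exactness of the powers of tau over the prime field\<close>

locale smith_complex = regular_complex K \<gamma> "CARD('p)"
  for K :: "'v set set" and \<gamma> and ty :: "'p::prime_card itself"
begin

lemma tau_norm:
  assumes c: "(c :: 'v list \<Rightarrow> 'p mod_ring) \<in> CH K" and s: "set \<sigma> \<subseteq> \<Union>K"
  shows "(tau \<gamma> ^^ (CARD('p) - 1)) c \<sigma> = (\<Sum>i<CARD('p). c (map (dl ^^ i) \<sigma>))"
proof -
  have "CARD('p) = Suc (CARD('p) - 1)" using prime_gt_0_nat[OF p] by simp
  then have "{..CARD('p) - 1} = {..<CARD('p)}" by (metis lessThan_Suc_atMost)
  then have "(tau \<gamma> ^^ (CARD('p) - 1)) c \<sigma> =
      (\<Sum>i<CARD('p). (-1) ^ i * of_nat ((CARD('p) - 1) choose i) * c (map (dl ^^ i) \<sigma>))"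
    unfolding tau_pow_eq[OF assms] by simp
  also have "\<dots> = (\<Sum>i<CARD('p). c (map (dl ^^ i) \<sigma>))"
  proof (rule sum.cong[OF refl])
    fix i assume "i \<in> {..<CARD('p)}"
    then have "i \<le> CARD('p) - 1" by simp
    from choose_prime_minus_1[OF this]
    show "(-1) ^ i * of_nat ((CARD('p) - 1) choose i) * c (map (dl ^^ i) \<sigma>) = c (map (dl ^^ i) \<sigma>)"
      by (simp only: mult_1)
  qed
  finally show ?thesis .
qed

text \<open>1 - g times the norm telescopes to the difference between \<open>c\<close> and its
  translate by the p-th power of the generator, which is \<open>c\<close> again.\<close>

lemma tau_p:
  assumes c: "(c :: 'v list \<Rightarrow> 'p mod_ring) \<in> CH K"
  shows "(tau \<gamma> ^^ CARD('p)) c = (\<lambda>_. 0)"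
proof
  fix \<sigma>
  have P: "CARD('p) = Suc (CARD('p) - 1)" using prime_gt_0_nat[OF p] by simp
  have c': "(tau \<gamma> ^^ CARD('p)) c \<in> CH K" by (rule tau_pow_CH[OF c])
  show "(tau \<gamma> ^^ CARD('p)) c \<sigma> = 0"
  proof (cases "set \<sigma> \<subseteq> \<Union>K")
    case True
    have T': "set (map dl \<sigma>) \<subseteq> \<Union>K" by (rule map_dl_vert1[OF True])
    have "(tau \<gamma> ^^ CARD('p)) c \<sigma> = (tau \<gamma> ^^ (CARD('p) - 1)) c \<sigma> - (tau \<gamma> ^^ (CARD('p) - 1)) c (map dl \<sigma>)"
      by (subst P) (simp only: funpow.simps o_apply tau_eq[OF tau_pow_CH[OF c] True])
    also have "\<dots> = (\<Sum>i<CARD('p). c (map (dl ^^ i) \<sigma>)) - (\<Sum>i<CARD('p). c (map (dl ^^ Suc i) \<sigma>))"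
      unfolding tau_norm[OF c True] tau_norm[OF c T'] by (simp add: o_def funpow_swap1)
    also have "\<dots> = c (map (dl ^^ 0) \<sigma>) - c (map (dl ^^ CARD('p)) \<sigma>)"
      unfolding sum_subtractf[symmetric] by (rule sum_lessThan_telescope')
    also have "map (dl ^^ CARD('p)) \<sigma> = \<sigma>"
      by (rule map_idI) (rule dl_period[OF subsetD[OF True]])
    finally show ?thesis by simp
  qed (rule CH_outside[OF c'])
qed

text \<open>Exactly one of the p translates of a free simplex lies in the transversal, so the norm
  picks up one value of \<open>c\<close>, and by invariance it is the right one.\<close>

lemma norm_mT:
  assumes c: "(c :: 'v list \<Rightarrow> 'p mod_ring) \<in> CH K" and van: "\<And>\<sigma>. set \<sigma> \<in> fixc K \<gamma> \<Longrightarrow> c \<sigma> = 0"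
    and t: "tau \<gamma> c = (\<lambda>_. 0)"
  shows "(tau \<gamma> ^^ (CARD('p) - 1)) (mT c) = c"
proof
  fix \<sigma>
  have inv: "c (map (dl ^^ i) \<sigma>) = c \<sigma>" if "set \<sigma> \<subseteq> \<Union>K" for i
  proof (induction i)
    case (Suc i)
    have "set (map (dl ^^ i) \<sigma>) \<subseteq> \<Union>K" by (rule map_dl_vert[OF that])
    from tau_eq[OF c this] t have "c (map (dl ^^ i) \<sigma>) = c (map dl (map (dl ^^ i) \<sigma>))" by simp
    then show ?case using Suc by (simp add: o_def)
  qed simp
  show "(tau \<gamma> ^^ (CARD('p) - 1)) (mT c) \<sigma> = c \<sigma>"
  proof (cases "set \<sigma> \<subseteq> \<Union>K")
    case True
    have "(tau \<gamma> ^^ (CARD('p) - 1)) (mT c) \<sigma> = (\<Sum>i<CARD('p). if (dl ^^ i) ` set \<sigma> \<in> T then c \<sigma> else 0)"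
      unfolding tau_norm[OF mT_CH[OF c] True] by (rule sum.cong[OF refl]) (simp add: mT_def inv[OF True])
    also have "\<dots> = c \<sigma>"
    proof (cases "c \<sigma> = 0")
      case False
      then obtain i where i: "i < CARD('p)" "(dl ^^ i) ` set \<sigma> \<in> T"
        "\<And>k. k < CARD('p) \<Longrightarrow> (dl ^^ k) ` set \<sigma> \<in> T \<Longrightarrow> k = i"
        using T_unique[of "set \<sigma>"] CH_D(2)[OF c] van by metis
      have "(\<Sum>k<CARD('p). if (dl ^^ k) ` set \<sigma> \<in> T then c \<sigma> else 0) = (\<Sum>k<CARD('p). if k = i then c \<sigma> else 0)"
      proof (rule sum.cong[OF refl])
        fix k assume "k \<in> {..<CARD('p)}"
        then have "(dl ^^ k) ` set \<sigma> \<in> T \<longleftrightarrow> k = i" using i by blast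
        then show "(if (dl ^^ k) ` set \<sigma> \<in> T then c \<sigma> else 0) = (if k = i then c \<sigma> else 0)" by simp
      qed
      then show ?thesis using i(1) by simp
    qed (simp add: sum.neutral)
    finally show ?thesis .
  next
    case False
    then show ?thesis using CH_outside[OF c] CH_outside[OF tau_pow_CH[OF mT_CH[OF c]]] by metis
  qed
qed

text \<open>In a free module over F_p[\<tau>]/(\<tau>^p) the kernel of \<tau>^j is the image of
  \<tau>^(p-j). In the induction step \<tau>^j c is invariant and hence a norm \<tau>^(p-1) e1;
  subtracting \<tau>^(p-1-j) e1 from c leaves a chain that \<tau>^j already kills.\<close>

lemma tau_exact_free:
  "j \<le> CARD('p) - 1 \<Longrightarrow> (c :: 'v list \<Rightarrow> 'p mod_ring) \<in> CH K \<Longrightarrow> deg q c \<Longrightarrow>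
    (\<And>\<sigma>. set \<sigma> \<in> fixc K \<gamma> \<Longrightarrow> c \<sigma> = 0) \<Longrightarrow> (tau \<gamma> ^^ j) c = (\<lambda>_. 0) \<Longrightarrow>
    \<exists>e. e \<in> CH K \<and> deg q e \<and> c = (tau \<gamma> ^^ (CARD('p) - j)) e"
proof (induction j arbitrary: c)
  case 0
  then show ?case
    by (intro exI[of _ "\<lambda>_. 0"]) (simp add: tau_pow_zero lin_subspaceD(1)[OF lin_subspace_CH] deg_def)
next
  case (Suc j)
  define b where "b = (tau \<gamma> ^^ j) c"
  define e1 where "e1 = mT b"
  \<comment> \<open>With this exponent the norm factors as \<tau>^j \<tau>^n, and the power
    \<tau>^(n+1) supplied by the induction hypothesis still contains the required \<tau>^n.\<close>
  define n where "n = CARD('p) - Suc j"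
  have n: "CARD('p) - j = Suc n" "n + j = CARD('p) - 1" using Suc.prems(1) prime_gt_0_nat[OF p] by (auto simp: n_def)
  have b: "b \<in> CH K" "deg q b" unfolding b_def using Suc.prems tau_pow_CH tau_pow_deg by blast+
  have bfix: "b \<sigma> = 0" if "set \<sigma> \<in> fixc K \<gamma>" for \<sigma>
    unfolding b_def using Suc.prems(4)[OF that] tau_pow_fixed_simplex[OF Suc.prems(2) that] by (cases "j = 0") auto
  have e1: "e1 \<in> CH K" "deg q e1" unfolding e1_def using b mT_CH mT_deg by blast+
  have "tau \<gamma> b = (\<lambda>_. 0)" using Suc.prems(5) by (simp add: b_def)
  then have "(tau \<gamma> ^^ (CARD('p) - 1)) e1 = b" unfolding e1_def by (intro norm_mT b bfix)
  then have jb: "(tau \<gamma> ^^ j) ((tau \<gamma> ^^ n) e1) = (tau \<gamma> ^^ j) c"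
    unfolding b_def using n(2) by (metis add.commute comp_apply funpow_add)
  define c' where "c' = (\<lambda>\<sigma>. c \<sigma> - (tau \<gamma> ^^ n) e1 \<sigma>)"
  have ne: "(tau \<gamma> ^^ n) e1 \<in> CH K" "deg q ((tau \<gamma> ^^ n) e1)" using e1 tau_pow_CH tau_pow_deg by blast+
  have "\<exists>e. e \<in> CH K \<and> deg q e \<and> c' = (tau \<gamma> ^^ (CARD('p) - j)) e"
  proof (rule Suc.IH)
    show "j \<le> CARD('p) - 1" using Suc.prems(1) by simp
    show "c' \<in> CH K" unfolding c'_def by (rule lin_subspaceD(5)[OF lin_subspace_CH Suc.prems(2) ne(1)])
    show "deg q c'" unfolding c'_def
      using lin_subspaceD(5)[OF lin_subspace_deg[of q], of c "(tau \<gamma> ^^ n) e1"] Suc.prems(3) ne(2) by simp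
    \<comment> \<open>For \<open>n = 0\<close> the power of \<open>tau\<close> is the identity, but
      then \<open>e1\<close> itself vanishes on fixed simplices since it is supported on the
      transversal.\<close>
    show "c' \<sigma> = 0" if "set \<sigma> \<in> fixc K \<gamma>" for \<sigma>
      unfolding c'_def using Suc.prems(4)[OF that] mT_fixed[OF that, of b] tau_pow_fixed_simplex[OF e1(1) that]
      by (cases "n = 0") (auto simp: e1_def)
    show "(tau \<gamma> ^^ j) c' = (\<lambda>_. 0)"
      unfolding c'_def linear_betweenD(3)[OF tau_pow_linear lin_subspace_CH Suc.prems(2) ne(1)] jb by simp
  qed
  then obtain e where e: "e \<in> CH K" "deg q e" "c' = (tau \<gamma> ^^ Suc n) e" unfolding n(1) by blast
  have te: "tau \<gamma> e \<in> CH K" "deg q (tau \<gamma> e)" using e tau_CH tau_deg by blast+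
  have "c = (\<lambda>\<sigma>. (tau \<gamma> ^^ n) e1 \<sigma> + (tau \<gamma> ^^ n) (tau \<gamma> e) \<sigma>)"
  proof
    fix \<sigma> show "c \<sigma> = (tau \<gamma> ^^ n) e1 \<sigma> + (tau \<gamma> ^^ n) (tau \<gamma> e) \<sigma>"
      using fun_cong[OF e(3), of \<sigma>] unfolding c'_def funpow_Suc_right o_apply by (simp add: algebra_simps)
  qed
  also have "\<dots> = (tau \<gamma> ^^ n) (\<lambda>\<sigma>. e1 \<sigma> + tau \<gamma> e \<sigma>)"
    by (rule linear_betweenD(1)[OF tau_pow_linear lin_subspace_CH e1(1) te(1), symmetric])
  finally show ?case
    using lin_subspaceD(2)[OF lin_subspace_CH e1(1) te(1)]
      lin_subspaceD(2)[OF lin_subspace_deg[of q], of e1 "tau \<gamma> e"] e1(2) te(2) n_def by auto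
qed

text \<open>The chain is split into its values on the fixed complex and the rest. As j > 0, \<tau>^j
  kills the first part, so exactness for chains without fixed part applies to the second.\<close>

lemma tau_exact:
  assumes j: "1 \<le> j" "j \<le> CARD('p) - 1" and c: "(c :: 'v list \<Rightarrow> 'p mod_ring) \<in> CH K" "deg q c"
    and t: "(tau \<gamma> ^^ j) c = (\<lambda>_. 0)"
  shows "\<exists>e f. e \<in> CH K \<and> deg q e \<and> f \<in> CH (fixc K \<gamma>) \<and> deg q f \<and>
    c = (\<lambda>\<sigma>. (tau \<gamma> ^^ (CARD('p) - j)) e \<sigma> + f \<sigma>)"
proof -
  define f where "f \<sigma> = (if set \<sigma> \<in> fixc K \<gamma> then c \<sigma> else 0)" for \<sigma>
  have f: "f \<in> CH (fixc K \<gamma>)" "deg q f"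
    using restrict_CH[OF c(1), of "fixc K \<gamma>"] c(2) fixc_sub unfolding f_def[abs_def]
    by (auto simp: deg_def Int_absorb1)
  have fK: "f \<in> CH K" using f(1) CH_mono[OF fixc_sub] by blast
  have "\<exists>e. e \<in> CH K \<and> deg q e \<and> (\<lambda>\<sigma>. c \<sigma> - f \<sigma>) = (tau \<gamma> ^^ (CARD('p) - j)) e"
  proof (rule tau_exact_free[OF j(2)])
    show "(\<lambda>\<sigma>. c \<sigma> - f \<sigma>) \<in> CH K" by (rule lin_subspaceD(5)[OF lin_subspace_CH c(1) fK])
    show "deg q (\<lambda>\<sigma>. c \<sigma> - f \<sigma>)"
      using lin_subspaceD(5)[OF lin_subspace_deg[of q], of c f] c(2) f(2) by simp
    show "(tau \<gamma> ^^ j) (\<lambda>\<sigma>. c \<sigma> - f \<sigma>) = (\<lambda>_. 0)"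
      using linear_betweenD(3)[OF tau_pow_linear lin_subspace_CH c(1) fK] t tau_pow_fixed_chain[OF f(1)] j by simp
  qed (simp add: f_def)
  then obtain e where e: "e \<in> CH K" "deg q e" "(\<lambda>\<sigma>. c \<sigma> - f \<sigma>) = (tau \<gamma> ^^ (CARD('p) - j)) e" by blast
  have "c = (\<lambda>\<sigma>. (tau \<gamma> ^^ (CARD('p) - j)) e \<sigma> + f \<sigma>)" unfolding e(3)[symmetric] by simp
  then show ?thesis using e f by blast
qed

text \<open>The image of a positive power of \<open>tau\<close> vanishes on fixed simplices and
  \<open>f\<close> vanishes on all others, so the two supports are disjoint.\<close>

lemma tau_fixed_direct:
  assumes "(e :: 'v list \<Rightarrow> 'p mod_ring) \<in> CH K" "f \<in> CH (fixc K \<gamma>)" "0 < n"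
    and z: "\<And>\<sigma>. (tau \<gamma> ^^ n) e \<sigma> + f \<sigma> = 0"
  shows "f = (\<lambda>_. 0)" "(tau \<gamma> ^^ n) e = (\<lambda>_. 0)"
proof -
  have "f \<sigma> = 0" for \<sigma>
    using z[of \<sigma>] CH_D(2)[OF assms(2), of \<sigma>] tau_pow_fixed_simplex[OF assms(1), of \<sigma> n] assms(3) by force
  then show "f = (\<lambda>_. 0)" "(tau \<gamma> ^^ n) e = (\<lambda>_. 0)" using z by auto
qed

end

section \<open>Direct systems of complexes\<close>

lemma lf_complex_empty: "lf_complex {}"
  by unfold_locales auto

context lf_complex
begin

lemma relcycles_eq:
  assumes "L \<subseteq> K"
  shows "lf_relcycles q K L = {c \<in> CH K. deg q c \<and> lf_boundary c \<in> CH L}"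
proof -
  have "(\<forall>\<tau>. lf_boundary c \<tau> \<noteq> 0 \<longrightarrow> set \<tau> \<in> L) \<longleftrightarrow> lf_boundary c \<in> CH L" if "c \<in> CH K" for c
    using CH_D(1)[OF boundary_CH[OF that]] by (auto simp: CH_def)
  then show ?thesis unfolding lf_relcycles_def lf_chains_eq by auto
qed

lemma relboundaries_eq:
  assumes "lf_complex L"
  shows "lf_relboundaries q K L =
    {(\<lambda>\<tau>. lf_boundary c \<tau> + l \<tau>) | c l. c \<in> CH K \<and> deg (Suc q) c \<and> l \<in> CH L \<and> deg q l}"
  unfolding lf_relboundaries_def lf_chains_eq lf_complex.lf_chains_eq[OF assms] by simp

lemma relboundariesI:
  assumes "lf_complex L" "c \<in> CH K" "deg (Suc q) c" "l \<in> CH L" "deg q l" "\<And>\<tau>. z \<tau> = lf_boundary c \<tau> + l \<tau>"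
  shows "z \<in> lf_relboundaries q K L"
  unfolding relboundaries_eq[OF assms(1)] using assms(2-) by blast

lemma cycles_eq: "lf_relcycles q K {} = {c \<in> CH K. deg q c \<and> lf_boundary c = (\<lambda>_. 0)}"
  unfolding relcycles_eq[OF empty_subsetI] CH_empty by simp

lemma boundaries_eq: "lf_relboundaries q K {} = {lf_boundary c | c. c \<in> CH K \<and> deg (Suc q) c}"
  unfolding relboundaries_eq[OF lf_complex_empty] CH_empty by (auto simp: deg_def)

end

locale complex_system =
  fixes K L :: "nat \<Rightarrow> 'v set set" and f :: "nat \<Rightarrow> 'v \<Rightarrow> 'v"
  assumes K: "lf_complex (K n)" and L: "lf_complex (L n)" and LK: "L n \<subseteq> K n"
    and fK: "smap (K n) (K (Suc n)) (f n)" and fL: "smap (L n) (L (Suc n)) (f n)"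
begin

abbreviation F :: "nat \<Rightarrow> nat \<Rightarrow> 'v \<Rightarrow> 'v" where "F m n \<equiv> fold f [m..<n]"

lemma F_refl: "F n n = id" by simp

lemma F_comp: "l \<le> m \<Longrightarrow> m \<le> n \<Longrightarrow> F m n \<circ> F l m = F l n"
  using upt_add_eq_append[of l m "n - m"] by (simp add: fun_eq_iff)

lemma F_Suc: "m \<le> n \<Longrightarrow> F m (Suc n) = f n \<circ> F m n" by (simp add: fun_eq_iff)

lemma F_K: "m \<le> n \<Longrightarrow> smap (K m) (K n) (F m n)"
proof (induction rule: dec_induct)
  case base
  then show ?case using smap_id[of "K m" "K m"] by (simp add: id_def)
next
  case (step n)
  show ?case unfolding F_Suc[OF step.hyps(1)] by (rule smap_comp[OF step.IH fK K])
qed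

lemma F_L: "m \<le> n \<Longrightarrow> smap (L m) (L n) (F m n)"
proof (induction rule: dec_induct)
  case base
  then show ?case using smap_id[of "L m" "L m"] by (simp add: id_def)
next
  case (step n)
  show ?case unfolding F_Suc[OF step.hyps(1)] by (rule smap_comp[OF step.IH fL L])
qed

abbreviation tr :: "nat \<Rightarrow> nat \<Rightarrow> ('v list \<Rightarrow> 'k::field) \<Rightarrow> 'v list \<Rightarrow> 'k" where
  "tr m n \<equiv> chain_push (F m n)"

lemma tr_refl: "c \<in> CH (K n) \<Longrightarrow> tr n n c = c"
  using lf_complex.push_id[OF K] by (simp add: F_refl del: upt_rec)

lemma tr_comp: "l \<le> m \<Longrightarrow> m \<le> n \<Longrightarrow> c \<in> CH (K l) \<Longrightarrow> tr m n (tr l m c) = tr l n c"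
  using lf_complex.push_comp[OF K _ F_K F_K K] F_comp by metis

lemma tr_lin: "m \<le> n \<Longrightarrow> linear_between (CH (K m)) (tr m n)"
  by (rule lf_complex.push_linear[OF K F_K])

lemma tr_CH: "m \<le> n \<Longrightarrow> c \<in> CH (K m) \<Longrightarrow> tr m n c \<in> CH (K n)"
  by (rule lf_complex.push_CH[OF K _ F_K])

lemma tr_CH_L: "m \<le> n \<Longrightarrow> c \<in> CH (L m) \<Longrightarrow> tr m n c \<in> CH (L n)"
  by (rule lf_complex.push_CH[OF L _ F_L])

lemma tr_boundary: "m \<le> n \<Longrightarrow> c \<in> CH (K m) \<Longrightarrow> lf_boundary (tr m n c) = tr m n (lf_boundary c)"
  by (rule lf_complex.push_boundary[OF K _ F_K])

lemma tr_deg: "deg q c \<Longrightarrow> deg q (tr m n c)"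
  using lf_complex.push_deg[OF K] .

lemma tr_add: "m \<le> n \<Longrightarrow> c \<in> CH (K m) \<Longrightarrow> d \<in> CH (K m) \<Longrightarrow>
    tr m n (\<lambda>s. c s + d s) = (\<lambda>s. tr m n c s + tr m n d s)"
  by (rule linear_betweenD(1)[OF tr_lin lin_subspace_CH])

lemma tr_diff: "m \<le> n \<Longrightarrow> c \<in> CH (K m) \<Longrightarrow> d \<in> CH (K m) \<Longrightarrow>
    tr m n (\<lambda>s. c s - d s) = (\<lambda>s. tr m n c s - tr m n d s)"
  by (rule linear_betweenD(3)[OF tr_lin lin_subspace_CH])

lemma LK_CH: "c \<in> CH (L n) \<Longrightarrow> c \<in> CH (K n)" using CH_mono[OF LK] by blast

lemma rel_tower:
  "tower (\<lambda>n. lf_relcycles q (K n) (L n)) (\<lambda>n. lf_relboundaries q (K n) (L n)) (\<lambda>m n. tr m n)"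
proof
  note rc = lf_complex.relcycles_eq[OF K LK] and rb = lf_complex.relboundaries_eq[OF K L]
  fix n
  note bl = linear_betweenD[OF lf_complex.boundary_linear[OF K, of n] lin_subspace_CH]
  note CK = lin_subspaceD[OF lin_subspace_CH[of "K n"]] and CL = lin_subspaceD[OF lin_subspace_CH[of "L n"]]
  show "lin_subspace (lf_relcycles q (K n) (L n) :: ('v list \<Rightarrow> 'k::field) set)"
    unfolding lin_subspace_def rc
  proof (intro conjI ballI allI CollectI)
    fix x y :: "'v list \<Rightarrow> 'k" and a
    show "(\<lambda>_. 0 :: 'k) \<in> CH (K n)" "deg q (\<lambda>_. 0 :: 'k)" "lf_boundary (\<lambda>_. 0 :: 'k) \<in> CH (L n)"
      unfolding bl(4) by (rule CK(1), simp add: deg_def, rule CL(1))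
    assume x: "x \<in> {c \<in> CH (K n). deg q c \<and> lf_boundary c \<in> CH (L n)}"
    show "(\<lambda>s. a * x s) \<in> CH (K n)" "deg q (\<lambda>s. a * x s)" "lf_boundary (\<lambda>s. a * x s) \<in> CH (L n)"
      using x CK(3)[of x a] CL(3)[of "lf_boundary x" a] bl(2)[of x a]
        lin_subspaceD(3)[OF lin_subspace_deg, of x q a] by auto
    assume y: "y \<in> {c \<in> CH (K n). deg q c \<and> lf_boundary c \<in> CH (L n)}"
    show "(\<lambda>s. x s + y s) \<in> CH (K n)" "deg q (\<lambda>s. x s + y s)" "lf_boundary (\<lambda>s. x s + y s) \<in> CH (L n)"
      using x y CK(2)[of x y] CL(2)[of "lf_boundary x" "lf_boundary y"] bl(1)[of x y]
        lin_subspaceD(2)[OF lin_subspace_deg, of x q y] by auto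
  qed
  show "lin_subspace (lf_relboundaries q (K n) (L n) :: ('v list \<Rightarrow> 'k::field) set)"
    unfolding lin_subspace_def rb
  proof (intro conjI ballI allI)
    let ?S = "{(\<lambda>\<tau>. lf_boundary c \<tau> + l \<tau>) | c l :: 'v list \<Rightarrow> 'k. c \<in> CH (K n) \<and> deg (Suc q) c \<and> l \<in> CH (L n) \<and> deg q l}"
    have e: "(\<lambda>_. 0 :: 'k) =  (\<lambda>\<tau>. lf_boundary (\<lambda>_ :: 'v list. 0 :: 'k) \<tau> + (\<lambda>_. 0) \<tau>)" unfolding bl(4) by simp
    have d: "deg q (\<lambda>_. 0 :: 'k)" for q by (simp add: deg_def)
    show "(\<lambda>_. 0) \<in> ?S" by (intro CollectI exI conjI) (rule e CK(1) CL(1) d)+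
    fix x y and a :: 'k assume "x \<in> ?S"
    then obtain c l where x: "x = (\<lambda>\<tau>. lf_boundary c \<tau> + l \<tau>)" "c \<in> CH (K n)" "deg (Suc q) c" "l \<in> CH (L n)" "deg q l"
      by blast
    have ea: "(\<lambda>s. a * x s) = (\<lambda>\<tau>. lf_boundary (\<lambda>s. a * c s) \<tau> + a * l \<tau>)"
      unfolding bl(2)[OF x(2)] x(1) by (simp add: algebra_simps)
    have ca: "(\<lambda>s. a * c s) \<in> CH (K n)" "deg (Suc q) (\<lambda>s. a * c s)" "(\<lambda>s. a * l s) \<in> CH (L n)" "deg q (\<lambda>s. a * l s)"
      using CK(3) CL(3) x lin_subspaceD(3)[OF lin_subspace_deg] by blast+
    show "(\<lambda>s. a * x s) \<in> ?S" by (intro CollectI exI conjI) (rule ea ca)+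
    assume "y \<in> ?S"
    then obtain c' l' where y: "y = (\<lambda>\<tau>. lf_boundary c' \<tau> + l' \<tau>)" "c' \<in> CH (K n)" "deg (Suc q) c'" "l' \<in> CH (L n)" "deg q l'"
      by blast
    have eb: "(\<lambda>s. x s + y s) = (\<lambda>\<tau>. lf_boundary (\<lambda>s. c s + c' s) \<tau> + (l \<tau> + l' \<tau>))"
      unfolding bl(1)[OF x(2) y(2)] x(1) y(1) by (simp add: algebra_simps)
    have cb: "(\<lambda>s. c s + c' s) \<in> CH (K n)" "deg (Suc q) (\<lambda>s. c s + c' s)"
        "(\<lambda>s. l s + l' s) \<in> CH (L n)" "deg q (\<lambda>s. l s + l' s)"
      using CK(2) CL(2) x y lin_subspaceD(2)[OF lin_subspace_deg] by blast+
    show "(\<lambda>s. x s + y s) \<in> ?S" by (intro CollectI exI conjI) (rule eb cb)+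
  qed
  show "lf_relboundaries q (K n) (L n) \<subseteq> (lf_relcycles q (K n) (L n) :: ('v list \<Rightarrow> 'k::field) set)"
  proof
    fix z :: "'v list \<Rightarrow> 'k" assume "z \<in> lf_relboundaries q (K n) (L n)"
    then obtain c l where z: "z = (\<lambda>\<tau>. lf_boundary c \<tau> + l \<tau>)" "c \<in> CH (K n)" "deg (Suc q) c" "l \<in> CH (L n)" "deg q l"
      unfolding rb by blast
    have b: "lf_boundary c \<in> CH (K n)" "deg q (lf_boundary c)"
      using lf_complex.boundary_CH[OF K z(2)] lf_complex.boundary_deg[OF K z(3)] by blast+
    have "lf_boundary z = (\<lambda>\<tau>. 0 + lf_boundary l \<tau>)"
      unfolding z(1) bl(1)[OF b(1) LK_CH[OF z(4)]] lf_complex.boundary_boundary[OF K z(2)] ..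
    then show "z \<in> lf_relcycles q (K n) (L n)"
      unfolding rc using z CK(2)[OF b(1) LK_CH[OF z(4)]] lin_subspaceD(2)[OF lin_subspace_deg, of "lf_boundary c" q l] b(2)
        lf_complex.boundary_CH[OF L z(4)] by auto
  qed
  fix m and z :: "'v list \<Rightarrow> 'k::field" assume mn: "m \<le> n"
  show "linear_between (lf_relcycles q (K m) (L m) :: ('v list \<Rightarrow> 'k) set) (tr m n)"
    by (rule linear_between_subset[OF tr_lin[OF mn]]) (auto simp: rc)
  show "tr m n z \<in> lf_relcycles q (K n) (L n)" if "z \<in> lf_relcycles q (K m) (L m)"
    using that mn unfolding rc by (auto simp: tr_CH tr_deg tr_boundary tr_CH_L)
  show "tr m n z \<in> lf_relboundaries q (K n) (L n)" if zm: "z \<in> lf_relboundaries q (K m) (L m)"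
  proof -
    obtain c l where z: "z = (\<lambda>\<tau>. lf_boundary c \<tau> + l \<tau>)" "c \<in> CH (K m)" "deg (Suc q) c" "l \<in> CH (L m)" "deg q l"
      using zm unfolding rb by blast
    have "tr m n z = (\<lambda>\<tau>. lf_boundary (tr m n c) \<tau> + tr m n l \<tau>)"
      unfolding z(1) tr_add[OF mn lf_complex.boundary_CH[OF K z(2)] LK_CH[OF z(4)]] tr_boundary[OF mn z(2)] ..
    then show ?thesis unfolding rb using z mn tr_CH tr_deg tr_CH_L by blast
  qed
next
  note rc = lf_complex.relcycles_eq[OF K LK]
  fix l m n and z :: "'v list \<Rightarrow> 'k::field"
  show "tr n n z = z" if "z \<in> lf_relcycles q (K n) (L n)" using that tr_refl unfolding rc by blast
  show "tr m n (tr l m z) = tr l n z" if "l \<le> m" "m \<le> n" "z \<in> lf_relcycles q (K l) (L l)"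
    using that tr_comp unfolding rc by blast
qed

end

text \<open>If every cycle becomes a boundary at a later stage, the limit has one element, and a
  power of the number of scalars is 1 only for exponent 0.\<close>

lemma vs_rank_zero:
  fixes Z B :: "nat \<Rightarrow> ('s \<Rightarrow> 'k::{field,finite}) set"
  assumes "tower Z B T" and van: "\<And>n z. z \<in> Z n \<Longrightarrow> \<exists>l\<ge>n. T n l z \<in> B l"
  shows "vs_rank (tower.lim Z B T) = 0"
proof -
  interpret tower Z B T by fact
  let ?z = "cl 0 (\<lambda>_. 0)"
  have z0: "(\<lambda>_. 0) \<in> Z n" for n by (rule lin_subspaceD(1)[OF Z])
  have "cl n z = ?z" if z: "z \<in> Z n" for n z
  proof -
    obtain l where l: "n \<le> l" "T n l z \<in> B l" using van[OF z] by blast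
    have "T 0 l (\<lambda>_. 0) = (\<lambda>_. 0)" by (rule linear_betweenD(4)[OF T_lin Z]) simp
    then have "(\<lambda>s. T n l z s - T 0 l (\<lambda>_. 0) s) \<in> B l" using l by simp
    then show ?thesis unfolding cl_eq_iff[OF z z0] using l(1) by blast
  qed
  then have "carrier lim = {?z}" using carrier_lim cl_closed[OF z0] by auto
  moreover have "vs_rank lim < \<infinity>" using vs_rank_finite_iff[OF dirlim_vectorspace] calculation by simp
  then obtain r where r: "vs_rank lim = enat r" by auto
  ultimately have "CARD('k) ^ r = 1" using card_eq_power_vs_rank[OF dirlim_vectorspace r] by simp
  moreover have "1 < CARD('k)"
    using card_mono[of "UNIV :: 'k set" "{0, 1}"] by simp
  ultimately have "r = 0" by (metis nat_less_le nat_power_eq_Suc_0_iff One_nat_def)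
  then show ?thesis using r by (simp add: zero_enat_def)
qed

section \<open>Direct systems with a cyclic action\<close>

locale smith_system = complex_system K "\<lambda>_. {}" f
  for K :: "nat \<Rightarrow> 'v set set" and f +
  fixes \<gamma> :: "'v \<Rightarrow> 'v" and ty :: "'p::prime_card itself"
  assumes S: "smith_complex TYPE('p) (K n) \<gamma>"
    and f\<gamma>: "v \<in> \<Union>(K n) \<Longrightarrow> f n (\<gamma> v) = \<gamma> (f n v)"
begin

lemma R: "regular_complex (K n) \<gamma> CARD('p)"
  using S smith_complex_def by blast

lemmas smith_gamma = regular_complex.smap_gamma[OF R]

lemma F_gamma: "m \<le> n \<Longrightarrow> v \<in> \<Union>(K m) \<Longrightarrow> F m n (\<gamma> v) = \<gamma> (F m n v)"
proof (induction n rule: dec_induct)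
  case (step n)
  have "F m n v \<in> \<Union>(K n)" using F_K[OF step.hyps(1)] step.prems unfolding smap_def by blast
  then show ?case using step.IH[OF step.prems] f\<gamma> step.hyps(1) by simp
qed simp

lemma tr_tau:
  assumes mn: "m \<le> n" and c: "c \<in> CH (K m)"
  shows "tr m n (tau \<gamma> c) = tau \<gamma> (tr m n c)"
proof -
  have "tr m n (chain_push \<gamma> c) = chain_push (F m n \<circ> \<gamma>) c"
    by (rule lf_complex.push_comp[OF K c smith_gamma F_K[OF mn] K])
  also have "\<dots> = chain_push (\<gamma> \<circ> F m n) c"
    by (rule lf_complex.push_cong[OF K c]) (simp add: F_gamma[OF mn])
  also have "\<dots> = chain_push \<gamma> (tr m n c)"
    by (rule lf_complex.push_comp[OF K c F_K[OF mn] smith_gamma K, symmetric])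
  finally show ?thesis
    unfolding tau_def using tr_diff[OF mn c lf_complex.push_CH[OF K c smith_gamma]] by simp
qed

lemma tr_tau_pow:
  assumes mn: "m \<le> n" and c: "c \<in> CH (K m)"
  shows "tr m n ((tau \<gamma> ^^ j) c) = (tau \<gamma> ^^ j) (tr m n c)"
  by (induction j) (simp_all add: tr_tau[OF mn regular_complex.tau_pow_CH[OF R c]])

lemma smith_chains_eq: "smith_chains j \<gamma> q (K n) = {(tau \<gamma> ^^ j) e | e. e \<in> CH (K n) \<and> deg q e}"
  unfolding smith_chains_def lf_complex.lf_chains_eq[OF K] by blast

lemma smith_chains_CH: "z \<in> smith_chains j \<gamma> q (K n) \<Longrightarrow> z \<in> CH (K n) \<and> deg q z"
  unfolding smith_chains_eq using regular_complex.tau_pow_CH[OF R] regular_complex.tau_pow_deg[OF R] by blast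

lemma lin_smith_chains: "lin_subspace (smith_chains j \<gamma> q (K n) :: ('v list \<Rightarrow> 'k::field) set)"
  unfolding smith_chains_def lf_complex.lf_chains_eq[OF K]
  by (rule linear_between_image[OF lin_subspace_Int[OF lin_subspace_CH lin_subspace_deg]
        linear_between_subset[OF regular_complex.tau_pow_linear[OF R]]]) blast

lemma smith_tower:
  "tower (\<lambda>n. smith_cycles j \<gamma> q (K n)) (\<lambda>n. smith_boundaries j \<gamma> q (K n)) (\<lambda>m n. tr m n)"
proof
  fix n
  note bl = linear_betweenD[OF lf_complex.boundary_linear[OF K, of n] lin_subspace_CH]
  note sc = smith_chains_CH and C = lin_subspaceD[OF lin_smith_chains]
  show "lin_subspace (smith_cycles j \<gamma> q (K n) :: ('v list \<Rightarrow> 'k::field) set)"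
    unfolding lin_subspace_def smith_cycles_def
  proof (intro conjI ballI allI CollectI)
    fix x y :: "'v list \<Rightarrow> 'k" and a
    show "(\<lambda>_. 0 :: 'k) \<in> smith_chains j \<gamma> q (K n)" by (rule C(1))
    show "lf_boundary (\<lambda>_ :: 'v list. 0 :: 'k) = (\<lambda>_. 0 :: 'k)" by (rule bl(4))
    assume x: "x \<in> {c \<in> smith_chains j \<gamma> q (K n). lf_boundary c = (\<lambda>_. 0)}"
    then have x': "x \<in> CH (K n)" using sc by blast
    show "(\<lambda>s. a * x s) \<in> smith_chains j \<gamma> q (K n)" using x C(3) by blast
    show "lf_boundary (\<lambda>s. a * x s) = (\<lambda>_. 0)" unfolding bl(2)[OF x'] using x by simp
    assume y: "y \<in> {c \<in> smith_chains j \<gamma> q (K n). lf_boundary c = (\<lambda>_. 0)}"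
    then have y': "y \<in> CH (K n)" using sc by blast
    show "(\<lambda>s. x s + y s) \<in> smith_chains j \<gamma> q (K n)" using x y C(2) by blast
    show "lf_boundary (\<lambda>s. x s + y s) = (\<lambda>_. 0)" unfolding bl(1)[OF x' y'] using x y by simp
  qed
  show "lin_subspace (smith_boundaries j \<gamma> q (K n) :: ('v list \<Rightarrow> 'k::field) set)"
    unfolding smith_boundaries_def
    by (rule linear_between_image[OF lin_smith_chains linear_between_subset[OF lf_complex.boundary_linear[OF K]]])
      (use sc in blast)
  show "smith_boundaries j \<gamma> q (K n) \<subseteq> (smith_cycles j \<gamma> q (K n) :: ('v list \<Rightarrow> 'k::field) set)"
  proof
    fix z :: "'v list \<Rightarrow> 'k" assume "z \<in> smith_boundaries j \<gamma> q (K n)"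
    then obtain e where e: "e \<in> CH (K n)" "deg (Suc q) e" "z = lf_boundary ((tau \<gamma> ^^ j) e)"
      unfolding smith_boundaries_def smith_chains_eq by blast
    have "lf_boundary z = (\<lambda>_. 0)" unfolding e(3)
      by (rule lf_complex.boundary_boundary[OF K regular_complex.tau_pow_CH[OF R e(1)]])
    moreover have "z = (tau \<gamma> ^^ j) (lf_boundary e)" unfolding e(3) by (rule regular_complex.tau_pow_boundary[OF R e(1)])
    ultimately show "z \<in> smith_cycles j \<gamma> q (K n)"
      unfolding smith_cycles_def smith_chains_eq
      using lf_complex.boundary_CH[OF K e(1)] lf_complex.boundary_deg[OF K e(2)] by blast
  qed
  fix m and z :: "'v list \<Rightarrow> 'k::field" assume mn: "m \<le> n"
  have trsc: "tr m n c \<in> smith_chains j \<gamma> q' (K n)" if c: "c \<in> smith_chains j \<gamma> q' (K m)" for c :: "'v list \<Rightarrow> 'k" and q'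
  proof -
    obtain e where e: "e \<in> CH (K m)" "deg q' e" "c = (tau \<gamma> ^^ j) e" using c unfolding smith_chains_eq by blast
    show ?thesis unfolding smith_chains_eq e(3) tr_tau_pow[OF mn e(1)]
      using tr_CH[OF mn e(1)] tr_deg[OF e(2)] by blast
  qed
  have trb: "lf_boundary (tr m n c) = tr m n (lf_boundary c)" if "c \<in> smith_chains j \<gamma> q' (K m)" for c :: "'v list \<Rightarrow> 'k" and q'
    using tr_boundary[OF mn] sc that by blast
  have tr0: "tr m n (\<lambda>_. 0) = (\<lambda>_. 0 :: 'k)" by (rule linear_betweenD(4)[OF tr_lin[OF mn] lin_subspace_CH])
  show "linear_between (smith_cycles j \<gamma> q (K m) :: ('v list \<Rightarrow> 'k) set) (tr m n)"
    by (rule linear_between_subset[OF tr_lin[OF mn]]) (use sc smith_cycles_def in blast)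
  show "tr m n z \<in> smith_cycles j \<gamma> q (K n)" if "z \<in> smith_cycles j \<gamma> q (K m)"
  proof -
    have z: "z \<in> smith_chains j \<gamma> q (K m)" "lf_boundary z = (\<lambda>_. 0)" using that unfolding smith_cycles_def by blast+
    show ?thesis unfolding smith_cycles_def using trsc[OF z(1)] trb[OF z(1)] z(2) tr0 by simp
  qed
  show "tr m n z \<in> smith_boundaries j \<gamma> q (K n)" if zb: "z \<in> smith_boundaries j \<gamma> q (K m)"
  proof -
    obtain c where "c \<in> smith_chains j \<gamma> (Suc q) (K m)" "z = lf_boundary c"
      using zb unfolding smith_boundaries_def by blast
    then show ?thesis unfolding smith_boundaries_def using trb trsc by (metis image_eqI)
  qed
next
  fix l m n and z :: "'v list \<Rightarrow> 'k::field"
  show "tr n n z = z" if "z \<in> smith_cycles j \<gamma> q (K n)"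
    using that tr_refl smith_chains_CH unfolding smith_cycles_def by blast
  show "tr m n (tr l m z) = tr l n z" if "l \<le> m" "m \<le> n" "z \<in> smith_cycles j \<gamma> q (K l)"
    using that tr_comp smith_chains_CH unfolding smith_cycles_def by blast
qed

lemma fix_complex: "lf_complex (fixc (K n) \<gamma>)"
  by (rule regular_complex.fixc_complex[OF R])

lemma fixc_CH: "c \<in> CH (fixc (K n) \<gamma>) \<Longrightarrow> c \<in> CH (K n)"
  using CH_mono[OF regular_complex.fixc_sub[OF R]] by blast

text \<open>Equivariant projections carry fixed vertices to fixed vertices, so the fixed complexes
  are preserved by the transition maps.\<close>

lemma fix_system: "complex_system (\<lambda>n. fixc (K n) \<gamma>) (\<lambda>_. {}) f"
proof
  fix n
  interpret lf_complex "fixc (K n) \<gamma>" by (rule fix_complex)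
  show "S \<in> fixc (K n) \<gamma> \<Longrightarrow> finite S \<and> S \<noteq> {}" "S \<in> fixc (K n) \<gamma> \<Longrightarrow> T \<subseteq> S \<Longrightarrow> T \<noteq> {} \<Longrightarrow> T \<in> fixc (K n) \<gamma>"
    "finite {S \<in> fixc (K n) \<gamma>. v \<in> S}" for S T v
    using simplex face locfin by blast+
  show "smap (fixc (K n) \<gamma>) (fixc (K (Suc n)) \<gamma>) (f n)"
    unfolding smap_def
  proof (intro conjI ballI allI)
    fix S assume S: "S \<in> fixc (K n) \<gamma>"
    then have "f n ` S \<in> K (Suc n)" using fK[of n] by (auto simp: smap_def fixc_def)
    moreover have "\<gamma> (f n v) = f n v" if v: "v \<in> S" for v
    proof -
      have "v \<in> \<Union>(K n)" "\<gamma> v = v" using S v by (auto simp: fixc_def)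
      then show ?thesis using f\<gamma>[of v n] by simp
    qed
    ultimately show "f n ` S \<in> fixc (K (Suc n)) \<gamma>" by (auto simp: fixc_def)
  next
    fix w
    show "finite {v \<in> \<Union>(fixc (K n) \<gamma>). f n v = w}"
      by (rule finite_subset[of _ "{v \<in> \<Union>(K n). f n v = w}"])
        (use fK[of n] in \<open>auto simp: smap_def fixc_def\<close>)
  qed
qed (auto simp: smap_def)

abbreviation smith_lim where
  "smith_lim j q \<equiv> tower.lim (\<lambda>n. smith_cycles j \<gamma> q (K n)) (\<lambda>n. smith_boundaries j \<gamma> q (K n)) (\<lambda>m n. tr m n)"

abbreviation hom_lim where
  "hom_lim q \<equiv> tower.lim (\<lambda>n. lf_relcycles q (K n) {}) (\<lambda>n. lf_relboundaries q (K n) {}) (\<lambda>m n. tr m n)"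

abbreviation fix_lim where
  "fix_lim q \<equiv> tower.lim (\<lambda>n. lf_relcycles q (fixc (K n) \<gamma>) {}) (\<lambda>n. lf_relboundaries q (fixc (K n) \<gamma>) {}) (\<lambda>m n. tr m n)"

text \<open>
  The pairs of classes with a given image in the homology of \<open>K\<close> form a torsor under the image
  of the connecting homomorphism; hence they are distinguished by a class of degree \<open>q + 1\<close>.
\<close>

theorem smith_inequality:
  assumes j: "1 \<le> j" "j \<le> CARD('p) - 1"
  shows "vs_rank (smith_lim (CARD('p) - j) q :: ('p mod_ring, _) module) + vs_rank (fix_lim q :: ('p mod_ring, _) module)
    \<le> vs_rank (hom_lim q :: ('p mod_ring, _) module) + vs_rank (smith_lim j (Suc q) :: ('p mod_ring, _) module)"
proof -
  \<comment> \<open>A special chain of exponent \<open>?i\<close> and a chain of the fixed complex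
    add up to a chain in the kernel of \<tau>^j, and by \<open>tau_exact\<close> this kernel
    consists of such sums.\<close>
  let ?i = "CARD('p) - j"
  have ij: "j + ?i = CARD('p)" "0 < ?i" using j prime_card[where 'a = 'p] by auto
  interpret A: tower "\<lambda>n. smith_cycles ?i \<gamma> q (K n) :: ('v list \<Rightarrow> 'p mod_ring) set"
    "\<lambda>n. smith_boundaries ?i \<gamma> q (K n)" "\<lambda>m n. tr m n" by (rule smith_tower)
  interpret SB: tower "\<lambda>n. smith_cycles j \<gamma> (Suc q) (K n) :: ('v list \<Rightarrow> 'p mod_ring) set"
    "\<lambda>n. smith_boundaries j \<gamma> (Suc q) (K n)" "\<lambda>m n. tr m n" by (rule smith_tower)
  interpret H: tower "\<lambda>n. lf_relcycles q (K n) {} :: ('v list \<Rightarrow> 'p mod_ring) set"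
    "\<lambda>n. lf_relboundaries q (K n) {}" "\<lambda>m n. tr m n" by (rule rel_tower)
  interpret X: tower "\<lambda>n. lf_relcycles q (fixc (K n) \<gamma>) {} :: ('v list \<Rightarrow> 'p mod_ring) set"
    "\<lambda>n. lf_relboundaries q (fixc (K n) \<gamma>) {}" "\<lambda>m n. tr m n" by (rule complex_system.rel_tower[OF fix_system])
  note Hc = lf_complex.cycles_eq[OF K] and Hb = lf_complex.boundaries_eq[OF K]
    and Xc = lf_complex.cycles_eq[OF fix_complex] and Xb = lf_complex.boundaries_eq[OF fix_complex]
  note CK = lin_subspaceD[OF lin_subspace_CH]
  have Ac: "z \<in> CH (K n) \<and> deg q z \<and> lf_boundary z = (\<lambda>_. 0) \<and> (\<exists>e\<in>CH (K n). z = (tau \<gamma> ^^ ?i) e)"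
    if "z \<in> smith_cycles ?i \<gamma> q (K n)" for z :: "'v list \<Rightarrow> 'p mod_ring" and n
  proof -
    have z: "z \<in> smith_chains ?i \<gamma> q (K n)" "lf_boundary z = (\<lambda>_. 0)" using that unfolding smith_cycles_def by blast+
    then show ?thesis using smith_chains_CH[OF z(1)] z(1)[unfolded smith_chains_eq] by blast
  qed
  have XK: "f \<in> CH (K n) \<and> deg q f \<and> lf_boundary f = (\<lambda>_. 0)" if "f \<in> lf_relcycles q (fixc (K n) \<gamma>) {}"
    for f :: "'v list \<Rightarrow> 'p mod_ring" and n using that fixc_CH unfolding Xc by blast
  have sumZ: "(\<lambda>\<sigma>. s \<sigma> + f \<sigma>) \<in> lf_relcycles q (K n) {}"
    if s: "s \<in> smith_cycles ?i \<gamma> q (K n)" and f: "f \<in> lf_relcycles q (fixc (K n) \<gamma>) {}"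
    for s f :: "'v list \<Rightarrow> 'p mod_ring" and n
  proof -
    note s' = Ac[OF s] and f' = XK[OF f]
    have "lf_boundary (\<lambda>\<sigma>. s \<sigma> + f \<sigma>) = (\<lambda>_. 0)"
      using linear_betweenD(1)[OF lf_complex.boundary_linear[OF K] lin_subspace_CH, of s n f] s' f' by simp
    then show ?thesis unfolding Hc
      using s' f' CK(2)[of s "K n" f] lin_subspaceD(2)[OF lin_subspace_deg[of q], of s f] by simp
  qed
  define D where "D = carrier A.lim \<times> carrier X.lim"
  have "\<exists>N s f. s \<in> smith_cycles ?i \<gamma> q (K N) \<and> f \<in> lf_relcycles q (fixc (K N) \<gamma>) {} \<and>
      fst x = A.cl N s \<and> snd x = X.cl N f" if xD: "x \<in> D" for x
  proof -
    obtain n s m f where sf: "s \<in> smith_cycles ?i \<gamma> q (K n)" "fst x = A.cl n s"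
      "f \<in> lf_relcycles q (fixc (K m) \<gamma>) {}" "snd x = X.cl m f"
      using xD unfolding D_def A.carrier_lim X.carrier_lim mem_Times_iff by blast
    let ?N = "max n m"
    show ?thesis
    proof (intro exI conjI)
      show "tr n ?N s \<in> smith_cycles ?i \<gamma> q (K ?N)" by (rule A.T_Z[OF _ sf(1)]) simp
      show "tr m ?N f \<in> lf_relcycles q (fixc (K ?N) \<gamma>) {}" by (rule X.T_Z[OF _ sf(3)]) simp
      show "fst x = A.cl ?N (tr n ?N s)" unfolding sf(2) by (rule A.cl_shift[OF _ sf(1), symmetric]) simp
      show "snd x = X.cl ?N (tr m ?N f)" unfolding sf(4) by (rule X.cl_shift[OF _ sf(3), symmetric]) simp
    qed
  qed
  then obtain N s f where N: "\<And>x. x \<in> D \<Longrightarrow> s x \<in> smith_cycles ?i \<gamma> q (K (N x))"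
    "\<And>x. x \<in> D \<Longrightarrow> f x \<in> lf_relcycles q (fixc (K (N x)) \<gamma>) {}"
    "\<And>x. x \<in> D \<Longrightarrow> fst x = A.cl (N x) (s x)" "\<And>x. x \<in> D \<Longrightarrow> snd x = X.cl (N x) (f x)" by metis
  define h where "h x = (\<lambda>\<sigma>. s x \<sigma> + f x \<sigma>)" for x
  have hZ: "h x \<in> lf_relcycles q (K (N x)) {}" if "x \<in> D" for x
    unfolding h_def by (rule sumZ[OF N(1,2)[OF that]])
  have hC: "h x \<in> CH (K (N x))" if "x \<in> D" for x using hZ[OF that] unfolding Hc by blast
  define \<eta> where "\<eta> x = H.cl (N x) (h x)" for x
  \<comment> \<open>A base point in each fibre of \<open>\<eta>\<close>. It depends on the value of
    \<open>\<eta>\<close> alone, so two pairs with the same image in the homology of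
    \<open>K\<close> are compared with the same base point.\<close>
  define b where "b x = (SOME y. y \<in> D \<and> \<eta> y = \<eta> x)" for x
  have b: "b x \<in> D \<and> \<eta> (b x) = \<eta> x" if "x \<in> D" for x unfolding b_def by (rule someI[of _ x]) (simp add: that)
  have beq: "b x = b y" if "\<eta> x = \<eta> y" for x y using that by (simp add: b_def)
  \<comment> \<open>\<open>c\<close> bounds the difference between \<open>x\<close> and its base
    point at a stage \<open>k\<close> that both have reached.\<close>
  define W where "W x k c \<longleftrightarrow> N x \<le> k \<and> N (b x) \<le> k \<and> c \<in> CH (K k) \<and> deg (Suc q) c \<and>
      lf_boundary c = (\<lambda>\<sigma>. tr (N x) k (h x) \<sigma> - tr (N (b x)) k (h (b x)) \<sigma>)" for x k c
  have "\<exists>k c. W x k c" if x: "x \<in> D" for x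
  proof -
    have "H.cl (N x) (h x) = H.cl (N (b x)) (h (b x))" using b[OF x] unfolding \<eta>_def by simp
    from this[unfolded H.cl_eq_iff[OF hZ[OF x] hZ[OF conjunct1[OF b[OF x]]]]] obtain k where
      k: "N x \<le> k" "N (b x) \<le> k"
        "(\<lambda>\<sigma>. tr (N x) k (h x) \<sigma> - tr (N (b x)) k (h (b x)) \<sigma>) \<in> lf_relboundaries q (K k) {}" by blast
    from k(3) obtain c where c: "c \<in> CH (K k)" "deg (Suc q) c"
      "(\<lambda>\<sigma>. tr (N x) k (h x) \<sigma> - tr (N (b x)) k (h (b x)) \<sigma>) = lf_boundary c" unfolding Hb by blast
    show ?thesis unfolding W_def
      by (intro exI[of _ k] exI[of _ c] conjI k(1,2) c(1,2) c(3)[symmetric])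
  qed
  then obtain k c where "\<And>x. x \<in> D \<Longrightarrow> W x (k x) (c x)" by metis
  then have kc: "\<And>x. x \<in> D \<Longrightarrow> N x \<le> k x" "\<And>x. x \<in> D \<Longrightarrow> N (b x) \<le> k x"
    "\<And>x. x \<in> D \<Longrightarrow> c x \<in> CH (K (k x))" "\<And>x. x \<in> D \<Longrightarrow> deg (Suc q) (c x)"
    "\<And>x. x \<in> D \<Longrightarrow> lf_boundary (c x) = (\<lambda>\<sigma>. tr (N x) (k x) (h x) \<sigma> - tr (N (b x)) (k x) (h (b x)) \<sigma>)"
    unfolding W_def by blast+
  \<comment> \<open>\<tau>^j kills the special part because \<tau>^p = 0, and the fixed part because
    j > 0.\<close>
  have tjh: "(tau \<gamma> ^^ j) (tr (N x) n (h x)) = (\<lambda>_. 0)" if x: "x \<in> D" and n: "N x \<le> n" for x n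
  proof -
    obtain e where e: "e \<in> CH (K (N x))" "s x = (tau \<gamma> ^^ ?i) e" using Ac[OF N(1)[OF x]] by blast
    have "(tau \<gamma> ^^ j) (h x) = (\<lambda>\<sigma>. (tau \<gamma> ^^ j) (s x) \<sigma> + (tau \<gamma> ^^ j) (f x) \<sigma>)"
      unfolding h_def using linear_betweenD(1)[OF regular_complex.tau_pow_linear[OF R] lin_subspace_CH]
        Ac[OF N(1)[OF x]] XK[OF N(2)[OF x]] by blast
    also have "(tau \<gamma> ^^ j) (s x) = (tau \<gamma> ^^ CARD('p)) e" unfolding e(2) by (metis comp_apply funpow_add ij(1))
    also have "\<dots> = (\<lambda>_. 0)" by (rule smith_complex.tau_p[OF S e(1)])
    also have "(tau \<gamma> ^^ j) (f x) = (\<lambda>_. 0)"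
      by (rule regular_complex.tau_pow_fixed_chain[OF R]) (use N(2)[OF x] j in \<open>auto simp: Xc\<close>)
    finally have "(tau \<gamma> ^^ j) (h x) = (\<lambda>_. 0)" by simp
    then show ?thesis
      unfolding tr_tau_pow[OF n hC[OF x], symmetric]
      using linear_betweenD(4)[OF tr_lin[OF n] lin_subspace_CH] by simp
  qed
  \<comment> \<open>The connecting construction: \<tau>^j applied to a chain that bounds the
    difference to the base point. The result is a cycle because \<tau>^j kills that
    difference.\<close>
  define w where "w x = (tau \<gamma> ^^ j) (c x)" for x
  have wZ: "w x \<in> smith_cycles j \<gamma> (Suc q) (K (k x))" if x: "x \<in> D" for x
  proof -
    have "lf_boundary (w x) = (tau \<gamma> ^^ j) (\<lambda>\<sigma>. tr (N x) (k x) (h x) \<sigma> - tr (N (b x)) (k x) (h (b x)) \<sigma>)"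
      unfolding w_def kc(5)[OF x, symmetric] by (rule regular_complex.tau_pow_boundary[OF R kc(3)[OF x]])
    also have "\<dots> = (\<lambda>\<sigma>. (tau \<gamma> ^^ j) (tr (N x) (k x) (h x)) \<sigma> - (tau \<gamma> ^^ j) (tr (N (b x)) (k x) (h (b x))) \<sigma>)"
      by (rule linear_betweenD(3)[OF regular_complex.tau_pow_linear[OF R] lin_subspace_CH
            tr_CH[OF kc(1)[OF x] hC[OF x]] tr_CH[OF kc(2)[OF x] hC[OF conjunct1[OF b[OF x]]]]])
    also have "\<dots> = (\<lambda>_. 0)" using tjh[OF x kc(1)[OF x]] tjh[OF conjunct1[OF b[OF x]] kc(2)[OF x]] by simp
    finally show ?thesis unfolding smith_cycles_def smith_chains_eq using kc(3,4)[OF x] w_def by blast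
  qed
  define \<Phi> where "\<Phi> x = (\<eta> x, SB.cl (k x) (w x))" for x
  show ?thesis
  proof (rule vs_rank_add_le[OF A.dirlim_vectorspace X.dirlim_vectorspace H.dirlim_vectorspace SB.dirlim_vectorspace])
    show "\<Phi> ` (carrier A.lim \<times> carrier X.lim) \<subseteq> carrier H.lim \<times> carrier SB.lim"
      using H.cl_closed[OF hZ] SB.cl_closed[OF wZ] unfolding D_def[symmetric] \<Phi>_def \<eta>_def by auto
    show "inj_on \<Phi> (carrier A.lim \<times> carrier X.lim)"
      unfolding D_def[symmetric]
    proof (rule inj_onI)
      fix x y assume x: "x \<in> D" and y: "y \<in> D" and "\<Phi> x = \<Phi> y"
      then have \<eta>: "\<eta> x = \<eta> y" and "SB.cl (k x) (w x) = SB.cl (k y) (w y)" by (auto simp: \<Phi>_def)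
      from this(2)[unfolded SB.cl_eq_iff[OF wZ[OF x] wZ[OF y]]] obtain n where n: "k x \<le> n" "k y \<le> n"
        "(\<lambda>\<sigma>. tr (k x) n (w x) \<sigma> - tr (k y) n (w y) \<sigma>) \<in> smith_boundaries j \<gamma> (Suc q) (K n)" by blast
      then obtain e where e: "e \<in> CH (K n)" "deg (Suc (Suc q)) e"
        "(\<lambda>\<sigma>. tr (k x) n (w x) \<sigma> - tr (k y) n (w y) \<sigma>) = lf_boundary ((tau \<gamma> ^^ j) e)"
        unfolding smith_boundaries_def smith_chains_eq by blast
      interpret Kn: smith_complex "K n" \<gamma> "TYPE('p)" by (rule S)
      note tl = linear_betweenD(3)[OF Kn.tau_pow_linear lin_subspace_CH]
        and bl = linear_betweenD(3)[OF Kn.boundary_linear lin_subspace_CH]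
      let ?cx = "tr (k x) n (c x)" and ?cy = "tr (k y) n (c y)"
      have cC: "?cx \<in> CH (K n)" "?cy \<in> CH (K n)" "deg (Suc q) ?cx" "deg (Suc q) ?cy"
        using kc(3,4)[OF x] kc(3,4)[OF y] n tr_CH tr_deg by blast+
      have be: "lf_boundary e \<in> CH (K n)" "deg (Suc q) (lf_boundary e)"
        using Kn.boundary_CH[OF e(1)] Kn.boundary_deg[OF e(2)] by blast+
      \<comment> \<open>Equality of the connecting classes provides \<open>e\<close>. Corrected by
        its boundary, the difference of the two bounding chains lies in the kernel of \<tau>^j, and
        exactness decomposes it.\<close>
      define u where "u = (\<lambda>\<sigma>. (?cx \<sigma> - ?cy \<sigma>) - lf_boundary e \<sigma>)"
      have cd: "(\<lambda>\<sigma>. ?cx \<sigma> - ?cy \<sigma>) \<in> CH (K n)" by (rule CK(5)[OF cC(1,2)])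
      have u: "u \<in> CH (K n)" "deg (Suc q) u"
        unfolding u_def using CK(5)[OF cd be(1)] lin_subspaceD(5)[OF lin_subspace_deg[of "Suc q"]] cC be
        by auto
      have "(tau \<gamma> ^^ j) u = (\<lambda>_. 0)"
        unfolding u_def tl[OF cd be(1)] tl[OF cC(1,2)] Kn.tau_pow_boundary[OF e(1), symmetric] e(3)[symmetric]
        using tr_tau_pow[OF n(1) kc(3)[OF x], of j] tr_tau_pow[OF n(2) kc(3)[OF y], of j] by (simp add: w_def)
      then obtain e1 f1 where e1: "e1 \<in> CH (K n)" "deg (Suc q) e1" "f1 \<in> CH (fixc (K n) \<gamma>)" "deg (Suc q) f1"
        "u = (\<lambda>\<sigma>. (tau \<gamma> ^^ ?i) e1 \<sigma> + f1 \<sigma>)" using Kn.tau_exact[OF j u] by blast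
      have Nn: "N x \<le> n" "N y \<le> n" "N (b x) \<le> n"
        using kc(1)[OF x] kc(1)[OF y] kc(2)[OF x] n by linarith+
      have bcx: "lf_boundary (tr (k x) n (c x)) = (\<lambda>\<sigma>. tr (N x) n (h x) \<sigma> - tr (N (b x)) n (h (b x)) \<sigma>)" if x: "x \<in> D" and n: "k x \<le> n" for x
        unfolding tr_boundary[OF n kc(3)[OF x]] kc(5)[OF x]
        using tr_diff[OF n, of "tr (N x) (k x) (h x)" "tr (N (b x)) (k x) (h (b x))"]
          tr_CH[OF kc(1)[OF x] hC[OF x]] tr_CH[OF kc(2)[OF x] hC[OF conjunct1[OF b[OF x]]]]
          tr_comp[OF kc(1)[OF x] n hC[OF x]] tr_comp[OF kc(2)[OF x] n hC[OF conjunct1[OF b[OF x]]]] by simp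
      \<comment> \<open>The contributions of the base point cancel here, since
        \<open>b x = b y\<close>.\<close>
      have "lf_boundary u = (\<lambda>\<sigma>. tr (N x) n (h x) \<sigma> - tr (N y) n (h y) \<sigma>)"
        unfolding u_def bl[OF cd be(1)] bl[OF cC(1,2)] Kn.boundary_boundary[OF e(1)]
          bcx[OF x n(1)] bcx[OF y n(2)] beq[OF \<eta>] by simp
      moreover have "lf_boundary u = (\<lambda>\<sigma>. (tau \<gamma> ^^ ?i) (lf_boundary e1) \<sigma> + lf_boundary f1 \<sigma>)"
        unfolding e1(5) Kn.tau_pow_boundary[OF e1(1), symmetric]
        by (rule linear_betweenD(1)[OF Kn.boundary_linear lin_subspace_CH Kn.tau_pow_CH[OF e1(1)] fixc_CH[OF e1(3)]])
      ultimately have eq: "tr (N x) n (h x) \<sigma> - tr (N y) n (h y) \<sigma> = (tau \<gamma> ^^ ?i) (lf_boundary e1) \<sigma> + lf_boundary f1 \<sigma>" for \<sigma>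
        by metis
      have trh: "tr (N x) n (h x) = (\<lambda>\<sigma>. tr (N x) n (s x) \<sigma> + tr (N x) n (f x) \<sigma>)" if "x \<in> D" "N x \<le> n" for x
        unfolding h_def using tr_add[OF that(2)] Ac[OF N(1)[OF that(1)]] XK[OF N(2)[OF that(1)]] by blast
      have "\<exists>e'\<in>CH (K n). tr (N x) n (s x) = (tau \<gamma> ^^ ?i) e'" if x: "x \<in> D" "N x \<le> n" for x
        using Ac[OF N(1)[OF x(1)]] tr_tau_pow[OF x(2)] tr_CH[OF x(2)] by metis
      then obtain ex ey where ex: "ex \<in> CH (K n)" "tr (N x) n (s x) = (tau \<gamma> ^^ ?i) ex"
        "ey \<in> CH (K n)" "tr (N y) n (s y) = (tau \<gamma> ^^ ?i) ey" using x y Nn by metis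
      define v where "v = (\<lambda>\<sigma>. (ex \<sigma> - ey \<sigma>) - lf_boundary e1 \<sigma>)"
      define g where "g = (\<lambda>\<sigma>. (tr (N x) n (f x) \<sigma> - tr (N y) n (f y) \<sigma>) - lf_boundary f1 \<sigma>)"
      have exy: "(\<lambda>\<sigma>. ex \<sigma> - ey \<sigma>) \<in> CH (K n)" by (rule CK(5)[OF ex(1,3)])
      have be1: "lf_boundary e1 \<in> CH (K n)" by (rule Kn.boundary_CH[OF e1(1)])
      have v: "v \<in> CH (K n)" unfolding v_def by (rule CK(5)[OF exy be1])
      have trX: "tr (N x) n (f x) \<in> CH (fixc (K n) \<gamma>)" if "x \<in> D" "N x \<le> n" for x
        using X.T_Z[OF that(2) N(2)[OF that(1)]] unfolding Xc by blast
      have g: "g \<in> CH (fixc (K n) \<gamma>)"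
        unfolding g_def
        by (rule CK(5)[OF CK(5)[OF trX[OF x Nn(1)] trX[OF y Nn(2)]] lf_complex.boundary_CH[OF fix_complex e1(3)]])
      \<comment> \<open>\<open>v\<close> collects the special components and \<open>g\<close> the
        fixed ones of the same equation. The sum is direct, so the homology between \<open>x\<close>
        and \<open>y\<close> splits into one between the special parts and one between the fixed
        parts.\<close>
      have "(tau \<gamma> ^^ ?i) v \<sigma> + g \<sigma> = 0" for \<sigma>
        unfolding v_def tl[OF exy be1] tl[OF ex(1,3)] g_def ex(2,4)[symmetric]
        using eq[of \<sigma>] unfolding trh[OF x Nn(1)] trh[OF y Nn(2)] by (simp add: algebra_simps)
      note dir = Kn.tau_fixed_direct[OF v g ij(2) this]
      have "(\<lambda>\<sigma>. tr (N x) n (f x) \<sigma> - tr (N y) n (f y) \<sigma>) = lf_boundary f1"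
        using dir(1) unfolding g_def by (simp add: fun_eq_iff)
      then have "(\<lambda>\<sigma>. tr (N x) n (f x) \<sigma> - tr (N y) n (f y) \<sigma>) \<in> lf_relboundaries q (fixc (K n) \<gamma>) {}"
        unfolding Xb using e1(3,4) by blast
      then have "X.cl (N x) (f x) = X.cl (N y) (f y)"
        unfolding X.cl_eq_iff[OF N(2)[OF x] N(2)[OF y]] using Nn by blast
      moreover have "(\<lambda>\<sigma>. tr (N x) n (s x) \<sigma> - tr (N y) n (s y) \<sigma>) = lf_boundary ((tau \<gamma> ^^ ?i) e1)"
        using dir(2) unfolding v_def tl[OF exy be1] tl[OF ex(1,3)] ex(2,4)[symmetric] Kn.tau_pow_boundary[OF e1(1)]
        by (simp add: fun_eq_iff)
      then have "(\<lambda>\<sigma>. tr (N x) n (s x) \<sigma> - tr (N y) n (s y) \<sigma>) \<in> smith_boundaries ?i \<gamma> q (K n)"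
        unfolding smith_boundaries_def smith_chains_eq using e1(1,2) by blast
      then have "A.cl (N x) (s x) = A.cl (N y) (s y)"
        unfolding A.cl_eq_iff[OF N(1)[OF x] N(1)[OF y]] using Nn by blast
      ultimately show "x = y" using N(3,4) x y by (simp add: prod_eq_iff)
    qed
  qed
qed

end

section \<open>Comparison of direct systems\<close>

text \<open>The homotopy writes the difference as the boundary of \<open>P z\<close> plus
  \<open>P\<close> of the boundary of \<open>z\<close>. For a relative cycle the latter is a chain
  of \<open>L1\<close>.\<close>

lemma contiguous_homologous:
  assumes K: "lf_complex K" "lf_complex K1" and L: "lf_complex L" "lf_complex L1" "L \<subseteq> K"
    and fg: "smap K K1 f" "smap K K1 g" and KK: "\<And>S. S \<in> K \<Longrightarrow> f ` S \<union> g ` S \<in> K1"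
    and LL: "\<And>S. S \<in> L \<Longrightarrow> f ` S \<union> g ` S \<in> L1"
    and \<kappa>: "\<And>S. S \<in> K \<Longrightarrow> inj_on (\<kappa> :: 'v \<Rightarrow> nat) S"
    and z: "z \<in> lf_relcycles q K L"
  shows "(\<lambda>\<sigma>. chain_push g z \<sigma> - chain_push f z \<sigma>) \<in> lf_relboundaries q K1 L1"
proof -
  interpret contiguous_maps K K1 f g \<kappa>
    using K fg KK \<kappa> by (simp add: contiguous_maps_def contiguous_maps_axioms_def)
  have z': "z \<in> CH K" "deg q z" "lf_boundary z \<in> CH L"
    using z unfolding K.relcycles_eq[OF L(3)] by auto
  \<comment> \<open>Read off from the supports: the boundary of \<open>z\<close> would have degree q
    - 1, which is not a degree for \<open>q = 0\<close>.\<close>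
  have d: "deg q (P (lf_boundary z))"
    unfolding deg_def
  proof (intro allI impI)
    fix \<tau> assume "P (lf_boundary z) \<tau> \<noteq> 0"
    then obtain \<sigma> where s: "lf_boundary z \<sigma> \<noteq> 0" "length \<tau> = Suc (length \<sigma>)" using P_support by blast
    then obtain v where "z (v # \<sigma>) \<noteq> 0" using lf_boundary_support by blast
    then show "length \<tau> = Suc q" using z'(2) s(2) by (auto simp: deg_def)
  qed
  show ?thesis
    by (rule L.relboundariesI[OF L(2) P_CH[OF z'(1)] P_deg[OF z'(2)] P_sub[OF z'(3) LL L(2)] d])
      (simp_all add: homotopy[OF z'(1)])
qed

text \<open>
  Two direct systems of pairs are compared by maps on representatives; no compatibility of the
  maps \<open>\<alpha> n\<close> with the transition maps is needed, since only injectivity in the limit matters.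
\<close>

lemma vs_rank_le_interleaved:
  fixes K L :: "nat \<Rightarrow> 'v set set" and K' L' :: "nat \<Rightarrow> 'w set set"
  assumes sys: "complex_system K L f" "complex_system K' L' f'"
    and \<alpha>: "\<And>n. smap (K n) (K' (k n)) (\<alpha> n)" "\<And>n. smap (L n) (L' (k n)) (\<alpha> n)"
    and \<beta>: "\<And>n m M. k n \<le> M \<Longrightarrow> k m \<le> M \<Longrightarrow> \<exists>l \<beta>. n \<le> l \<and> m \<le> l \<and> smap (K' M) (K l) \<beta> \<and> smap (L' M) (L l) \<beta> \<and>
      (\<forall>i\<in>{n, m}. (\<forall>S\<in>K i. fold f [i..<l] ` S \<union> (\<beta> \<circ> (fold f' [k i..<M] \<circ> \<alpha> i)) ` S \<in> K l) \<and>
         (\<forall>S\<in>L i. fold f [i..<l] ` S \<union> (\<beta> \<circ> (fold f' [k i..<M] \<circ> \<alpha> i)) ` S \<in> L l))"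
    and \<kappa>: "\<And>n. \<exists>\<kappa> :: 'v \<Rightarrow> nat. \<forall>S\<in>K n. inj_on \<kappa> S"
  shows "vs_rank (tower.lim (\<lambda>n. lf_relcycles q (K n) (L n) :: ('v list \<Rightarrow> 'k::{field,finite}) set)
      (\<lambda>n. lf_relboundaries q (K n) (L n)) (\<lambda>m n. chain_push (fold f [m..<n])))
    \<le> vs_rank (tower.lim (\<lambda>n. lf_relcycles q (K' n) (L' n) :: ('w list \<Rightarrow> 'k::{field,finite}) set)
      (\<lambda>n. lf_relboundaries q (K' n) (L' n)) (\<lambda>m n. chain_push (fold f' [m..<n])))"
proof -
  interpret A: complex_system K L f by fact
  interpret B: complex_system K' L' f' by fact
  interpret At: tower "\<lambda>n. lf_relcycles q (K n) (L n) :: ('v list \<Rightarrow> 'k) set"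
      "\<lambda>n. lf_relboundaries q (K n) (L n)" "\<lambda>m n. chain_push (fold f [m..<n])" by (rule A.rel_tower)
  note rcA = lf_complex.relcycles_eq[OF A.K A.LK] and rcB = lf_complex.relcycles_eq[OF B.K B.LK]
  show ?thesis
  proof (rule vs_rank_le_tower[OF A.rel_tower B.rel_tower, where \<alpha> = "\<lambda>n. chain_push (\<alpha> n)" and k = k])
    fix n and z :: "'v list \<Rightarrow> 'k" assume z: "z \<in> lf_relcycles q (K n) (L n)"
    then have z': "z \<in> CH (K n)" "deg q z" "lf_boundary z \<in> CH (L n)" unfolding rcA by blast+
    show "chain_push (\<alpha> n) z \<in> lf_relcycles q (K' (k n)) (L' (k n))"
      using lf_complex.push_CH[OF A.K z'(1) \<alpha>(1)] lf_complex.push_CH[OF A.L z'(3) \<alpha>(2)]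
        lf_complex.push_deg[OF A.K z'(2)] lf_complex.push_boundary[OF A.K z'(1) \<alpha>(1)]
      unfolding rcB by simp
  next
    fix n m and z w :: "'v list \<Rightarrow> 'k" and M
    assume z: "z \<in> lf_relcycles q (K n) (L n)" and w: "w \<in> lf_relcycles q (K m) (L m)"
      and M: "k n \<le> M" "k m \<le> M"
      and d: "(\<lambda>\<sigma>. chain_push (fold f' [k n..<M]) (chain_push (\<alpha> n) z) \<sigma> -
          chain_push (fold f' [k m..<M]) (chain_push (\<alpha> m) w) \<sigma>) \<in> lf_relboundaries q (K' M) (L' M)"
    obtain l \<beta> where l: "n \<le> l" "m \<le> l" and \<beta>: "smap (K' M) (K l) \<beta>" "smap (L' M) (L l) \<beta>"
      and ct: "\<And>i. i \<in> {n, m} \<Longrightarrow> (\<forall>S\<in>K i. fold f [i..<l] ` S \<union> (\<beta> \<circ> (fold f' [k i..<M] \<circ> \<alpha> i)) ` S \<in> K l) \<and>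
         (\<forall>S\<in>L i. fold f [i..<l] ` S \<union> (\<beta> \<circ> (fold f' [k i..<M] \<circ> \<alpha> i)) ` S \<in> L l)"
      using \<beta>[OF M] by metis
    have comp: "smap (K i) (K' M) (fold f' [k i..<M] \<circ> \<alpha> i)" if "k i \<le> M" for i
      by (rule smap_comp[OF \<alpha>(1) B.F_K[OF that] A.K])
    \<comment> \<open>Going to the other system and back is contiguous to the transition map, hence
      agrees with it up to relative boundaries.\<close>
    have hom: "(\<lambda>\<sigma>. chain_push \<beta> (chain_push (fold f' [k i..<M]) (chain_push (\<alpha> i) x)) \<sigma>
        - chain_push (fold f [i..<l]) x \<sigma>) \<in> lf_relboundaries q (K l) (L l)"
      if x: "x \<in> lf_relcycles q (K i) (L i)" and i: "i \<in> {n, m}" "k i \<le> M" "i \<le> l" for i and x :: "'v list \<Rightarrow> 'k"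
    proof -
      obtain \<kappa> :: "'v \<Rightarrow> nat" where \<kappa>: "\<forall>S\<in>K i. inj_on \<kappa> S" using \<kappa> by blast
      have xC: "x \<in> CH (K i)" using x unfolding rcA by blast
      have "chain_push \<beta> (chain_push (fold f' [k i..<M]) (chain_push (\<alpha> i) x)) =
          chain_push \<beta> (chain_push (fold f' [k i..<M] \<circ> \<alpha> i) x)"
        using lf_complex.push_comp[OF A.K xC \<alpha>(1) B.F_K[OF i(2)] B.K] by simp
      also have "\<dots> = chain_push (\<beta> \<circ> (fold f' [k i..<M] \<circ> \<alpha> i)) x"
        by (rule lf_complex.push_comp[OF A.K xC comp[OF i(2)] \<beta>(1) B.K])
      finally have e: "chain_push \<beta> (chain_push (fold f' [k i..<M]) (chain_push (\<alpha> i) x)) =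
          chain_push (\<beta> \<circ> (fold f' [k i..<M] \<circ> \<alpha> i)) x" .
      show ?thesis unfolding e
        by (rule contiguous_homologous[OF A.K A.K A.L A.L A.LK A.F_K[OF i(3)] smap_comp[OF comp[OF i(2)] \<beta>(1) A.K] _ _ _ x, where \<kappa> = \<kappa>])
          (use ct[OF i(1)] \<kappa> in blast)+
    qed
    let ?z = "chain_push (fold f' [k n..<M]) (chain_push (\<alpha> n) z)"
    let ?w = "chain_push (fold f' [k m..<M]) (chain_push (\<alpha> m) w)"
    have zw: "?z \<in> CH (K' M)" "?w \<in> CH (K' M)"
      using z w M B.tr_CH lf_complex.push_CH[OF A.K _ \<alpha>(1)] unfolding rcA by blast+
    have "(\<lambda>\<sigma>. chain_push \<beta> ?z \<sigma> - chain_push \<beta> ?w \<sigma>) \<in> lf_relboundaries q (K l) (L l)"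
    proof -
      obtain c e where c: "(\<lambda>\<sigma>. ?z \<sigma> - ?w \<sigma>) = (\<lambda>\<tau>. lf_boundary c \<tau> + e \<tau>)" "c \<in> CH (K' M)" "deg (Suc q) c"
        "e \<in> CH (L' M)" "deg q e" using d unfolding lf_complex.relboundaries_eq[OF B.K B.L] by blast
      note pl = linear_betweenD[OF lf_complex.push_linear[OF B.K \<beta>(1)] lin_subspace_CH]
      have "(\<lambda>\<sigma>. chain_push \<beta> ?z \<sigma> - chain_push \<beta> ?w \<sigma>) = (\<lambda>\<tau>. lf_boundary (chain_push \<beta> c) \<tau> + chain_push \<beta> e \<tau>)"
        unfolding pl(3)[OF zw, symmetric] c(1) pl(1)[OF lf_complex.boundary_CH[OF B.K c(2)] B.LK_CH[OF c(4)]]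
          lf_complex.push_boundary[OF B.K c(2) \<beta>(1)] ..
      then show ?thesis
        using lf_complex.relboundariesI[OF A.K A.L lf_complex.push_CH[OF B.K c(2) \<beta>(1)] lf_complex.push_deg[OF B.K c(3)]
            lf_complex.push_CH[OF B.L c(4) \<beta>(2)] lf_complex.push_deg[OF B.K c(5)]] by (metis (no_types, lifting))
    qed
    \<comment> \<open>The round trips of \<open>z\<close> and \<open>w\<close> are homologous, and
      each is homologous to its own transition; three boundaries combine.\<close>
    from lin_subspaceD(2)[OF At.B lin_subspaceD(5)[OF At.B this hom[OF z _ M(1) l(1)]] hom[OF w _ M(2) l(2)]]
    have "(\<lambda>\<sigma>. chain_push (fold f [n..<l]) z \<sigma> - chain_push (fold f [m..<l]) w \<sigma>) \<in> lf_relboundaries q (K l) (L l)"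
      by (simp add: algebra_simps)
    then show "\<exists>l. n \<le> l \<and> m \<le> l \<and> (\<lambda>\<sigma>. chain_push (fold f [n..<l]) z \<sigma> - chain_push (fold f [m..<l]) w \<sigma>)
        \<in> lf_relboundaries q (K l) (L l)" using l by blast
  qed
qed

section \<open>Nerves of coverings\<close>

text \<open>The metric content of a covering: a uniform diameter bound for refining into later
  stages, and the finiteness that makes nerves locally finite and refinements proper.\<close>

definition bounded_covering :: "'a set \<Rightarrow> ('a \<Rightarrow> 'a \<Rightarrow> real) \<Rightarrow> 'a set set \<Rightarrow> bool" where
  "bounded_covering M d \<U> \<longleftrightarrow> \<Union>\<U> = M \<and> (\<exists>R. \<forall>U\<in>\<U>. \<forall>x\<in>U. \<forall>y\<in>U. d x y \<le> R) \<and>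
     (\<forall>B. Metric_space.mbounded M d B \<longrightarrow> finite {U \<in> \<U>. U \<inter> B \<noteq> {}})"

lemma coarsening_system_bounded:
  "coarsening_system M d \<U> pr \<Longrightarrow> bounded_covering M d (\<U> n)"
proof -
  assume c: "coarsening_system M d \<U> pr"
  then have "uniform_covering M d (\<U> n)" unfolding coarsening_system_def by simp
  moreover have "\<exists>R. \<forall>U\<in>\<U> n. \<forall>x\<in>U. \<forall>y\<in>U. d x y \<le> R" using c unfolding coarsening_system_def by metis
  ultimately show ?thesis unfolding bounded_covering_def uniform_covering_def by simp
qed

lemma coarsening_system_pr:
  "coarsening_system M d \<U> pr \<Longrightarrow> U \<in> \<U> n \<Longrightarrow> pr n U \<in> \<U> (Suc n) \<and> U \<subseteq> pr n U"
  unfolding coarsening_system_def by blast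

text \<open>\<open>R n\<close> tends to infinity, so all late coverings have Lebesgue number at
  least \<open>D\<close>. The statement covers all stages from \<open>k0\<close> on because stages
  get enlarged to meet further conditions.\<close>

lemma coarsening_system_lebesgue:
  assumes "coarsening_system M d \<U> pr"
  shows "\<exists>k0. \<forall>k\<ge>k0. \<forall>S\<subseteq>M. (\<forall>x\<in>S. \<forall>y\<in>S. d x y \<le> D) \<longrightarrow> (\<exists>U\<in>\<U> k. S \<subseteq> U)"
proof -
  obtain R where R: "filterlim R at_top sequentially" "\<And>n. \<exists>l\<ge>R n. lebesgue_number M d (\<U> (Suc n)) l"
    using assms unfolding coarsening_system_def by metis
  obtain n0 where n0: "\<And>n. n \<ge> n0 \<Longrightarrow> R n \<ge> D"
    using R(1) unfolding filterlim_at_top eventually_sequentially by blast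
  show ?thesis
  proof (intro exI allI impI)
    fix k S assume k: "Suc n0 \<le> k" and S: "S \<subseteq> M" "\<forall>x\<in>S. \<forall>y\<in>S. d x y \<le> D"
    obtain n where n: "k = Suc n" "n \<ge> n0" using k by (cases k) auto
    obtain l where "l \<ge> R n" "lebesgue_number M d (\<U> k) l" using R(2)[of n] n by blast
    moreover have "d x y \<le> l" if "x \<in> S" "y \<in> S" for x y
    proof -
      have "d x y \<le> D" using S(2) that by blast
      then show ?thesis using n0[OF n(2)] \<open>l \<ge> R n\<close> by linarith
    qed
    ultimately show "\<exists>U\<in>\<U> k. S \<subseteq> U" using S(1) unfolding lebesgue_number_def by blast
  qed
qed

lemma nerveI: "finite S \<Longrightarrow> S \<noteq> {} \<Longrightarrow> S \<subseteq> \<U> \<Longrightarrow> x \<in> A \<Longrightarrow> (\<And>U. U \<in> S \<Longrightarrow> x \<in> U) \<Longrightarrow> S \<in> nerve \<U> A"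
  unfolding nerve_def by blast

lemma nerveD:
  assumes "S \<in> nerve \<U> A"
  shows "finite S" "S \<noteq> {}" "S \<subseteq> \<U>" "\<exists>x\<in>A. \<forall>U\<in>S. x \<in> U"
  using assms unfolding nerve_def by auto

lemma nerve_mono: "A \<subseteq> B \<Longrightarrow> nerve \<U> A \<subseteq> nerve \<U> B"
  unfolding nerve_def by blast

lemma nerve_empty: "nerve \<U> {} = {}"
  unfolding nerve_def by blast

lemma nerve_verts: "\<Union>(nerve \<U> A) = {U \<in> \<U>. U \<inter> A \<noteq> {}}"
proof (intro equalityI subsetI)
  fix U assume "U \<in> {U \<in> \<U>. U \<inter> A \<noteq> {}}"
  then have "{U} \<in> nerve \<U> A" unfolding nerve_def by auto
  then show "U \<in> \<Union>(nerve \<U> A)" by blast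
qed (auto simp: nerve_def)

text \<open>Empty members of a covering are no vertices of the nerve, so they are exempt.\<close>

definition refining :: "'a set set \<Rightarrow> 'a set set \<Rightarrow> ('a set \<Rightarrow> 'a set) \<Rightarrow> bool" where
  "refining \<U> \<V> a \<longleftrightarrow> (\<forall>U\<in>\<U>. U \<noteq> {} \<longrightarrow> a U \<in> \<V> \<and> U \<subseteq> a U)"

lemma refining_exists:
  assumes "\<And>U. U \<in> \<U> \<Longrightarrow> U \<noteq> {} \<Longrightarrow> \<exists>V\<in>\<V>. U \<subseteq> V"
  shows "\<exists>a. refining \<U> \<V> a"
  using assms unfolding refining_def by metis

lemma refining_comp: "refining \<U> \<V> a \<Longrightarrow> refining \<V> \<W> b \<Longrightarrow> refining \<U> \<W> (b \<circ> a)"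
  unfolding refining_def by (simp add: subset_iff) blast

text \<open>A point common to the members of \<open>S\<close> lies in all their images under both
  maps. So any two refinements are contiguous, also over a subset \<open>A\<close>.\<close>

lemma refining_contiguous:
  assumes "refining \<U> \<V> a" "refining \<U> \<V> b" "S \<in> nerve \<U> A"
  shows "a ` S \<union> b ` S \<in> nerve \<V> A"
proof -
  obtain x where x: "x \<in> A" "\<forall>U\<in>S. x \<in> U" using nerveD(4)[OF assms(3)] by blast
  have "U \<noteq> {}" "U \<in> \<U>" if "U \<in> S" for U using x that nerveD(3)[OF assms(3)] by auto
  then have "a U \<in> \<V> \<and> b U \<in> \<V> \<and> x \<in> a U \<and> x \<in> b U" if "U \<in> S" for U
    using assms(1,2) x that unfolding refining_def by (metis subsetD)
  then show ?thesis using nerveD(1,2)[OF assms(3)] x(1) by (intro nerveI[of _ _ x]) auto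
qed

context Metric_space
begin

lemma bounded_coveringD:
  assumes "bounded_covering M d \<U>" "U \<in> \<U>"
  shows "mbounded U"
proof -
  have "U \<subseteq> M" "\<exists>R. \<forall>x\<in>U. \<forall>y\<in>U. d x y \<le> R"
    using assms unfolding bounded_covering_def by (blast, metis)
  then show ?thesis unfolding mbounded_alt by blast
qed

lemma bounded_covering_meet: "bounded_covering M d \<U> \<Longrightarrow> mbounded B \<Longrightarrow> finite {U \<in> \<U>. U \<inter> B \<noteq> {}}"
  unfolding bounded_covering_def by blast

lemma nerve_complex:
  assumes "bounded_covering M d \<U>"
  shows "lf_complex (nerve \<U> A)"
proof
  fix S assume S: "S \<in> nerve \<U> A"
  show "finite S \<and> S \<noteq> {}" using nerveD[OF S] by blast
  show "T \<in> nerve \<U> A" if T: "T \<subseteq> S" "T \<noteq> {}" for T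
  proof -
    obtain x where "x \<in> A" "\<forall>U\<in>S. x \<in> U" using nerveD(4)[OF S] by blast
    then show ?thesis using nerveD(1,3)[OF S] T by (intro nerveI[of T _ x]) (auto intro: finite_subset)
  qed
next
  fix U
  show "finite {S \<in> nerve \<U> A. U \<in> S}"
  proof (cases "U \<in> \<U>")
    case True
    have "{S \<in> nerve \<U> A. U \<in> S} \<subseteq> Pow {V \<in> \<U>. V \<inter> U \<noteq> {}}"
      unfolding nerve_def by auto
    then show ?thesis using bounded_covering_meet[OF assms bounded_coveringD[OF assms True]]
      by (meson finite_Pow_iff finite_subset)
  next
    case False
    then have "{S \<in> nerve \<U> A. U \<in> S} = {}" unfolding nerve_def by auto
    then show ?thesis by (simp only: finite.emptyI)
  qed
qed

text \<open>The vertices sent to \<open>V\<close> are contained in \<open>V\<close> and not empty,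
  and only finitely many members meet the bounded set \<open>V\<close>.\<close>

lemma refining_smap:
  assumes "bounded_covering M d \<U>" "bounded_covering M d \<V>" "refining \<U> \<V> a"
  shows "smap (nerve \<U> A) (nerve \<V> A) a"
  unfolding smap_def
proof (intro conjI ballI allI)
  show "a ` S \<in> nerve \<V> A" if "S \<in> nerve \<U> A" for S
    using refining_contiguous[OF assms(3,3) that] by simp
  fix V
  have "{U \<in> \<Union>(nerve \<U> A). a U = V} \<subseteq> {U \<in> \<U>. U \<inter> V \<noteq> {}}"
    using assms(3) unfolding nerve_verts refining_def by blast
  moreover have "finite {U \<in> \<U>. U \<inter> V \<noteq> {}}" if "V \<in> \<V>"
    by (rule bounded_covering_meet[OF assms(1) bounded_coveringD[OF assms(2) that]])
  moreover have "{U \<in> \<Union>(nerve \<U> A). a U = V} = {}" if "V \<notin> \<V>"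
    using assms(3) that unfolding nerve_verts refining_def by blast
  ultimately show "finite {U \<in> \<Union>(nerve \<U> A). a U = V}"
    by (cases "V \<in> \<V>") (rule finite_subset, assumption, simp, simp only: not_False_eq_True simp_thms finite.emptyI)
qed

lemma countable_covering:
  assumes "bounded_covering M d \<U>"
  shows "countable {U \<in> \<U>. U \<noteq> {}}"
proof (cases "M = {}")
  case True
  then have "{U \<in> \<U>. U \<noteq> {}} = {}" using assms unfolding bounded_covering_def by blast
  then show ?thesis by (simp only: countable_empty)
next
  case False
  then obtain x where x: "x \<in> M" by blast
  have "{U \<in> \<U>. U \<noteq> {}} \<subseteq> (\<Union>n::nat. {U \<in> \<U>. U \<inter> mcball x (real n) \<noteq> {}})"
  proof
    fix U assume U: "U \<in> {U \<in> \<U>. U \<noteq> {}}"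
    then obtain y where y: "y \<in> U" "y \<in> M" using assms unfolding bounded_covering_def by blast
    obtain n where "d x y \<le> real n" using real_arch_simple by blast
    then have "y \<in> U \<inter> mcball x (real n)" using x y by simp
    then show "U \<in> (\<Union>n::nat. {U \<in> \<U>. U \<inter> mcball x (real n) \<noteq> {}})" using U by blast
  qed
  moreover have "countable (\<Union>n::nat. {U \<in> \<U>. U \<inter> mcball x (real n) \<noteq> {}})"
    using bounded_covering_meet[OF assms mbounded_mcball] by (intro countable_UN) (auto intro: countable_finite)
  ultimately show ?thesis by (rule countable_subset)
qed

text \<open>There are countably many nonempty members, since finitely many meet each ball. An
  enumeration of them is injective on simplices and serves as the order of moves in the
  homotopy.\<close>

lemma nerve_injective_rank:
  assumes "bounded_covering M d \<U>"
  shows "\<exists>\<kappa> :: 'a set \<Rightarrow> nat. \<forall>S\<in>nerve \<U> A. inj_on \<kappa> S"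
proof (intro exI ballI)
  fix S assume "S \<in> nerve \<U> A"
  then have "S \<subseteq> {U \<in> \<U>. U \<noteq> {}}" unfolding nerve_def by blast
  then show "inj_on (to_nat_on {U \<in> \<U>. U \<noteq> {}}) S"
    by (rule inj_on_subset[OF inj_on_to_nat_on[OF countable_covering[OF assms]]])
qed

lemma refining_fold:
  assumes "coarsening_system M d \<U> pr" "m \<le> n"
  shows "refining (\<U> m) (\<U> n) (fold pr [m..<n])"
  using assms(2)
proof (induction rule: dec_induct)
  case base
  then show ?case by (simp add: refining_def)
next
  case (step n)
  have "refining (\<U> n) (\<U> (Suc n)) (pr n)"
    using coarsening_system_pr[OF assms(1)] by (simp add: refining_def)
  from refining_comp[OF step.IH this] show ?case using step.hyps by (simp add: o_def)
qed

lemma nerve_system: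
  assumes "coarsening_system M d \<U> pr" "B \<subseteq> A"
  shows "complex_system (\<lambda>n. nerve (\<U> n) A) (\<lambda>n. nerve (\<U> n) B) pr"
proof -
  have "refining (\<U> n) (\<U> (Suc n)) (pr n)" for n
    using coarsening_system_pr[OF assms(1)] by (simp add: refining_def)
  then show ?thesis unfolding complex_system_def
    using nerve_complex[OF coarsening_system_bounded[OF assms(1)]] nerve_mono[OF assms(2)]
      refining_smap[OF coarsening_system_bounded[OF assms(1)] coarsening_system_bounded[OF assms(1)]] by blast
qed

lemma nerve_system0:
  assumes "coarsening_system M d \<U> pr"
  shows "complex_system (\<lambda>n. nerve (\<U> n) A) (\<lambda>n. {}) pr"
  using nerve_system[OF assms, of "{}" A] by (simp add: nerve_empty)

end

section \<open>Coarse homology as the limit of a tower\<close>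

lemma HC_tower:
  assumes "complex_system (\<lambda>n. nerve (\<U> n) A) (\<lambda>n. nerve (\<U> n) B) pr"
  shows "HC \<U> pr q A B = (tower.lim (\<lambda>n. lf_relcycles q (nerve (\<U> n) A) (nerve (\<U> n) B) :: (_ \<Rightarrow> 'k::field) set)
    (\<lambda>n. lf_relboundaries q (nerve (\<U> n) A) (nerve (\<U> n) B)) (\<lambda>m n. chain_push (fold pr [m..<n])))"
proof -
  interpret tower "\<lambda>n. lf_relcycles q (nerve (\<U> n) A) (nerve (\<U> n) B) :: (_ \<Rightarrow> 'k) set"
    "\<lambda>n. lf_relboundaries q (nerve (\<U> n) A) (nerve (\<U> n) B)" "\<lambda>m n. chain_push (fold pr [m..<n])"
    by (rule complex_system.rel_tower[OF assms])
  show ?thesis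
    unfolding HC_def HC_stage_def[abs_def] HC_trans_def[abs_def] lf_homology_def lf_homology_map_def
      stage_def[abs_def] trans_def[abs_def] ..
qed

lemma HC_smith_tower:
  assumes "smith_system TYPE('p::prime_card) (\<lambda>n. nerve (\<V> n) M) pr (image (\<phi> g))"
  shows "HC_smith M \<phi> g j \<V> pr q = (tower.lim (\<lambda>n. smith_cycles j (image (\<phi> g)) q (nerve (\<V> n) M) :: (_ \<Rightarrow> 'p mod_ring) set)
    (\<lambda>n. smith_boundaries j (image (\<phi> g)) q (nerve (\<V> n) M)) (\<lambda>m n. chain_push (fold pr [m..<n])))"
proof -
  interpret tower "\<lambda>n. smith_cycles j (image (\<phi> g)) q (nerve (\<V> n) M) :: (_ \<Rightarrow> 'p mod_ring) set"
    "\<lambda>n. smith_boundaries j (image (\<phi> g)) q (nerve (\<V> n) M)" "\<lambda>m n. chain_push (fold pr [m..<n])"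
    by (rule smith_system.smith_tower[OF assms])
  show ?thesis
    unfolding HC_smith_def smith_homology_def smith_homology_map_def
      stage_def[abs_def] trans_def[abs_def] ..
qed

text \<open>Every covering of one system refines some covering of the other, so the systems
  interleave. By symmetry the rank does not depend on the coarsening system.\<close>

lemma HC_le:
  assumes "Metric_space M d" "coarsening_system M d \<U> pr" "coarsening_system M d \<U>' pr'"
  shows "vs_rank (HC \<U> pr q M {} :: ('k::{field,finite}, _) module) \<le> vs_rank (HC \<U>' pr' q M {} :: ('k, _) module)"
proof -
  interpret Metric_space M d by fact
  note b = coarsening_system_bounded[OF assms(2)] and b' = coarsening_system_bounded[OF assms(3)]
  have ex: "\<exists>k0. \<forall>k\<ge>k0. \<exists>a. refining \<U> (\<V>' k) a"
    if bU: "bounded_covering M d \<U>" and cV: "coarsening_system M d \<V>' prr" for \<U> :: "'a set set" and \<V>' prr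
  proof -
    obtain R where R: "\<forall>U\<in>\<U>. \<forall>x\<in>U. \<forall>y\<in>U. d x y \<le> R" and sub: "\<Union>\<U> = M"
      using bU unfolding bounded_covering_def by metis
    obtain k0 where k0: "\<forall>k\<ge>k0. \<forall>S\<subseteq>M. (\<forall>x\<in>S. \<forall>y\<in>S. d x y \<le> R) \<longrightarrow> (\<exists>U\<in>\<V>' k. S \<subseteq> U)"
      using coarsening_system_lebesgue[OF cV] by blast
    have "\<exists>a. refining \<U> (\<V>' k) a" if k: "k0 \<le> k" for k
    proof (rule refining_exists)
      fix U assume "U \<in> \<U>"
      then have "U \<subseteq> M" "\<forall>x\<in>U. \<forall>y\<in>U. d x y \<le> R" using R sub by auto
      then show "\<exists>V\<in>\<V>' k. U \<subseteq> V" using k0 k by blast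
    qed
    then show ?thesis by blast
  qed
  have "\<exists>k a. refining (\<U> n) (\<U>' k) a" for n using ex[OF b assms(3), of n] by blast
  then obtain k a where a: "\<And>n. refining (\<U> n) (\<U>' (k n)) (a n)" by metis
  note sys = nerve_system0[OF assms(2)] and sys' = nerve_system0[OF assms(3)]
  show ?thesis
    unfolding HC_tower[OF nerve_system[OF assms(2) empty_subsetI]] HC_tower[OF nerve_system[OF assms(3) empty_subsetI]] nerve_empty
  proof (rule vs_rank_le_interleaved[OF sys sys', where k = k and \<alpha> = a])
    show "smap (nerve (\<U> n) M) (nerve (\<U>' (k n)) M) (a n)" for n by (rule refining_smap[OF b b' a])
    show "smap {} {} (a n)" for n by (simp add: smap_def)
    show "\<exists>\<kappa> :: 'a set \<Rightarrow> nat. \<forall>S\<in>nerve (\<U> n) M. inj_on \<kappa> S" for n by (rule nerve_injective_rank[OF b])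
    fix n m K assume K: "k n \<le> K" "k m \<le> K"
    obtain k0 where k0: "\<forall>l\<ge>k0. \<exists>c. refining (\<U>' K) (\<U> l) c" using ex[OF b' assms(2)] by blast
    define l where "l = max k0 (max n m)"
    have l: "k0 \<le> l" "n \<le> l" "m \<le> l" by (auto simp: l_def)
    obtain c where c: "refining (\<U>' K) (\<U> l) c" using k0 l(1) by blast
    show "\<exists>l \<beta>. n \<le> l \<and> m \<le> l \<and> smap (nerve (\<U>' K) M) (nerve (\<U> l) M) \<beta> \<and> smap {} {} \<beta> \<and>
      (\<forall>i\<in>{n, m}. (\<forall>S\<in>nerve (\<U> i) M. fold pr [i..<l] ` S \<union> (\<beta> \<circ> (fold pr' [k i..<K] \<circ> a i)) ` S \<in> nerve (\<U> l) M) \<and>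
         (\<forall>S\<in>{}. fold pr [i..<l] ` S \<union> (\<beta> \<circ> (fold pr' [k i..<K] \<circ> a i)) ` S \<in> {}))"
    proof (intro exI[of _ l] exI[of _ c] conjI ballI)
      fix i S assume "i \<in> {n, m}" and S: "S \<in> nerve (\<U> i) M"
      then have i: "k i \<le> K" "i \<le> l" using K l by auto
      show "fold pr [i..<l] ` S \<union> (c \<circ> (fold pr' [k i..<K] \<circ> a i)) ` S \<in> nerve (\<U> l) M"
        by (rule refining_contiguous[OF refining_fold[OF assms(2) i(2)]
              refining_comp[OF refining_comp[OF a refining_fold[OF assms(3) i(1)]] c] S])
    next
      show "smap (nerve (\<U>' K) M) (nerve (\<U> l) M) c" by (rule refining_smap[OF b' b c])
      show "smap {} {} c" by (simp add: smap_def)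
    qed (simp_all add: l)
  qed
qed

lemma chain_push_zero: "chain_push f (\<lambda>_. 0) = (\<lambda>_. 0)"
  by (rule ext) (simp add: chain_push_def)

section \<open>Equivariant coverings\<close>

locale coarse_cyclic_action = Metric_space X d + group G
  for X :: "'a set" and d and G :: "('g, 'r) monoid_scheme" (structure) +
  fixes g :: 'g and \<phi> :: "'g \<Rightarrow> 'a \<Rightarrow> 'a" and ty :: "'p::prime_card itself"
  assumes order: "Coset.order G = CARD('p)" and g: "g \<in> carrier G" and gen: "carrier G = generate G {g}"
    and action: "coarse_action G X d \<phi>"
begin

abbreviation \<gamma> :: "'a set \<Rightarrow> 'a set" where "\<gamma> \<equiv> image (\<phi> g)"

lemma prime_p: "prime CARD('p)" by (rule prime_card)

lemma finite_G: "finite (carrier G)"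
  using order prime_gt_0_nat[OF prime_p] unfolding Coset.order_def by (metis card.infinite less_irrefl)

lemma carrier_powers: "h \<in> carrier G \<longleftrightarrow> (\<exists>i::nat. h = g [^] i)"
  using generate_pow_on_finite_carrier[OF finite_G g] gen by auto

lemma g_pow_p: "g [^] CARD('p) = \<one>"
  using pow_order_eq_1[OF g] order by simp

lemma phi_X: "h \<in> carrier G \<Longrightarrow> x \<in> X \<Longrightarrow> \<phi> h x \<in> X"
  using action unfolding coarse_action_def quasi_isometry_def by blast

lemma phi_one: "x \<in> X \<Longrightarrow> \<phi> \<one> x = x"
  using action unfolding coarse_action_def by blast

lemma phi_lipschitz: "\<exists>L>0. \<exists>C>0. \<forall>h\<in>carrier G. \<forall>x\<in>X. \<forall>y\<in>X. d (\<phi> h x) (\<phi> h y) \<le> L * d x y + C"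
proof -
  obtain L C where "L > 0" "C > 0" "\<forall>h\<in>carrier G. quasi_isometry L C X d X d (\<phi> h)"
    using action unfolding coarse_action_def by blast
  then show ?thesis unfolding quasi_isometry_def by (intro exI[of _ L] conjI exI[of _ C]) simp_all
qed

definition Gcov :: "'a set set \<Rightarrow> bool" where
  "Gcov \<V> \<longleftrightarrow> bounded_covering X d \<V> \<and> G_covering G \<phi> \<V> \<and> regular_G_complex G (\<lambda>h. image (\<phi> h)) (nerve \<V> X)"

lemma Gcov_regular_system: "regular_G_coarsening_system G X d \<phi> \<V> pr \<Longrightarrow> Gcov (\<V> n)"
  unfolding regular_G_coarsening_system_def Gcov_def using coarsening_system_bounded by blast

lemma GcovD:
  assumes "Gcov \<V>" "U \<in> \<V>"
  shows "U \<subseteq> X" "h \<in> carrier G \<Longrightarrow> \<phi> h ` U \<in> \<V>"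
    "h \<in> carrier G \<Longrightarrow> k \<in> carrier G \<Longrightarrow> \<phi> h ` \<phi> k ` U = \<phi> (h \<otimes> k) ` U"
proof -
  show "U \<subseteq> X" using assms unfolding Gcov_def bounded_covering_def by blast
  have "{\<phi> h ` U |U. U \<in> \<V>} = \<V>" if "h \<in> carrier G" for h
    using assms(1) that unfolding Gcov_def G_covering_def by simp
  then show "h \<in> carrier G \<Longrightarrow> \<phi> h ` U \<in> \<V>" using assms(2) by blast
  show "h \<in> carrier G \<Longrightarrow> k \<in> carrier G \<Longrightarrow> \<phi> h ` \<phi> k ` U = \<phi> (h \<otimes> k) ` U"
    using assms unfolding Gcov_def G_covering_def by simp
qed

lemma gamma_pow:
  assumes "Gcov \<V>" "U \<in> \<V>"
  shows "(\<gamma> ^^ i) U = \<phi> (g [^] i) ` U"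
proof (induction i)
  case 0
  have "\<phi> \<one> ` U = U" using phi_one GcovD(1)[OF assms] by (auto simp: image_iff subset_iff)
  then show ?case by simp
next
  case (Suc i)
  have "(\<gamma> ^^ Suc i) U = \<phi> g ` \<phi> (g [^] i) ` U" using Suc by simp
  also have "\<dots> = \<phi> (g \<otimes> g [^] i) ` U" using GcovD(3)[OF assms g] g by simp
  also have "g \<otimes> g [^] i = g [^] Suc i" by (rule nat_pow_Suc2[OF g, symmetric])
  finally show ?case .
qed

lemma gamma_pow_in: "Gcov \<V> \<Longrightarrow> U \<in> \<V> \<Longrightarrow> (\<gamma> ^^ i) U \<in> \<V>"
  using gamma_pow GcovD(2) g by simp

lemma gamma_period: "Gcov \<V> \<Longrightarrow> U \<in> \<V> \<Longrightarrow> (\<gamma> ^^ CARD('p)) U = U"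
  using gamma_pow[of \<V> U "CARD('p)"] gamma_pow[of \<V> U 0] g_pow_p by simp

lemma gamma_pow_mono: "U \<subseteq> V \<Longrightarrow> (\<gamma> ^^ i) U \<subseteq> (\<gamma> ^^ i) V"
  by (induction i) auto

lemma gamma_pow_empty: "(\<gamma> ^^ i) U = {} \<longleftrightarrow> U = {}"
  by (induction i) auto

lemma nerve_verts_X: "Gcov \<V> \<Longrightarrow> \<Union>(nerve \<V> X) = {U \<in> \<V>. U \<noteq> {}}"
  unfolding nerve_verts using GcovD(1) by blast

lemma nerve_gamma:
  assumes V: "Gcov \<V>" and S: "S \<in> nerve \<V> X"
  shows "\<gamma> ` S \<in> nerve \<V> X"
proof -
  obtain x where x: "x \<in> X" "\<forall>U\<in>S. x \<in> U" using nerveD(4)[OF S] by blast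
  show ?thesis
  proof (rule nerveI[of _ _ "\<phi> g x"])
    show "\<gamma> ` S \<subseteq> \<V>" using GcovD(2)[OF V _ g] nerveD(3)[OF S] by blast
  qed (use nerveD[OF S] x phi_X[OF g] in auto)
qed

text \<open>The action on points is only coarse, but \<open>G_covering\<close> makes compositions
  exact on members, so the generator acts on the nerve with period p and has an inverse
  there.\<close>

lemma nerve_smith: 
  assumes V: "Gcov \<V>"
  shows "smith_complex TYPE('p) (nerve \<V> X) \<gamma>"
proof -
  let ?K = "nerve \<V> X" and ?p = "CARD('p)"
  interpret lf_complex ?K using V unfolding Gcov_def by (intro nerve_complex) blast
  note verts = nerve_verts_X[OF V]
  have inv: "(\<gamma> ^^ (?p - 1)) (\<gamma> U) = U" if "U \<in> \<V>" for U
    using gamma_period[OF V that] prime_gt_0_nat[OF prime_p]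
    by (metis One_nat_def Suc_pred comp_apply funpow_Suc_right)
  have inv': "\<gamma> ((\<gamma> ^^ (?p - 1)) U) = U" if "U \<in> \<V>" for U
    using inv[OF that] by (metis comp_apply funpow_swap1)
  have pows: "(\<lambda>U. (\<gamma> ^^ i) U) ` S \<in> ?K" if "S \<in> ?K" for S i
  proof (induction i)
    case (Suc i)
    have "(\<lambda>U. (\<gamma> ^^ Suc i) U) ` S = \<gamma> ` ((\<lambda>U. (\<gamma> ^^ i) U) ` S)" by (simp add: image_image)
    then show ?case using nerve_gamma[OF V Suc] by metis
  qed (simp add: that)
  have aut: "aut ?K \<gamma>"
    unfolding aut_def verts
  proof (intro conjI allI impI)
    show "bij_betw \<gamma> {U \<in> \<V>. U \<noteq> {}} {U \<in> \<V>. U \<noteq> {}}"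
    proof (rule bij_betw_byWitness[where f' = "\<gamma> ^^ (?p - 1)"])
      show "\<gamma> ` {U \<in> \<V>. U \<noteq> {}} \<subseteq> {U \<in> \<V>. U \<noteq> {}}" using GcovD(2)[OF V _ g] by auto
      show "(\<gamma> ^^ (?p - 1)) ` {U \<in> \<V>. U \<noteq> {}} \<subseteq> {U \<in> \<V>. U \<noteq> {}}"
        using gamma_pow_in[OF V] gamma_pow_empty by auto
    qed (use inv inv' in auto)
    fix S assume S: "S \<subseteq> {U \<in> \<V>. U \<noteq> {}}"
    show "\<gamma> ` S \<in> ?K \<longleftrightarrow> S \<in> ?K"
    proof
      assume "\<gamma> ` S \<in> ?K"
      then have "(\<lambda>U. (\<gamma> ^^ (?p - 1)) U) ` \<gamma> ` S \<in> ?K" by (rule pows)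
      moreover have "(\<lambda>U. (\<gamma> ^^ (?p - 1)) U) ` \<gamma> ` S = (\<lambda>U. U) ` S"
        unfolding image_image using inv S by (intro image_cong) auto
      ultimately show "S \<in> ?K" by simp
    qed (rule nerve_gamma[OF V])
  qed
  have "regular_complex ?K \<gamma> ?p"
  proof
    show "aut ?K \<gamma>" by (rule aut)
    show "prime ?p" by (rule prime_p)
    show "(\<gamma> ^^ ?p) U = U" if "U \<in> \<Union>?K" for U using that gamma_period[OF V] unfolding verts by blast
    fix ks vs assume l: "length ks = length vs" and vs: "set vs \<in> ?K" and "set (map2 (\<lambda>k. \<gamma> ^^ k) ks vs) \<in> ?K"
    have inV: "vs ! i \<in> \<V>" if "i < length vs" for i using nerveD(3)[OF vs] that by auto
    \<comment> \<open>Exponents become group elements for the regularity of the covering, and the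
      element found is a power of \<open>g\<close> again.\<close>
    let ?hs = "map (\<lambda>k. g [^] (k::nat)) ks"
    have "map2 (\<lambda>h. image (\<phi> h)) ?hs vs = map2 (\<lambda>k. \<gamma> ^^ k) ks vs"
      using l inV gamma_pow[OF V] by (intro nth_equalityI) auto
    then have *: "set (map2 (\<lambda>h. image (\<phi> h)) ?hs vs) \<in> ?K" using \<open>set (map2 (\<lambda>k. \<gamma> ^^ k) ks vs) \<in> ?K\<close> by simp
    have reg: "\<forall>hs vs. length hs = length vs \<and> set hs \<subseteq> carrier G \<and> set vs \<in> ?K \<and> set (map2 (\<lambda>h. image (\<phi> h)) hs vs) \<in> ?K \<longrightarrow>
        (\<exists>h\<in>carrier G. \<forall>i<length vs. \<phi> h ` (vs ! i) = \<phi> (hs ! i) ` (vs ! i))"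
      using V subgroup_self unfolding Gcov_def regular_G_complex_def by blast
    have "set ?hs \<subseteq> carrier G" using g by auto
    then obtain h where h: "h \<in> carrier G" "\<forall>i<length vs. \<phi> h ` (vs ! i) = \<phi> (?hs ! i) ` (vs ! i)"
      using reg l vs * by (metis length_map)
    obtain k :: nat where k: "h = g [^] k" using h(1) carrier_powers by blast
    show "\<exists>k. \<forall>i<length vs. (\<gamma> ^^ k) (vs ! i) = (\<gamma> ^^ (ks ! i)) (vs ! i)"
      using h(2) l gamma_pow[OF V inV] unfolding k by (intro exI[of _ k]) simp
  qed
  then show ?thesis unfolding smith_complex_def .
qed

text \<open>A common point makes \<open>U\<close> and its translate a simplex, and a simplex has at
  most one vertex in each orbit.\<close>

lemma fixed_if_meet:
  assumes V: "Gcov \<V>" and U: "U \<in> \<V>" "x \<in> U" "x \<in> \<gamma> U"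
  shows "\<gamma> U = U"
proof -
  interpret smith_complex "nerve \<V> X" \<gamma> "TYPE('p)" by (rule nerve_smith[OF V])
  have "{U, \<gamma> U} \<in> nerve \<V> X"
    using U GcovD(1)[OF V U(1)] GcovD(2)[OF V U(1) g] by (intro nerveI[of _ _ x]) auto
  then show ?thesis using one_per_orbit[of "{U, \<gamma> U}" U 1] by simp
qed

text \<open>A refinement is chosen on one representative of each orbit and carried along the orbit
  by powers of \<open>\<gamma>\<close>. The exponent is unique modulo p unless the representative is
  fixed; in that case its image meets its own translate and is fixed as well.\<close>

lemma equivariant_refinement:
  assumes V: "Gcov \<V>" and W: "Gcov \<W>" and ex: "\<And>U. U \<in> \<V> \<Longrightarrow> U \<noteq> {} \<Longrightarrow> \<exists>V\<in>\<W>. U \<subseteq> V"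
  shows "\<exists>a. refining \<V> \<W> a \<and> (\<forall>U\<in>\<V>. U \<noteq> {} \<longrightarrow> a (\<gamma> U) = \<gamma> (a U))"
proof -
  interpret V: smith_complex "nerve \<V> X" \<gamma> "TYPE('p)" by (rule nerve_smith[OF V])
  interpret W: smith_complex "nerve \<W> X" \<gamma> "TYPE('p)" by (rule nerve_smith[OF W])
  obtain a0 where a0: "\<And>U. U \<in> \<V> \<Longrightarrow> U \<noteq> {} \<Longrightarrow> a0 U \<in> \<W> \<and> U \<subseteq> a0 U" using ex by metis
  define orb where "orb U = range (\<lambda>i. (\<gamma> ^^ i) U)" for U
  define rt where "rt U = (SOME U'. U' \<in> orb U)" for U
  \<comment> \<open>Some exponent from the representative to \<open>U\<close>.
    \<open>ix (\<gamma> U)\<close> need not be \<open>Suc (ix U)\<close>, which is the point to be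
    settled for equivariance.\<close>
  define ix where "ix U = (SOME i. U = (\<gamma> ^^ i) (rt U))" for U
  define a where "a U = (\<gamma> ^^ ix U) (a0 (rt U))" for U
  have rt: "\<exists>i. rt U = (\<gamma> ^^ i) U" for U
  proof -
    have "rt U \<in> orb U" unfolding rt_def by (rule someI[of _ U]) (auto simp: orb_def intro: range_eqI[of _ _ 0])
    then show ?thesis by (auto simp: orb_def)
  qed
  have backw: "U = (\<gamma> ^^ (CARD('p) * i - i)) ((\<gamma> ^^ i) U)" if "U \<in> \<V>" "U \<noteq> {}" for U i
  proof -
    have "CARD('p) * i - i + i = CARD('p) * i" using prime_gt_0_nat[OF prime_p] by simp
    then have "(\<gamma> ^^ (CARD('p) * i - i)) ((\<gamma> ^^ i) U) = (\<gamma> ^^ (CARD('p) * i)) U" by (metis comp_apply funpow_add)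
    also have "\<dots> = U" by (rule V.period_mult) (use that nerve_verts_X[OF V] in blast)
    finally show ?thesis by simp
  qed
  have ix: "U = (\<gamma> ^^ ix U) (rt U)" if U: "U \<in> \<V>" "U \<noteq> {}" for U
  proof -
    obtain i where "rt U = (\<gamma> ^^ i) U" using rt by blast
    then have "\<exists>i. U = (\<gamma> ^^ i) (rt U)" using backw[OF U] by metis
    then show ?thesis unfolding ix_def by (rule someI_ex)
  qed
  have rtV: "rt U \<in> \<V>" "rt U \<noteq> {}" if U: "U \<in> \<V>" "U \<noteq> {}" for U
    using rt[of U] gamma_pow_in[OF V U(1)] gamma_pow_empty U(2) by metis+
  have rt_gamma: "rt (\<gamma> U) = rt U" if U: "U \<in> \<V>" "U \<noteq> {}" for U
  proof -
    have "orb (\<gamma> U) = orb U"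
    proof (intro equalityI subsetI)
      fix W assume "W \<in> orb (\<gamma> U)"
      then obtain i where "W = (\<gamma> ^^ Suc i) U" unfolding orb_def funpow_Suc_right by auto
      then show "W \<in> orb U" unfolding orb_def by blast
    next
      fix W assume "W \<in> orb U"
      then obtain i where "W = (\<gamma> ^^ i) U" unfolding orb_def by blast
      also have "U = (\<gamma> ^^ (CARD('p) - 1)) (\<gamma> U)" using backw[OF U, of 1] by simp
      finally have "W = (\<gamma> ^^ (i + (CARD('p) - 1))) (\<gamma> U)" by (simp only: funpow_add o_apply)
      then show "W \<in> orb (\<gamma> U)" unfolding orb_def by blast
    qed
    then show ?thesis by (simp add: rt_def)
  qed
  have "refining \<V> \<W> a"
    unfolding refining_def
  proof (intro ballI impI conjI)
    fix U assume U: "U \<in> \<V>" "U \<noteq> {}"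
    show "a U \<in> \<W>" unfolding a_def using gamma_pow_in[OF W] a0[OF rtV[OF U]] by blast
    have "(\<gamma> ^^ ix U) (rt U) \<subseteq> a U" unfolding a_def using gamma_pow_mono a0[OF rtV[OF U]] by blast
    then show "U \<subseteq> a U" using ix[OF U] by simp
  qed
  moreover have "a (\<gamma> U) = \<gamma> (a U)" if U: "U \<in> \<V>" "U \<noteq> {}" for U
  proof -
    define R where "R = rt U"
    define V0 where "V0 = a0 R"
    have R: "R \<in> \<V>" "R \<noteq> {}" unfolding R_def using rtV[OF U] by auto
    have V0: "V0 \<in> \<W>" "R \<subseteq> V0" "V0 \<noteq> {}" unfolding V0_def using a0[OF R] R(2) by auto
    have gU: "\<gamma> U \<in> \<V>" "\<gamma> U \<noteq> {}" using GcovD(2)[OF V U(1) g] U(2) by auto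
    define k where "k = ix (\<gamma> U)"
    define l where "l = Suc (ix U)"
    have kl: "(\<gamma> ^^ k) R = (\<gamma> ^^ l) R"
      using ix[OF gU] ix[OF U] rt_gamma[OF U] unfolding k_def l_def R_def by simp
    have "(\<gamma> ^^ k) V0 = (\<gamma> ^^ l) V0"
    proof (cases "[k = l] (mod CARD('p))")
      case True
      then show ?thesis using W.funpow_mod[of V0 k] W.funpow_mod[of V0 l] V0 nerve_verts_X[OF W]
        by (simp add: cong_def)
    next
      \<comment> \<open>Exponents with different residues move \<open>R\<close> to the same set, so
        \<open>R\<close> is fixed. \<open>V0\<close> contains \<open>R\<close> and therefore meets
        its translate.\<close>
      case False
      have "(\<gamma> ^^ (CARD('p) * k - k + l)) R = (\<gamma> ^^ (CARD('p) * k - k)) ((\<gamma> ^^ l) R)"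
        by (simp only: funpow_add o_apply)
      also have "\<dots> = R" using backw[OF R, of k] unfolding kl by (rule sym)
      finally have "(\<gamma> ^^ (CARD('p) * k - k + l)) R = R" .
      moreover have "\<not> CARD('p) dvd CARD('p) * k - k + l"
      proof
        assume "CARD('p) dvd CARD('p) * k - k + l"
        then have "[CARD('p) * k - k + l + k = 0 + k] (mod CARD('p))" by (intro cong_add) (auto simp: cong_0_iff)
        moreover have "k \<le> CARD('p) * k" using prime_gt_0_nat[OF prime_p] by simp
        then have "CARD('p) * k - k + l + k = l + CARD('p) * k" by linarith
        ultimately show False using False by (simp add: cong_def)
      qed
      ultimately have "\<gamma> R = R" using V.fixed_if_power_fixed[of R] R nerve_verts_X[OF V] by blast
      then have "R \<subseteq> \<gamma> V0" using V0(2) by blast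
      then have "\<gamma> V0 = V0" using fixed_if_meet[OF W V0(1)] R(2) V0(2) by blast
      then show ?thesis by (simp add: W.fixed_pow)
    qed
    then show ?thesis unfolding a_def rt_gamma[OF U] k_def l_def R_def[symmetric] V0_def by simp
  qed
  ultimately show ?thesis by blast
qed

lemma refine_into:
  assumes V: "bounded_covering X d \<V>" and W: "coarsening_system X d \<W> pr"
  shows "\<exists>k0. \<forall>k\<ge>k0. \<forall>U\<in>\<V>. \<exists>V\<in>\<W> k. U \<subseteq> V"
proof -
  obtain R where R: "\<forall>U\<in>\<V>. \<forall>x\<in>U. \<forall>y\<in>U. d x y \<le> R" and sub: "\<Union>\<V> = X"
    using V unfolding bounded_covering_def by metis
  obtain k0 where k0: "\<forall>k\<ge>k0. \<forall>S\<subseteq>X. (\<forall>x\<in>S. \<forall>y\<in>S. d x y \<le> R) \<longrightarrow> (\<exists>U\<in>\<W> k. S \<subseteq> U)"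
    using coarsening_system_lebesgue[OF W] by blast
  have "\<exists>V\<in>\<W> k. U \<subseteq> V" if "k0 \<le> k" "U \<in> \<V>" for k U
  proof -
    have "U \<subseteq> X" "\<forall>x\<in>U. \<forall>y\<in>U. d x y \<le> R" using R sub that by auto
    then show ?thesis using k0 that by blast
  qed
  then show ?thesis by blast
qed

lemma nerve_smith_system:
  assumes "regular_G_coarsening_system G X d \<phi> \<V> pr" "equivariant_projections G \<phi> \<V> pr"
  shows "smith_system TYPE('p) (\<lambda>n. nerve (\<V> n) X) pr \<gamma>"
proof -
  have c: "coarsening_system X d \<V> pr" using assms(1) unfolding regular_G_coarsening_system_def by blast
  note G = Gcov_regular_system[OF assms(1)]
  have "pr n (\<gamma> U) = \<gamma> (pr n U)" if "U \<in> \<Union>(nerve (\<V> n) X)" for n U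
    using assms(2) that g nerve_verts_X[OF G] unfolding equivariant_projections_def by blast
  then show ?thesis
    unfolding smith_system_def smith_system_axioms_def using nerve_system0[OF c] nerve_smith[OF G] by simp
qed

text \<open>
  In the limit every system is dominated by one of dimension at most \<open>D\<close>; equivariance of the
  comparison maps and of the homotopy makes this work for the special groups.
\<close>

lemma HC_smith_vanishes:
  assumes V: "regular_G_coarsening_system G X d \<phi> \<V> pr" "equivariant_projections G \<phi> \<V> pr"
    and W: "regular_G_coarsening_system G X d \<phi> \<W> prW" and D: "\<And>n S. S \<in> nerve (\<W> n) X \<Longrightarrow> card S \<le> D + 1"
    and q: "D < q"
  shows "vs_rank (HC_smith X \<phi> g j \<V> pr q :: ('p mod_ring, _) module) = 0"
  unfolding HC_smith_tower[where \<phi> = \<phi> and g = g, OF nerve_smith_system[OF V]]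
proof (rule vs_rank_zero[OF smith_system.smith_tower[OF nerve_smith_system[OF V]]])
  interpret smith_system "\<lambda>n. nerve (\<V> n) X" pr \<gamma> "TYPE('p)" by (rule nerve_smith_system[OF V])
  have cV: "coarsening_system X d \<V> pr" and cW: "coarsening_system X d \<W> prW"
    using V(1) W unfolding regular_G_coarsening_system_def by simp_all
  note GV = Gcov_regular_system[OF V(1)] and GW = Gcov_regular_system[OF W]
  note bV = coarsening_system_bounded[OF cV] and bW = coarsening_system_bounded[OF cW]
  fix n and z :: "'a set list \<Rightarrow> 'p mod_ring" assume z: "z \<in> smith_cycles j \<gamma> q (nerve (\<V> n) X)"
  \<comment> \<open>A detour through a nerve of dimension at most \<open>D\<close>: an equivariant
    refinement into a covering of \<open>\<W>\<close>, and from there one into a later stage of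
    \<open>\<V>\<close>.\<close>
  obtain k where "\<forall>U\<in>\<V> n. \<exists>V\<in>\<W> k. U \<subseteq> V" using refine_into[OF bV cW, of n] by (meson order_refl)
  then obtain a where a: "refining (\<V> n) (\<W> k) a" "\<And>U. U \<in> \<V> n \<Longrightarrow> U \<noteq> {} \<Longrightarrow> a (\<gamma> U) = \<gamma> (a U)"
    using equivariant_refinement[OF GV GW, of n k] by metis
  obtain l0 where l0: "\<forall>l\<ge>l0. \<forall>U\<in>\<W> k. \<exists>V\<in>\<V> l. U \<subseteq> V" using refine_into[OF bW cV, of k] by (elim exE)
  define l where "l = max n l0"
  have nl: "n \<le> l" "l0 \<le> l" by (auto simp: l_def)
  obtain b where b: "refining (\<W> k) (\<V> l) b" "\<And>U. U \<in> \<W> k \<Longrightarrow> U \<noteq> {} \<Longrightarrow> b (\<gamma> U) = \<gamma> (b U)"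
    using equivariant_refinement[OF GW GV, of k l] l0 nl by metis
  interpret Vn: smith_complex "nerve (\<V> n) X" \<gamma> "TYPE('p)" by (rule nerve_smith[OF GV])
  interpret Vl: smith_complex "nerve (\<V> l) X" \<gamma> "TYPE('p)" by (rule nerve_smith[OF GV])
  let ?F = "fold pr [n..<l]"
  have F: "refining (\<V> n) (\<V> l) ?F" by (rule refining_fold[OF cV nl(1)])
  have ba: "refining (\<V> n) (\<V> l) (b \<circ> a)" by (rule refining_comp[OF a(1) b(1)])
  have sa: "smap (nerve (\<V> n) X) (nerve (\<W> k) X) a" by (rule refining_smap[OF bV bW a(1)])
  have sb: "smap (nerve (\<W> k) X) (nerve (\<V> l) X) b" by (rule refining_smap[OF bW bV b(1)])
  let ?orb = "\<lambda>U. range (\<lambda>i. (\<gamma> ^^ i) U)"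
  let ?O = "?orb ` {U \<in> \<V> n. U \<noteq> {}}"
  \<comment> \<open>Vertices are ranked by their orbits. This rank is invariant, and still injective
    on simplices as a simplex has at most one vertex in each orbit.\<close>
  define \<kappa> where "\<kappa> U = to_nat_on ?O (?orb U)" for U
  have cO: "countable ?O" by (rule countable_image[OF countable_covering[OF bV]])
  have vn: "\<Union>(nerve (\<V> n) X) = {U \<in> \<V> n. U \<noteq> {}}" by (rule nerve_verts_X[OF GV])
  interpret contiguous_maps "nerve (\<V> n) X" "nerve (\<V> l) X" "b \<circ> a" ?F \<kappa>
  proof (unfold_locales)
    show "smap (nerve (\<V> n) X) (nerve (\<V> l) X) (b \<circ> a)" by (rule refining_smap[OF bV bV ba])
    show "smap (nerve (\<V> n) X) (nerve (\<V> l) X) ?F" by (rule refining_smap[OF bV bV F])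
    fix S assume S: "S \<in> nerve (\<V> n) X"
    show "(b \<circ> a) ` S \<union> ?F ` S \<in> nerve (\<V> l) X" by (rule refining_contiguous[OF ba F S])
    show "inj_on \<kappa> S"
    proof (rule inj_onI)
      fix U U' assume U: "U \<in> S" "U' \<in> S" and "\<kappa> U = \<kappa> U'"
      moreover have "?orb U \<in> ?O" "?orb U' \<in> ?O" using U S vn by blast+
      ultimately have "?orb U = ?orb U'" unfolding \<kappa>_def using inj_on_to_nat_on[OF cO] by (metis (no_types, lifting) inj_on_def)
      moreover have "U' \<in> ?orb U'" by (rule range_eqI[of _ _ 0]) simp
      ultimately have "U' \<in> ?orb U" by (simp only:)
      then obtain i where "U' = (\<gamma> ^^ i) U" by (rule rangeE)
      then show "U = U'" using Vn.one_per_orbit[OF S U(1)] U(2) by metis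
    qed
  qed
  have equi: "P (chain_push \<gamma> c) = chain_push \<gamma> (P c)" if c: "c \<in> CH (nerve (\<V> n) X)" for c :: "'a set list \<Rightarrow> 'p mod_ring"
  proof (rule P_equivariant[OF Vn.aut Vl.aut _ _ _ c])
    fix U assume U: "U \<in> \<Union>(nerve (\<V> n) X)"
    then have U': "U \<in> \<V> n" "U \<noteq> {}" unfolding vn by auto
    have "a U \<in> \<W> k" "a U \<noteq> {}" using a(1) U' unfolding refining_def by blast+
    then show "(b \<circ> a) (\<gamma> U) = \<gamma> ((b \<circ> a) U)" using a(2)[OF U'] b(2) by simp
    show "?F (\<gamma> U) = \<gamma> (?F U)" by (rule F_gamma[OF nl(1) U])
    have "?orb (\<gamma> U) = ?orb U"
    proof (intro equalityI subsetI)
      fix W assume "W \<in> ?orb (\<gamma> U)"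
      then obtain i where "W = (\<gamma> ^^ Suc i) U" unfolding funpow_Suc_right by auto
      then show "W \<in> ?orb U" by blast
    next
      fix W assume "W \<in> ?orb U"
      then obtain i where "W = (\<gamma> ^^ i) U" by blast
      also have "U = (\<gamma> ^^ (CARD('p) - 1)) (\<gamma> U)"
        using Vn.period[OF U] prime_gt_0_nat[OF prime_p] by (metis One_nat_def Suc_pred comp_apply funpow_Suc_right)
      finally have "W = (\<gamma> ^^ (i + (CARD('p) - 1))) (\<gamma> U)" by (simp only: funpow_add o_apply)
      then show "W \<in> ?orb (\<gamma> U)" by blast
    qed
    then show "\<kappa> (\<gamma> U) = \<kappa> U" unfolding \<kappa>_def by simp
  qed
  note Plin = linear_betweenD[OF P_linear lin_subspace_CH]
  have Ptau: "P ((tau \<gamma> ^^ i) c) = (tau \<gamma> ^^ i) (P c)" if c: "c \<in> CH (nerve (\<V> n) X)" for c :: "'a set list \<Rightarrow> 'p mod_ring" and i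
  proof (induction i)
    case (Suc i)
    let ?c = "(tau \<gamma> ^^ i) c"
    have ci: "?c \<in> CH (nerve (\<V> n) X)" by (rule Vn.tau_pow_CH[OF c])
    have "P (tau \<gamma> ?c) = (\<lambda>\<sigma>. P ?c \<sigma> - P (chain_push \<gamma> ?c) \<sigma>)"
      unfolding tau_def[of \<gamma> ?c] by (rule Plin(3)[OF ci Vn.push_CH[OF ci Vn.smap_gamma]])
    also have "\<dots> = tau \<gamma> (P ?c)" unfolding equi[OF ci] by (rule tau_def[symmetric])
    moreover have "(tau \<gamma> ^^ Suc i) x = tau \<gamma> ((tau \<gamma> ^^ i) x)" for x :: "'a set list \<Rightarrow> 'p mod_ring" by simp
    ultimately show ?case unfolding Suc by (simp only:)
  qed simp
  have zc: "z \<in> smith_chains j \<gamma> q (nerve (\<V> n) X)" "lf_boundary z = (\<lambda>_. 0)"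
    using z unfolding smith_cycles_def by blast+
  obtain e where e: "e \<in> CH (nerve (\<V> n) X)" "deg q e" "z = (tau \<gamma> ^^ j) e"
    using zc(1) unfolding smith_chains_eq by blast
  have zC: "z \<in> CH (nerve (\<V> n) X)" "deg q z" using smith_chains_CH[OF zc(1)] by auto
  \<comment> \<open>In degree q > D a nonzero value would need a simplex with q + 1 distinct
    vertices, while those of this nerve have at most D + 1.\<close>
  have "chain_push a z = (\<lambda>_. 0)"
  proof
    fix \<sigma>
    have aC: "chain_push a z \<in> CH (nerve (\<W> k) X)" by (rule Vn.push_CH[OF zC(1) sa])
    show "chain_push a z \<sigma> = 0"
    proof (rule ccontr)
      assume nz: "chain_push a z \<sigma> \<noteq> 0"
      have "card (set \<sigma>) = length \<sigma>" by (rule distinct_card[OF alt_distinct[OF CH_D(1)[OF aC] nz]])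
      moreover have "length \<sigma> = Suc q" using Vn.push_deg[OF zC(2), of a] nz unfolding deg_def by blast
      moreover have "card (set \<sigma>) \<le> D + 1" by (rule D[OF CH_D(2)[OF aC nz]])
      ultimately show False using q by simp
    qed
  qed
  then have "chain_push (b \<circ> a) z = chain_push b (\<lambda>_. 0)"
    using Vn.push_comp[OF zC(1) sa sb nerve_complex[OF bW]] by simp
  then have "chain_push (b \<circ> a) z = (\<lambda>_. 0)" unfolding chain_push_zero .
  moreover have "P (\<lambda>_. 0) = (\<lambda>_. 0 :: 'p mod_ring)" by (rule Plin(4))
  \<comment> \<open>The homotopy runs from the detour to the transition map. The detour vanishes on
    \<open>z\<close> and \<open>z\<close> is a cycle, so only the boundary of \<open>P z\<close>
    remains.\<close>
  ultimately have "tr n l z = lf_boundary (P z)"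
    using homotopy[OF zC(1)] zc(2) by (simp add: fun_eq_iff)
  \<comment> \<open>Equivariance keeps the bounding chain special.\<close>
  also have "P z = (tau \<gamma> ^^ j) (P e)" unfolding e(3) by (rule Ptau[OF e(1)])
  finally have "tr n l z \<in> smith_boundaries j \<gamma> q (nerve (\<V> l) X)"
    unfolding smith_boundaries_def smith_chains_eq using P_CH[OF e(1)] P_deg[OF e(2)] by blast
  then show "\<exists>l\<ge>n. chain_push (fold pr [n..<l]) z \<in> smith_boundaries j \<gamma> q (nerve (\<V> l) X)" using nl by blast
qed

end

section \<open>The bounded fixed set\<close>

lemma (in tower) cl_ops:
  assumes "x \<in> Z n" "y \<in> Z n"
  shows "cl n x \<oplus>\<^bsub>lim\<^esub> cl n y = cl n (\<lambda>s. x s + y s)" "a \<odot>\<^bsub>lim\<^esub> cl n x = cl n (\<lambda>s. a * x s)"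
  using assms dcls_add[of "cst (B n) x" n "cst (B n) y"] dcls_smult[of "cst (B n) x" n a]
  by (simp_all add: cl_def stage_carrier stage_ops)

lemma (in tower) cl_common:
  assumes "P \<in> carrier lim" "Q \<in> carrier lim"
  shows "\<exists>n. \<exists>x\<in>Z n. \<exists>y\<in>Z n. P = cl n x \<and> Q = cl n y"
  using dirlim_common[OF assms] unfolding stage_carrier cl_def by blast

locale system_inclusion = A: complex_system K "\<lambda>_. {}" f + B: complex_system K' "\<lambda>_. {}" f
  for K K' :: "nat \<Rightarrow> 'v set set" and f +
  assumes sub: "K n \<subseteq> K' n"
begin

lemma cycles_sub: "lf_relcycles q (K n) {} \<subseteq> lf_relcycles q (K' n) {}"
  unfolding lf_complex.cycles_eq[OF A.K] lf_complex.cycles_eq[OF B.K] using CH_mono[OF sub] by blast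

lemma boundaries_sub: "lf_relboundaries q (K n) {} \<subseteq> lf_relboundaries q (K' n) {}"
  unfolding lf_complex.boundaries_eq[OF A.K] lf_complex.boundaries_eq[OF B.K] using CH_mono[OF sub] by blast

text \<open>The inclusion acts on classes by keeping the representing cycle. It allows the limit
  over \<open>r\<close> in \<open>HC_bd\<close> to be handled with cycles as well.\<close>

lemma inclusion_cl:
  assumes z: "(z :: 'v list \<Rightarrow> 'k::field) \<in> lf_relcycles q (K n) {}"
  shows "dirlim_map
    (tower.stage (\<lambda>n. lf_relcycles q (K' n) {}) (\<lambda>n. lf_relboundaries q (K' n) {}))
    (tower.trans (\<lambda>n. lf_relcycles q (K' n) {}) (\<lambda>n. lf_relboundaries q (K' n) {}) (\<lambda>m n. chain_push (fold f [m..<n])))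
    (\<lambda>n. coset_map (fun_space (lf_relcycles q (K' n) {})) (lf_relboundaries q (K' n) {}) (chain_push id))
    (tower.cl (\<lambda>n. lf_relcycles q (K n) {}) (\<lambda>n. lf_relboundaries q (K n) {}) (\<lambda>m n. chain_push (fold f [m..<n])) n z)
    = tower.cl (\<lambda>n. lf_relcycles q (K' n) {}) (\<lambda>n. lf_relboundaries q (K' n) {}) (\<lambda>m n. chain_push (fold f [m..<n])) n z"
proof -
  interpret a: tower "\<lambda>n. lf_relcycles q (K n) {} :: ('v list \<Rightarrow> 'k) set"
    "\<lambda>n. lf_relboundaries q (K n) {}" "\<lambda>m n. chain_push (fold f [m..<n])" by (rule A.rel_tower)
  interpret b: tower "\<lambda>n. lf_relcycles q (K' n) {} :: ('v list \<Rightarrow> 'k) set"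
    "\<lambda>n. lf_relboundaries q (K' n) {}" "\<lambda>m n. chain_push (fold f [m..<n])" by (rule B.rel_tower)
  define i where "i n = coset_map (fun_space (lf_relcycles q (K' n) {})) (lf_relboundaries q (K' n) {} :: ('v list \<Rightarrow> 'k) set) (chain_push id)" for n
  have pid: "chain_push id x = x" if "x \<in> lf_relcycles q (K n) {}" for x :: "'v list \<Rightarrow> 'k" and n
    using that lf_complex.push_id[OF A.K, of x n] unfolding lf_complex.cycles_eq[OF A.K] by simp
  have i: "i n (cst (lf_relboundaries q (K n) {}) x) = cst (lf_relboundaries q (K' n) {}) x"
    if x: "x \<in> lf_relcycles q (K n) {}" for x n
  proof -
    have "i n (cst (lf_relboundaries q (K n) {}) x) = cst (lf_relboundaries q (K' n) {}) (chain_push id x)"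
      unfolding i_def
    proof (rule coset_map_cst[OF a.B b.B])
      fix w :: "'v list \<Rightarrow> 'k" assume w: "w \<in> lf_relboundaries q (K n) {}"
      then have "w \<in> lf_relcycles q (K n) {}" using a.BZ by blast
      from pid[OF lin_subspaceD(2)[OF a.Z this x]]
      show "(\<lambda>s. chain_push id (\<lambda>s. w s + x s) s - chain_push id x s) \<in> lf_relboundaries q (K' n) {}"
        using w boundaries_sub unfolding pid[OF x] by auto
    qed
    then show ?thesis unfolding pid[OF x] .
  qed
  have inZ: "x \<in> lf_relcycles q (K' n) {}" if "x \<in> lf_relcycles q (K n) {}" for x :: "'v list \<Rightarrow> 'k" and n
    using cycles_sub that by blast
  interpret dirsys_map a.stage a.trans b.stage b.trans i
  proof (unfold_locales)
    fix n m X Y and c :: 'k assume "X \<in> carrier (a.stage n)"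
    then obtain x where x: "x \<in> lf_relcycles q (K n) {}" "X = cst (lf_relboundaries q (K n) {}) x"
      unfolding a.stage_carrier by blast
    show "i n X \<in> carrier (b.stage n)" unfolding x(2) i[OF x(1)] b.stage_carrier using inZ[OF x(1)] by blast
    show "i n (c \<odot>\<^bsub>a.stage n\<^esub> X) = c \<odot>\<^bsub>b.stage n\<^esub> i n X"
      unfolding x(2) i[OF x(1)] a.stage_ops b.stage_ops by (rule i[OF lin_subspaceD(3)[OF a.Z x(1)]])
    show "i m (a.trans n m X) = b.trans n m (i n X)" if nm: "n \<le> m"
      unfolding x(2) i[OF x(1)] a.trans_cst[OF nm x(1)] b.trans_cst[OF nm inZ[OF x(1)]]
      by (rule i[OF a.T_Z[OF nm x(1)]])
    assume "Y \<in> carrier (a.stage n)"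
    then obtain y where y: "y \<in> lf_relcycles q (K n) {}" "Y = cst (lf_relboundaries q (K n) {}) y"
      unfolding a.stage_carrier by blast
    show "i n (X \<oplus>\<^bsub>a.stage n\<^esub> Y) = i n X \<oplus>\<^bsub>b.stage n\<^esub> i n Y"
      unfolding x(2) y(2) i[OF x(1)] i[OF y(1)] a.stage_ops b.stage_ops by (rule i[OF lin_subspaceD(2)[OF a.Z x(1) y(1)]])
  qed
  have "dirlim_map b.stage b.trans i (a.cl n z) = b.cl n z"
    unfolding a.cl_def b.cl_def using dirlim_map_dcls[of "cst (lf_relboundaries q (K n) {}) z" n] i[OF z] z
    by (simp add: a.stage_carrier)
  then show ?thesis unfolding i_def[abs_def] .
qed

end

lemma fixed_upto_mono: "r \<le> s \<Longrightarrow> fixed_upto G X d \<phi> r \<subseteq> fixed_upto G X d \<phi> s"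
  unfolding fixed_upto_def by fastforce

context coarse_cyclic_action
begin

abbreviation XG :: "real \<Rightarrow> 'a set" where "XG r \<equiv> fixed_upto G X d \<phi> r"

lemma XG_X: "XG r \<subseteq> X" by (auto simp: fixed_upto_def)

text \<open>A member \<open>U\<close> that meets the points moved by at most \<open>r\<close> lies
  together with \<open>\<gamma> U\<close> in a member of a late covering of \<open>\<V>\<close>;
  that member meets its translate and is fixed. Conversely a fixed member consists of points moved
  at most by its diameter, and the limit over \<open>r\<close> absorbs these diameters.\<close>

lemma vs_rank_HC_bd_le:
  assumes U: "coarsening_system X d \<U> pr"
    and V: "regular_G_coarsening_system G X d \<phi> \<V> prV" "equivariant_projections G \<phi> \<V> prV"
  shows "vs_rank (HC_bd G X d \<phi> \<U> pr q :: ('p mod_ring, _) module) \<le>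
    vs_rank (tower.lim (\<lambda>n. lf_relcycles q (fixc (nerve (\<V> n) X) \<gamma>) {} :: (_ \<Rightarrow> 'p mod_ring) set)
       (\<lambda>n. lf_relboundaries q (fixc (nerve (\<V> n) X) \<gamma>) {}) (\<lambda>m n. chain_push (fold prV [m..<n])))"
proof -
  have cV: "coarsening_system X d \<V> prV" using V(1) unfolding regular_G_coarsening_system_def by simp
  note bU = coarsening_system_bounded[OF U] and bV = coarsening_system_bounded[OF cV]
  note GV = Gcov_regular_system[OF V(1)]
  interpret S: smith_system "\<lambda>n. nerve (\<V> n) X" prV \<gamma> "TYPE('p)" by (rule nerve_smith_system[OF V])
  interpret F: tower "\<lambda>n. lf_relcycles q (fixc (nerve (\<V> n) X) \<gamma>) {} :: (_ \<Rightarrow> 'p mod_ring) set"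
    "\<lambda>n. lf_relboundaries q (fixc (nerve (\<V> n) X) \<gamma>) {}" "\<lambda>m n. chain_push (fold prV [m..<n])"
    by (rule complex_system.rel_tower[OF S.fix_system])
  have sysU: "complex_system (\<lambda>n. nerve (\<U> n) A) (\<lambda>_. {}) pr" for A by (rule nerve_system0[OF U])
  have twU: "tower (\<lambda>n. lf_relcycles q (nerve (\<U> n) A) {} :: (_ \<Rightarrow> 'p mod_ring) set)
     (\<lambda>n. lf_relboundaries q (nerve (\<U> n) A) {}) (\<lambda>m n. chain_push (fold pr [m..<n]))" for A
    by (rule complex_system.rel_tower[OF sysU])
  define Zr :: "real \<Rightarrow> nat \<Rightarrow> ('a set list \<Rightarrow> 'p mod_ring) set" where "Zr r n = lf_relcycles q (nerve (\<U> n) (XG r)) {}" for r n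
  define Br :: "real \<Rightarrow> nat \<Rightarrow> ('a set list \<Rightarrow> 'p mod_ring) set" where "Br r n = lf_relboundaries q (nerve (\<U> n) (XG r)) {}" for r n
  let ?T = "\<lambda>m n. chain_push (fold pr [m..<n]) :: (_ \<Rightarrow> 'p mod_ring) \<Rightarrow> _"
  have twr: "tower (Zr r) (Br r) ?T" for r
    using twU[of "XG r"] unfolding Zr_def[abs_def] Br_def[abs_def] .
  define W :: "real \<Rightarrow> ('p mod_ring, (nat \<times> ('a set list \<Rightarrow> 'p mod_ring) set) set) module" where
    "W r = HC \<U> pr q (XG r) {}" for r
  define t :: "real \<Rightarrow> real \<Rightarrow> (nat \<times> ('a set list \<Rightarrow> 'p mod_ring) set) set \<Rightarrow> (nat \<times> ('a set list \<Rightarrow> 'p mod_ring) set) set" where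
    "t r s = HC_inclusion \<U> pr q (XG s)" for r s
  have W: "W r = tower.lim (Zr r) (Br r) ?T" for r
    unfolding W_def HC_tower[OF nerve_system[OF U empty_subsetI]] Zr_def[abs_def] Br_def[abs_def] nerve_empty ..
  define c where "c r = tower.cl (Zr r) (Br r) ?T" for r
  \<comment> \<open>Maps between different values of \<open>r\<close> keep representatives, so the
    axioms of the outer direct system reduce to the inclusions of cycles.\<close>
  have Zr_mono: "Zr r n \<subseteq> Zr s n" and tcl: "z \<in> Zr r n \<Longrightarrow> t r s (c r n z) = c s n z" if rs: "r \<le> s" for r s n z
  proof -
    interpret system_inclusion "\<lambda>n. nerve (\<U> n) (XG r)" "\<lambda>n. nerve (\<U> n) (XG s)" pr
      using sysU nerve_mono[OF fixed_upto_mono[OF rs]] unfolding system_inclusion_def system_inclusion_axioms_def by blast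
    show "Zr r n \<subseteq> Zr s n" unfolding Zr_def by (rule cycles_sub)
    interpret b: tower "Zr s" "Br s" ?T by (rule twr)
    have st: "HC_stage \<U> q (XG s) {} = (b.stage :: nat \<Rightarrow> ('p mod_ring, _) module)"
      unfolding HC_stage_def[abs_def] b.stage_def[abs_def] lf_homology_def Zr_def Br_def nerve_empty ..
    have tr: "HC_trans \<U> pr q (XG s) {} = (b.trans :: nat \<Rightarrow> nat \<Rightarrow> ('a set list \<Rightarrow> 'p mod_ring) set \<Rightarrow> _)"
      unfolding HC_trans_def[abs_def] b.trans_def[abs_def] lf_homology_map_def Zr_def Br_def nerve_empty ..
    have h: "(\<lambda>n. lf_homology_map q (nerve (\<U> n) (XG s)) (nerve (\<U> n) {}) id) = (\<lambda>n. coset_map (fun_space (Zr s n)) (Br s n) (chain_push id))"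
      unfolding lf_homology_map_def Zr_def Br_def nerve_empty ..
    show "t r s (c r n z) = c s n z" if "z \<in> Zr r n"
      unfolding t_def HC_inclusion_def st tr h c_def
      using inclusion_cl[of z q n] that unfolding Zr_def[abs_def] Br_def[abs_def] .
  qed
  interpret O: dirsys W t
  proof (rule dirsys.intro)
    show "vectorspace class_ring (W r)" for r
    proof -
      interpret a: tower "Zr r" "Br r" ?T by (rule twr)
      show ?thesis unfolding W by (rule a.dirlim_vectorspace)
    qed
  next
    fix r s u :: real and P Q and a :: "'p mod_ring"
    interpret a: tower "Zr r" "Br r" ?T by (rule twr)
    assume P: "P \<in> carrier (W r)"
    then obtain n x where x: "x \<in> Zr r n" "P = c r n x" unfolding W a.carrier_lim c_def by blast
    show "t r r P = P" unfolding x(2) by (rule tcl[OF order_refl x(1)])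
    assume rs: "r \<le> s"
    interpret b: tower "Zr s" "Br s" ?T by (rule twr)
    have xs: "x \<in> Zr s n" using Zr_mono[OF rs] x(1) by blast
    show "t s u (t r s P) = t r u P" if su: "s \<le> u"
      unfolding x(2) tcl[OF rs x(1)] tcl[OF su xs] tcl[OF order_trans[OF rs su] x(1)] ..
    show "t r s P \<in> carrier (W s)" unfolding x(2) tcl[OF rs x(1)] unfolding W c_def by (rule b.cl_closed[OF xs])
    show "t r s (a \<odot>\<^bsub>W r\<^esub> P) = a \<odot>\<^bsub>W s\<^esub> t r s P"
    proof -
      have "a \<odot>\<^bsub>W r\<^esub> P = c r n (\<lambda>\<sigma>. a * x \<sigma>)" unfolding x(2) W c_def by (rule a.cl_ops(2)[OF x(1) x(1)])
      moreover have "a \<odot>\<^bsub>W s\<^esub> t r s P = c s n (\<lambda>\<sigma>. a * x \<sigma>)"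
        unfolding x(2) tcl[OF rs x(1)] unfolding W c_def by (rule b.cl_ops(2)[OF xs xs])
      ultimately show ?thesis using tcl[OF rs lin_subspaceD(3)[OF a.Z x(1)]] by simp
    qed
    assume Q: "Q \<in> carrier (W r)"
    obtain n x y where xy: "x \<in> Zr r n" "y \<in> Zr r n" "P = c r n x" "Q = c r n y"
      using a.cl_common[OF P[unfolded W] Q[unfolded W]] unfolding c_def by blast
    have xys: "x \<in> Zr s n" "y \<in> Zr s n" using Zr_mono[OF rs] xy by blast+
    show "t r s (P \<oplus>\<^bsub>W r\<^esub> Q) = t r s P \<oplus>\<^bsub>W s\<^esub> t r s Q"
    proof -
      have "P \<oplus>\<^bsub>W r\<^esub> Q = c r n (\<lambda>\<sigma>. x \<sigma> + y \<sigma>)" unfolding xy(3,4) W c_def by (rule a.cl_ops(1)[OF xy(1,2)])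
      moreover have "t r s P \<oplus>\<^bsub>W s\<^esub> t r s Q = c s n (\<lambda>\<sigma>. x \<sigma> + y \<sigma>)"
        unfolding xy(3,4) tcl[OF rs xy(1)] tcl[OF rs xy(2)] unfolding W c_def by (rule b.cl_ops(1)[OF xys])
      ultimately show ?thesis using tcl[OF rs lin_subspaceD(2)[OF a.Z xy(1,2)]] by simp
    qed
  qed
  have HC_bd: "HC_bd G X d \<phi> \<U> pr q = dirlim W t"
    unfolding HC_bd_def W_def[abs_def] t_def[abs_def] ..
  define D where "D = carrier (dirlim W t)"
  have "\<exists>r n z. z \<in> Zr r n \<and> P = O.dcls r (c r n z)" if PD: "P \<in> D" for P
  proof -
    obtain r p where p: "p \<in> carrier (W r)" "P = O.dcls r p" using PD O.carrier_dirlim unfolding D_def by blast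
    interpret a: tower "Zr r" "Br r" ?T by (rule twr)
    from p(1) obtain n z where "z \<in> Zr r n" "p = c r n z" unfolding W a.carrier_lim c_def by blast
    then show ?thesis using p(2) by blast
  qed
  then obtain r n z where rnz: "\<And>P. P \<in> D \<Longrightarrow> z P \<in> Zr (r P) (n P)" "\<And>P. P \<in> D \<Longrightarrow> P = O.dcls (r P) (c (r P) (n P) (z P))"
    by metis
  obtain L C where LC: "L > 0" "C > 0" "\<forall>h\<in>carrier G. \<forall>x\<in>X. \<forall>y\<in>X. d (\<phi> h x) (\<phi> h y) \<le> L * d x y + C"
    using phi_lipschitz by blast
  define J where "J r n k a \<longleftrightarrow> refining (\<U> n) (\<V> k) a \<and> (\<forall>U\<in>\<U> n. U \<inter> XG r \<noteq> {} \<longrightarrow> \<gamma> (a U) = a U)" for r n k a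
  have "\<exists>k a. J r n k a" for r n
  proof -
    obtain R where R: "\<forall>U\<in>\<U> n. \<forall>x\<in>U. \<forall>y\<in>U. d x y \<le> R" and sub: "\<Union>(\<U> n) = X"
      using bU[of n] unfolding bounded_covering_def by metis
    \<comment> \<open>Bounds the distance to a point x of \<open>U\<close> moved by at most
      \<open>r\<close>: R for the points of \<open>U\<close>, and for those of
      \<open>\<gamma> U\<close> the Lipschitz estimate L R + C plus the displacement of x. Then
      \<open>2 * E\<close> bounds the diameter of the union.\<close>
    define E where "E = \<bar>R\<bar> + (L * \<bar>R\<bar> + C) + \<bar>r\<bar>"
    have E: "\<bar>R\<bar> \<le> E" "\<bar>R\<bar> + (L * \<bar>R\<bar> + C) + \<bar>r\<bar> \<le> E" "0 \<le> E" unfolding E_def using LC by auto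
    obtain k where k: "\<forall>S\<subseteq>X. (\<forall>x\<in>S. \<forall>y\<in>S. d x y \<le> 2 * E) \<longrightarrow> (\<exists>U\<in>\<V> k. S \<subseteq> U)"
      using coarsening_system_lebesgue[OF cV, of "2 * E"] by (meson order_refl)
    have kk: "\<exists>V\<in>\<V> k. S \<subseteq> V" if "S \<subseteq> X" "\<And>x y. x \<in> S \<Longrightarrow> y \<in> S \<Longrightarrow> d x y \<le> 2 * E" for S
      using k[rule_format, of S] that by simp
    have "\<exists>V\<in>\<V> k. U \<subseteq> V \<and> (U \<inter> XG r \<noteq> {} \<longrightarrow> \<gamma> V = V)" if UU: "U \<in> \<U> n" for U
    proof (cases "U \<inter> XG r = {}")
      case True
      have dU: "d x y \<le> 2 * E" if "x \<in> U" "y \<in> U" for x y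
      proof -
        have "d x y \<le> R" using R UU that by blast
        then show ?thesis using E by linarith
      qed
      have "U \<subseteq> X" using sub UU by blast
      from kk[OF this dU] True show ?thesis by blast
    next
      case False
      then obtain x where x: "x \<in> U" "x \<in> X" "d x (\<phi> g x) \<le> r" using g by (auto simp: fixed_upto_def)
      have UX: "U \<subseteq> X" using sub UU by blast
      have near: "d w x \<le> E" if "w \<in> U \<union> \<gamma> U" for w
      proof -
        have yx: "d y x \<le> R" if "y \<in> U" for y using R UU x that by blast
        show ?thesis
        proof (cases "w \<in> U")
          case True
          then show ?thesis using yx[OF True] E by linarith
        next
          case False
          then obtain y where y: "y \<in> U" "w = \<phi> g y" using \<open>w \<in> U \<union> \<gamma> U\<close> by blast
          have yX: "y \<in> X" using y UX by blast
          have "d w x \<le> d w (\<phi> g x) + d (\<phi> g x) x"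
            using triangle[of w "\<phi> g x" x] phi_X[OF g] yX x(2) y(2) by simp
          moreover have "d w (\<phi> g x) \<le> L * d y x + C" unfolding y(2) using LC(3) g yX x(2) by blast
          moreover have "L * d y x \<le> L * \<bar>R\<bar>" using yx[OF y(1)] LC(1) by (intro mult_left_mono) auto
          moreover have "d (\<phi> g x) x \<le> r" using x(3) commute by metis
          ultimately show ?thesis using E by linarith
        qed
      qed
      have sX: "U \<union> \<gamma> U \<subseteq> X" using UX phi_X[OF g] by blast
      have dU: "d w w' \<le> 2 * E" if "w \<in> U \<union> \<gamma> U" "w' \<in> U \<union> \<gamma> U" for w w'
      proof -
        have "w \<in> X" "w' \<in> X" using sX that by blast+
        then have "d w w' \<le> d w x + d x w'" using triangle x(2) by blast
        moreover have "d x w' = d w' x" by (rule commute)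
        ultimately show ?thesis using near[OF that(1)] near[OF that(2)] by linarith
      qed
      from kk[OF sX dU] obtain V where V: "V \<in> \<V> k" "U \<union> \<gamma> U \<subseteq> V" by blast
      \<comment> \<open>The point \<open>\<phi> g x\<close> lies in \<open>\<gamma> U\<close>, hence
        in \<open>V\<close>, and it lies in \<open>\<gamma> V\<close> since x is in
        \<open>V\<close>.\<close>
      have "\<phi> g x \<in> V" "\<phi> g x \<in> \<gamma> V" using V(2) x(1) by auto
      then have "\<gamma> V = V" by (rule fixed_if_meet[OF GV V(1)])
      then show ?thesis using V by blast
    qed
    then obtain a where "\<And>U. U \<in> \<U> n \<Longrightarrow> a U \<in> \<V> k \<and> U \<subseteq> a U \<and> (U \<inter> XG r \<noteq> {} \<longrightarrow> \<gamma> (a U) = a U)" by metis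
    then show ?thesis unfolding J_def refining_def by blast
  qed
  then obtain k a where J: "\<And>\<rho> \<nu>. J \<rho> \<nu> (k \<rho> \<nu>) (a \<rho> \<nu>)" by metis
  have ka: "refining (\<U> \<nu>) (\<V> (k \<rho> \<nu>)) (a \<rho> \<nu>)"
    "U \<in> \<U> \<nu> \<Longrightarrow> U \<inter> XG \<rho> \<noteq> {} \<Longrightarrow> \<gamma> (a \<rho> \<nu> U) = a \<rho> \<nu> U" for \<rho> \<nu> U
    using J[of \<rho> \<nu>] unfolding J_def by blast+
  have sa: "smap (nerve (\<U> \<nu>) (XG \<rho>)) (fixc (nerve (\<V> (k \<rho> \<nu>)) X) \<gamma>) (a \<rho> \<nu>)" for \<rho> \<nu>
    unfolding smap_def
  proof (intro conjI ballI allI)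
    note sm = refining_smap[OF bU bV ka(1)[of \<nu> \<rho>], where A = "XG \<rho>"]
    show "finite {v \<in> \<Union>(nerve (\<U> \<nu>) (XG \<rho>)). a \<rho> \<nu> v = w}" for w using sm unfolding smap_def by blast
    fix S assume S: "S \<in> nerve (\<U> \<nu>) (XG \<rho>)"
    then have "a \<rho> \<nu> ` S \<in> nerve (\<V> (k \<rho> \<nu>)) X"
      using sm nerve_mono[OF XG_X] unfolding smap_def by blast
    moreover have "\<gamma> (a \<rho> \<nu> U) = a \<rho> \<nu> U" if "U \<in> S" for U
    proof -
      have "U \<in> {U \<in> \<U> \<nu>. U \<inter> XG \<rho> \<noteq> {}}" using S that unfolding nerve_verts[symmetric] by blast
      then show ?thesis using ka(2) by blast
    qed
    ultimately show "a \<rho> \<nu> ` S \<in> fixc (nerve (\<V> (k \<rho> \<nu>)) X) \<gamma>" unfolding fixc_def by blast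
  qed
  note rcU = lf_complex.cycles_eq[OF nerve_complex[OF bU]] and rbU = lf_complex.boundaries_eq[OF nerve_complex[OF bU]]
  note rcF = lf_complex.cycles_eq[OF S.fix_complex] and rbF = lf_complex.boundaries_eq[OF S.fix_complex]
  define K where "K P = k (r P) (n P)" for P
  define y where "y P = chain_push (a (r P) (n P)) (z P)" for P
  have yZ: "y P \<in> lf_relcycles q (fixc (nerve (\<V> (K P)) X) \<gamma>) {}" if P: "P \<in> D" for P
  proof -
    have z: "z P \<in> CH (nerve (\<U> (n P)) (XG (r P)))" "deg q (z P)" "lf_boundary (z P) = (\<lambda>_. 0)"
      using rnz(1)[OF P] unfolding Zr_def rcU by blast+
    note N = nerve_complex[OF bU]
    show ?thesis unfolding rcF y_def K_def
      using lf_complex.push_CH[OF N z(1) sa] lf_complex.push_deg[OF N z(2)] lf_complex.push_boundary[OF N z(1) sa] z(3)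
      by (simp add: chain_push_zero)
  qed
  define \<Psi> where "\<Psi> P = F.cl (K P) (y P)" for P
  show ?thesis unfolding HC_bd
  proof (rule vs_rank_le[OF O.dirlim_vectorspace F.dirlim_vectorspace])
    show "\<Psi> ` carrier (dirlim W t) \<subseteq> carrier F.lim"
      using F.cl_closed[OF yZ] unfolding \<Psi>_def D_def by blast
    show "inj_on \<Psi> (carrier (dirlim W t))"
      unfolding D_def[symmetric]
    proof (rule inj_onI)
      fix P Q assume P: "P \<in> D" and Q: "Q \<in> D" and "\<Psi> P = \<Psi> Q"
      from this(3)[unfolded \<Psi>_def F.cl_eq_iff[OF yZ[OF P] yZ[OF Q]]] obtain M where
        M: "K P \<le> M" "K Q \<le> M" and dM: "(\<lambda>\<sigma>. chain_push (fold prV [K P..<M]) (y P) \<sigma> - chain_push (fold prV [K Q..<M]) (y Q) \<sigma>)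
          \<in> lf_relboundaries q (fixc (nerve (\<V> M) X) \<gamma>) {}" by blast
      obtain R where R: "\<forall>V\<in>\<V> M. \<forall>x\<in>V. \<forall>y\<in>V. d x y \<le> R" using bV[of M] unfolding bounded_covering_def by metis
      \<comment> \<open>Large enough for both classes and for the diameters of the members of
        \<open>\<V> M\<close>, so that fixed members consist of points moved by at most
        \<open>s\<close>.\<close>
      define s where "s = max R (max (r P) (r Q))"
      have s: "R \<le> s" "r P \<le> s" "r Q \<le> s" by (auto simp: s_def)
      have fixV: "V \<subseteq> XG s" if V: "V \<in> \<V> M" "\<gamma> V = V" for V
      proof
        fix x assume x: "x \<in> V"
        have "d x (\<phi> h x) \<le> s" if h: "h \<in> carrier G" for h
        proof -
          obtain i :: nat where i: "h = g [^] i" using carrier_powers h by blast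
          have "(\<gamma> ^^ i) V = V" using V(2) by (induction i) auto
          then have "\<phi> h x \<in> V" using gamma_pow[OF GV V(1), of i] x unfolding i by blast
          then have "d x (\<phi> h x) \<le> R" using R V(1) x by blast
          then show ?thesis using s(1) by linarith
        qed
        moreover have "x \<in> X" using GcovD(1)[OF GV V(1)] x by blast
        ultimately show "x \<in> XG s" by (simp add: fixed_upto_def)
      qed
      obtain l0 where l0: "\<forall>l\<ge>l0. \<forall>V\<in>\<V> M. \<exists>U\<in>\<U> l. V \<subseteq> U" using refine_into[OF bV U, of M] by (elim exE)
      define l where "l = max l0 (max (n P) (n Q))"
      have l: "l0 \<le> l" "n P \<le> l" "n Q \<le> l" by (auto simp: l_def)
      obtain b where b: "refining (\<V> M) (\<U> l) b" using refining_exists[of "\<V> M" "\<U> l"] l0 l(1) by blast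
      have sb: "smap (fixc (nerve (\<V> M) X) \<gamma>) (nerve (\<U> l) (XG s)) b"
        unfolding smap_def
      proof (intro conjI ballI allI)
        fix S assume S: "S \<in> fixc (nerve (\<V> M) X) \<gamma>"
        then have SN: "S \<in> nerve (\<V> M) X" and fx: "\<forall>V\<in>S. \<gamma> V = V" unfolding fixc_def by auto
        obtain x V where x: "\<forall>U\<in>S. x \<in> U" "V \<in> S" using nerveD[OF SN] by blast
        have "V \<in> \<V> M" using nerveD(3)[OF SN] x(2) by blast
        then have "x \<in> XG s" using fixV fx x by blast
        then have "S \<in> nerve (\<V> M) (XG s)" using nerveD[OF SN] x(1) by (intro nerveI[of _ _ x]) auto
        then show "b ` S \<in> nerve (\<U> l) (XG s)" using refining_smap[OF bV bU b] unfolding smap_def by blast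
      next
        fix w
        have "finite {v \<in> \<Union>(nerve (\<V> M) X). b v = w}" using refining_smap[OF bV bU b] unfolding smap_def by blast
        then show "finite {v \<in> \<Union>(fixc (nerve (\<V> M) X) \<gamma>). b v = w}"
          by (rule rev_finite_subset) (auto simp: fixc_def)
      qed
      interpret s: tower "Zr s" "Br s" ?T by (rule twr)
      have NU: "lf_complex (nerve (\<U> i) A)" for i A by (rule nerve_complex[OF bU])
      have hom: "(\<lambda>\<sigma>. chain_push b (chain_push (fold prV [K P..<M]) (y P)) \<sigma> - ?T (n P) l (z P) \<sigma>) \<in> Br s l"
        if P: "P \<in> D" and KM: "K P \<le> M" and rs: "r P \<le> s" and nl: "n P \<le> l" for P
      proof -
        let ?a = "a (r P) (n P)" and ?f = "fold prV [K P..<M]"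
        let ?N = "nerve (\<U> (n P)) (XG (r P))"
        have zC: "z P \<in> CH ?N" using rnz(1)[OF P] unfolding Zr_def rcU by blast
        have sf: "smap (fixc (nerve (\<V> (K P)) X) \<gamma>) (fixc (nerve (\<V> M) X) \<gamma>) ?f"
          by (rule complex_system.F_K[OF S.fix_system KM])
        note sa' = sa[of "n P" "r P", folded K_def]
        note sfa = smap_comp[OF sa' sf NU]
        have "chain_push b (chain_push ?f (y P)) = chain_push b (chain_push (?f \<circ> ?a) (z P))"
          unfolding y_def by (subst lf_complex.push_comp[OF NU zC sa' sf S.fix_complex]) (rule refl)
        also have "\<dots> = chain_push (b \<circ> (?f \<circ> ?a)) (z P)"
          by (rule lf_complex.push_comp[OF NU zC sfa sb S.fix_complex])
        finally have e: "chain_push b (chain_push ?f (y P)) = chain_push (b \<circ> (?f \<circ> ?a)) (z P)" .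
        obtain \<kappa> :: "'a set \<Rightarrow> nat" where \<kappa>: "\<forall>S\<in>?N. inj_on \<kappa> S" using nerve_injective_rank[OF bU] by metis
        have r1: "refining (\<U> (n P)) (\<U> l) (fold pr [n P..<l])" by (rule refining_fold[OF U nl])
        have r2: "refining (\<U> (n P)) (\<U> l) (b \<circ> (?f \<circ> ?a))"
          by (rule refining_comp[OF refining_comp[OF ka(1)[of "n P" "r P", folded K_def] refining_fold[OF cV KM]] b])
        have sub: "?N \<subseteq> nerve (\<U> (n P)) (XG s)" by (rule nerve_mono[OF fixed_upto_mono[OF rs]])
        show ?thesis
          unfolding e Br_def
        proof (rule contiguous_homologous[OF NU NU lf_complex_empty lf_complex_empty, where \<kappa> = \<kappa>])
          show "{} \<subseteq> ?N" by simp
          have "smap ?N (nerve (\<U> l) (XG (r P))) (fold pr [n P..<l])" by (rule refining_smap[OF bU bU r1])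
          then show "smap ?N (nerve (\<U> l) (XG s)) (fold pr [n P..<l])"
            using nerve_mono[OF fixed_upto_mono[OF rs]] unfolding smap_def by blast
          show "smap ?N (nerve (\<U> l) (XG s)) (b \<circ> (?f \<circ> ?a))" by (rule smap_comp[OF sfa sb NU])
          show "fold pr [n P..<l] ` S \<union> (b \<circ> (?f \<circ> ?a)) ` S \<in> nerve (\<U> l) (XG s)" if "S \<in> ?N" for S
            using refining_contiguous[OF r1 r2, of S "XG s"] sub that by blast
          show "inj_on \<kappa> S" if "S \<in> ?N" for S using \<kappa> that by blast
          show "z P \<in> lf_relcycles q ?N {}" using rnz(1)[OF P] unfolding Zr_def .
        qed simp
      qed
      let ?p = "chain_push (fold prV [K P..<M]) (y P)" and ?q = "chain_push (fold prV [K Q..<M]) (y Q)"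
      have pq: "?p \<in> CH (fixc (nerve (\<V> M) X) \<gamma>)" "?q \<in> CH (fixc (nerve (\<V> M) X) \<gamma>)"
        using F.T_Z[OF M(1) yZ[OF P]] F.T_Z[OF M(2) yZ[OF Q]] unfolding rcF by blast+
      obtain e where e: "e \<in> CH (fixc (nerve (\<V> M) X) \<gamma>)" "deg (Suc q) e" "(\<lambda>\<sigma>. ?p \<sigma> - ?q \<sigma>) = lf_boundary e"
        using dM unfolding rbF by blast
      have "(\<lambda>\<sigma>. chain_push b ?p \<sigma> - chain_push b ?q \<sigma>) = lf_boundary (chain_push b e)"
        unfolding linear_betweenD(3)[OF lf_complex.push_linear[OF S.fix_complex sb] lin_subspace_CH pq, symmetric] e(3)
          lf_complex.push_boundary[OF S.fix_complex e(1) sb] ..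
      then have "(\<lambda>\<sigma>. chain_push b ?p \<sigma> - chain_push b ?q \<sigma>) \<in> Br s l"
        unfolding Br_def rbU using lf_complex.push_CH[OF S.fix_complex e(1) sb] lf_complex.push_deg[OF S.fix_complex e(2)] by blast
      from lin_subspaceD(2)[OF s.B lin_subspaceD(5)[OF s.B this hom[OF P M(1) s(2) l(2)]] hom[OF Q M(2) s(3) l(3)]]
      have fin: "(\<lambda>\<sigma>. ?T (n P) l (z P) \<sigma> - ?T (n Q) l (z Q) \<sigma>) \<in> Br s l" by (simp add: algebra_simps)
      have zs: "z P \<in> Zr s (n P)" "z Q \<in> Zr s (n Q)" using Zr_mono[OF s(2)] Zr_mono[OF s(3)] rnz(1)[OF P] rnz(1)[OF Q] by blast+
      have "c s (n P) (z P) = c s (n Q) (z Q)"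
        unfolding c_def s.cl_eq_iff[OF zs] using fin l by blast
      moreover have cW: "c (r x) (n x) (z x) \<in> carrier (W (r x))" if "x \<in> D" for x
      proof -
        interpret a: tower "Zr (r x)" "Br (r x)" ?T by (rule twr)
        show ?thesis unfolding W c_def by (rule a.cl_closed[OF rnz(1)[OF that]])
      qed
      ultimately have "O.dcls (r P) (c (r P) (n P) (z P)) = O.dcls (r Q) (c (r Q) (n Q) (z Q))"
        unfolding O.dcls_eq_iff[OF cW[OF P] cW[OF Q]]
        using s tcl[OF s(2) rnz(1)[OF P]] tcl[OF s(3) rnz(1)[OF Q]] by (intro exI[of _ s]) simp
      then show "P = Q" using rnz(2)[OF P] rnz(2)[OF Q] by simp
    qed
  qed
qed

end

section \<open>The transfer\<close>

text \<open>
  Chains of the orbit complex modulo chains of the fixed complex are identified with the chains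
  of the form \<open>\<tau>\<^bsup>p - 1\<^esup> e\<close>, as \<open>\<tau>\<^bsup>p - 1\<^esup>\<close> is the norm.
\<close>

context smith_complex
begin

definition orb :: "'v \<Rightarrow> 'v set" where "orb v = range (\<lambda>i. (\<gamma> ^^ i) v)"

text \<open>Simplices are sets of orbits of vertices; by regularity (\<open>orbit_lift\<close>) they
  correspond to orbits of simplices.\<close>

definition Kbar :: "'v set set set" where "Kbar = (image orb) ` K"

definition Fbar :: "'v set set set" where "Fbar = (image orb) ` fixc K \<gamma>"

text \<open>The transfer: pullback along the orbit map, with the fixed simplices removed. A pullback
  is invariant, and without fixed part an invariant chain is a norm.\<close>

definition trf :: "('v set list \<Rightarrow> 'p mod_ring) \<Rightarrow> 'v list \<Rightarrow> 'p mod_ring" where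
  "trf c \<sigma> = (if set \<sigma> \<in> K - fixc K \<gamma> then c (map orb \<sigma>) else 0)"

lemma pos_p: "0 < CARD('p)" by (rule prime_gt_0_nat[OF p])

lemma p_minus_1: "0 < CARD('p) - 1" using prime_ge_2_nat[OF p] by simp

lemma orb_self: "v \<in> orb v" unfolding orb_def by (rule range_eqI[of _ _ 0]) simp

lemma gamma_back: "v \<in> \<Union>K \<Longrightarrow> (\<gamma> ^^ (CARD('p) * i - i)) ((\<gamma> ^^ i) v) = v"
proof -
  assume v: "v \<in> \<Union>K"
  have "i \<le> CARD('p) * i" using pos_p by simp
  then have "CARD('p) * i - i + i = CARD('p) * i" by simp
  then have "(\<gamma> ^^ (CARD('p) * i - i)) ((\<gamma> ^^ i) v) = (\<gamma> ^^ (CARD('p) * i)) v" by (metis comp_apply funpow_add)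
  then show ?thesis using period_mult[OF v] by simp
qed

lemma orb_gamma: "v \<in> \<Union>K \<Longrightarrow> orb ((\<gamma> ^^ i) v) = orb v"
proof (intro equalityI subsetI)
  fix w assume "w \<in> orb ((\<gamma> ^^ i) v)"
  then obtain j where "w = (\<gamma> ^^ (j + i)) v" unfolding orb_def by (auto simp: funpow_add)
  then show "w \<in> orb v" unfolding orb_def by blast
next
  fix w assume v: "v \<in> \<Union>K" and "w \<in> orb v"
  then obtain j where "w = (\<gamma> ^^ j) v" unfolding orb_def by blast
  then have "w = (\<gamma> ^^ j) ((\<gamma> ^^ (CARD('p) * i - i)) ((\<gamma> ^^ i) v))" using gamma_back[OF v] by simp
  then have "w = (\<gamma> ^^ (j + (CARD('p) * i - i))) ((\<gamma> ^^ i) v)" by (simp only: funpow_add o_apply)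
  then show "w \<in> orb ((\<gamma> ^^ i) v)" unfolding orb_def by blast
qed

lemma orb_eq: "orb v = orb w \<Longrightarrow> \<exists>i. w = (\<gamma> ^^ i) v"
  using orb_self[of w] unfolding orb_def by auto

lemma finite_orb: "v \<in> \<Union>K \<Longrightarrow> finite (orb v)"
proof -
  assume v: "v \<in> \<Union>K"
  have "orb v \<subseteq> (\<lambda>i. (\<gamma> ^^ i) v) ` {..<CARD('p)}"
    unfolding orb_def using funpow_mod[OF v] pos_p by (metis image_subsetI imageI lessThan_iff mod_less_divisor)
  then show ?thesis by (rule finite_subset) simp
qed

lemma orb_verts: "v \<in> \<Union>K \<Longrightarrow> orb v \<subseteq> \<Union>K"
  unfolding orb_def using gamma_vert by blast

lemma Kbar_verts: "\<Union>Kbar = orb ` (\<Union>K)" unfolding Kbar_def by blast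

lemma Kbar_complex: "lf_complex Kbar"
proof
  fix S assume "S \<in> Kbar"
  then obtain R where R: "R \<in> K" "S = orb ` R" unfolding Kbar_def by blast
  show "finite S \<and> S \<noteq> {}" using simplex[OF R(1)] R(2) by simp
  show "Q \<in> Kbar" if Q: "Q \<subseteq> S" "Q \<noteq> {}" for Q
  proof -
    define R' where "R' = {v \<in> R. orb v \<in> Q}"
    have "Q = orb ` R'" using Q(1) R(2) unfolding R'_def by blast
    moreover have "R' \<noteq> {}" using Q(2) calculation by blast
    moreover have "R' \<subseteq> R" unfolding R'_def by (rule Collect_restrict)
    ultimately have "Q = orb ` R'" "R' \<in> K" using face[OF R(1)] by blast+
    then show ?thesis unfolding Kbar_def by blast
  qed
next
  fix w
  show "finite {S \<in> Kbar. w \<in> S}"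
  proof (cases "w \<in> \<Union>Kbar")
    case True
    then obtain v where v: "v \<in> \<Union>K" "w = orb v" unfolding Kbar_verts by blast
    have "{S \<in> Kbar. w \<in> S} \<subseteq> (image orb) ` (\<Union>x\<in>orb v. {R \<in> K. x \<in> R})"
    proof
      fix S assume "S \<in> {S \<in> Kbar. w \<in> S}"
      then obtain R x where R: "R \<in> K" "S = orb ` R" "x \<in> R" "orb x = orb v" using v(2) unfolding Kbar_def by blast
      then have "x \<in> orb v" using orb_self[of x] by simp
      then show "S \<in> (image orb) ` (\<Union>x\<in>orb v. {R \<in> K. x \<in> R})" using R by blast
    qed
    moreover have "finite (\<Union>x\<in>orb v. {R \<in> K. x \<in> R})" by (intro finite_UN_I finite_orb v locfin)
    ultimately show ?thesis by (meson finite_imageI finite_subset)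
  next
    case False
    then have "{S \<in> Kbar. w \<in> S} = {}" by blast
    then show ?thesis by (simp only: finite.emptyI)
  qed
qed

lemma Fbar_sub: "Fbar \<subseteq> Kbar" unfolding Fbar_def Kbar_def using fixc_sub by blast

lemma Fbar_complex: "lf_complex Fbar"
proof
  interpret B: lf_complex Kbar by (rule Kbar_complex)
  fix S assume S: "S \<in> Fbar"
  then obtain R where R: "R \<in> fixc K \<gamma>" "S = orb ` R" unfolding Fbar_def by blast
  show "finite S \<and> S \<noteq> {}" using B.simplex S Fbar_sub by blast
  show "Q \<in> Fbar" if Q: "Q \<subseteq> S" "Q \<noteq> {}" for Q
  proof -
    define R' where "R' = {v \<in> R. orb v \<in> Q}"
    have "Q = orb ` R'" using Q(1) R(2) unfolding R'_def by blast
    moreover have "R' \<noteq> {}" using Q(2) calculation by blast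
    moreover have "R' \<subseteq> R" unfolding R'_def by (rule Collect_restrict)
    ultimately have "Q = orb ` R'" "R' \<in> fixc K \<gamma>" using lf_complex.face[OF fixc_complex R(1)] by blast+
    then show ?thesis unfolding Fbar_def by blast
  qed
next
  fix w show "finite {S \<in> Fbar. w \<in> S}"
    by (rule finite_subset[OF _ lf_complex.locfin[OF Kbar_complex, of w]]) (use Fbar_sub in blast)
qed

lemma smap_orb: "smap K Kbar orb"
  unfolding smap_def
proof (intro conjI ballI allI)
  show "orb ` S \<in> Kbar" if "S \<in> K" for S using that unfolding Kbar_def by blast
  fix w
  show "finite {v \<in> \<Union>K. orb v = w}"
  proof (cases "\<exists>v\<in>\<Union>K. orb v = w")
    case True
    then obtain v where v: "v \<in> \<Union>K" "orb v = w" by blast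
    have "{v \<in> \<Union>K. orb v = w} \<subseteq> orb v" using orb_self v(2) by auto
    then show ?thesis using finite_orb[OF v(1)] by (rule finite_subset)
  next
    case False
    then have "{v \<in> \<Union>K. orb v = w} = {}" by blast
    then show ?thesis by (simp only: finite.emptyI)
  qed
qed

text \<open>Each entry of \<open>ws\<close> is a translate of the entry of \<open>vs\<close>, with
  an exponent that depends on the entry. Regularity replaces these exponents by a single
  one.\<close>

lemma orbit_lift:
  assumes vs: "set vs \<in> K" and ws: "set ws \<in> K" and o: "map orb vs = map orb ws"
  shows "\<exists>k. ws = map (\<gamma> ^^ k) vs"
proof -
  have l: "length vs = length ws" using o by (metis length_map)
  have "\<exists>i. ws ! j = (\<gamma> ^^ i) (vs ! j)" if "j < length vs" for j
  proof -
    have "orb (vs ! j) = orb (ws ! j)" using o that l by (metis nth_map)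
    then show ?thesis by (rule orb_eq)
  qed
  then obtain i where i: "\<And>j. j < length vs \<Longrightarrow> ws ! j = (\<gamma> ^^ (i j)) (vs ! j)" by metis
  let ?ks = "map i [0..<length vs]"
  have m: "map2 (\<lambda>k. \<gamma> ^^ k) ?ks vs = ws" by (rule nth_equalityI) (use l i in auto)
  have "\<exists>k. \<forall>j<length vs. (\<gamma> ^^ k) (vs ! j) = (\<gamma> ^^ (?ks ! j)) (vs ! j)"
    by (rule regular) (use vs ws m in simp_all)
  then obtain k where k: "\<forall>j<length vs. (\<gamma> ^^ k) (vs ! j) = (\<gamma> ^^ (?ks ! j)) (vs ! j)" by blast
  have "ws = map (\<gamma> ^^ k) vs" by (rule nth_equalityI) (use l i k in auto)
  then show ?thesis by blast
qed

lemma fixed_orb: "v \<in> \<Union>K \<Longrightarrow> w \<in> \<Union>K \<Longrightarrow> orb v = orb w \<Longrightarrow> \<gamma> w = w \<Longrightarrow> \<gamma> v = v"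
  using orb_eq[of v w] gamma_fixed_iff[of v] by metis

text \<open>The orbit of a fixed vertex consists of that vertex, so a simplex with the same orbits
  as a fixed simplex is fixed.\<close>

lemma free_not_Fbar: "S \<in> K \<Longrightarrow> S \<notin> fixc K \<gamma> \<Longrightarrow> orb ` S \<notin> Fbar"
proof
  assume S: "S \<in> K" "S \<notin> fixc K \<gamma>" and "orb ` S \<in> Fbar"
  then obtain R where R: "R \<in> fixc K \<gamma>" "orb ` S = orb ` R" unfolding Fbar_def by blast
  have "\<gamma> v = v" if v: "v \<in> S" for v
  proof -
    obtain w where w: "w \<in> R" "orb v = orb w" using v R(2) by blast
    have "\<gamma> w = w" "w \<in> \<Union>K" using w(1) R(1) unfolding fixc_def by auto
    then show ?thesis using fixed_orb[of v w] w(2) S(1) v by blast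
  qed
  then show False using S unfolding fixc_def by blast
qed

lemma trf_CH:
  assumes c: "c \<in> CH Kbar"
  shows "trf c \<in> CH K"
  unfolding CH_def alt_def
proof (intro CollectI conjI allI impI)
  fix xs v w ys
  show "trf c (xs @ v # v # ys) = 0" using altD(1)[OF CH_D(1)[OF c], of "map orb xs" "orb v" "map orb ys"] by (simp add: trf_def)
  have "set (xs @ v # w # ys) = set (xs @ w # v # ys)" by auto
  then show "trf c (xs @ v # w # ys) = - trf c (xs @ w # v # ys)"
    using altD(2)[OF CH_D(1)[OF c], of "map orb xs" "orb v" "orb w" "map orb ys"] by (simp add: trf_def)
next
  fix \<sigma> assume "trf c \<sigma> \<noteq> 0" then show "set \<sigma> \<in> K" by (auto simp: trf_def split: if_splits)
qed

lemma trf_deg: "deg q c \<Longrightarrow> deg q (trf c)"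
  unfolding deg_def trf_def by (metis length_map)

lemma trf_fixed: "set \<sigma> \<in> fixc K \<gamma> \<Longrightarrow> trf c \<sigma> = 0" by (simp add: trf_def)

lemma trf_Fbar: "c \<in> CH Fbar \<Longrightarrow> trf c = (\<lambda>_. 0)"
proof
  fix \<sigma> assume c: "c \<in> CH Fbar"
  show "trf c \<sigma> = 0"
    using CH_D(2)[OF c, of "map orb \<sigma>"] free_not_Fbar[of "set \<sigma>"] unfolding trf_def by auto
qed

lemma tau_trf:
  assumes c: "c \<in> CH Kbar"
  shows "tau \<gamma> (trf c) = (\<lambda>_. 0)"
proof
  fix \<sigma>
  show "tau \<gamma> (trf c) \<sigma> = 0"
  proof (cases "set \<sigma> \<subseteq> \<Union>K")
    case True
    have "map orb (map dl \<sigma>) = map orb \<sigma>" using True orb_gamma unfolding dl_def by (auto simp: subset_iff)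
    moreover have "set (map dl \<sigma>) \<in> K - fixc K \<gamma> \<longleftrightarrow> set \<sigma> \<in> K - fixc K \<gamma>"
      unfolding dl_def using gamma_simplex[OF True] gamma_fixc[OF True] by simp
    ultimately have "trf c (map dl \<sigma>) = trf c \<sigma>" unfolding trf_def by presburger
    then show ?thesis unfolding tau_eq[OF trf_CH[OF c] True] by simp
  next
    case False
    then show ?thesis by (rule CH_outside[OF tau_CH[OF trf_CH[OF c]]])
  qed
qed

lemma trf_norm: "c \<in> CH Kbar \<Longrightarrow> (tau \<gamma> ^^ (CARD('p) - 1)) (mT (trf c)) = trf c"
  by (rule norm_mT[OF trf_CH trf_fixed tau_trf])

text \<open>On fixed simplices the boundary of a transfer vanishes, because the transfer is a norm
  and so is its boundary. At a free simplex the vertices that extend it correspond bijectively to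
  the orbits that extend its image.\<close>

lemma trf_boundary:
  assumes c: "c \<in> CH Kbar"
  shows "lf_boundary (trf c) = trf (lf_boundary c)"
proof
  fix \<sigma>
  interpret B: lf_complex Kbar by (rule Kbar_complex)
  show "lf_boundary (trf c) \<sigma> = trf (lf_boundary c) \<sigma>"
  proof (cases "set \<sigma> \<in> K - fixc K \<gamma>")
    case False
    have "lf_boundary (trf c) \<sigma> = 0"
    proof (cases "set \<sigma> \<in> K")
      case True
      have "lf_boundary (trf c) = (tau \<gamma> ^^ (CARD('p) - 1)) (lf_boundary (mT (trf c)))"
        using tau_pow_boundary[OF mT_CH[OF trf_CH[OF c]]] trf_norm[OF c] by metis
      then show ?thesis
        using tau_pow_fixed_simplex[OF boundary_CH[OF mT_CH[OF trf_CH[OF c]]] _ p_minus_1, of \<sigma>] True False by simp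
    next
      case False
      then show ?thesis using CH_D(2)[OF boundary_CH[OF trf_CH[OF c]], of \<sigma>] by blast
    qed
    moreover have "trf (lf_boundary c) \<sigma> = 0" using False unfolding trf_def by (simp only: if_False)
    ultimately show ?thesis by (simp only:)
  next
    case True
    then have sK: "set \<sigma> \<in> K" and free: "set \<sigma> \<notin> fixc K \<gamma>" by auto
    have ne: "\<sigma> \<noteq> []" using simplex[OF sK] by auto
    \<comment> \<open>Includes the vertices of \<open>\<sigma>\<close> itself, where the alternating
      chain vanishes.\<close>
    define V where "V = {v. set (v # \<sigma>) \<in> K}"
    have "V \<subseteq> star (hd \<sigma>)"
    proof
      fix v assume "v \<in> V"
      then show "v \<in> star (hd \<sigma>)" using simplex_star[of "set (v # \<sigma>)" "hd \<sigma>"] ne by (auto simp: V_def)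
    qed
    then have fV: "finite V" using finite_star finite_subset by blast
    \<comment> \<open>Two extensions over the same orbits differ by a power of
      \<open>\<gamma>\<close> that fixes all vertices of \<open>\<sigma>\<close>; as
      \<open>\<sigma>\<close> is not fixed, p divides the exponent.\<close>
    have inj: "inj_on orb V"
    proof (rule inj_onI)
      fix v v' assume v: "v \<in> V" "v' \<in> V" and "orb v = orb v'"
      then obtain k where k: "v' # \<sigma> = map (\<gamma> ^^ k) (v # \<sigma>)"
        using orbit_lift[of "v # \<sigma>" "v' # \<sigma>"] unfolding V_def by auto
      have "CARD('p) dvd k"
      proof (rule ccontr)
        assume nd: "\<not> CARD('p) dvd k"
        have "\<gamma> x = x" if x: "x \<in> set \<sigma>" for x
        proof -
          have "map (\<gamma> ^^ k) \<sigma> = \<sigma>" using k by simp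
          then have "(\<gamma> ^^ k) x = x" using x by (metis list.map_ident map_eq_conv)
          then show ?thesis using fixed_if_power_fixed[of x k] nd sK x by blast
        qed
        then show False using free sK unfolding fixc_def by blast
      qed
      then obtain j where "k = CARD('p) * j" by (elim dvdE)
      moreover have "v \<in> \<Union>K" using v(1) unfolding V_def by auto
      ultimately show "v = v'" using k period_mult[of v j] by simp
    qed
    have vne: "set (v # \<sigma>) \<notin> fixc K \<gamma>" for v
      using free sK unfolding fixc_def by auto
    have "lf_boundary (trf c) \<sigma> = bd V (trf c) \<sigma>"
      by (rule boundary_bd'[OF trf_CH[OF c] ne fV]) (simp add: V_def)
    also have "\<dots> = (\<Sum>v\<in>V. c (orb v # map orb \<sigma>))"
      unfolding bd_def using vne by (intro sum.cong) (auto simp: trf_def V_def)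
    also have "\<dots> = bd (orb ` V) c (map orb \<sigma>)"
      unfolding bd_def by (simp add: sum.reindex[OF inj])
    also have "\<dots> = lf_boundary c (map orb \<sigma>)"
    proof (rule lf_boundary_bd[symmetric])
      show "finite (orb ` V)" using fV by simp
      show "map orb \<sigma> \<noteq> []" using ne by simp
      fix w assume "c (w # map orb \<sigma>) \<noteq> 0"
      then have "set (w # map orb \<sigma>) \<in> Kbar" by (rule CH_D(2)[OF c])
      then obtain S where S: "S \<in> K" "set (w # map orb \<sigma>) = orb ` S" unfolding Kbar_def by blast
      have "\<forall>x\<in>set \<sigma>. \<exists>y\<in>S. orb y = orb x" using S(2) by (metis image_iff list.set_intros(2) list.set_map)
      then obtain h where h: "\<And>x. x \<in> set \<sigma> \<Longrightarrow> h x \<in> S \<and> orb (h x) = orb x" by metis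
      obtain u where u: "u \<in> S" "w = orb u" using S(2) by (metis image_iff list.set_intros(1))
      have "set (map h \<sigma>) \<in> K" using h ne by (intro face[OF S(1)]) auto
      moreover have "map orb \<sigma> = map orb (map h \<sigma>)" using h by simp
      ultimately obtain k where k: "map h \<sigma> = map (\<gamma> ^^ k) \<sigma>" using orbit_lift[OF sK] by blast
      \<comment> \<open>A simplex over \<open>w\<close> and the orbits of \<open>\<sigma>\<close> is
        translated back so that it extends \<open>\<sigma>\<close> itself.\<close>
      define v where "v = (\<gamma> ^^ (CARD('p) * k - k)) u"
      have uK: "u \<in> \<Union>K" using u(1) S(1) by blast
      have vK: "v \<in> \<Union>K" unfolding v_def by (rule gamma_vert[OF uK])
      have gv: "(\<gamma> ^^ k) v = u"
        using gamma_back[OF uK, of k] unfolding v_def by (metis add.commute comp_apply funpow_add)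
      have sub: "set (v # \<sigma>) \<subseteq> \<Union>K" using vK sK by auto
      have "(\<gamma> ^^ k) ` set (v # \<sigma>) = insert u (set (map h \<sigma>))" using gv unfolding k by simp
      also have "\<dots> \<in> K" using h u(1) by (intro face[OF S(1)]) auto
      finally have "set (v # \<sigma>) \<in> K" using gamma_simplex[OF sub] by blast
      moreover have "orb v = w" unfolding v_def u(2) by (rule orb_gamma[OF uK])
      ultimately show "w \<in> orb ` V" unfolding V_def by blast
    qed
    also have "\<dots> = trf (lf_boundary c) \<sigma>" using True by (simp add: trf_def)
    finally show ?thesis .
  qed
qed

text \<open>Over an ordered simplex of the orbit complex outside \<open>Fbar\<close> there is
  exactly one ordered simplex from the transversal. So projecting the transversal part of the
  transfer returns \<open>c\<close> up to chains of \<open>Fbar\<close>.\<close>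

lemma push_orb_trf:
  assumes c: "c \<in> CH Kbar"
  shows "(\<lambda>\<omega>. chain_push orb (mT (trf c)) \<omega> - c \<omega>) \<in> CH Fbar"
proof -
  let ?e = "mT (trf c)" let ?D = "\<lambda>\<omega>. chain_push orb ?e \<omega> - c \<omega>"
  have e: "?e \<in> CH K" by (rule mT_CH[OF trf_CH[OF c]])
  have D: "?D \<in> CH Kbar" by (rule lin_subspaceD(5)[OF lin_subspace_CH push_CH[OF e smap_orb] c])
  have ev: "?e \<sigma> = (if set \<sigma> \<in> T then c (map orb \<sigma>) else 0)" for \<sigma>
    unfolding mT_def trf_def T_def by auto
  have "?D \<omega> = 0" if w: "set \<omega> \<notin> Fbar" for \<omega>
  proof (cases "set \<omega> \<in> Kbar \<and> c \<omega> \<noteq> 0")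
    case False
    have "c \<omega> = 0" using False CH_D(2)[OF c] by blast
    moreover have "chain_push orb ?e \<omega> = 0"
    proof (rule ccontr)
      assume "chain_push orb ?e \<omega> \<noteq> 0"
      then obtain \<sigma> where "map orb \<sigma> = \<omega>" "?e \<sigma> \<noteq> 0" using chain_push_support by blast
      then show False using \<open>c \<omega> = 0\<close> unfolding ev by (auto split: if_splits)
    qed
    ultimately show ?thesis by simp
  next
    case True
    then obtain S where S: "S \<in> K" "set \<omega> = orb ` S" unfolding Kbar_def by blast
    have free: "S \<notin> fixc K \<gamma>" using w S(2) unfolding Fbar_def by blast
    have injS: "inj_on orb S"
    proof (rule inj_onI)
      fix v v' assume v: "v \<in> S" "v' \<in> S" "orb v = orb v'"
      then obtain i where "v' = (\<gamma> ^^ i) v" using orb_eq by blast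
      then show "v = v'" using one_per_orbit[OF S(1) v(1)] v(2) by metis
    qed
    define \<sigma>1 where "\<sigma>1 = map (inv_into S orb) \<omega>"
    have m1: "map orb \<sigma>1 = \<omega>" unfolding \<sigma>1_def map_map
      by (rule map_idI) (use S(2) in \<open>simp add: f_inv_into_f\<close>)
    have s1: "set \<sigma>1 = S" unfolding \<sigma>1_def using S(2) injS by (simp add: inv_into_image_cancel)
    obtain i where i: "(dl ^^ i) ` S \<in> T" using T_unique[OF S(1) free] by blast
    define \<sigma>0 where "\<sigma>0 = map (dl ^^ i) \<sigma>1"
    have s0: "set \<sigma>0 \<in> T" using i s1 by (simp add: \<sigma>0_def)
    have m0: "map orb \<sigma>0 = \<omega>"
    proof -
      have "orb ((dl ^^ i) v) = orb v" if "v \<in> S" for v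
        unfolding dl_pow using orb_gamma[of v] S(1) that by blast
      then show ?thesis unfolding \<sigma>0_def m1[symmetric] map_map using s1 by simp
    qed
    have TK: "set \<sigma> \<in> K" "set \<sigma> \<notin> fixc K \<gamma>" "rep (set \<sigma>) = set \<sigma>" if "set \<sigma> \<in> T" for \<sigma>
      using that by (auto simp: T_def)
    \<comment> \<open>Two lifts differ by one power of \<open>\<gamma>\<close>; both are the chosen
      simplex of their common orbit, so the power preserves this simplex and p divides the
      exponent.\<close>
    have "\<sigma> = \<sigma>0" if s: "map orb \<sigma> = \<omega>" "set \<sigma> \<in> T" for \<sigma>
    proof -
      obtain k where k: "\<sigma> = map (\<gamma> ^^ k) \<sigma>0"
        using orbit_lift[OF TK(1)[OF s0] TK(1)[OF s(2)]] s(1) m0 by metis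
      have sub: "set \<sigma>0 \<subseteq> \<Union>K" using TK(1)[OF s0] by blast
      have img: "set \<sigma> = (\<gamma> ^^ k) ` set \<sigma>0" unfolding k by simp
      have "set \<sigma> = set \<sigma>0"
        using rep_gamma[OF sub, of k] TK(3)[OF s(2)] TK(3)[OF s0] unfolding img[symmetric] by simp
      then have "CARD('p) dvd k" using free_simplex[OF TK(1,2)[OF s0], of k] img by simp
      then obtain j where j: "k = CARD('p) * j" by (elim dvdE)
      show ?thesis unfolding k j by (rule map_idI) (use period_mult sub in blast)
    qed
    then have uq: "\<sigma> = \<sigma>0" if "map orb \<sigma> = \<omega> \<and> ?e \<sigma> \<noteq> 0" for \<sigma>
      using that unfolding ev by (metis (full_types))
    have "?e \<sigma>0 \<noteq> 0" unfolding ev m0 if_P[OF s0] using True by blast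
    then have "{\<sigma>. map orb \<sigma> = \<omega> \<and> ?e \<sigma> \<noteq> 0} = {\<sigma>0}" using m0 uq by (intro equalityI subsetI) blast+
    moreover have "distinct \<omega>" using alt_distinct[OF CH_D(1)[OF c]] True by blast
    ultimately have "chain_push orb ?e \<omega> = ?e \<sigma>0" by (simp add: chain_push_def)
    then show ?thesis using s0 m0 unfolding ev by simp
  qed
  then show ?thesis using CH_D(1)[OF D] unfolding CH_def by blast
qed

end

section \<open>The transfer in the limit\<close>

context smith_system
begin

text \<open>A relative cycle goes to the transfer \<open>s\<close> of its image, which is
  \<tau>^(p-1) of a chain \<open>e\<close>. If two transfers become homologous, their chains
  \<open>e\<close> agree up to a boundary, a chain \<tau> e1 and a fixed chain. The map
  \<open>\<beta>\<close> back is constant on orbits, so it kills \<tau> e1, and it carries fixed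
  chains into \<open>LW\<close>. Of \<open>a n\<close> only the composite with the orbit map has to
  be simplicial.\<close>

lemma rel_le_smith:
  fixes KW LW :: "nat \<Rightarrow> 'w set set" and a :: "nat \<Rightarrow> 'w \<Rightarrow> 'v"
  assumes sys: "complex_system KW LW fW"
    and \<alpha>: "\<And>n. smap (KW n) (smith_complex.Kbar (K (k n)) \<gamma>) (smith_complex.orb \<gamma> \<circ> a n)"
      "\<And>n. smap (LW n) (smith_complex.Fbar (K (k n)) \<gamma>) (smith_complex.orb \<gamma> \<circ> a n)"
    and aK: "\<And>n w. w \<in> \<Union>(KW n) \<Longrightarrow> a n w \<in> \<Union>(K (k n))"
    and \<beta>: "\<And>n m M. k n \<le> M \<Longrightarrow> k m \<le> M \<Longrightarrow> \<exists>l \<beta>. n \<le> l \<and> m \<le> l \<and> smap (K M) (KW l) \<beta> \<and>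
      smap (fixc (K M) \<gamma>) (LW l) \<beta> \<and> (\<forall>v\<in>\<Union>(K M). \<beta> (\<gamma> v) = \<beta> v) \<and>
      (\<forall>i\<in>{n, m}. (\<forall>S\<in>KW i. fold fW [i..<l] ` S \<union> (\<beta> \<circ> (F (k i) M \<circ> a i)) ` S \<in> KW l) \<and>
         (\<forall>S\<in>LW i. fold fW [i..<l] ` S \<union> (\<beta> \<circ> (F (k i) M \<circ> a i)) ` S \<in> LW l))"
    and \<kappa>: "\<And>n. \<exists>\<kappa> :: 'w \<Rightarrow> nat. \<forall>S\<in>KW n. inj_on \<kappa> S"
  shows "vs_rank (tower.lim (\<lambda>n. lf_relcycles q (KW n) (LW n) :: ('w list \<Rightarrow> 'p mod_ring) set)
      (\<lambda>n. lf_relboundaries q (KW n) (LW n)) (\<lambda>m n. chain_push (fold fW [m..<n])))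
    \<le> vs_rank (smith_lim (CARD('p) - 1) q :: ('p mod_ring, _) module)"
proof -
  interpret W: complex_system KW LW fW by fact
  interpret Wt: tower "\<lambda>n. lf_relcycles q (KW n) (LW n) :: ('w list \<Rightarrow> 'p mod_ring) set"
      "\<lambda>n. lf_relboundaries q (KW n) (LW n)" "\<lambda>m n. chain_push (fold fW [m..<n])" by (rule W.rel_tower)
  note rc = lf_complex.relcycles_eq[OF W.K W.LK]
  define cb where "cb n z = chain_push (smith_complex.orb \<gamma> \<circ> a n) z" for n and z :: "'w list \<Rightarrow> 'p mod_ring"
  have cb: "cb n z \<in> CH (smith_complex.Kbar (K (k n)) \<gamma>)" "deg q (cb n z)"
      "lf_boundary (cb n z) \<in> CH (smith_complex.Fbar (K (k n)) \<gamma>)" if z: "z \<in> lf_relcycles q (KW n) (LW n)" for n z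
  proof -
    have z': "z \<in> CH (KW n)" "deg q z" "lf_boundary z \<in> CH (LW n)" using z unfolding rc by blast+
    show "cb n z \<in> CH (smith_complex.Kbar (K (k n)) \<gamma>)" unfolding cb_def by (rule lf_complex.push_CH[OF W.K z'(1) \<alpha>(1)])
    show "deg q (cb n z)" unfolding cb_def by (rule lf_complex.push_deg[OF W.K z'(2)])
    show "lf_boundary (cb n z) \<in> CH (smith_complex.Fbar (K (k n)) \<gamma>)"
      unfolding cb_def lf_complex.push_boundary[OF W.K z'(1) \<alpha>(1)] by (rule lf_complex.push_CH[OF W.L z'(3) \<alpha>(2)])
  qed
  define s where "s n z = smith_complex.trf (K (k n)) \<gamma> (cb n z)" for n z
  define e where "e n z = regular_complex.mT (K (k n)) \<gamma> (s n z)" for n z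
  have e: "e n z \<in> CH (K (k n))" "deg q (e n z)" "(tau \<gamma> ^^ (CARD('p) - 1)) (e n z) = s n z"
    if z: "z \<in> lf_relcycles q (KW n) (LW n)" for n z
  proof -
    interpret k: smith_complex "K (k n)" \<gamma> "TYPE('p)" by (rule S)
    show "e n z \<in> CH (K (k n))" unfolding e_def s_def by (rule k.mT_CH[OF k.trf_CH[OF cb(1)[OF z]]])
    show "deg q (e n z)" unfolding e_def s_def by (rule k.mT_deg[OF k.trf_deg[OF cb(2)[OF z]]])
    show "(tau \<gamma> ^^ (CARD('p) - 1)) (e n z) = s n z" unfolding e_def s_def by (rule k.trf_norm[OF cb(1)[OF z]])
  qed
  show ?thesis
  proof (rule vs_rank_le_tower[OF W.rel_tower smith_tower, where \<alpha> = s and k = k])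
    fix n and z :: "'w list \<Rightarrow> 'p mod_ring" assume z: "z \<in> lf_relcycles q (KW n) (LW n)"
    interpret k: smith_complex "K (k n)" \<gamma> "TYPE('p)" by (rule S)
    have "lf_boundary (s n z) = k.trf (lf_boundary (cb n z))" unfolding s_def by (rule k.trf_boundary[OF cb(1)[OF z]])
    also have "\<dots> = (\<lambda>_. 0)" by (rule k.trf_Fbar[OF cb(3)[OF z]])
    finally show "s n z \<in> smith_cycles (CARD('p) - 1) \<gamma> q (K (k n))"
      unfolding smith_cycles_def smith_chains_eq using e[OF z] by (auto intro!: exI[of _ "e n z"])
  next
    fix n m and z w :: "'w list \<Rightarrow> 'p mod_ring" and M
    assume z: "z \<in> lf_relcycles q (KW n) (LW n)" and w: "w \<in> lf_relcycles q (KW m) (LW m)"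
      and M: "k n \<le> M" "k m \<le> M"
      and d: "(\<lambda>\<sigma>. tr (k n) M (s n z) \<sigma> - tr (k m) M (s m w) \<sigma>) \<in> smith_boundaries (CARD('p) - 1) \<gamma> q (K M)"
    obtain l \<beta> where l: "n \<le> l" "m \<le> l" and \<beta>: "smap (K M) (KW l) \<beta>" "smap (fixc (K M) \<gamma>) (LW l) \<beta>"
      and \<beta>\<gamma>: "\<And>v. v \<in> \<Union>(K M) \<Longrightarrow> \<beta> (\<gamma> v) = \<beta> v"
      and ct: "\<And>i. i \<in> {n, m} \<Longrightarrow> (\<forall>S\<in>KW i. fold fW [i..<l] ` S \<union> (\<beta> \<circ> (F (k i) M \<circ> a i)) ` S \<in> KW l) \<and>
         (\<forall>S\<in>LW i. fold fW [i..<l] ` S \<union> (\<beta> \<circ> (F (k i) M \<circ> a i)) ` S \<in> LW l)"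
      using \<beta>[OF M] by metis
    interpret M: smith_complex "K M" \<gamma> "TYPE('p)" by (rule S)
    have hom: "(\<lambda>\<sigma>. chain_push \<beta> (tr (k i) M (e i x)) \<sigma> - chain_push (fold fW [i..<l]) x \<sigma>) \<in> lf_relboundaries q (KW l) (LW l)"
      if x: "x \<in> lf_relcycles q (KW i) (LW i)" and i: "i \<in> {n, m}" "k i \<le> M" "i \<le> l" for i x
    proof -
      interpret k: smith_complex "K (k i)" \<gamma> "TYPE('p)" by (rule S)
      have xC: "x \<in> CH (KW i)" using x unfolding rc by blast
      define B where "B = \<beta> \<circ> F (k i) M"
      have B\<gamma>1: "B (\<gamma> v) = B v" if v: "v \<in> \<Union>(K (k i))" for v
      proof -
        have "F (k i) M v \<in> \<Union>(K M)" using F_K[OF i(2)] v unfolding smap_def by blast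
        then show ?thesis unfolding B_def using F_gamma[OF i(2) v] \<beta>\<gamma> by simp
      qed
      have B\<gamma>: "B ((\<gamma> ^^ j) v) = B v" if v: "v \<in> \<Union>(K (k i))" for v j
        by (induction j) (use B\<gamma>1 k.gamma_vert[OF v] in auto)
      \<comment> \<open>\<open>B\<close> is constant on orbits and so factors through the orbit
        complex.\<close>
      define Bb where "Bb \<omega> = B (SOME v. v \<in> \<omega>)" for \<omega>
      have Bb: "Bb (k.orb v) = B v" if v: "v \<in> \<Union>(K (k i))" for v
      proof -
        have "(SOME u. u \<in> k.orb v) \<in> k.orb v" by (rule someI[of _ v]) (rule k.orb_self)
        then show ?thesis unfolding Bb_def k.orb_def using B\<gamma>[OF v] by auto
      qed
      have sB: "smap (K (k i)) (KW l) B" unfolding B_def by (rule smap_comp[OF F_K[OF i(2)] \<beta>(1) K])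
      have FfM: "smap (fixc (K (k i)) \<gamma>) (fixc (K M) \<gamma>) (F (k i) M)" by (rule complex_system.F_K[OF fix_system i(2)])
      have sBf: "smap (fixc (K (k i)) \<gamma>) (LW l) B" unfolding B_def by (rule smap_comp[OF FfM \<beta>(2) fix_complex])
      have gen: "smap ((image k.orb) ` C) L' Bb" if C: "C \<subseteq> K (k i)" and sC: "smap C L' B" for C L'
        unfolding smap_def
      proof (intro conjI ballI allI)
        fix S assume "S \<in> (image k.orb) ` C"
        then obtain R where R: "R \<in> C" "S = k.orb ` R" by blast
        have "Bb ` S = B ` R" unfolding R(2) image_image using Bb C R(1) by (intro image_cong) auto
        then show "Bb ` S \<in> L'" using sC R(1) unfolding smap_def by simp
      next
        fix y
        have "{\<omega> \<in> \<Union>((image k.orb) ` C). Bb \<omega> = y} \<subseteq> k.orb ` {v \<in> \<Union>C. B v = y}"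
        proof
          fix \<omega> assume "\<omega> \<in> {\<omega> \<in> \<Union>((image k.orb) ` C). Bb \<omega> = y}"
          then obtain R v where v: "R \<in> C" "v \<in> R" "\<omega> = k.orb v" "Bb \<omega> = y" by blast
          have "v \<in> \<Union>(K (k i))" using v(1,2) C by blast
          then have "B v = y" using Bb[of v] v(3,4) by (simp only:)
          then show "\<omega> \<in> k.orb ` {v \<in> \<Union>C. B v = y}" using v(1,2) unfolding v(3) by blast
        qed
        moreover have "finite {v \<in> \<Union>C. B v = y}" using sC unfolding smap_def by blast
        ultimately show "finite {\<omega> \<in> \<Union>((image k.orb) ` C). Bb \<omega> = y}" by (meson finite_imageI finite_subset)
      qed
      have sBb: "smap k.Kbar (KW l) Bb" unfolding k.Kbar_def by (rule gen[OF subset_refl sB])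
      have sBbf: "smap k.Fbar (LW l) Bb" unfolding k.Fbar_def by (rule gen[OF k.fixc_sub sBf])
      let ?c = "cb i x" and ?e = "e i x"
      note c = cb[OF x] and eC = e[OF x]
      \<comment> \<open>The projection of \<open>?e\<close> differs from the original chain by a
        fixed chain, which \<open>Bb\<close> sends into \<open>LW l\<close> and which is therefore
        zero in relative homology.\<close>
      define D where "D = (\<lambda>\<omega>. chain_push k.orb ?e \<omega> - ?c \<omega>)"
      have D: "D \<in> CH k.Fbar" unfolding D_def e_def s_def by (rule k.push_orb_trf[OF c(1)])
      have "deg q (chain_push k.orb ?e)" by (rule k.push_deg[OF eC(2)])
      then have Dd: "deg q D" unfolding D_def
        using lin_subspaceD(5)[OF lin_subspace_deg[of q], of "chain_push k.orb ?e" ?c] c(2) by blast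
      have DK: "D \<in> CH k.Kbar" using D CH_mono[OF k.Fbar_sub] by blast
      have "chain_push \<beta> (tr (k i) M ?e) = chain_push B ?e"
        unfolding B_def by (rule k.push_comp[OF eC(1) F_K[OF i(2)] \<beta>(1) K])
      also have "\<dots> = chain_push (Bb \<circ> k.orb) ?e" by (rule k.push_cong[OF eC(1)]) (simp add: Bb)
      also have "\<dots> = chain_push Bb (chain_push k.orb ?e)"
        by (rule k.push_comp[OF eC(1) k.smap_orb sBb k.Kbar_complex, symmetric])
      also have "chain_push k.orb ?e = (\<lambda>\<omega>. ?c \<omega> + D \<omega>)" unfolding D_def by simp
      also have "chain_push Bb \<dots> = (\<lambda>\<sigma>. chain_push Bb ?c \<sigma> + chain_push Bb D \<sigma>)"
        by (rule linear_betweenD(1)[OF lf_complex.push_linear[OF k.Kbar_complex sBb] lin_subspace_CH c(1) DK])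
      also have "chain_push Bb ?c = chain_push (Bb \<circ> (k.orb \<circ> a i)) x"
        unfolding cb_def by (rule lf_complex.push_comp[OF W.K xC \<alpha>(1) sBb k.Kbar_complex])
      finally have eq: "chain_push \<beta> (tr (k i) M ?e) = (\<lambda>\<sigma>. chain_push (Bb \<circ> (k.orb \<circ> a i)) x \<sigma> + chain_push Bb D \<sigma>)" .
      obtain \<kappa> :: "'w \<Rightarrow> nat" where \<kappa>: "\<forall>S\<in>KW i. inj_on \<kappa> S" using \<kappa> by blast
      have im: "(Bb \<circ> (k.orb \<circ> a i)) ` S = (\<beta> \<circ> (F (k i) M \<circ> a i)) ` S" if "S \<in> KW i" for S
        using Bb[OF aK] that by (intro image_cong) (auto simp: B_def)
      have h1: "(\<lambda>\<sigma>. chain_push (Bb \<circ> (k.orb \<circ> a i)) x \<sigma> - chain_push (fold fW [i..<l]) x \<sigma>) \<in> lf_relboundaries q (KW l) (LW l)"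
      proof (rule contiguous_homologous[OF W.K W.K W.L W.L W.LK W.F_K[OF i(3)] smap_comp[OF \<alpha>(1) sBb W.K] _ _ _ x, where \<kappa> = \<kappa>])
        show "fold fW [i..<l] ` S \<union> (Bb \<circ> (k.orb \<circ> a i)) ` S \<in> KW l" if "S \<in> KW i" for S
          using ct[OF i(1)] that im[OF that] by simp
        show "fold fW [i..<l] ` S \<union> (Bb \<circ> (k.orb \<circ> a i)) ` S \<in> LW l" if "S \<in> LW i" for S
          using ct[OF i(1)] that im[of S] W.LK[of i] by auto
        show "inj_on \<kappa> S" if "S \<in> KW i" for S using \<kappa> that by blast
      qed
      have CK0: "(\<lambda>_. 0) \<in> CH (KW l)" by (rule lin_subspaceD(1)[OF lin_subspace_CH])
      have bz: "lf_boundary (\<lambda>_. 0) = (\<lambda>_. 0 :: 'p mod_ring)" by (simp add: lf_boundary_def fun_eq_iff)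
      have h2: "chain_push Bb D \<in> lf_relboundaries q (KW l) (LW l)"
      proof (rule lf_complex.relboundariesI[OF W.K W.L CK0 _ lf_complex.push_CH[OF k.Fbar_complex D sBbf]
            lf_complex.push_deg[OF k.Kbar_complex Dd]])
        show "chain_push Bb D \<tau> = lf_boundary (\<lambda>_. 0) \<tau> + chain_push Bb D \<tau>" for \<tau> unfolding bz by simp
      qed (simp add: deg_def)
      show ?thesis unfolding eq using lin_subspaceD(2)[OF Wt.B h1 h2] by (simp add: algebra_simps)
    qed
    let ?z = "tr (k n) M (e n z)" and ?w = "tr (k m) M (e m w)"
    have zw: "?z \<in> CH (K M)" "?w \<in> CH (K M)" "deg q ?z" "deg q ?w"
      using tr_CH[OF M(1) e(1)[OF z]] tr_CH[OF M(2) e(1)[OF w]] tr_deg[OF e(2)[OF z]] tr_deg[OF e(2)[OF w]] by auto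
    obtain e2 where e2: "e2 \<in> CH (K M)" "deg (Suc q) e2"
      "(\<lambda>\<sigma>. tr (k n) M (s n z) \<sigma> - tr (k m) M (s m w) \<sigma>) = lf_boundary ((tau \<gamma> ^^ (CARD('p) - 1)) e2)"
      using d unfolding smith_boundaries_def smith_chains_eq by blast
    have be2: "lf_boundary e2 \<in> CH (K M)" "deg q (lf_boundary e2)"
      using M.boundary_CH[OF e2(1)] M.boundary_deg[OF e2(2)] by blast+
    note tl = linear_betweenD(3)[OF M.tau_pow_linear lin_subspace_CH]
    have zmw: "(\<lambda>\<sigma>. ?z \<sigma> - ?w \<sigma>) \<in> CH (K M)" by (rule lin_subspaceD(5)[OF lin_subspace_CH zw(1,2)])
    define u where "u = (\<lambda>\<sigma>. (?z \<sigma> - ?w \<sigma>) - lf_boundary e2 \<sigma>)"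
    have u: "u \<in> CH (K M)" unfolding u_def by (rule lin_subspaceD(5)[OF lin_subspace_CH zmw be2(1)])
    have ud: "deg q u" unfolding u_def
      using lin_subspaceD(5)[OF lin_subspace_deg[of q]] zw(3,4) be2(2) by auto
    have "(tau \<gamma> ^^ (CARD('p) - 1)) u = (\<lambda>_. 0)"
      unfolding u_def tl[OF zmw be2(1)] tl[OF zw(1,2)] M.tau_pow_boundary[OF e2(1), symmetric] e2(3)[symmetric]
      using tr_tau_pow[OF M(1) e(1)[OF z], of "CARD('p) - 1"] tr_tau_pow[OF M(2) e(1)[OF w], of "CARD('p) - 1"] e(3)[OF z] e(3)[OF w] by simp
    moreover have "1 \<le> CARD('p) - 1" using M.p_minus_1 by simp
    ultimately obtain e1 f1 where
      e1: "e1 \<in> CH (K M)" "f1 \<in> CH (fixc (K M) \<gamma>)" "deg q f1" "u = (\<lambda>\<sigma>. (tau \<gamma> ^^ (CARD('p) - (CARD('p) - 1))) e1 \<sigma> + f1 \<sigma>)"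
      using M.tau_exact[OF _ order_refl u ud] by blast
    \<comment> \<open>For j = p - 1 exactness yields an image of \<open>tau\<close> itself, which
      \<open>\<beta>\<close> kills.\<close>
    have one: "CARD('p) - (CARD('p) - 1) = 1" using M.pos_p by simp
    note pl = linear_betweenD[OF lf_complex.push_linear[OF K \<beta>(1)] lin_subspace_CH]
    have "chain_push \<beta> (chain_push \<gamma> e1) = chain_push (\<beta> \<circ> \<gamma>) e1" by (rule M.push_comp[OF e1(1) M.smap_gamma \<beta>(1) K])
    also have "\<dots> = chain_push \<beta> e1" by (rule M.push_cong[OF e1(1)]) (simp add: \<beta>\<gamma>)
    finally have te: "chain_push \<beta> (tau \<gamma> e1) = (\<lambda>_. 0)"
      unfolding tau_def pl(3)[OF e1(1) M.push_CH[OF e1(1) M.smap_gamma]] by simp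
    have "chain_push \<beta> u = chain_push \<beta> f1"
      unfolding e1(4) one using pl(1)[OF M.tau_CH[OF e1(1)] fixc_CH[OF e1(2)]] te by simp
    moreover have "chain_push \<beta> u = (\<lambda>\<sigma>. (chain_push \<beta> ?z \<sigma> - chain_push \<beta> ?w \<sigma>) - lf_boundary (chain_push \<beta> e2) \<sigma>)"
      unfolding u_def pl(3)[OF zmw be2(1)] pl(3)[OF zw(1,2)] M.push_boundary[OF e2(1) \<beta>(1)] ..
    ultimately have eqn: "chain_push \<beta> ?z \<tau> - chain_push \<beta> ?w \<tau> = lf_boundary (chain_push \<beta> e2) \<tau> + chain_push \<beta> f1 \<tau>" for \<tau>
      by (metis (no_types, lifting) add.commute diff_add_cancel)
    have "(\<lambda>\<sigma>. chain_push \<beta> ?z \<sigma> - chain_push \<beta> ?w \<sigma>) \<in> lf_relboundaries q (KW l) (LW l)"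
      by (rule lf_complex.relboundariesI[OF W.K W.L M.push_CH[OF e2(1) \<beta>(1)] M.push_deg[OF e2(2)]
            lf_complex.push_CH[OF fix_complex e1(2) \<beta>(2)] M.push_deg[OF e1(3)] eqn])
    from lin_subspaceD(2)[OF Wt.B lin_subspaceD(5)[OF Wt.B this hom[OF z _ M(1) l(1)]] hom[OF w _ M(2) l(2)]]
    have "(\<lambda>\<sigma>. chain_push (fold fW [n..<l]) z \<sigma> - chain_push (fold fW [m..<l]) w \<sigma>) \<in> lf_relboundaries q (KW l) (LW l)"
      by (simp add: algebra_simps)
    then show "\<exists>l. n \<le> l \<and> m \<le> l \<and> (\<lambda>\<sigma>. chain_push (fold fW [n..<l]) z \<sigma> - chain_push (fold fW [m..<l]) w \<sigma>)
        \<in> lf_relboundaries q (KW l) (LW l)" using l by blast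
  qed
qed

end

section \<open>The orbit space\<close>

locale coarse_orbit_space = coarse_cyclic_action X d G g \<phi> ty + M': Metric_space X' d'
  for X :: "'a set" and d and G :: "('g, 'r) monoid_scheme" (structure) and g \<phi>
    and ty :: "'p::prime_card itself" and X' :: "'b set" and d' +
  fixes \<psi> :: "'g \<Rightarrow> 'b \<Rightarrow> 'b" and f :: "'a \<Rightarrow> 'b" and L C B :: real
  assumes iso: "isometric_action G X' d' \<psi>"
    and pos: "L > 0" "C > 0" "B \<ge> 0"
    and qi: "quasi_isometry L C X d X' d' f"
    and equi: "h \<in> carrier G \<Longrightarrow> x \<in> X \<Longrightarrow> d' (\<psi> h (f x)) (f (\<phi> h x)) \<le> B"
begin

sublocale A: group_action G X' \<psi>
  using iso unfolding isometric_action_def by blast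

abbreviation Orb :: "'b set set" where "Orb \<equiv> orbits G X' \<psi>"
abbreviation dO :: "'b set \<Rightarrow> 'b set \<Rightarrow> real" where "dO \<equiv> orbit_dist G X' d' \<psi>"
abbreviation ob :: "'b \<Rightarrow> 'b set" where "ob \<equiv> orbit G \<psi>"

lemma psi_X: "h \<in> carrier G \<Longrightarrow> y \<in> X' \<Longrightarrow> \<psi> h y \<in> X'" by (rule A.element_image[OF _ _ refl])

lemma psi_d: "h \<in> carrier G \<Longrightarrow> y \<in> X' \<Longrightarrow> z \<in> X' \<Longrightarrow> d' (\<psi> h y) (\<psi> h z) = d' y z"
  using iso unfolding isometric_action_def by blast

lemma psi_inv: "h \<in> carrier G \<Longrightarrow> y \<in> X' \<Longrightarrow> \<psi> (inv h) (\<psi> h y) = y"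
  by (rule A.orbit_sym_aux[OF _ _ refl])

lemma psi_adjoint:
  assumes "h \<in> carrier G" "y \<in> X'" "z \<in> X'"
  shows "d' (\<psi> h y) z = d' y (\<psi> (inv h) z)"
  using psi_d[OF inv_closed[OF assms(1)] psi_X[OF assms(1,2)] assms(3)] psi_inv[OF assms(1,2)] by simp

lemma f_X: "x \<in> X \<Longrightarrow> f x \<in> X'" using qi unfolding quasi_isometry_def by blast

lemma near: "y \<in> X' \<Longrightarrow> \<exists>x\<in>X. d' y (f x) \<le> C" using qi unfolding quasi_isometry_def by blast

lemma f_upper: "x \<in> X \<Longrightarrow> z \<in> X \<Longrightarrow> d' (f x) (f z) \<le> L * d x z + C" using qi unfolding quasi_isometry_def by blast

lemma f_lower: "x \<in> X \<Longrightarrow> z \<in> X \<Longrightarrow> d' (f x) (f z) \<le> r \<Longrightarrow> d x z \<le> L * (r + C)"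
proof -
  assume "x \<in> X" "z \<in> X" "d' (f x) (f z) \<le> r"
  then have "(1 / L) * d x z \<le> r + C" using qi unfolding quasi_isometry_def by fastforce
  then show ?thesis using pos(1) by (simp add: field_simps)
qed

lemma o_self: "y \<in> X' \<Longrightarrow> y \<in> ob y" by (rule A.orbit_refl)

lemma o_O: "y \<in> X' \<Longrightarrow> ob y \<in> Orb" unfolding orbits_def by blast

lemma O_D: "P \<in> Orb \<Longrightarrow> \<exists>y\<in>X'. P = ob y" unfolding orbits_def by blast

lemma o_psi: "h \<in> carrier G \<Longrightarrow> y \<in> X' \<Longrightarrow> ob (\<psi> h y) = ob y"
proof -
  assume h: "h \<in> carrier G" "y \<in> X'"
  have "\<psi> h y \<in> ob (\<psi> h y)" "\<psi> h y \<in> ob y" using o_self[OF psi_X[OF h]] h(1) unfolding orbit_def by blast+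
  then show ?thesis using A.disjoint_union[OF o_O[OF psi_X[OF h]] o_O[OF h(2)]] by blast
qed

lemma finite_o: "finite (ob y)"
proof -
  have "ob y = (\<lambda>h. \<psi> h y) ` carrier G" unfolding orbit_def by blast
  then show ?thesis using finite_G by simp
qed

lemma finite_dists: "finite {d' x y | x y. x \<in> ob a \<and> y \<in> ob b}"
proof -
  have "{d' x y | x y. x \<in> ob a \<and> y \<in> ob b} = (\<lambda>(x, y). d' x y) ` (ob a \<times> ob b)" by auto
  then show ?thesis using finite_o by simp
qed

lemma dO_le: "y \<in> X' \<Longrightarrow> z \<in> X' \<Longrightarrow> dO (ob y) (ob z) \<le> d' y z"
  unfolding orbit_dist_def using o_O o_self finite_dists[of y z] by (auto intro!: Min_le)

text \<open>The minimum runs over pairs of points of the two orbits; as the action is isometric, the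
  second point can be moved to the given \<open>z\<close>.\<close>

lemma dO_attained:
  assumes y: "y \<in> X'" "z \<in> X'"
  shows "\<exists>h\<in>carrier G. d' (\<psi> h y) z = dO (ob y) (ob z)"
proof -
  let ?D = "{d' x u | x u. x \<in> ob y \<and> u \<in> ob z}"
  have "?D \<noteq> {}" using o_self y by blast
  then have "Min ?D \<in> ?D" by (rule Min_in[OF finite_dists])
  then obtain a b where ab: "a \<in> carrier G" "b \<in> carrier G" "Min ?D = d' (\<psi> a y) (\<psi> b z)" unfolding orbit_def by blast
  have "d' (\<psi> (inv b \<otimes> a) y) z = d' (\<psi> (inv b) (\<psi> a y)) (\<psi> (inv b) (\<psi> b z))"
    using A.composition_rule[OF y(1) inv_closed[OF ab(2)] ab(1)] psi_inv[OF ab(2) y(2)] by simp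
  also have "\<dots> = d' (\<psi> a y) (\<psi> b z)" by (rule psi_d[OF inv_closed[OF ab(2)] psi_X[OF ab(1) y(1)] psi_X[OF ab(2) y(2)]])
  also have "\<dots> = dO (ob y) (ob z)" unfolding orbit_dist_def using o_O y ab(3) by simp
  finally show ?thesis using ab by (intro bexI[of _ "inv b \<otimes> a"]) auto
qed

lemma dO_swap_le: "y \<in> X' \<Longrightarrow> z \<in> X' \<Longrightarrow> dO (ob y) (ob z) \<le> dO (ob z) (ob y)"
proof -
  assume yz: "y \<in> X'" "z \<in> X'"
  obtain h where h: "h \<in> carrier G" "d' (\<psi> h z) y = dO (ob z) (ob y)" using dO_attained[OF yz(2,1)] by blast
  have "dO (ob y) (ob (\<psi> h z)) \<le> d' y (\<psi> h z)" by (rule dO_le[OF yz(1) psi_X[OF h(1) yz(2)]])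
  then show ?thesis using h(2) o_psi[OF h(1) yz(2)] M'.commute[of y "\<psi> h z"] by simp
qed

lemma dO_triangle:
  assumes "x \<in> X'" "y \<in> X'" "z \<in> X'"
  shows "dO (ob x) (ob z) \<le> dO (ob x) (ob y) + dO (ob y) (ob z)"
proof -
  obtain h where h: "h \<in> carrier G" "d' (\<psi> h x) y = dO (ob x) (ob y)" using dO_attained[OF assms(1,2)] by blast
  obtain k where k: "k \<in> carrier G" "d' (\<psi> k y) z = dO (ob y) (ob z)" using dO_attained[OF assms(2,3)] by blast
  note hx = psi_X[OF h(1) assms(1)]
  have "dO (ob x) (ob z) = dO (ob (\<psi> k (\<psi> h x))) (ob z)" using o_psi[OF k(1) hx] o_psi[OF h(1) assms(1)] by simp
  also have "\<dots> \<le> d' (\<psi> k (\<psi> h x)) z" by (rule dO_le[OF psi_X[OF k(1) hx] assms(3)])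
  also have "\<dots> \<le> d' (\<psi> k (\<psi> h x)) (\<psi> k y) + d' (\<psi> k y) z"
    by (rule M'.triangle[OF psi_X[OF k(1) hx] psi_X[OF k(1) assms(2)] assms(3)])
  also have "\<dots> = dO (ob x) (ob y) + dO (ob y) (ob z)" using h(2) k(2) psi_d[OF k(1) hx assms(2)] by simp
  finally show ?thesis .
qed

sublocale Q: Metric_space Orb dO
proof
  show nonneg: "0 \<le> dO P Q" for P Q
  proof (cases "P \<in> Orb \<and> Q \<in> Orb")
    case True
    then obtain y z where yz: "y \<in> X'" "z \<in> X'" "P = ob y" "Q = ob z" using O_D by blast
    then show ?thesis using dO_attained[OF yz(1,2)] M'.nonneg by metis
  next
    case False
    then have "dO P Q = 0" unfolding orbit_dist_def by (rule if_not_P)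
    then show ?thesis by simp
  qed
  show "dO P Q = dO Q P" for P Q
  proof (cases "P \<in> Orb \<and> Q \<in> Orb")
    case True
    then obtain y z where yz: "y \<in> X'" "z \<in> X'" "P = ob y" "Q = ob z" using O_D by blast
    show ?thesis unfolding yz(3,4) using dO_swap_le[OF yz(1,2)] dO_swap_le[OF yz(2,1)] by (rule antisym)
  next
    case False
    then have F: "\<not> (P \<in> Orb \<and> Q \<in> Orb)" "\<not> (Q \<in> Orb \<and> P \<in> Orb)" by blast+
    have "dO P Q = 0" "dO Q P = 0" unfolding orbit_dist_def if_not_P[OF F(1)] if_not_P[OF F(2)] by (rule refl)+
    then show ?thesis by simp
  qed
  show "dO P Q = 0 \<longleftrightarrow> P = Q" if PQ: "P \<in> Orb" "Q \<in> Orb" for P Q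
  proof -
    obtain y z where yz: "y \<in> X'" "z \<in> X'" "P = ob y" "Q = ob z" using PQ O_D by blast
    show ?thesis
    proof
      assume "dO P Q = 0"
      then obtain h where h: "h \<in> carrier G" "d' (\<psi> h y) z = 0" using dO_attained[OF yz(1,2)] unfolding yz(3,4) by auto
      then have "\<psi> h y = z" using M'.zero[OF psi_X[OF h(1) yz(1)] yz(2)] by blast
      then show "P = Q" using o_psi[OF h(1) yz(1)] unfolding yz(3,4) by simp
    next
      assume "P = Q"
      then have "dO P Q \<le> d' y y" using dO_le[OF yz(1,1)] unfolding yz(3) by simp
      then show "dO P Q = 0" using nonneg[of P Q] M'.zero[OF yz(1,1)] by simp
    qed
  qed
  show "dO P R \<le> dO P Q + dO Q R" if PQR: "P \<in> Orb" "Q \<in> Orb" "R \<in> Orb" for P Q R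
  proof -
    obtain x y z where "x \<in> X'" "P = ob x" "y \<in> X'" "Q = ob y" "z \<in> X'" "R = ob z" using PQR O_D by metis
    then show ?thesis using dO_triangle[of x y z] by simp
  qed
qed

section \<open>Coverings of the space and of its orbit space\<close>

text \<open>A coarse action provides preimages only up to a constant. An equivariant covering
  provides exact ones, because \<open>h\<close> after its inverse maps each member onto
  itself.\<close>

lemma phi_surj:
  assumes V: "Gcov \<V>" and h: "h \<in> carrier G" and x: "x \<in> X"
  shows "\<exists>z\<in>X. \<phi> h z = x"
proof -
  obtain U where U: "U \<in> \<V>" "x \<in> U" using V x unfolding Gcov_def bounded_covering_def by blast
  have "\<phi> \<one> ` U = U" using phi_one GcovD(1)[OF V U(1)] by (auto simp: image_iff subset_iff)
  then have "x \<in> \<phi> h ` \<phi> (inv h) ` U" using GcovD(3)[OF V U(1) h inv_closed[OF h]] h U(2) by simp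
  then show ?thesis using GcovD(1)[OF V GcovD(2)[OF V U(1) inv_closed[OF h]]] by blast
qed

lemma o_f_phi: "h \<in> carrier G \<Longrightarrow> x \<in> X \<Longrightarrow> dO (ob (f (\<phi> h x))) (ob (f x)) \<le> B"
proof -
  assume h: "h \<in> carrier G" "x \<in> X"
  have "dO (ob (\<psi> h (f x))) (ob (f (\<phi> h x))) \<le> d' (\<psi> h (f x)) (f (\<phi> h x))"
    by (rule dO_le[OF psi_X[OF h(1) f_X[OF h(2)]] f_X[OF phi_X[OF h]]])
  then show ?thesis
    using equi[OF h] o_psi[OF h(1) f_X[OF h(2)]] Q.commute[of "ob (f x)" "ob (f (\<phi> h x))"] by simp
qed

text \<open>
  A member \<open>W\<close> of a covering of the orbit space is lifted to a member of a covering of \<open>X\<close> that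
  contains all points mapped by \<open>f\<close> near one chosen representative of \<open>W\<close>.
\<close>

lemma lift_covering:
  assumes V: "regular_G_coarsening_system G X d \<phi> \<V> pr"
    and W: "bounded_covering Orb dO \<W>" and Y: "Y' \<subseteq> fixed_upto G X' d' \<psi> k0"
  shows "\<exists>k a. \<forall>W\<in>\<W>. W \<noteq> {} \<longrightarrow> a W \<in> \<V> k \<and>
    (\<forall>y\<in>X'. \<forall>x\<in>X. ob y \<in> W \<longrightarrow> d' y (f x) \<le> C \<longrightarrow>
      (\<exists>h\<in>carrier G. \<exists>z\<in>a W. z \<in> X \<and> \<phi> h z = x \<and> dO (ob y) (ob (f z)) \<le> B + C \<and> (y \<in> Y' \<longrightarrow> \<phi> g z \<in> a W)))"
proof -
  have cV: "coarsening_system X d \<V> pr" using V unfolding regular_G_coarsening_system_def by simp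
  obtain R where R: "\<forall>W\<in>\<W>. \<forall>P\<in>W. \<forall>Q\<in>W. dO P Q \<le> R" and sub: "\<Union>\<W> = Orb"
    using W unfolding bounded_covering_def by metis
  \<comment> \<open>R across \<open>W\<close> and B + C from \<open>f z\<close> to a translate of y;
    for \<open>\<phi> g z\<close> once more B, and twice the displacement k0 of a point of
    \<open>Y'\<close>.\<close>
  define S where "S = R + 2 * B + C + 2 * \<bar>k0\<bar>"
  have "\<exists>y\<in>X'. ob y \<in> W" if W': "W \<in> \<W>" "W \<noteq> {}" for W
  proof -
    obtain P where "P \<in> W" "P \<in> Orb" using W' sub by blast
    then show ?thesis using O_D by blast
  qed
  then obtain r where r: "\<And>W. W \<in> \<W> \<Longrightarrow> W \<noteq> {} \<Longrightarrow> r W \<in> X' \<and> ob (r W) \<in> W" by metis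
  define N where "N W = {x \<in> X. d' (f x) (r W) \<le> S}" for W
  \<comment> \<open>Points near the representative have images at distance at most
    \<open>2 * S\<close>, and \<open>f_lower\<close> turns this into the bound used here.\<close>
  obtain k where k: "\<forall>T\<subseteq>X. (\<forall>x\<in>T. \<forall>y\<in>T. d x y \<le> L * (2 * S + C)) \<longrightarrow> (\<exists>U\<in>\<V> k. T \<subseteq> U)"
    using coarsening_system_lebesgue[OF cV] by (meson order_refl)
  have "\<exists>U\<in>\<V> k. N W \<subseteq> U" if W': "W \<in> \<W>" "W \<noteq> {}" for W
  proof -
    have "d x y \<le> L * (2 * S + C)" if xy: "x \<in> N W" "y \<in> N W" for x y
    proof (rule f_lower)
      show "x \<in> X" "y \<in> X" using xy unfolding N_def by blast+
      then have "d' (f x) (f y) \<le> d' (f x) (r W) + d' (r W) (f y)"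
        using M'.triangle[OF f_X _ f_X] r[OF W'] by blast
      then show "d' (f x) (f y) \<le> 2 * S" using xy M'.commute[of "r W" "f y"] unfolding N_def by simp
    qed
    then have "\<forall>x\<in>N W. \<forall>y\<in>N W. d x y \<le> L * (2 * S + C)" by (intro ballI)
    moreover have "N W \<subseteq> X" unfolding N_def by (rule Collect_restrict)
    ultimately show ?thesis using k[rule_format, of "N W"] by simp
  qed
  then obtain a where a: "\<And>W. W \<in> \<W> \<Longrightarrow> W \<noteq> {} \<Longrightarrow> a W \<in> \<V> k \<and> N W \<subseteq> a W" by metis
  have "\<exists>h\<in>carrier G. \<exists>z\<in>a W. z \<in> X \<and> \<phi> h z = x \<and> dO (ob y) (ob (f z)) \<le> B + C \<and> (y \<in> Y' \<longrightarrow> \<phi> g z \<in> a W)"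
    if W: "W \<in> \<W>" and y: "y \<in> X'" "ob y \<in> W" and x: "x \<in> X" "d' y (f x) \<le> C" for W y x
  proof -
    have Wn: "W \<noteq> {}" using y(2) by blast
    note rW = r[OF W Wn] and aW = a[OF W Wn]
    obtain h where h: "h \<in> carrier G" "d' (\<psi> h y) (r W) = dO (ob y) (ob (r W))" using dO_attained[OF y(1)] rW by blast
    have hR: "d' (\<psi> h y) (r W) \<le> R" using R W y(2) rW unfolding h(2) by blast
    \<comment> \<open>\<open>h\<close> moves y close to the representative of \<open>W\<close>. The
      point \<open>z\<close> that \<open>h'\<close> sends to x then has its image near
      \<open>\<psi> h y\<close>, by approximate equivariance of \<open>f\<close>.\<close>
    define h' where "h' = inv h"
    have h': "h' \<in> carrier G" "inv h' = h" using h(1) by (simp_all add: h'_def)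
    obtain z where z: "z \<in> X" "\<phi> h' z = x" using phi_surj[OF Gcov_regular_system[OF V] h'(1) x(1)] by blast
    note fz = f_X[OF z(1)] and fx = f_X[OF x(1)] and hy = psi_X[OF h(1) y(1)]
    have "d' (\<psi> h' (f z)) y \<le> d' (\<psi> h' (f z)) (f x) + d' (f x) y" by (rule M'.triangle[OF psi_X[OF h'(1) fz] fx y(1)])
    also have "\<dots> \<le> B + C" using equi[OF h'(1) z(1)] z(2) x(2) M'.commute[of "f x" y] by simp
    finally have near1: "d' (f z) (\<psi> h y) \<le> B + C" using psi_adjoint[OF h'(1) fz y(1)] h'(2) by simp
    have tri: "d' (f z) (r W) \<le> d' (f z) (\<psi> h y) + d' (\<psi> h y) (r W)" by (rule M'.triangle[OF fz hy]) (use rW in blast)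
    have "z \<in> N W" unfolding N_def S_def using z(1) tri near1 hR pos by simp
    then have "z \<in> a W" using aW by blast
    moreover have "dO (ob y) (ob (f z)) \<le> B + C"
      using dO_le[OF fz hy] near1 o_psi[OF h(1) y(1)] Q.commute[of "ob (f z)" "ob y"] by simp
    moreover have "\<phi> g z \<in> a W" if "y \<in> Y'"
    proof -
      have yk: "d' y (\<psi> l y) \<le> k0" if "l \<in> carrier G" for l using \<open>y \<in> Y'\<close> Y that unfolding fixed_upto_def by blast
      define gh where "gh = g \<otimes> h"
      have gh: "gh \<in> carrier G" "\<psi> gh y = \<psi> g (\<psi> h y)"
        using g h(1) A.composition_rule[OF y(1) g h(1)] by (simp_all add: gh_def)
      note z' = phi_X[OF g z(1)] note fz' = f_X[OF z']
      note gfz = psi_X[OF g fz] and ghy = psi_X[OF gh(1) y(1)]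
      have e1: "d' (f (\<phi> g z)) (\<psi> g (f z)) \<le> B" using equi[OF g z(1)] M'.commute[of "f (\<phi> g z)" "\<psi> g (f z)"] by simp
      have e2: "d' (\<psi> g (f z)) (\<psi> gh y) \<le> B + C" unfolding gh(2) psi_d[OF g fz hy] by (rule near1)
      have e3: "d' (\<psi> gh y) y \<le> k0" using yk[OF gh(1)] M'.commute[of "\<psi> gh y" y] by simp
      have "d' (f (\<phi> g z)) (r W) \<le> d' (f (\<phi> g z)) (\<psi> g (f z)) + (d' (\<psi> g (f z)) (\<psi> gh y) + (d' (\<psi> gh y) y + (d' y (\<psi> h y) + d' (\<psi> h y) (r W))))"
        using M'.triangle[OF fz' gfz, of "r W"] M'.triangle[OF gfz ghy, of "r W"] M'.triangle[OF ghy y(1), of "r W"]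
          M'.triangle[OF y(1) hy, of "r W"] rW by linarith
      also have "\<dots> \<le> S" unfolding S_def using e1 e2 e3 yk[OF h(1)] hR by linarith
      finally have "\<phi> g z \<in> N W" unfolding N_def using z' by simp
      then show ?thesis using aW by blast
    qed
    ultimately show ?thesis using h'(1) z by blast
  qed
  then show ?thesis using a by blast
qed

text \<open>The value is chosen for the orbit of \<open>V\<close>, hence invariant. It contains
  everything within \<open>r\<close> of the image of the whole orbit; as \<open>f\<close> is
  equivariant up to \<open>B\<close>, this is within r + B of the image of \<open>V\<close> alone,
  which bounds its diameter.\<close>

lemma collapse_covering:
  assumes V: "Gcov \<V>" and W: "coarsening_system Orb dO \<W> prW"
  shows "\<exists>l0. \<forall>l\<ge>l0. \<exists>b. \<forall>V\<in>\<V>. V \<noteq> {} \<longrightarrow> b V \<in> \<W> l \<and> b (\<gamma> V) = b V \<and>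
    (\<forall>P\<in>Orb. \<forall>x\<in>V. dO P (ob (f x)) \<le> r \<longrightarrow> P \<in> b V)"
proof -
  interpret k: smith_complex "nerve \<V> X" \<gamma> "TYPE('p)" by (rule nerve_smith[OF V])
  obtain s where s: "\<forall>V\<in>\<V>. \<forall>x\<in>V. \<forall>y\<in>V. d x y \<le> s"
    using V unfolding Gcov_def bounded_covering_def by metis
  define E where "E \<omega> = {P \<in> Orb. \<exists>V\<in>\<omega>. \<exists>x\<in>V. dO P (ob (f x)) \<le> r}" for \<omega>
  \<comment> \<open>A step r + B to the image of \<open>V\<close>, a distance of at most L s + C
    across this image, and a step r + B back.\<close>
  define t where "t = r + B + (L * s + C) + (r + B)"
  have E: "\<forall>P\<in>E (k.orb V). \<forall>Q\<in>E (k.orb V). dO P Q \<le> t" if V': "V \<in> \<V>" "V \<noteq> {}" for V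
  proof -
    have pt: "\<exists>v\<in>V. dO P (ob (f v)) \<le> r + B" if P: "P \<in> E (k.orb V)" for P
    proof -
      obtain i x where x: "P \<in> Orb" "x \<in> (\<gamma> ^^ i) V" "dO P (ob (f x)) \<le> r"
        using P unfolding E_def k.orb_def by blast
      obtain v where v: "v \<in> V" "x = \<phi> (g [^] i) v" using x(2) unfolding gamma_pow[OF V V'(1)] by blast
      have vX: "v \<in> X" using v(1) GcovD(1)[OF V V'(1)] by blast
      have gi: "g [^] i \<in> carrier G" using g by simp
      have "dO P (ob (f v)) \<le> dO P (ob (f x)) + dO (ob (f x)) (ob (f v))"
        unfolding v(2) using x(1) o_O f_X vX phi_X[OF gi vX] by (intro Q.triangle) auto
      then show ?thesis using o_f_phi[OF gi vX] x(3) v by (intro bexI[of _ v]) auto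
    qed
    show ?thesis
    proof (intro ballI)
      fix P Q assume PQ: "P \<in> E (k.orb V)" "Q \<in> E (k.orb V)"
      then have PQO: "P \<in> Orb" "Q \<in> Orb" unfolding E_def by blast+
      obtain v w where v: "v \<in> V" "dO P (ob (f v)) \<le> r + B" and w: "w \<in> V" "dO Q (ob (f w)) \<le> r + B"
        using pt[OF PQ(1)] pt[OF PQ(2)] by blast
      have vw: "v \<in> X" "w \<in> X" using v(1) w(1) GcovD(1)[OF V V'(1)] by blast+
      have "d v w \<le> s" using s V'(1) v(1) w(1) by blast
      then have "L * d v w \<le> L * s" using pos(1) by simp
      then have "dO (ob (f v)) (ob (f w)) \<le> L * s + C" using dO_le[OF f_X[OF vw(1)] f_X[OF vw(2)]] f_upper[OF vw] by linarith
      moreover have "dO P Q \<le> dO P (ob (f v)) + dO (ob (f v)) Q"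
        using PQO o_O[OF f_X[OF vw(1)]] by (intro Q.triangle)
      moreover have "dO (ob (f v)) Q \<le> dO (ob (f v)) (ob (f w)) + dO (ob (f w)) Q"
        using PQO o_O[OF f_X[OF vw(1)]] o_O[OF f_X[OF vw(2)]] by (intro Q.triangle)
      ultimately show "dO P Q \<le> t" unfolding t_def using v(2) w(2) Q.commute[of "ob (f w)" Q] by linarith
    qed
  qed
  obtain l0 where l0: "\<forall>l\<ge>l0. \<forall>T\<subseteq>Orb. (\<forall>P\<in>T. \<forall>Q\<in>T. dO P Q \<le> t) \<longrightarrow> (\<exists>W\<in>\<W> l. T \<subseteq> W)"
    using coarsening_system_lebesgue[OF W] by blast
  have "\<exists>b. \<forall>V\<in>\<V>. V \<noteq> {} \<longrightarrow> b V \<in> \<W> l \<and> b (\<gamma> V) = b V \<and> (\<forall>P\<in>Orb. \<forall>x\<in>V. dO P (ob (f x)) \<le> r \<longrightarrow> P \<in> b V)" if l: "l0 \<le> l" for l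
  proof -
    define c where "c \<omega> = (SOME W. W \<in> \<W> l \<and> E \<omega> \<subseteq> W)" for \<omega>
    have c: "c (k.orb V) \<in> \<W> l \<and> E (k.orb V) \<subseteq> c (k.orb V)" if "V \<in> \<V>" "V \<noteq> {}" for V
    proof -
      have "E (k.orb V) \<subseteq> Orb" unfolding E_def by (rule Collect_restrict)
      then have "\<exists>W. W \<in> \<W> l \<and> E (k.orb V) \<subseteq> W" using l0 l E[OF that] by blast
      then show ?thesis unfolding c_def by (rule someI_ex)
    qed
    show ?thesis
    proof (intro exI[of _ "\<lambda>V. c (k.orb V)"] ballI impI conjI)
      fix V assume V': "V \<in> \<V>" "V \<noteq> {}"
      show "c (k.orb V) \<in> \<W> l" using c[OF V'] by blast
      have "V \<in> \<Union>(nerve \<V> X)" using V' unfolding nerve_verts_X[OF V] by blast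
      then show "c (k.orb (\<gamma> V)) = c (k.orb V)" using k.orb_gamma[of V 1] by simp
      fix P x assume "P \<in> Orb" "x \<in> V" "dO P (ob (f x)) \<le> r"
      then have "P \<in> E (k.orb V)" unfolding E_def using k.orb_self[of V] by blast
      then show "P \<in> c (k.orb V)" using c[OF V'] by blast
    qed
  qed
  then show ?thesis by blast
qed

text \<open>Points whose image orbit lies in \<open>W\<close> stay within a fixed distance of one of
  finitely many translates of a single point, and each ball meets finitely many members.\<close>

lemma finite_meet_preimage:
  assumes V: "bounded_covering X d \<V>" and D: "W \<subseteq> Orb" "\<forall>P\<in>W. \<forall>Q\<in>W. dO P Q \<le> R"
  shows "finite {V \<in> \<V>. \<exists>x\<in>V. ob (f x) \<in> W}"
proof (cases "\<exists>x\<in>X. ob (f x) \<in> W")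
  case False
  then have "{V \<in> \<V>. \<exists>x\<in>V. ob (f x) \<in> W} = {}" using V unfolding bounded_covering_def by blast
  then show ?thesis by (simp only: finite.emptyI)
next
  case True
  then obtain x1 where x1: "x1 \<in> X" "ob (f x1) \<in> W" by blast
  let ?r = "L * ((R + B) + C)"
  have "{V \<in> \<V>. \<exists>x\<in>V. ob (f x) \<in> W} \<subseteq> (\<Union>h\<in>carrier G. {V \<in> \<V>. V \<inter> mcball (\<phi> h x1) ?r \<noteq> {}})"
  proof
    fix V' assume "V' \<in> {V \<in> \<V>. \<exists>x\<in>V. ob (f x) \<in> W}"
    then obtain x where x: "V' \<in> \<V>" "x \<in> V'" "ob (f x) \<in> W" by blast
    have xX: "x \<in> X" using x(1,2) V unfolding bounded_covering_def by blast
    note fx = f_X[OF xX] and fx1 = f_X[OF x1(1)]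
    obtain h where h: "h \<in> carrier G" "d' (\<psi> h (f x)) (f x1) = dO (ob (f x)) (ob (f x1))" using dO_attained[OF fx fx1] by blast
    define k where "k = inv h"
    have k: "k \<in> carrier G" using h(1) by (simp add: k_def)
    have "dO (ob (f x)) (ob (f x1)) \<le> R" using D(2) x(3) x1(2) by blast
    then have "d' (f x) (\<psi> k (f x1)) \<le> R" using psi_adjoint[OF h(1) fx fx1] h(2) unfolding k_def by simp
    moreover have "d' (f x) (f (\<phi> k x1)) \<le> d' (f x) (\<psi> k (f x1)) + d' (\<psi> k (f x1)) (f (\<phi> k x1))"
      by (rule M'.triangle[OF fx psi_X[OF k fx1] f_X[OF phi_X[OF k x1(1)]]])
    ultimately have "d' (f x) (f (\<phi> k x1)) \<le> R + B" using equi[OF k x1(1)] by linarith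
    then have "d x (\<phi> k x1) \<le> ?r" by (rule f_lower[OF xX phi_X[OF k x1(1)]])
    then have "x \<in> mcball (\<phi> k x1) ?r" using xX phi_X[OF k x1(1)] commute[of x "\<phi> k x1"] by simp
    then show "V' \<in> (\<Union>h\<in>carrier G. {V \<in> \<V>. V \<inter> mcball (\<phi> h x1) ?r \<noteq> {}})" using x k by blast
  qed
  moreover have "finite (\<Union>h\<in>carrier G. {V \<in> \<V>. V \<inter> mcball (\<phi> h x1) ?r \<noteq> {}})"
    by (intro finite_UN_I finite_G bounded_covering_meet[OF V mbounded_mcball])
  ultimately show ?thesis by (rule finite_subset)
qed

lemma finite_meet_image:
  assumes W: "bounded_covering Orb dO \<W>" and U: "U \<subseteq> X" "\<forall>x\<in>U. \<forall>y\<in>U. d x y \<le> s"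
  shows "finite {W \<in> \<W>. \<exists>P\<in>W. \<exists>z\<in>U. dO P (ob (f z)) \<le> r}"
proof (cases "U = {}")
  case False
  then obtain u where u: "u \<in> U" "u \<in> X" using U(1) by blast
  have "{W \<in> \<W>. \<exists>P\<in>W. \<exists>z\<in>U. dO P (ob (f z)) \<le> r} \<subseteq> {W \<in> \<W>. W \<inter> Q.mcball (ob (f u)) (r + (L * s + C)) \<noteq> {}}"
  proof
    fix W' assume "W' \<in> {W \<in> \<W>. \<exists>P\<in>W. \<exists>z\<in>U. dO P (ob (f z)) \<le> r}"
    then obtain P z where P: "W' \<in> \<W>" "P \<in> W'" "z \<in> U" "dO P (ob (f z)) \<le> r" by blast
    have PO: "P \<in> Orb" using P(1,2) W unfolding bounded_covering_def by blast
    have z: "z \<in> X" using P(3) U(1) by blast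
    have "d z u \<le> s" using U(2) P(3) u(1) by blast
    then have "L * d z u \<le> L * s" using pos(1) by simp
    then have "dO (ob (f z)) (ob (f u)) \<le> L * s + C" using dO_le[OF f_X[OF z] f_X[OF u(2)]] f_upper[OF z u(2)] by linarith
    moreover have "dO P (ob (f u)) \<le> dO P (ob (f z)) + dO (ob (f z)) (ob (f u))"
      by (rule Q.triangle[OF PO o_O[OF f_X[OF z]] o_O[OF f_X[OF u(2)]]])
    ultimately have "P \<in> Q.mcball (ob (f u)) (r + (L * s + C))"
      using PO o_O[OF f_X[OF u(2)]] P(4) Q.commute[of P "ob (f u)"] by simp
    then show "W' \<in> {W \<in> \<W>. W \<inter> Q.mcball (ob (f u)) (r + (L * s + C)) \<noteq> {}}" using P(1,2) by blast
  qed
  then show ?thesis by (rule finite_subset) (rule Q.bounded_covering_meet[OF W Q.mbounded_mcball])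
qed simp

text \<open>Members of coverings of the orbit space are lifted to members of \<open>\<V>\<close>.
  The lifts of the vertices of a simplex need not meet, but suitable translates of them do, which
  suffices for a simplicial map to the orbit complex. Over points of \<open>Y'\<close> the lifts are
  fixed, so the subcomplex over the image of \<open>Y'\<close> goes to the fixed one.\<close>

theorem HC_orbit_le:
  assumes V: "regular_G_coarsening_system G X d \<phi> \<V> pr" "equivariant_projections G \<phi> \<V> pr"
    and Y: "bounded_fixed_set G X' d' \<psi> Y'" and W: "coarsening_system Orb dO \<W> prW"
  shows "vs_rank (HC \<W> prW q Orb (ob ` Y') :: ('p mod_ring, _) module)
    \<le> vs_rank (HC_smith X \<phi> g (CARD('p) - 1) \<V> pr q :: ('p mod_ring, _) module)"
proof -
  obtain k0 where k0: "Y' \<subseteq> fixed_upto G X' d' \<psi> k0"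
    "\<And>k. k \<ge> k0 \<Longrightarrow> coarse_equivalence Y' d' (fixed_upto G X' d' \<psi> k) d' (\<lambda>x. x)"
    using Y unfolding bounded_fixed_set_def by metis
  have Y'X: "Y' \<subseteq> X'" using k0(1) unfolding fixed_upto_def by blast
  have YO: "ob ` Y' \<subseteq> Orb" using Y'X o_O by blast
  note sys = Q.nerve_system[OF W YO]
  have cV: "coarsening_system X d \<V> pr" using V(1) unfolding regular_G_coarsening_system_def by simp
  note bV = coarsening_system_bounded[OF cV] and bW = coarsening_system_bounded[OF W]
  note GV = Gcov_regular_system[OF V(1)]
  interpret S: smith_system "\<lambda>n. nerve (\<V> n) X" pr \<gamma> "TYPE('p)" by (rule nerve_smith_system[OF V])
  define lifts where "lifts n k a \<longleftrightarrow> (\<forall>W\<in>\<W> n. W \<noteq> {} \<longrightarrow> a W \<in> \<V> k \<and>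
    (\<forall>y\<in>X'. \<forall>x\<in>X. ob y \<in> W \<longrightarrow> d' y (f x) \<le> C \<longrightarrow>
      (\<exists>h\<in>carrier G. \<exists>z\<in>a W. z \<in> X \<and> \<phi> h z = x \<and> dO (ob y) (ob (f z)) \<le> B + C \<and> (y \<in> Y' \<longrightarrow> \<phi> g z \<in> a W))))" for n k a
  have "\<exists>k a. lifts n k a" for n unfolding lifts_def by (rule lift_covering[OF V(1) bW k0(1)])
  then obtain k a where a: "\<And>n. lifts n (k n) (a n)" by metis
  have aV: "a n W \<in> \<V> (k n)" if "W \<in> \<W> n" "W \<noteq> {}" for n W using a[of n] that unfolding lifts_def by blast
  have az: "\<exists>h\<in>carrier G. \<exists>z\<in>a n W. z \<in> X \<and> \<phi> h z = x \<and> dO (ob y) (ob (f z)) \<le> B + C \<and> (y \<in> Y' \<longrightarrow> \<phi> g z \<in> a n W)"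
    if "W \<in> \<W> n" "y \<in> X'" "x \<in> X" "ob y \<in> W" "d' y (f x) \<le> C" for n W y x
    using a[of n] that unfolding lifts_def by blast
  have az0: "\<exists>z\<in>a n W. z \<in> X \<and> dO P (ob (f z)) \<le> B + C" if W': "W \<in> \<W> n" "P \<in> W" for n W P
  proof -
    have "P \<in> Orb" using W' bW[of n] unfolding bounded_covering_def by blast
    then obtain y where y: "y \<in> X'" "P = ob y" using O_D by blast
    obtain x where x: "x \<in> X" "d' y (f x) \<le> C" using near[OF y(1)] by blast
    show ?thesis using az[OF W'(1) y(1) x(1) _ x(2)] W'(2) unfolding y(2) by blast
  qed
  have vW: "\<Union>(nerve (\<W> n) A) \<subseteq> {W \<in> \<W> n. W \<noteq> {}}" for n A unfolding nerve_verts by blast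
  have aK: "a n W \<in> \<Union>(nerve (\<V> (k n)) X)" if W': "W \<in> \<W> n" "W \<noteq> {}" for n W
  proof -
    have "a n W \<noteq> {}" using az0[OF W'(1)] W'(2) by blast
    then show ?thesis using aV[OF W'] unfolding nerve_verts_X[OF GV] by blast
  qed
  have point: "\<exists>y\<in>X'. \<exists>x\<in>X. d' y (f x) \<le> C \<and> ob y \<in> A \<and> (\<forall>W\<in>T. ob y \<in> W) \<and> (A = ob ` Y' \<longrightarrow> y \<in> Y')"
    if T: "T \<in> nerve (\<W> n) A" and A: "A = Orb \<or> A = ob ` Y'" for T n A
  proof -
    obtain P where P: "P \<in> A" "\<forall>W\<in>T. P \<in> W" using nerveD(4)[OF T] by blast
    have "\<exists>y\<in>X'. P = ob y \<and> (A = ob ` Y' \<longrightarrow> y \<in> Y')"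
    proof (cases "A = ob ` Y'")
      case True
      then show ?thesis using P(1) Y'X by blast
    next
      case False
      then show ?thesis using P(1) A O_D by blast
    qed
    then obtain y where y: "y \<in> X'" "P = ob y" "A = ob ` Y' \<longrightarrow> y \<in> Y'" by blast
    obtain x where "x \<in> X" "d' y (f x) \<le> C" using near[OF y(1)] by blast
    then show ?thesis using y P unfolding y(2) by (intro bexI[of _ y] bexI[of _ x] conjI)
  qed
  \<comment> \<open>A fibre is finite because an orbit has finitely many members, and a lift of
    \<open>W\<close> contains a point whose image is within B + C of a point of
    \<open>W\<close>.\<close>
  have fin: "finite {W \<in> \<Union>(nerve (\<W> n) A). (smith_complex.orb \<gamma> \<circ> a n) W = \<omega>}" for n A \<omega>
  proof (cases "\<exists>W\<in>\<Union>(nerve (\<W> n) A). (smith_complex.orb \<gamma> \<circ> a n) W = \<omega>")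
    case False
    then have "{W \<in> \<Union>(nerve (\<W> n) A). (smith_complex.orb \<gamma> \<circ> a n) W = \<omega>} = {}" by blast
    then show ?thesis by (simp only: finite.emptyI)
  next
    case True
    interpret k: smith_complex "nerve (\<V> (k n)) X" \<gamma> "TYPE('p)" by (rule nerve_smith[OF GV])
    obtain W0 where W0: "W0 \<in> \<W> n" "W0 \<noteq> {}" "k.orb (a n W0) = \<omega>" using True vW[of n A] by auto
    have fo: "finite \<omega>" "\<omega> \<subseteq> {U \<in> \<V> (k n). U \<noteq> {}}"
      using k.finite_orb[OF aK[OF W0(1,2)]] k.orb_verts[OF aK[OF W0(1,2)]] unfolding W0(3) nerve_verts_X[OF GV] by blast+
    have "{W \<in> \<Union>(nerve (\<W> n) A). (k.orb \<circ> a n) W = \<omega>} \<subseteq> (\<Union>U\<in>\<omega>. {W \<in> \<W> n. \<exists>P\<in>W. \<exists>z\<in>U. dO P (ob (f z)) \<le> B + C})"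
    proof
      fix W assume "W \<in> {W \<in> \<Union>(nerve (\<W> n) A). (k.orb \<circ> a n) W = \<omega>}"
      then have W': "W \<in> \<W> n" "W \<noteq> {}" "k.orb (a n W) = \<omega>" using vW[of n A] by auto
      obtain P where P: "P \<in> W" using W'(2) by blast
      have "a n W \<in> \<omega>" using k.orb_self[of "a n W"] unfolding W'(3) .
      then show "W \<in> (\<Union>U\<in>\<omega>. {W \<in> \<W> n. \<exists>P\<in>W. \<exists>z\<in>U. dO P (ob (f z)) \<le> B + C})"
        using az0[OF W'(1) P] W'(1) P by blast
    qed
    moreover have "finite (\<Union>U\<in>\<omega>. {W \<in> \<W> n. \<exists>P\<in>W. \<exists>z\<in>U. dO P (ob (f z)) \<le> B + C})"
    proof (intro finite_UN_I fo(1))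
      obtain s where s: "\<forall>V\<in>\<V> (k n). \<forall>x\<in>V. \<forall>y\<in>V. d x y \<le> s" using bV[of "k n"] unfolding bounded_covering_def by metis
      fix U assume "U \<in> \<omega>"
      then have "U \<in> \<V> (k n)" using fo(2) by blast
      then show "finite {W \<in> \<W> n. \<exists>P\<in>W. \<exists>z\<in>U. dO P (ob (f z)) \<le> B + C}"
        using finite_meet_image[OF bW GcovD(1)[OF GV]] s by blast
    qed
    ultimately show ?thesis by (rule finite_subset)
  qed
  \<comment> \<open>The lifts are translated until all of them contain one point x; this does not
    change their orbits.\<close>
  have lift: "\<exists>T'\<in>nerve (\<V> (k n)) X. smith_complex.orb \<gamma> ` T' = (smith_complex.orb \<gamma> \<circ> a n) ` T \<and>
      (A = ob ` Y' \<longrightarrow> T' \<in> fixc (nerve (\<V> (k n)) X) \<gamma>)"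
    if T: "T \<in> nerve (\<W> n) A" and A: "A = Orb \<or> A = ob ` Y'" for T n A
  proof -
    interpret k: smith_complex "nerve (\<V> (k n)) X" \<gamma> "TYPE('p)" by (rule nerve_smith[OF GV])
    obtain y x where y: "y \<in> X'" "x \<in> X" "d' y (f x) \<le> C" "\<forall>W\<in>T. ob y \<in> W" "A = ob ` Y' \<longrightarrow> y \<in> Y'"
      using point[OF T A] by blast
    have TW: "W \<in> \<W> n" "W \<noteq> {}" if "W \<in> T" for W using nerveD(3)[OF T] y(4) that by blast+
    have ex: "\<exists>i::nat. x \<in> (\<gamma> ^^ i) (a n W) \<and> (y \<in> Y' \<longrightarrow> \<gamma> (a n W) = a n W)" if W': "W \<in> T" for W
    proof -
      obtain h z where z: "h \<in> carrier G" "z \<in> a n W" "\<phi> h z = x" "y \<in> Y' \<longrightarrow> \<phi> g z \<in> a n W"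
        using az[OF TW(1)[OF W'] y(1,2) _ y(3)] y(4) W' by blast
      obtain i :: nat where i: "h = g [^] i" using z(1) carrier_powers by blast
      have "x \<in> (\<gamma> ^^ i) (a n W)" unfolding gamma_pow[OF GV aV[OF TW[OF W']]] using z(2,3) i by blast
      moreover have "\<gamma> (a n W) = a n W" if "y \<in> Y'"
        by (rule fixed_if_meet[OF GV aV[OF TW[OF W']], of "\<phi> g z"]) (use z that in blast)+
      ultimately show ?thesis by blast
    qed
    then obtain i :: "'b set set \<Rightarrow> nat" where i: "\<And>W. W \<in> T \<Longrightarrow> x \<in> (\<gamma> ^^ i W) (a n W)"
      "\<And>W. W \<in> T \<Longrightarrow> y \<in> Y' \<Longrightarrow> \<gamma> (a n W) = a n W" by metis
    define T' where "T' = (\<lambda>W. (\<gamma> ^^ i W) (a n W)) ` T"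
    have T': "T' \<in> nerve (\<V> (k n)) X"
    proof (rule nerveI[of _ _ x])
      show "finite T'" "T' \<noteq> {}" unfolding T'_def using nerveD(1,2)[OF T] by auto
      show "T' \<subseteq> \<V> (k n)" unfolding T'_def using gamma_pow_in[OF GV aV[OF TW]] by blast
      show "x \<in> U" if "U \<in> T'" for U using that i(1) unfolding T'_def by blast
    qed (rule y(2))
    moreover have "k.orb ` T' = (k.orb \<circ> a n) ` T"
      unfolding T'_def image_image using k.orb_gamma[OF aK[OF TW]] by (intro image_cong) simp_all
    moreover have "T' \<in> fixc (nerve (\<V> (k n)) X) \<gamma>" if "A = ob ` Y'"
    proof -
      have "\<gamma> U = U" if "U \<in> T'" for U
      proof -
        obtain W where W': "W \<in> T" "U = (\<gamma> ^^ i W) (a n W)" using \<open>U \<in> T'\<close> unfolding T'_def by blast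
        have fx: "\<gamma> (a n W) = a n W" using i(2)[OF W'(1)] y(5) \<open>A = ob ` Y'\<close> by blast
        show ?thesis unfolding W'(2) k.fixed_pow[OF fx] by (rule fx)
      qed
      then show ?thesis unfolding fixc_def using T' by blast
    qed
    ultimately show ?thesis by blast
  qed
  show ?thesis
    unfolding HC_tower[OF sys] HC_smith_tower[where \<phi> = \<phi> and g = g, OF nerve_smith_system[OF V]]
  proof (rule S.rel_le_smith[OF sys, where k = k and a = a])
    fix n
    interpret k: smith_complex "nerve (\<V> (k n)) X" \<gamma> "TYPE('p)" by (rule nerve_smith[OF GV])
    show "smap (nerve (\<W> n) Orb) k.Kbar (k.orb \<circ> a n)"
      unfolding smap_def k.Kbar_def
    proof (intro conjI ballI allI fin)
      fix T assume "T \<in> nerve (\<W> n) Orb"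
      from lift[OF this] show "(k.orb \<circ> a n) ` T \<in> (image k.orb) ` nerve (\<V> (k n)) X" by (metis imageI)
    qed
    show "smap (nerve (\<W> n) (ob ` Y')) k.Fbar (k.orb \<circ> a n)"
      unfolding smap_def k.Fbar_def
    proof (intro conjI ballI allI fin)
      fix T assume "T \<in> nerve (\<W> n) (ob ` Y')"
      from lift[OF this] show "(k.orb \<circ> a n) ` T \<in> (image k.orb) ` fixc (nerve (\<V> (k n)) X) \<gamma>" by (metis imageI)
    qed
    show "a n W \<in> \<Union>(nerve (\<V> (k n)) X)" if "W \<in> \<Union>(nerve (\<W> n) Orb)" for W
      by (rule aK) (use vW[of n Orb] that in blast)+
    show "\<exists>\<kappa> :: 'b set set \<Rightarrow> nat. \<forall>S\<in>nerve (\<W> n) Orb. inj_on \<kappa> S" by (rule Q.nerve_injective_rank[OF bW])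
  next
    fix n m M assume M: "k n \<le> M" "k m \<le> M"
    obtain s where s: "\<forall>V\<in>\<V> M. \<forall>x\<in>V. \<forall>y\<in>V. d x y \<le> s" using bV[of M] unfolding bounded_covering_def by metis
    \<comment> \<open>A point of a fixed member is moved by at most s, so its image under
      \<open>f\<close> is moved by at most L s + C + B. The maximum with k0 brings this bound into
      the range of the coarse equivalence for \<open>Y'\<close>.\<close>
    define \<rho> where "\<rho> = max k0 (L * s + C + B)"
    \<comment> \<open>\<open>hh\<close> is a coarse inverse of the inclusion of \<open>Y'\<close>;
      it moves points by at most \<open>b\<close>.\<close>
    obtain hh b where hh: "\<forall>y\<in>fixed_upto G X' d' \<psi> \<rho>. hh y \<in> Y' \<and> d' (hh y) y \<le> b"
      using k0(2)[of \<rho>] unfolding coarse_equivalence_def coarse_map_def \<rho>_def by (auto simp: Pi_iff) metis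
    \<comment> \<open>Covers both uses of the collapse: B + C for the points in the lifts, and
      \<open>b\<close> for the points moved into \<open>Y'\<close>.\<close>
    define r where "r = max (B + C) b"
    obtain l0 where l0: "\<forall>l\<ge>l0. \<exists>b. \<forall>V\<in>\<V> M. V \<noteq> {} \<longrightarrow> b V \<in> \<W> l \<and> b (\<gamma> V) = b V \<and>
        (\<forall>P\<in>Orb. \<forall>x\<in>V. dO P (ob (f x)) \<le> r \<longrightarrow> P \<in> b V)"
      using collapse_covering[OF GV W, of M r] by (elim exE)
    define l where "l = max l0 (max n m)"
    have l: "l0 \<le> l" "n \<le> l" "m \<le> l" by (auto simp: l_def)
    obtain \<beta> where \<beta>0: "\<forall>V\<in>\<V> M. V \<noteq> {} \<longrightarrow> \<beta> V \<in> \<W> l \<and> \<beta> (\<gamma> V) = \<beta> V \<and>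
        (\<forall>P\<in>Orb. \<forall>x\<in>V. dO P (ob (f x)) \<le> r \<longrightarrow> P \<in> \<beta> V)"
      using mp[OF spec[OF l0, of l] l(1)] by (elim exE)
    have \<beta>: "\<beta> V \<in> \<W> l" "\<beta> (\<gamma> V) = \<beta> V" if "V \<in> \<V> M" "V \<noteq> {}" for V using \<beta>0 that by blast+
    have \<beta>P: "P \<in> \<beta> V" if "V \<in> \<V> M" "P \<in> Orb" "x \<in> V" "dO P (ob (f x)) \<le> r" for V P x using \<beta>0 that by blast
    have r0: "0 \<le> r" using pos unfolding r_def by linarith
    have \<beta>f: "ob (f x) \<in> \<beta> V" if V': "V \<in> \<V> M" "x \<in> V" for V x
    proof (rule \<beta>P[OF V'(1) _ V'(2)])
      have "x \<in> X" using GcovD(1)[OF GV V'(1)] V'(2) by blast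
      then show Orb': "ob (f x) \<in> Orb" by (rule o_O[OF f_X])
      show "dO (ob (f x)) (ob (f x)) \<le> r" using Q.zero[OF Orb' Orb'] r0 by simp
    qed
    have finV: "finite {V \<in> {V \<in> \<V> M. V \<noteq> {}}. \<beta> V = W}" for W
    proof (cases "W \<in> \<W> l")
      case True
      obtain t where t: "\<forall>W\<in>\<W> l. \<forall>P\<in>W. \<forall>Q\<in>W. dO P Q \<le> t" and sub: "\<Union>(\<W> l) = Orb"
        using bW[of l] unfolding bounded_covering_def by metis
      have "finite {V \<in> \<V> M. \<exists>x\<in>V. ob (f x) \<in> W}"
        by (rule finite_meet_preimage[OF bV, of _ t]) (use True t sub in blast)+
      moreover have "{V \<in> {V \<in> \<V> M. V \<noteq> {}}. \<beta> V = W} \<subseteq> {V \<in> \<V> M. \<exists>x\<in>V. ob (f x) \<in> W}" using \<beta>f by blast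
      ultimately show ?thesis by (rule rev_finite_subset)
    next
      case False
      then have "{V \<in> {V \<in> \<V> M. V \<noteq> {}}. \<beta> V = W} = {}" using \<beta>(1) by blast
      then show ?thesis by (simp only: finite.emptyI)
    qed
    have sm1: "smap (nerve (\<V> M) X) (nerve (\<W> l) Orb) \<beta>"
      unfolding smap_def
    proof (intro conjI ballI allI)
      fix T assume T: "T \<in> nerve (\<V> M) X"
      obtain x where x: "x \<in> X" "\<forall>V\<in>T. x \<in> V" using nerveD(4)[OF T] by blast
      show "\<beta> ` T \<in> nerve (\<W> l) Orb"
      proof (rule nerveI[of _ _ "ob (f x)"])
        show "finite (\<beta> ` T)" "\<beta> ` T \<noteq> {}" using nerveD(1,2)[OF T] by auto
        show "\<beta> ` T \<subseteq> \<W> l" using \<beta>(1) nerveD(3)[OF T] x(2) by blast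
        show "ob (f x) \<in> Orb" by (rule o_O[OF f_X[OF x(1)]])
        show "ob (f x) \<in> W" if "W \<in> \<beta> ` T" for W using that \<beta>f nerveD(3)[OF T] x(2) by blast
      qed
    next
      fix W show "finite {V \<in> \<Union>(nerve (\<V> M) X). \<beta> V = W}" unfolding nerve_verts_X[OF GV] by (rule finV)
    qed
    have sm2: "smap (fixc (nerve (\<V> M) X) \<gamma>) (nerve (\<W> l) (ob ` Y')) \<beta>"
      unfolding smap_def
    proof (intro conjI ballI allI)
      fix T assume "T \<in> fixc (nerve (\<V> M) X) \<gamma>"
      then have T: "T \<in> nerve (\<V> M) X" "\<forall>V\<in>T. \<gamma> V = V" unfolding fixc_def by blast+
      interpret M: smith_complex "nerve (\<V> M) X" \<gamma> "TYPE('p)" by (rule nerve_smith[OF GV])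
      obtain x where x: "x \<in> X" "\<forall>V\<in>T. x \<in> V" using nerveD(4)[OF T(1)] by blast
      obtain V0 where V0: "V0 \<in> T" using nerveD(2)[OF T(1)] by blast
      have V0': "V0 \<in> \<V> M" "x \<in> V0" using V0 nerveD(3)[OF T(1)] x(2) by blast+
      note fx = f_X[OF x(1)]
      have "d' (f x) (\<psi> h (f x)) \<le> \<rho>" if h: "h \<in> carrier G" for h
      proof -
        obtain i :: nat where i: "h = g [^] i" using h carrier_powers by blast
        have "(\<gamma> ^^ i) V0 = V0" by (rule M.fixed_pow) (use T(2) V0 in blast)
        then have "\<phi> h x \<in> V0" using V0'(2) unfolding gamma_pow[OF GV V0'(1)] i by blast
        then have "d x (\<phi> h x) \<le> s" using s V0' by blast
        then have "L * d x (\<phi> h x) \<le> L * s" using pos(1) by simp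
        then have "d' (f x) (f (\<phi> h x)) \<le> L * s + C" using f_upper[OF x(1) phi_X[OF h x(1)]] by linarith
        moreover have "d' (f x) (\<psi> h (f x)) \<le> d' (f x) (f (\<phi> h x)) + d' (f (\<phi> h x)) (\<psi> h (f x))"
          by (rule M'.triangle[OF fx f_X[OF phi_X[OF h x(1)]] psi_X[OF h fx]])
        ultimately show ?thesis using equi[OF h x(1)] M'.commute[of "f (\<phi> h x)" "\<psi> h (f x)"] unfolding \<rho>_def by linarith
      qed
      then have "f x \<in> fixed_upto G X' d' \<psi> \<rho>" unfolding fixed_upto_def using fx by blast
      then have y: "hh (f x) \<in> Y'" "d' (hh (f x)) (f x) \<le> b" using hh by blast+
      have yX: "hh (f x) \<in> X'" using y(1) Y'X by blast
      have dy: "dO (ob (hh (f x))) (ob (f x)) \<le> r" using dO_le[OF yX fx] y(2) unfolding r_def by linarith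
      show "\<beta> ` T \<in> nerve (\<W> l) (ob ` Y')"
      proof (rule nerveI[of _ _ "ob (hh (f x))"])
        show "finite (\<beta> ` T)" "\<beta> ` T \<noteq> {}" using nerveD(1,2)[OF T(1)] by auto
        show "\<beta> ` T \<subseteq> \<W> l" using \<beta>(1) nerveD(3)[OF T(1)] x(2) by blast
        show "ob (hh (f x)) \<in> ob ` Y'" using y(1) by blast
        show "ob (hh (f x)) \<in> W" if WT: "W \<in> \<beta> ` T" for W
        proof -
          obtain V where "V \<in> T" "W = \<beta> V" using WT by blast
          then show ?thesis using \<beta>P[OF _ o_O[OF yX] _ dy, of V] nerveD(3)[OF T(1)] x(2) by blast
        qed
      qed
    next
      fix W
      have "{V \<in> \<Union>(fixc (nerve (\<V> M) X) \<gamma>). \<beta> V = W} \<subseteq> {V \<in> {V \<in> \<V> M. V \<noteq> {}}. \<beta> V = W}"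
        unfolding nerve_verts_X[OF GV, symmetric] fixc_def by blast
      then show "finite {V \<in> \<Union>(fixc (nerve (\<V> M) X) \<gamma>). \<beta> V = W}" by (rule finite_subset[OF _ finV])
    qed
    have \<beta>\<gamma>: "\<beta> (\<gamma> V) = \<beta> V" if "V \<in> \<Union>(nerve (\<V> M) X)" for V using \<beta>(2) that unfolding nerve_verts_X[OF GV] by blast
    \<comment> \<open>Both maps send every member in \<open>T\<close> to a member that contains the
      same point \<open>ob y\<close>.\<close>
    have contig: "fold prW [i..<l] ` T \<union> (\<beta> \<circ> (fold pr [k i..<M] \<circ> a i)) ` T \<in> nerve (\<W> l) A"
      if i: "k i \<le> M" "i \<le> l" and T: "T \<in> nerve (\<W> i) A" and A: "A = Orb \<or> A = ob ` Y'" for i T A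
    proof -
      obtain y x where y: "y \<in> X'" "x \<in> X" "d' y (f x) \<le> C" "ob y \<in> A" "\<forall>W\<in>T. ob y \<in> W"
        using point[OF T A] by blast
      have TW: "W \<in> \<W> i" "W \<noteq> {}" if "W \<in> T" for W using nerveD(3)[OF T] y(5) that by blast+
      have p1: "fold prW [i..<l] W \<in> \<W> l \<and> ob y \<in> fold prW [i..<l] W" if "W \<in> T" for W
        using Q.refining_fold[OF W i(2)] TW[OF that] y(5) that unfolding refining_def by blast
      have p2: "(\<beta> \<circ> (fold pr [k i..<M] \<circ> a i)) W \<in> \<W> l \<and> ob y \<in> (\<beta> \<circ> (fold pr [k i..<M] \<circ> a i)) W" if W': "W \<in> T" for W
      proof -
        obtain z where z: "z \<in> a i W" "dO (ob y) (ob (f z)) \<le> B + C" using az0[OF TW(1)[OF W']] y(5) W' by blast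
        have F: "fold pr [k i..<M] (a i W) \<in> \<V> M" "a i W \<subseteq> fold pr [k i..<M] (a i W)"
          using refining_fold[OF cV i(1)] aV[OF TW[OF W']] z(1) unfolding refining_def by blast+
        have "z \<in> fold pr [k i..<M] (a i W)" using z(1) F(2) by blast
        moreover have "dO (ob y) (ob (f z)) \<le> r" using z(2) unfolding r_def by linarith
        ultimately show ?thesis using \<beta>(1)[OF F(1)] \<beta>P[OF F(1) o_O[OF y(1)]] by auto
      qed
      show ?thesis
      proof (rule nerveI[of _ _ "ob y"])
        show "finite (fold prW [i..<l] ` T \<union> (\<beta> \<circ> (fold pr [k i..<M] \<circ> a i)) ` T)" using nerveD(1)[OF T] by simp
        show "fold prW [i..<l] ` T \<union> (\<beta> \<circ> (fold pr [k i..<M] \<circ> a i)) ` T \<noteq> {}" using nerveD(2)[OF T] by simp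
        show "fold prW [i..<l] ` T \<union> (\<beta> \<circ> (fold pr [k i..<M] \<circ> a i)) ` T \<subseteq> \<W> l" using p1 p2 by (intro Un_least image_subsetI) blast+
        show "ob y \<in> A" by (rule y(4))
        show "ob y \<in> U" if "U \<in> fold prW [i..<l] ` T \<union> (\<beta> \<circ> (fold pr [k i..<M] \<circ> a i)) ` T" for U
          using that p1 p2 by (elim UnE imageE) (simp only:)+
      qed
    qed
    show "\<exists>l \<beta>. n \<le> l \<and> m \<le> l \<and> smap (nerve (\<V> M) X) (nerve (\<W> l) Orb) \<beta> \<and>
        smap (fixc (nerve (\<V> M) X) \<gamma>) (nerve (\<W> l) (ob ` Y')) \<beta> \<and> (\<forall>v\<in>\<Union>(nerve (\<V> M) X). \<beta> (\<gamma> v) = \<beta> v) \<and>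
        (\<forall>i\<in>{n, m}. (\<forall>S\<in>nerve (\<W> i) Orb. fold prW [i..<l] ` S \<union> (\<beta> \<circ> (fold pr [k i..<M] \<circ> a i)) ` S \<in> nerve (\<W> l) Orb) \<and>
           (\<forall>S\<in>nerve (\<W> i) (ob ` Y'). fold prW [i..<l] ` S \<union> (\<beta> \<circ> (fold pr [k i..<M] \<circ> a i)) ` S \<in> nerve (\<W> l) (ob ` Y')))"
    proof (intro exI[of _ l] exI[of _ \<beta>] conjI ballI)
      fix i assume "i \<in> {n, m}"
      then have i: "k i \<le> M" "i \<le> l" using M l by auto
      show "fold prW [i..<l] ` S \<union> (\<beta> \<circ> (fold pr [k i..<M] \<circ> a i)) ` S \<in> nerve (\<W> l) Orb" if "S \<in> nerve (\<W> i) Orb" for S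
        by (rule contig[OF i that]) simp
      show "fold prW [i..<l] ` S \<union> (\<beta> \<circ> (fold pr [k i..<M] \<circ> a i)) ` S \<in> nerve (\<W> l) (ob ` Y')" if "S \<in> nerve (\<W> i) (ob ` Y')" for S
        by (rule contig[OF i that]) simp
    qed (use l sm1 sm2 \<beta>\<gamma> in blast)+
  qed
qed

end

section \<open>The Smith inequality\<close>

text \<open>The remainder in degree q + 1 belongs to p - j, to which the inequality applies again,
  so j and p - j alternate until the degree exceeds \<open>D\<close>. Infinite values are split off
  before the infinite sum of the \<open>b\<close> is bounded, since the argument for it subtracts
  the term \<open>s j m\<close>.\<close>

lemma alternating_sum_bound:
  fixes s :: "nat \<Rightarrow> nat \<Rightarrow> enat" and b h :: "nat \<Rightarrow> enat"
  assumes step: "\<And>j q. 1 \<le> j \<Longrightarrow> j \<le> p - 1 \<Longrightarrow> s j q + b q \<le> h q + s (p - j) (Suc q)"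
    and vanish: "\<And>j q. D < q \<Longrightarrow> s j q = 0" and j: "1 \<le> j" "j \<le> p - 1"
  shows "s j m + (\<Sum>i. b (m + i)) \<le> (\<Sum>i. h (m + i))"
proof -
  \<comment> \<open>\<open>j'\<close> is j or p - j, according to the parity of
    \<open>n\<close>.\<close>
  have part: "\<exists>j'. s j m + (\<Sum>i<n. b (m + i)) \<le> (\<Sum>i<n. h (m + i)) + s j' (m + n)" if "1 \<le> j" "j \<le> p - 1" for j m n
    using that
  proof (induction n arbitrary: j m)
    case 0
    show ?case by (intro exI[of _ j]) simp
  next
    case (Suc n)
    have "1 \<le> p - j" "p - j \<le> p - 1" using Suc.prems by auto
    then obtain j' where j': "s (p - j) (Suc m) + (\<Sum>i<n. b (Suc m + i)) \<le> (\<Sum>i<n. h (Suc m + i)) + s j' (Suc m + n)"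
      using Suc.IH by blast
    have "s j m + (\<Sum>i<Suc n. b (m + i)) = (s j m + b m) + (\<Sum>i<n. b (Suc m + i))"
      unfolding sum.lessThan_Suc_shift by (simp add: add.assoc)
    also have "\<dots> \<le> (h m + s (p - j) (Suc m)) + (\<Sum>i<n. b (Suc m + i))"
      by (rule add_right_mono[OF step[OF Suc.prems]])
    also have "\<dots> = h m + (s (p - j) (Suc m) + (\<Sum>i<n. b (Suc m + i)))" by (rule add.assoc)
    also have "\<dots> \<le> h m + ((\<Sum>i<n. h (Suc m + i)) + s j' (Suc m + n))" by (rule add_left_mono[OF j'])
    also have "\<dots> = (\<Sum>i<Suc n. h (m + i)) + s j' (m + Suc n)" unfolding sum.lessThan_Suc_shift by (simp add: add.assoc)
    finally show ?case by blast
  qed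
  have bound: "s j m + (\<Sum>i<n. b (m + i)) \<le> (\<Sum>i. h (m + i))" for n
  proof -
    \<comment> \<open>At least \<open>n\<close>, and far enough for the remaining special term to
      lie above degree \<open>D\<close>.\<close>
    let ?N = "n + Suc D"
    obtain j' where "s j m + (\<Sum>i<?N. b (m + i)) \<le> (\<Sum>i<?N. h (m + i)) + s j' (m + ?N)" using part[OF j] by blast
    also have "s j' (m + ?N) = 0" by (rule vanish) simp
    finally have "s j m + (\<Sum>i<?N. b (m + i)) \<le> (\<Sum>i<?N. h (m + i))" by simp
    also have "\<dots> \<le> (\<Sum>i. h (m + i))" by (rule sum_le_suminf) (auto intro: summableI)
    finally have "s j m + (\<Sum>i<?N. b (m + i)) \<le> (\<Sum>i. h (m + i))" .
    moreover have "(\<Sum>i<n. b (m + i)) \<le> (\<Sum>i<?N. b (m + i))" by (rule sum_mono2) auto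
    ultimately show ?thesis using add_left_mono order_trans by blast
  qed
  show ?thesis
  proof (cases "(\<Sum>i. h (m + i))")
    case (enat H)
    have "s j m \<le> enat H" using bound[of 0] enat by simp
    then obtain a where a: "s j m = enat a" "a \<le> H" by (cases "s j m") auto
    have "(\<Sum>i. b (m + i)) \<le> enat (H - a)"
    proof (rule suminf_le_const[OF summableI])
      fix n
      have "enat a + (\<Sum>i<n. b (m + i)) \<le> enat H" using bound[of n] a(1) enat by simp
      then show "(\<Sum>i<n. b (m + i)) \<le> enat (H - a)" by (cases "\<Sum>i<n. b (m + i)") auto
    qed
    then have "s j m + (\<Sum>i. b (m + i)) \<le> enat a + enat (H - a)" unfolding a(1) by (rule add_left_mono)
    then show ?thesis unfolding enat using a(2) by simp
  qed simp
qed

lemma suminf_shift_le: "(\<Sum>i. f (c + i)) \<le> (\<Sum>i. f i)" for f :: "nat \<Rightarrow> enat"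
proof (rule suminf_le_const[OF summableI])
  fix n
  have "(\<Sum>i<n. f (c + i)) \<le> (\<Sum>i<c + n. f i)"
    by (induction n) (simp_all add: add_right_mono)
  also have "\<dots> \<le> (\<Sum>i. f i)" by (rule sum_le_suminf) (auto intro: summableI)
  finally show "(\<Sum>i<n. f (c + i)) \<le> (\<Sum>i. f i)" .
qed

text \<open>The inequality for the system \<open>\<V>\<close> is used with p - j in place of j,
  which puts the exponent j on the left. The homology of the fixed complexes and that of X are then
  replaced by the groups computed from \<open>\<U>\<close>.\<close>

lemma (in coarse_cyclic_action) smith_step:
  assumes U: "coarsening_system X d \<U> prU"
    and V: "regular_G_coarsening_system G X d \<phi> \<V> prV" "equivariant_projections G \<phi> \<V> prV"
    and j: "1 \<le> j" "j \<le> CARD('p) - 1"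
  shows "vs_rank (HC_smith X \<phi> g j \<V> prV q :: ('p mod_ring, _) module)
      + vs_rank (HC_bd G X d \<phi> \<U> prU q :: ('p mod_ring, _) module)
    \<le> vs_rank (HC \<U> prU q X {} :: ('p mod_ring, _) module)
      + vs_rank (HC_smith X \<phi> g (CARD('p) - j) \<V> prV (Suc q) :: ('p mod_ring, _) module)"
proof -
  have cV: "coarsening_system X d \<V> prV" using V(1) unfolding regular_G_coarsening_system_def by simp
  interpret S: smith_system "\<lambda>n. nerve (\<V> n) X" prV \<gamma> "TYPE('p)" by (rule nerve_smith_system[OF V])
  note sm = HC_smith_tower[where \<phi> = \<phi> and g = g, OF nerve_smith_system[OF V]]
  have i: "1 \<le> CARD('p) - j" "CARD('p) - j \<le> CARD('p) - 1" "CARD('p) - (CARD('p) - j) = j" using j by auto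
  have "vs_rank (S.smith_lim j q :: ('p mod_ring, _) module) + vs_rank (HC_bd G X d \<phi> \<U> prU q :: ('p mod_ring, _) module)
      \<le> vs_rank (S.smith_lim j q :: ('p mod_ring, _) module) + vs_rank (S.fix_lim q :: ('p mod_ring, _) module)"
    by (rule add_left_mono[OF vs_rank_HC_bd_le[OF U V]])
  also have "\<dots> \<le> vs_rank (S.hom_lim q :: ('p mod_ring, _) module) + vs_rank (S.smith_lim (CARD('p) - j) (Suc q) :: ('p mod_ring, _) module)"
    using S.smith_inequality[OF i(1,2), of q] unfolding i(3) .
  also have "\<dots> \<le> vs_rank (HC \<U> prU q X {} :: ('p mod_ring, _) module) + vs_rank (S.smith_lim (CARD('p) - j) (Suc q) :: ('p mod_ring, _) module)"
    using HC_le[OF Metric_space_axioms cV U, of q]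
    unfolding HC_tower[OF nerve_system[OF cV empty_subsetI]] nerve_empty by (rule add_right_mono)
  finally show ?thesis unfolding sm .
qed

theorem theorem11p9:
  fixes X :: "'a set" and d :: "'a \<Rightarrow> 'a \<Rightarrow> real"
    and G :: "('g, 'r) monoid_scheme" and g :: 'g and \<phi> :: "'g \<Rightarrow> 'a \<Rightarrow> 'a"
    and \<U> \<V> :: "nat \<Rightarrow> 'a set set" and pr\<^sub>U pr\<^sub>V :: "nat \<Rightarrow> 'a set \<Rightarrow> 'a set"
    and m j :: nat
  assumes "proper_metric_space X d"
    and "group G" and "Coset.order G = CARD('p::prime_card)"
    and "g \<in> carrier G" and "carrier G = generate G {g}"
    and "coarse_action G X d \<phi>"
    and "G_finitistic G X d \<phi>"
    and "\<exists>Y. bounded_fixed_set G X d \<phi> Y"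
    and "coarsening_system X d \<U> pr\<^sub>U"
    and "regular_G_coarsening_system G X d \<phi> \<V> pr\<^sub>V"
    and "equivariant_projections G \<phi> \<V> pr\<^sub>V"
    and "1 \<le> j" and "j \<le> CARD('p) - 1"
  shows
    "vs_rank (HC_smith X \<phi> g j \<V> pr\<^sub>V m :: ('p mod_ring, _) module)
        + (\<Sum>i. vs_rank (HC_bd G X d \<phi> \<U> pr\<^sub>U (m + i) :: ('p mod_ring, _) module))
      \<le> (\<Sum>i. vs_rank (HC \<U> pr\<^sub>U (m + i) X {} :: ('p mod_ring, _) module)) \<and>
     ((\<Sum>i. vs_rank (HC \<U> pr\<^sub>U (m + i) X {} :: ('p mod_ring, _) module)) < \<infinity> \<longrightarrow>
        vs_rank (HC_smith X \<phi> g j \<V> pr\<^sub>V m :: ('p mod_ring, _) module)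
          + (\<Sum>i. vs_rank (HC_bd G X d \<phi> \<U> pr\<^sub>U (m + i) :: ('p mod_ring, _) module)) < \<infinity> \<and>
        (\<forall>(X' :: 'b set) d' \<psi> Y' \<W> pr\<^sub>W.
           proper_metric_space X' d' \<and> isometric_action G X' d' \<psi> \<and>
           coarsely_G_equivalent G X d \<phi> X' d' \<psi> \<and>
           bounded_fixed_set G X' d' \<psi> Y' \<and>
           coarsening_system (orbits G X' \<psi>) (orbit_dist G X' d' \<psi>) \<W> pr\<^sub>W \<longrightarrow>
           (\<forall>i\<ge>m. vs_rank (HC \<W> pr\<^sub>W i (orbits G X' \<psi>) (orbit G \<psi> ` Y')
                      :: ('p mod_ring, _) module) < \<infinity>)))"
proof -
  have M: "Metric_space X d" using assms(1) unfolding proper_metric_space_def by blast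
  interpret coarse_cyclic_action X d G g \<phi> "TYPE('p)"
    by (intro coarse_cyclic_action.intro coarse_cyclic_action_axioms.intro M assms)
  \<comment> \<open>A finite-dimensional system, in general different from \<open>\<V>\<close>;
    through it the special groups computed from \<open>\<V>\<close> vanish above degree
    \<open>D\<close>.\<close>
  obtain \<V>' pr' D where fin: "regular_G_coarsening_system G X d \<phi> \<V>' pr'"
      "\<And>n S. S \<in> nerve (\<V>' n) X \<Longrightarrow> card S \<le> D + 1"
    using assms(7) unfolding G_finitistic_def by metis
  define s where "s j q = vs_rank (HC_smith X \<phi> g j \<V> pr\<^sub>V q :: ('p mod_ring, _) module)" for j q
  define b where "b q = vs_rank (HC_bd G X d \<phi> \<U> pr\<^sub>U q :: ('p mod_ring, _) module)" for q
  define h where "h q = vs_rank (HC \<U> pr\<^sub>U q X {} :: ('p mod_ring, _) module)" for q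
  have bound: "s j q + (\<Sum>i. b (q + i)) \<le> (\<Sum>i. h (q + i))" if "1 \<le> j" "j \<le> CARD('p) - 1" for j q
  proof (rule alternating_sum_bound[OF _ _ that])
    show "s j q + b q \<le> h q + s (CARD('p) - j) (Suc q)" if "1 \<le> j" "j \<le> CARD('p) - 1" for j q
      unfolding s_def b_def h_def by (rule smith_step[OF assms(9-11) that])
    show "s j q = 0" if "D < q" for j q
      unfolding s_def by (rule HC_smith_vanishes[OF assms(10,11) fin that])
  qed
  have orbit: "vs_rank (HC \<W> pr\<^sub>W i (orbits G X' \<psi>) (orbit G \<psi> ` Y') :: ('p mod_ring, _) module) < \<infinity>"
    if X': "proper_metric_space X' d'" "isometric_action G X' d' \<psi>" "coarsely_G_equivalent G X d \<phi> X' d' \<psi>"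
      and Y': "bounded_fixed_set G X' d' \<psi> Y'"
      and W: "coarsening_system (orbits G X' \<psi>) (orbit_dist G X' d' \<psi>) \<W> pr\<^sub>W"
      and i: "m \<le> i" and sum: "(\<Sum>i. h (m + i)) < \<infinity>"
    for X' :: "'b set" and d' \<psi> Y' \<W> pr\<^sub>W i
  proof -
    obtain f L C B where f: "L > 0" "C > 0" "quasi_isometry L C X d X' d' f"
      "\<And>h x. h \<in> carrier G \<Longrightarrow> x \<in> X \<Longrightarrow> d' (\<psi> h (f x)) (f (\<phi> h x)) \<le> B"
      using X'(3) unfolding coarsely_G_equivalent_def by metis
    have M': "Metric_space X' d'" using X'(1) unfolding proper_metric_space_def by blast
    \<comment> \<open>The bound from the coarse equivalence comes without a sign, hence
      \<open>max B 0\<close>.\<close>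
    interpret Q: coarse_orbit_space X d G g \<phi> "TYPE('p)" X' d' \<psi> f L C "max B 0"
      using f X'(2) M' by (intro coarse_orbit_space.intro coarse_orbit_space_axioms.intro coarse_cyclic_action_axioms)
        (simp_all add: le_max_iff_disj)
    \<comment> \<open>The transfer lands in the special group of exponent p - 1, whatever the given
      \<open>j\<close> is; the bound was therefore proved for all exponents and degrees.\<close>
    have "vs_rank (HC \<W> pr\<^sub>W i (orbits G X' \<psi>) (orbit G \<psi> ` Y') :: ('p mod_ring, _) module) \<le> s (CARD('p) - 1) i"
      unfolding s_def by (rule Q.HC_orbit_le[OF assms(10,11) Y' W])
    also have "\<dots> \<le> s (CARD('p) - 1) i + (\<Sum>k. b (i + k))" by simp
    also have "\<dots> \<le> (\<Sum>k. h (i + k))" using assms(12,13) by (intro bound) auto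
    \<comment> \<open>The tail from degree \<open>i\<close> on is rewritten as a shift of the tail
      from \<open>m\<close> on, whose sum is assumed finite.\<close>
    also have "\<dots> = (\<Sum>k. h (m + ((i - m) + k)))" using i by simp
    also have "\<dots> \<le> (\<Sum>k. h (m + k))" by (rule suminf_shift_le)
    also note sum
    finally show ?thesis .
  qed
  show ?thesis
    using bound[OF assms(12,13), of m] orbit unfolding s_def b_def h_def
    by (intro conjI impI allI) (blast intro: le_less_trans)+
qed

end
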